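(* Let $(X,G)$ be a small compact $G$-space, where the topology of $G$ has a basis of neighborhoods of the identity consisting of open subgroups (e.g. $G$ carries the compact-open topology). Let $H$ be a group $\emptyset$-closed in $X^{teq}$, and suppose $H$ is abelian and $\mathcal{NM}(H)<\omega$. Then for every $*$-closed subgroup $H_1\le H$ there is an $Acl^{eq}(\emptyset)$-closed subgroup $K$ of $H$ commensurable with $H_1$.
   Context: A Polish structure $(X,G)$: $G$ Polish, acting faithfully on $X$ with closed point stabilizers; small if countably many orbits on each $X^n$. A compact $G$-space: $X$ compact Hausdorff, action continuous. $G_A$ is the pointwise stabilizer of $A$, $o(a/A)=G_Aa$. $X^{eq}$ is the union of all $X^n/E$ with $E$ a $G$-invariant equivalence relation on $X^n$ all of whose classes have closed stabilizers; $X^{teq}$ is the disjoint union of the $X^n/E$ with $E$ closed and $G$-invariant, with quotient topology. For finite $A\subseteq X^{eq}$ a subset of (a product of sorts of) $X^{teq}$ is $A$-closed if it is closed and $G_A$-invariant, $*$-closed if $A$-closed for some finite $A$; a group is $A$-closed if its set and the graph of its operation are. $Acl^{eq}(\emptyset)$ is the set of elements of $X^{eq}$ whose $G$-orbit is countable; $Acl^{eq}(\emptyset)$-closed means $A$-closed for some finite $A\subseteq Acl^{eq}(\emptyset)$. $nm$-independence: $a$ is $nm$-independent from $B$ over $A$ iff $\pi_A^{-1}[o(a/AB)]$ is non-meager in $\pi_A^{-1}[o(a/A)]$, $\pi_A(g)=ga$. $\mathcal{NM}(a/A)\ge\alpha+1$ iff there is finite $B\supseteq A$ with $a$ $nm$-dependent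 on $B$ over $A$ and $\mathcal{NM}(a/B)\ge\alpha$; $\mathcal{NM}(H)=\sup_{h\in H}\mathcal{NM}(h/\emptyset)$. Subgroups are commensurable if their intersection has finite index in each. *)

theory Defs
  imports "HOL-Analysis.Analysis" "HOL-Algebra.Group_Action"
begin

section \<open>Polish structures and compact \<open>G\<close>-spaces\<close>

text \<open>
  The underlying set \<open>X\<close> is \<open>topspace (XTop S)\<close>. The notion of a Polish structure only uses
  this set; the topology on it becomes relevant for compact \<open>G\<close>-spaces.
\<close>

record ('g, 'x) gspace =
  Grp :: "'g monoid"
  GTop :: "'g topology"
  XTop :: "'x topology"
  act :: "'g \<Rightarrow> 'x \<Rightarrow> 'x"

definition polish_group :: "'g monoid \<Rightarrow> 'g topology \<Rightarrow> bool" where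
  "polish_group G T \<longleftrightarrow>
     group G \<and> topspace T = carrier G \<and>
     continuous_map (prod_topology T T) T (\<lambda>(g, h). g \<otimes>\<^bsub>G\<^esub> h) \<and>
     continuous_map T T (\<lambda>g. inv\<^bsub>G\<^esub> g) \<and>
     completely_metrizable_space T \<and> second_countable T"

definition polish_structure :: "('g, 'x) gspace \<Rightarrow> bool" where
  "polish_structure S \<longleftrightarrow>
     polish_group (Grp S) (GTop S) \<and>
     faithful_action (Grp S) (topspace (XTop S)) (act S) \<and>
     (\<forall>x \<in> topspace (XTop S). closedin (GTop S) (stabilizer (Grp S) (act S) x))"

text \<open>
  A power or finite product indexed by \<open>{..<n}\<close> consists of extensional functions, as in
  \<open>product_topology\<close>.
\<close>

definition tuple_act :: "nat \<Rightarrow> ('g \<Rightarrow> 'a \<Rightarrow> 'a) \<Rightarrow> 'g \<Rightarrow> (nat \<Rightarrow> 'a) \<Rightarrow> (nat \<Rightarrow> 'a)" where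
  "tuple_act n \<rho> g t = (\<lambda>i\<in>{..<n}. \<rho> g (t i))"

definition pow_top :: "('g, 'x) gspace \<Rightarrow> nat \<Rightarrow> (nat \<Rightarrow> 'x) topology" where
  "pow_top S n = product_topology (\<lambda>i. XTop S) {..<n}"

abbreviation pow :: "('g, 'x) gspace \<Rightarrow> nat \<Rightarrow> (nat \<Rightarrow> 'x) set" where
  "pow S n \<equiv> topspace (pow_top S n)"

definition small :: "('g, 'x) gspace \<Rightarrow> bool" where
  "small S \<longleftrightarrow> (\<forall>n. countable (orbits (Grp S) (pow S n) (tuple_act n (act S))))"

definition compact_gspace :: "('g, 'x) gspace \<Rightarrow> bool" where
  "compact_gspace S \<longleftrightarrow>
     polish_structure S \<and> compact_space (XTop S) \<and> Hausdorff_space (XTop S) \<and>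
     continuous_map (prod_topology (GTop S) (XTop S)) (XTop S) (\<lambda>(g, x). act S g x)"

definition open_subgroup_basis :: "'g monoid \<Rightarrow> 'g topology \<Rightarrow> bool" where
  "open_subgroup_basis G T \<longleftrightarrow>
     (\<forall>U. openin T U \<and> \<one>\<^bsub>G\<^esub> \<in> U \<longrightarrow> (\<exists>V. subgroup V G \<and> openin T V \<and> V \<subseteq> U))"


section \<open>Imaginaries\<close>

text \<open>
  A sort is given by a pair \<open>(n, E)\<close>. Elements of \<open>X\<^sup>n/E\<close> carry their sort as a tag, so that
  different sorts are disjoint.
\<close>

type_synonym 'x srt = "nat \<times> ((nat \<Rightarrow> 'x) \<times> (nat \<Rightarrow> 'x)) set"
type_synonym 'x imag = "'x srt \<times> (nat \<Rightarrow> 'x) set"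

definition invariant_equiv ::
    "('g, 'x) gspace \<Rightarrow> nat \<Rightarrow> ((nat \<Rightarrow> 'x) \<times> (nat \<Rightarrow> 'x)) set \<Rightarrow> bool" where
  "invariant_equiv S n E \<longleftrightarrow>
     equiv (pow S n) E \<and>
     (\<forall>g \<in> carrier (Grp S). \<forall>(s, t) \<in> E. (tuple_act n (act S) g s, tuple_act n (act S) g t) \<in> E)"

definition eq_sorts :: "('g, 'x) gspace \<Rightarrow> 'x srt set" where
  "eq_sorts S = {(n, E). invariant_equiv S n E \<and>
     (\<forall>c \<in> pow S n // E.
        closedin (GTop S) (stabilizer (Grp S) (\<lambda>g. (`) (tuple_act n (act S) g)) c))}"

definition teq_sorts :: "('g, 'x) gspace \<Rightarrow> 'x srt set" where
  "teq_sorts S = {(n, E). invariant_equiv S n E \<and>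
     closedin (prod_topology (pow_top S n) (pow_top S n)) E}"

definition Xeq :: "('g, 'x) gspace \<Rightarrow> 'x imag set" where
  "Xeq S = {((n, E), c) | n E c. (n, E) \<in> eq_sorts S \<and> c \<in> pow S n // E}"

fun imag_act :: "('g, 'x) gspace \<Rightarrow> 'g \<Rightarrow> 'x imag \<Rightarrow> 'x imag" where
  "imag_act S g ((n, E), c) = ((n, E), tuple_act n (act S) g ` c)"

definition quotient_topology :: "'a topology \<Rightarrow> ('a \<Rightarrow> 'b) \<Rightarrow> 'b topology" where
  "quotient_topology T p =
     topology (\<lambda>U. U \<subseteq> p ` topspace T \<and> openin T {x \<in> topspace T. p x \<in> U})"

lemma openin_quotient_topology:
  "openin (quotient_topology T p) U \<longleftrightarrow>
     U \<subseteq> p ` topspace T \<and> openin T {x \<in> topspace T. p x \<in> U}"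
proof -
  let ?P = "\<lambda>U. U \<subseteq> p ` topspace T \<and> openin T {x \<in> topspace T. p x \<in> U}"
  have "istopology ?P"
    unfolding istopology_def
  proof (intro conjI allI impI)
    fix A B assume A: "?P A" and B: "?P B"
    have "{x \<in> topspace T. p x \<in> A \<inter> B} =
        {x \<in> topspace T. p x \<in> A} \<inter> {x \<in> topspace T. p x \<in> B}" by blast
    with A B show "openin T {x \<in> topspace T. p x \<in> A \<inter> B}" by auto
  next
    fix K assume K: "\<forall>A \<in> K. ?P A"
    have "{x \<in> topspace T. p x \<in> \<Union>K} = (\<Union>A\<in>K. {x \<in> topspace T. p x \<in> A})" by blast
    with K show "openin T {x \<in> topspace T. p x \<in> \<Union>K}" by auto
  qed auto
  then show ?thesis by (simp add: quotient_topology_def)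
qed

lemma quotient_map_quotient_topology: "quotient_map T (quotient_topology T p) p"
proof -
  have "{x \<in> topspace T. p x \<in> p ` topspace T} = topspace T" by blast
  then have "openin (quotient_topology T p) (p ` topspace T)"
    by (simp add: openin_quotient_topology)
  then have "topspace (quotient_topology T p) = p ` topspace T"
    by (metis openin_quotient_topology openin_subset openin_topspace subset_antisym)
  then show ?thesis by (auto simp: quotient_map_def openin_quotient_topology)
qed

fun sort_top :: "('g, 'x) gspace \<Rightarrow> 'x srt \<Rightarrow> 'x imag topology" where
  "sort_top S (n, E) = quotient_topology (pow_top S n) (\<lambda>t. ((n, E), E `` {t}))"

definition sorts_top :: "('g, 'x) gspace \<Rightarrow> nat \<Rightarrow> (nat \<Rightarrow> 'x srt) \<Rightarrow> (nat \<Rightarrow> 'x imag) topology" where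
  "sorts_top S k \<sigma> = product_topology (\<lambda>i. sort_top S (\<sigma> i)) {..<k}"

definition pstab :: "('g, 'x) gspace \<Rightarrow> 'x imag set \<Rightarrow> 'g set" where
  "pstab S A = {g \<in> carrier (Grp S). \<forall>a \<in> A. imag_act S g a = a}"

definition Acl_empty :: "('g, 'x) gspace \<Rightarrow> 'x imag set" where
  "Acl_empty S = {a \<in> Xeq S. countable (orbit (Grp S) (imag_act S) a)}"


section \<open>Relatively closed sets and groups\<close>

text \<open>Here \<open>T\<close> is a product of sorts and \<open>\<rho>\<close> the induced action on it.\<close>

definition A_closed ::
    "('g, 'x) gspace \<Rightarrow> 'x imag set \<Rightarrow> 'b topology \<Rightarrow> ('g \<Rightarrow> 'b \<Rightarrow> 'b) \<Rightarrow> 'b set \<Rightarrow> bool" where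
  "A_closed S A T \<rho> D \<longleftrightarrow> closedin T D \<and> (\<forall>g \<in> pstab S A. \<rho> g ` D \<subseteq> D)"

definition mult_graph :: "('a, 'm) monoid_scheme \<Rightarrow> ('a \<times> 'a \<times> 'a) set" where
  "mult_graph H = {(x, y, x \<otimes>\<^bsub>H\<^esub> y) | x y. x \<in> carrier H \<and> y \<in> carrier H}"

definition A_closed_group ::
    "('g, 'x) gspace \<Rightarrow> nat \<Rightarrow> (nat \<Rightarrow> 'x srt) \<Rightarrow> 'x imag set \<Rightarrow>
      (nat \<Rightarrow> 'x imag) monoid \<Rightarrow> bool" where
  "A_closed_group S k \<sigma> A H \<longleftrightarrow>
     group H \<and>
     (let P = sorts_top S k \<sigma>; \<rho> = tuple_act k (imag_act S) in
        A_closed S A P \<rho> (carrier H) \<and>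
        A_closed S A (prod_topology P (prod_topology P P))
          (\<lambda>g. map_prod (\<rho> g) (map_prod (\<rho> g) (\<rho> g))) (mult_graph H))"

definition star_closed_group ::
    "('g, 'x) gspace \<Rightarrow> nat \<Rightarrow> (nat \<Rightarrow> 'x srt) \<Rightarrow> (nat \<Rightarrow> 'x imag) monoid \<Rightarrow> bool" where
  "star_closed_group S k \<sigma> H \<longleftrightarrow> (\<exists>A. finite A \<and> A \<subseteq> Xeq S \<and> A_closed_group S k \<sigma> A H)"

definition Acl_closed_group ::
    "('g, 'x) gspace \<Rightarrow> nat \<Rightarrow> (nat \<Rightarrow> 'x srt) \<Rightarrow> (nat \<Rightarrow> 'x imag) monoid \<Rightarrow> bool" where
  "Acl_closed_group S k \<sigma> H \<longleftrightarrow> (\<exists>A. finite A \<and> A \<subseteq> Acl_empty S \<and> A_closed_group S k \<sigma> A H)"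

definition commensurable :: "('a, 'm) monoid_scheme \<Rightarrow> 'a set \<Rightarrow> 'a set \<Rightarrow> bool" where
  "commensurable H K L \<longleftrightarrow>
     finite (rcosets\<^bsub>H\<lparr>carrier := K\<rparr>\<^esub> (K \<inter> L)) \<and> finite (rcosets\<^bsub>H\<lparr>carrier := L\<rparr>\<^esub> (K \<inter> L))"


section \<open>Independence and rank\<close>

definition meager_in :: "'a topology \<Rightarrow> 'a set \<Rightarrow> bool" where
  "meager_in T M \<longleftrightarrow>
     (\<exists>\<N>. countable \<N> \<and> M = \<Union>\<N> \<and>
        (\<forall>N \<in> \<N>. N \<subseteq> topspace T \<and> T interior_of (T closure_of N) = {}))"

text \<open>
  A tuple \<open>a\<close> of length \<open>k\<close> of imaginaries is a function extensional outside \<open>{..<k}\<close>.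
\<close>

definition orbit_over ::
    "('g, 'x) gspace \<Rightarrow> nat \<Rightarrow> (nat \<Rightarrow> 'x imag) \<Rightarrow> 'x imag set \<Rightarrow> (nat \<Rightarrow> 'x imag) set" where
  "orbit_over S k a A = orbit (Grp S\<lparr>carrier := pstab S A\<rparr>) (tuple_act k (imag_act S)) a"

text \<open>The preimage of \<open>D\<close> under \<open>\<pi>\<^sub>A\<close>, the map \<open>g \<mapsto> g a\<close> with domain the stabilizer of \<open>A\<close>.\<close>

definition pi_vimage ::
    "('g, 'x) gspace \<Rightarrow> nat \<Rightarrow> (nat \<Rightarrow> 'x imag) \<Rightarrow> 'x imag set \<Rightarrow> (nat \<Rightarrow> 'x imag) set \<Rightarrow> 'g set" where
  "pi_vimage S k a A D = {g \<in> pstab S A. tuple_act k (imag_act S) g a \<in> D}"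

definition nm_indep ::
    "('g, 'x) gspace \<Rightarrow> nat \<Rightarrow> (nat \<Rightarrow> 'x imag) \<Rightarrow> 'x imag set \<Rightarrow> 'x imag set \<Rightarrow> bool" where
  "nm_indep S k a A B \<longleftrightarrow>
     \<not> meager_in (subtopology (GTop S) (pi_vimage S k a A (orbit_over S k a A)))
         (pi_vimage S k a A (orbit_over S k a (A \<union> B)))"

primrec NM_ge ::
    "('g, 'x) gspace \<Rightarrow> nat \<Rightarrow> (nat \<Rightarrow> 'x imag) \<Rightarrow> 'x imag set \<Rightarrow> nat \<Rightarrow> bool" where
  "NM_ge S k a A 0 \<longleftrightarrow> True"
| "NM_ge S k a A (Suc m) \<longleftrightarrow>
     (\<exists>B. finite B \<and> A \<subseteq> B \<and> B \<subseteq> Xeq S \<and> \<not> nm_indep S k a A B \<and> NM_ge S k a B m)"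

text \<open>
  The ordinal-valued rank cut off at \<open>\<omega>\<close>: the value \<open>\<infinity>\<close> means that the rank is at least \<open>\<omega>\<close>
  (at a limit ordinal \<open>\<lambda>\<close>, rank at least \<open>\<lambda>\<close> means rank at least \<open>\<alpha>\<close> for all \<open>\<alpha> < \<lambda>\<close>).
  In particular the supremum below is finite iff the ordinal supremum is less than \<open>\<omega>\<close>.
\<close>

definition NM :: "('g, 'x) gspace \<Rightarrow> nat \<Rightarrow> (nat \<Rightarrow> 'x imag) \<Rightarrow> 'x imag set \<Rightarrow> enat" where
  "NM S k a A = Sup {enat m | m. NM_ge S k a A m}"

definition NM_set :: "('g, 'x) gspace \<Rightarrow> nat \<Rightarrow> (nat \<Rightarrow> 'x imag) set \<Rightarrow> enat" where
  "NM_set S k D = (SUP h\<in>D. NM S k h {})"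

end

theory Submission
  imports Defs "HOL-Algebra.Multiplicative_Group" "HOL-Algebra.QuotRing" "HOL-Number_Theory.Cong"
    "HOL-Computational_Algebra.Fundamental_Theorem_Algebra" "HOL-Computational_Algebra.Polynomial_Factorial"
begin

text \<open>Write \<open>A \<sim> B\<close> for commensurability of closed subgroups of \<open>H\<close>, and let \<open>LL\<close> be the family of those
  closed subgroups that are invariant under some \<open>W \<inter> G\<^sub>F\<close>, with \<open>W\<close> an open subgroup of \<open>G\<close> and \<open>F\<close> a
  finite subset of \<open>X\<close>. A strictly decreasing (up to \<open>\<sim>\<close>) chain in \<open>LL\<close> of length \<open>n\<close> produces an element of
  NM-rank at least \<open>n\<close>, since all but countably many cosets of a subgroup of infinite index are moved by
  arbitrarily small elements of \<open>G\<^sub>F\<close>; so chains have bounded length.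

  An infinite \<open>V\<close> in \<open>LL\<close> is an atom if each of its subgroups in \<open>LL\<close> is finite or \<open>\<sim> V\<close>. There are only
  countably many atoms up to \<open>\<sim>\<close>: every atom is commensurable with one of prime exponent, which is
  profinite by Bogolyubov's lemma; atoms inside a sum of two atoms are graphs of partial isomorphisms, which give
  equivariant endomorphisms of a common subgroup \<open>Y\<close>; these endomorphisms, modulo those with infinite
  kernel, form a finite domain, which by Wedderburn is a field and contains at most \<open>m\<close> solutions of \<open>f\<^sup>m = 1\<close>.

  Passing to quotients and inducting on the chain length, every \<open>L\<close> in \<open>LL\<close> has only countably many translates \<open>g L\<close> up to
  \<open>\<sim>\<close>. By Baire category, \<open>[L : L \<inter> w L]\<close> is then bounded for \<open>w\<close> near the identity. Among the subgroups
  \<open>M \<sim> L\<close> for which \<open>[M : M \<inter> w L]\<close> has the least possible bound near the identity there is a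
  greatest one \<open>K\<close>, and its stabilizer is open and contains that of \<open>L\<close>. An open subgroup containing some \<open>G\<^sub>F\<close> is
  the stabilizer of an imaginary, whose orbit is countable because the stabilizer is open.\<close>


text \<open>Smallness is used through one fact: each \<open>P\<close> in \<open>SS\<close> has
  countably many orbits on \<open>H\<close>. Since a countable closed subgroup is finite by Baire,
  fixed-point groups are finite; torsion and the finiteness of the rings of endomorphisms follow
  from this. Invariance is asked only under \<open>W \<inter> G\<^sub>F\<close>, since a subgroup of
  finite index in an invariant group is preserved only by elements near the identity, and finite
  index has to be disregarded throughout. Prime exponent matters because there the closed subgroups
  of finite index separate points, so that finite intersections can be made trivial. Countability of
  the translates of \<open>L\<close> cannot be read off from atoms alone: a minimal step from
  \<open>K\<close> up to \<open>L\<close> is an atom of \<open>H Mod K\<close>, but its translates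
  remain steps over the same \<open>K\<close> only if \<open>K\<close> is preserved by an open
  subgroup. A group between \<open>K\<close> and \<open>L\<close> may lack this property and is
  therefore replaced by a commensurable one with open stabilizer before the induction goes on. To
  count atoms of \<open>H Mod K\<close>, the acting group is hidden behind a directed family of
  acting sets, of which those preserving \<open>K\<close> are kept.\<close>

section \<open>Cyclotomic values and Wedderburn's little theorem\<close>

lemma map_poly_of_int_mult:
 "map_poly (of_int :: int => 'a::{comm_ring_1}) (p * q) = map_poly of_int p * map_poly of_int q"
 by (rule poly_eqI) (simp add: coeff_map_poly coeff_mult)

lemma power_minus_one_dvd_cofactor:
 fixes x :: "'a::comm_ring_1"
 assumes "n = d * e"
 shows "x ^ n - 1 = (x ^ d - 1) * (\<Sum>i<e. (x ^ d) ^ i)"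
 using power_diff_1_eq[of "x ^ d" e] assms by (simp add: power_mult)

text \<open>A point of the unit circle other than 1 has real part below 1. The strict inequality is
  what pushes a cyclotomic value beyond \<open>q - 1\<close>.\<close>

lemma norm_of_nat_minus_unit_gt:
 fixes z :: complex and q :: nat
 assumes "norm z = 1" "z ~= 1" "q \<ge> 2"
 shows "norm (of_nat q - z) > real q - 1"
proof -
 have re: "Re z < 1"
 proof (rule ccontr)
  assume "\<not> Re z < 1"
  hence "Re z = 1" using complex_Re_le_cmod[of z] assms(1) by auto
  moreover hence "Im z = 0" using assms(1) by (simp add: cmod_def)
  ultimately show False using assms(2) by (simp add: complex_eq_iff)
 qed
 have "Re (of_nat q - z) \<le> norm (of_nat q - z)" by (rule complex_Re_le_cmod)
 thus ?thesis using re by simp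
qed

text \<open>The number \<open>g\<close> is (a divisor of) the value at \<open>q\<close> of the \<open>n\<close>-th cyclotomic polynomial,
  obtained as \<open>(X ^ n - 1) / F\<close> where \<open>F\<close> is the least common multiple of
  the \<open>X ^ d - 1\<close> for the proper divisors \<open>d\<close> of \<open>n\<close>.\<close>

lemma cyclotomic_value:
 fixes q n :: nat
 assumes q: "q \<ge> 2" and n: "n \<ge> 2"
 obtains g :: int where "g dvd int q ^ n - 1" "\<not> g dvd int q - 1"
  "!!d. d dvd n ==> d < n ==> g * (int q ^ d - 1) dvd int q ^ n - 1"
proof -
 define X where "X = (Polynomial.monom 1 1 :: int poly)"
 define D where "D = {d. d dvd n & d < n}"
 have finD: "finite D" unfolding D_def by auto
 have D0: "d > 0" if "d \<in> D" for d using that n by (auto simp: D_def intro: Nat.gr0I)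
 define F where "F = Lcm_fin ((%d. X ^ d - 1) ` D)"
 have dvdn: "X ^ d - 1 dvd X ^ n - 1" if "d \<in> D" for d
  using that power_minus_one_dvd_cofactor[of n d _ X] unfolding D_def dvd_def by blast
 have "F dvd X ^ n - 1" unfolding F_def using finD dvdn by (intro Lcm_fin_least) auto
 then obtain G where G: "X ^ n - 1 = F * G" by (auto simp: dvd_def)
 have "F dvd (\<Prod>d\<in>D. X ^ d - 1)" unfolding F_def
  using finD by (intro Lcm_fin_least) auto
 then obtain E where E: "(\<Prod>d\<in>D. X ^ d - 1) = F * E" by (auto simp: dvd_def)
 define ev where "ev p z = poly (map_poly of_int p) z" for p :: "int poly" and z :: complex
 have ev_mult: "ev (p * q) z = ev p z * ev q z" for p q z
  by (simp add: ev_def map_poly_of_int_mult)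
 have ev_X: "ev (X ^ d - 1) z = z ^ d - 1" for d z
 proof -
  have "X ^ d - 1 = Polynomial.monom 1 d - 1" by (simp add: X_def monom_power)
  moreover have "map_poly of_int (Polynomial.monom 1 d - 1 :: int poly) = (Polynomial.monom 1 d - 1 :: complex poly)"
   by (rule poly_eqI) (simp add: coeff_map_poly)
  ultimately show ?thesis by (simp add: ev_def poly_monom)
 qed
 have ev_prod: "ev (\<Prod>d\<in>D'. X ^ d - 1) z = (\<Prod>d\<in>D'. z ^ d - 1)" if "finite D'" for D' z
  using that by (induction D') (auto simp: ev_mult ev_X, simp add: ev_def)
 have pX: "poly (X ^ d - 1) (int q) = int q ^ d - 1" for d
  by (simp add: X_def poly_monom)
 \<comment> \<open>Where \<open>z ^ d = 1\<close>, the cofactor of \<open>X ^ d - 1\<close> takes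
   the nonzero value \<open>e\<close>: the roots of \<open>X ^ n - 1\<close> are simple. For
   \<open>d = 1\<close> this shows that 1 is not a root of \<open>G\<close>.\<close>
 have cof: "EX A. X ^ n - 1 = (X ^ d - 1) * (A * G) & (ALL z. z ^ d = 1 --> ev (A * G) z ~= 0)" if d: "d \<in> D" for d
 proof -
  have "X ^ d - 1 dvd F" unfolding F_def using d finD by (intro dvd_Lcm_fin) auto
  then obtain A where A: "F = (X ^ d - 1) * A" by (auto simp: dvd_def)
  from d obtain e where e: "n = d * e" unfolding D_def by auto
  have "e > 0" using e n by (cases e) auto
  have nz: "X ^ d - 1 ~= 0"
  proof
   assume "X ^ d - 1 = 0"
   hence "ev (X ^ d - 1) 2 = 0" by (simp add: ev_def)
   hence "(2::complex) ^ d = 1" by (simp add: ev_X)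
   hence "norm ((2::complex) ^ d) = 1" by simp
   hence "(2::real) ^ d = 1" by (simp add: norm_power)
   thus False using D0[OF d] one_less_power[of "2::real" d] by auto
  qed
  have "(X ^ d - 1) * (A * G) = (X ^ d - 1) * (\<Sum>i<e. (X ^ d) ^ i)"
   using power_minus_one_dvd_cofactor[OF e, of X] G A by (simp add: mult.assoc)
  hence AG: "A * G = (\<Sum>i<e. (X ^ d) ^ i)" using nz by simp
  have "ev (A * G) z ~= 0" if "z ^ d = 1" for z
  proof -
   have 1: "map_poly (of_int :: int => complex) (\<Sum>i<e. (X ^ d) ^ i) = (\<Sum>i<e. Polynomial.monom 1 (d * i))"
    by (rule poly_eqI) (auto simp: coeff_map_poly coeff_sum X_def monom_power intro!: sum.cong)
   have "ev (A * G) z = (\<Sum>i<e. (z ^ d) ^ i)"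
    unfolding AG ev_def 1 by (simp add: poly_sum poly_monom power_mult)
   thus ?thesis using that \<open>e > 0\<close> by simp
  qed
  thus ?thesis using G A by (metis mult.assoc)
 qed
 have Gdvd: "poly G (int q) dvd int q ^ n - 1"
  using pX[of n] G by (metis dvd_triv_right poly_mult)
 have Gd: "poly G (int q) * (int q ^ d - 1) dvd int q ^ n - 1" if "d dvd n" "d < n" for d
 proof -
  obtain A where "X ^ n - 1 = (X ^ d - 1) * (A * G)" using cof[of d] \<open>d dvd n\<close> \<open>d < n\<close> by (auto simp: D_def)
  hence "int q ^ n - 1 = (int q ^ d - 1) * (poly A (int q) * poly G (int q))"
   using pX[of n] pX[of d] by (metis poly_mult)
  hence "int q ^ n - 1 = (poly G (int q) * (int q ^ d - 1)) * poly A (int q)"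
   by (simp add: mult_ac)
  thus ?thesis by (rule dvdI)
 qed
 define Gc where "Gc = map_poly (of_int :: int => complex) G"
 have Gne: "G ~= 0"
 proof
  assume "G = 0"
  hence "ev (X ^ n - 1) 2 = 0" using G by (simp add: ev_def)
  hence "(2::complex) ^ n = 1" by (simp add: ev_X)
  hence "norm ((2::complex) ^ n) = 1" by simp
  hence "(2::real) ^ n = 1" by (simp add: norm_power)
  thus False using n one_less_power[of "2::real" n] by auto
 qed
 have lc: "lead_coeff Gc = of_int (lead_coeff G)"
  unfolding Gc_def by (simp add: coeff_map_poly degree_map_poly)
 have root: "norm z = 1 & z ~= 1" if "poly Gc z = 0" for z
 proof -
  have "ev G z = 0" using that by (simp add: Gc_def ev_def)
  hence "ev (X ^ n - 1) z = 0" using G by (simp add: ev_mult)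
  hence "z ^ n = 1" by (simp add: ev_X)
  hence "norm z ^ n = 1" by (metis norm_one norm_power)
  hence "norm z = 1" using n power_eq_1_iff[of "norm z" n] by auto
  moreover have "1 \<in> D" using n by (auto simp: D_def)
  then obtain A where "ALL z. z ^ 1 = 1 --> ev (A * G) z ~= 0" using cof by blast
  hence "z ~= 1" using \<open>ev G z = 0\<close> by (auto simp: ev_mult)
  ultimately show ?thesis by simp
 qed
 \<comment> \<open>A primitive \<open>n\<close>-th root of unity is a root of no
   \<open>X ^ d - 1\<close> with \<open>d\<close> a proper divisor, hence not of \<open>F\<close>,
   so it is a root of \<open>G\<close>. With no root at all the product below would be empty and the
   bound lost.\<close>
 have deg: "degree Gc > 0"
 proof -
  define w where "w = cis (2 * pi / real n)"
  have wd: "w ^ d ~= 1" if "d \<in> D" for d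
  proof
   assume "w ^ d = 1"
   hence "cis (real d * (2 * pi / real n)) = 1" unfolding w_def by (simp only: Complex.DeMoivre)
   hence "cos (real d * (2 * pi / real n)) = 1" by (simp add: complex_eq_iff)
   then obtain j :: int where j: "real d * (2 * pi / real n) = of_int j * 2 * pi"
    by (auto simp: cos_one_2pi_int)
   hence "(2 * pi) * (real d / real n) = (2 * pi) * of_int j" by (simp add: mult_ac)
   hence "real d / real n = of_int j" by (subst (asm) mult_left_cancel) auto
   moreover have "0 < real d / real n" "real d / real n < 1" using D0[OF that] that n by (auto simp: D_def)
   ultimately have "0 < j" "j < 1" by auto
   thus False by simp
  qed
  have wn: "w ^ n = 1" unfolding w_def Complex.DeMoivre using n by simp
  have "ev F w ~= 0"
  proof
   assume "ev F w = 0"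
   hence "ev (\<Prod>d\<in>D. X ^ d - 1) w = 0" unfolding E by (simp add: ev_mult)
   thus False using wd finD by (simp add: ev_prod)
  qed
  moreover have "ev F w * ev G w = 0" using wn G ev_X[of n w] by (metis ev_mult diff_self)
  ultimately have "poly Gc w = 0" by (simp add: ev_def Gc_def)
  moreover have "Gc ~= 0" using lc Gne by auto
  ultimately show ?thesis
   by (metis gr0I degree_eq_zeroE mult_zero_right poly_pCons poly_0 add.right_neutral pCons_0_0)
 qed
 \<comment> \<open>The leading coefficient is a nonzero integer and every linear factor exceeds
   \<open>q - 1\<close>, which is at least 1; so a single factor carries the bound.\<close>
 have "norm (poly Gc (of_nat q)) > real q - 1"
 proof -
  obtain r where r: "Polynomial.smult (lead_coeff Gc) (\<Prod>i<degree Gc. [:- r i, 1:]) = Gc"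
   using complex_poly_decompose'[of Gc] by blast
  have rr: "poly Gc (r i) = 0" if "i < degree Gc" for i
  proof -
   have "poly (\<Prod>i<degree Gc. [:- r i, 1:]) (r i) = 0" using that by (auto simp: poly_prod)
   thus ?thesis by (subst r[symmetric]) simp
  qed
  have "poly Gc (of_nat q) = lead_coeff Gc * (\<Prod>i<degree Gc. of_nat q - r i)"
   by (subst r[symmetric]) (simp add: poly_prod)
  hence eq: "norm (poly Gc (of_nat q)) = norm (lead_coeff Gc) * (\<Prod>i<degree Gc. norm (of_nat q - r i))"
   by (simp add: norm_mult prod_norm)
  have "\<bar>lead_coeff G\<bar> \<ge> 1" using Gne by (simp add: int_one_le_iff_zero_less)
  hence l: "norm (lead_coeff Gc) \<ge> 1" unfolding lc by simp
  have gt: "norm (of_nat q - r i) > real q - 1" if "i < degree Gc" for i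
   using norm_of_nat_minus_unit_gt root[OF rr[OF that]] q by blast
  obtain m where m: "degree Gc = Suc m" using deg by (cases "degree Gc") auto
  have "(\<Prod>i<m. norm (of_nat q - r i)) \<ge> 1"
  proof (rule prod_ge_1)
   fix i assume "i \<in> {..<m}"
   thus "1 \<le> norm (of_nat q - r i)" using gt[of i] m q by auto
  qed
  hence "(\<Prod>i<degree Gc. norm (of_nat q - r i)) \<ge> 1 * norm (of_nat q - r m)"
   unfolding m using mult_right_mono[OF _ norm_ge_zero] by fastforce
  hence "(\<Prod>i<degree Gc. norm (of_nat q - r i)) > real q - 1" using gt[of m] m by simp
  thus ?thesis unfolding eq using l q
   by (smt (verit, best) mult_left_le_one_le mult_less_cancel_right1 mult_le_cancel_right1 of_nat_1 of_nat_le_iff one_le_numeral order_trans)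
 qed
 moreover have "poly Gc (of_nat q) = of_int (poly G (int q))"
 proof -
  have "poly (map_poly of_int p) (of_nat q :: complex) = of_int (poly p (int q))" for p
   by (induction p) (auto simp: map_poly_pCons)
  thus ?thesis by (simp add: Gc_def)
 qed
 ultimately have big: "\<bar>poly G (int q)\<bar> > int q - 1" by (smt (verit) norm_of_int of_int_less_iff of_int_of_nat_eq of_int_1 of_int_diff of_int_abs)
 have "\<not> poly G (int q) dvd int q - 1"
  using big q zdvd_imp_le[of "\<bar>poly G (int q)\<bar>" "int q - 1"] by (auto)
 with Gdvd Gd show ?thesis using that by blast
qed

text \<open>Dimension over a division ring \<open>K\<close> without the vocabulary of vector spaces:
  a largest \<open>K\<close>-submodule \<open>S\<close> among those of size a power of
  \<open>card K\<close> must be \<open>D\<close>, because adjoining a missing \<open>x\<close> gives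
  \<open>S + K x\<close>, larger by the factor \<open>card K\<close>.\<close>

lemma (in ring) card_power_of_division_subring:
 assumes fin: "finite (carrier R)" and KD: "K <= D" "D <= carrier R"
  and K: "\<zero> \<in> K" "!!a b. a \<in> K ==> b \<in> K ==> a \<ominus> b \<in> K"
   "!!a. a \<in> K ==> a ~= \<zero> ==> EX b:K. b \<otimes> a = \<one>"
  and D: "!!a b. a \<in> D ==> b \<in> D ==> a \<oplus> b \<in> D" "!!a. a \<in> D ==> \<ominus> a \<in> D"
   "!!a b. a \<in> K ==> b \<in> D ==> a \<otimes> b \<in> D"
  and Km: "!!a b. a \<in> K ==> b \<in> K ==> a \<otimes> b \<in> K"
  and one_in: "\<one> \<in> K" "\<one> ~= \<zero>" and Ka: "!!a b. a \<in> K ==> b \<in> K ==> a \<oplus> b \<in> K"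
 shows "EX m. card D = card K ^ m"
proof -
 define sub where "sub S \<longleftrightarrow> S <= D & \<zero> \<in> S & (ALL a:S. ALL b:S. a \<oplus> b \<in> S) & (ALL a:S. \<ominus> a \<in> S)
  & (ALL k:K. ALL a:S. k \<otimes> a \<in> S)" for S
 define A where "A = {S. sub S & (EX j. card S = card K ^ j)}"
 have finD: "finite D" using fin KD finite_subset by blast
 hence "finite A" unfolding A_def sub_def by (auto intro: finite_subset[of _ "Pow D"])
 have Kc: "k \<in> carrier R" if "k \<in> K" for k using that KD by auto
 have Dc: "k \<in> carrier R" if "k \<in> D" for k using that KD by auto
 have "{\<zero>} \<in> A"
  unfolding A_def sub_def using K(1) KD Kc by (auto intro!: exI[of _ 0])
 then obtain S where S: "S \<in> A" and Smax: "!!S'. S' \<in> A ==> card S' \<le> card S"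
  using that \<open>finite A\<close> Max_in[of "card ` A"] Max_ge[of "card ` A"] by (metis (no_types, lifting) empty_iff finite_imageI image_iff imageI)
 from S obtain j where j: "card S = card K ^ j" by (auto simp: A_def)
 from S have s: "S <= D" "\<zero> \<in> S" "!!a b. a \<in> S ==> b \<in> S ==> a \<oplus> b \<in> S" "!!a. a \<in> S ==> \<ominus> a \<in> S"
  "!!k a. k \<in> K ==> a \<in> S ==> k \<otimes> a \<in> S" by (auto simp: A_def sub_def)
 have Sc: "k \<in> carrier R" if "k \<in> S" for k using that s KD by auto
 have "S = D"
 proof (rule ccontr)
  assume "S ~= D"
  then obtain x where x: "x \<in> D" "x \<notin> S" using s by auto
  hence xc: "x \<in> carrier R" using Dc by auto
  define f where "f = (%(a, k). a \<oplus> k \<otimes> x)"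
  \<comment> \<open>If two representations agree, \<open>k - k'\<close> multiplies \<open>x\<close>
    into \<open>S\<close>; were it nonzero, its inverse would bring \<open>x\<close> itself into
    \<open>S\<close>.\<close>
  have inj: "inj_on f (S \<times> K)"
  proof (rule inj_onI, clarify)
   fix a k a' k' assume ak: "a \<in> S" "k \<in> K" "a' \<in> S" "k' \<in> K" and eq: "f (a, k) = f (a', k')"
   hence c: "a \<in> carrier R" "k \<in> carrier R" "a' \<in> carrier R" "k' \<in> carrier R" using Sc Kc by auto
   have e: "a \<oplus> k \<otimes> x = a' \<oplus> k' \<otimes> x" using eq by (simp add: f_def)
   have e1: "(k \<ominus> k') \<otimes> x = a' \<oplus> \<ominus> a"
   proof -
    have "(k \<ominus> k') \<otimes> x = (\<ominus> a \<oplus> (a \<oplus> k \<otimes> x)) \<oplus> \<ominus> (k' \<otimes> x)"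
     using c xc by (simp add: r_neg1 l_neg minus_eq l_distr l_minus r_neg a_assoc)
    also have "\<dots> = \<ominus> a \<oplus> a'" unfolding e using c xc by (simp add: a_assoc r_neg)
    finally show ?thesis using c by (simp add: a_comm)
   qed
   have "k \<ominus> k' = \<zero>"
   proof (rule ccontr)
    assume "k \<ominus> k' ~= \<zero>"
    then obtain b where b: "b \<in> K" "b \<otimes> (k \<ominus> k') = \<one>" using K ak by blast
    have "x = b \<otimes> ((k \<ominus> k') \<otimes> x)" using b c xc Kc by (simp add: m_assoc[symmetric])
    also have "\<dots> \<in> S" unfolding e1 using s ak b by auto
    finally show False using x by simp
   qed
   hence kk: "k = k'" using c by (metis minus_eq r_right_minus_eq)
   hence "a = a'" using e c xc by simp
   thus "a = a' & k = k'" using kk by simp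
  qed
  define S' where "S' = f ` (S \<times> K)"
  have "card S' = card K ^ Suc j" unfolding S'_def card_image[OF inj] by (simp add: j card_cartesian_product)
  moreover have "sub S'"
   unfolding sub_def
  proof (intro conjI ballI)
   show "S' <= D" unfolding S'_def f_def using s D x by auto
   show "\<zero> \<in> S'" unfolding S'_def f_def using s K xc by (auto intro!: rev_image_eqI[of "(\<zero>, \<zero>)"])
  next
   fix u v assume "u \<in> S'" "v \<in> S'"
   then obtain a k a' k' where uv: "u = a \<oplus> k \<otimes> x" "v = a' \<oplus> k' \<otimes> x" "a \<in> S" "k \<in> K" "a' \<in> S" "k' \<in> K"
    unfolding S'_def f_def by auto
   hence c: "a \<in> carrier R" "k \<in> carrier R" "a' \<in> carrier R" "k' \<in> carrier R" using Sc Kc by auto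
   have "u \<oplus> v = f (a \<oplus> a', k \<oplus> k')" unfolding uv f_def using c xc by (simp add: l_distr a_ac)
   thus "u \<oplus> v \<in> S'" unfolding S'_def using uv s Ka by auto
  next
   fix u assume "u \<in> S'"
   then obtain a k where uv: "u = a \<oplus> k \<otimes> x" "a \<in> S" "k \<in> K"
    unfolding S'_def f_def by auto
   hence c: "a \<in> carrier R" "k \<in> carrier R" using Sc Kc by auto
   have "\<zero> \<ominus> k = \<ominus> k" using c by (simp add: minus_eq)
   hence "\<ominus> k \<in> K" using K(1) K(2)[OF K(1) uv(3)] by simp
   moreover have "\<ominus> u = f (\<ominus> a, \<ominus> k)" unfolding uv f_def using c xc by (simp add: l_minus minus_add a_comm)
   ultimately show "\<ominus> u \<in> S'" unfolding S'_def using uv s by auto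

  next
   fix l u assume "l \<in> K" "u \<in> S'"
   then obtain a k where uv: "u = a \<oplus> k \<otimes> x" "a \<in> S" "k \<in> K"
    unfolding S'_def f_def by auto
   hence c: "a \<in> carrier R" "k \<in> carrier R" using Sc Kc by auto
   have "l \<otimes> u = f (l \<otimes> a, l \<otimes> k)" unfolding uv f_def using c xc Kc[OF \<open>l \<in> K\<close>] by (simp add: r_distr m_assoc)
   thus "l \<otimes> u \<in> S'" unfolding S'_def using uv s Km \<open>l \<in> K\<close> by auto
  qed
  ultimately have "S' \<in> A" unfolding A_def by blast
  hence le: "card S' \<le> card S" using Smax by blast
  have "S \<subset> S'"
  proof
   show "S <= S'"
   proof
    fix a assume "a \<in> S"
    hence "f (a, \<zero>) \<in> S'" unfolding S'_def using K by blast
    thus "a \<in> S'" using xc Sc[OF \<open>a \<in> S\<close>] by (simp add: f_def)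
   qed
   show "S ~= S'"
   proof -
    have "f (\<zero>, \<one>) \<in> S'" unfolding S'_def using one_in s by blast
    hence "x \<in> S'" using xc by (simp add: f_def)
    thus ?thesis using x by auto
   qed
  qed
  hence "card S < card S'" using finD \<open>sub S'\<close> by (intro psubset_card_mono) (unfold sub_def, meson finite_subset)
  thus False using le by simp
 qed
 thus ?thesis using j by auto
qed

text \<open>Witt's argument: in the class equation of the unit group, the order of the group and the
  size of every noncentral conjugacy class are divisible by a cyclotomic value \<open>g\<close>.
  Then \<open>g\<close> divides \<open>q - 1\<close> as well, which \<open>cyclotomic_value\<close>
  excludes.\<close>

theorem (in ring) finite_integral_ring_commutative:
 assumes fin: "finite (carrier R)" and nontriv: "\<one> ~= \<zero>"
  and nzd: "!!a b. a \<in> carrier R ==> b \<in> carrier R ==> a \<otimes> b = \<zero> ==> a = \<zero> \<or> b = \<zero>"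
  and a: "a \<in> carrier R" and b: "b \<in> carrier R"
 shows "a \<otimes> b = b \<otimes> a"
proof -
 have sur: "EX c:carrier R. c \<otimes> x = \<one>" if x: "x \<in> carrier R" "x ~= \<zero>" for x
 proof -
  have "inj_on (%c. c \<otimes> x) (carrier R)"
  proof (rule inj_onI)
   fix c d assume cd: "c \<in> carrier R" "d \<in> carrier R" "c \<otimes> x = d \<otimes> x"
   hence "(c \<ominus> d) \<otimes> x = \<zero>" using x by (simp add: minus_eq l_distr l_minus r_neg)
   hence "c \<ominus> d = \<zero>" using nzd[of "c \<ominus> d" x] x cd by auto
   thus "c = d" using cd by (metis minus_eq r_right_minus_eq)
  qed
  moreover have "(%c. c \<otimes> x) ` carrier R <= carrier R" using x by auto
  ultimately have "(%c. c \<otimes> x) ` carrier R = carrier R" using fin endo_inj_surj by blast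
  thus ?thesis using one_closed by (metis (no_types, lifting) imageE)
 qed
 have lr: "x \<otimes> c = \<one>" if x: "x \<in> carrier R" "c \<in> carrier R" "c \<otimes> x = \<one>" for x c
 proof -
  have "c ~= \<zero>" using that nontriv by auto
  then obtain d where d: "d \<in> carrier R" "d \<otimes> c = \<one>" using sur x by blast
  have "x = d \<otimes> c \<otimes> x" using d x by simp
  also have "\<dots> = d" using d(1) x m_assoc[of d c x] by simp
  finally show ?thesis using d by simp
 qed
 have units: "Units R = carrier R - {\<zero>}"
 proof
  show "Units R <= carrier R - {\<zero>}" using nontriv by (auto simp: Units_def)
  show "carrier R - {\<zero>} <= Units R"
  proof
   fix x assume "x \<in> carrier R - {\<zero>}"
   then obtain c where "c \<in> carrier R" "c \<otimes> x = \<one>" using sur by blast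
   thus "x \<in> Units R" using lr \<open>x \<in> carrier R - {\<zero>}\<close> unfolding Units_def by blast
  qed
 qed
 define Z where "Z = {z \<in> carrier R. ALL x:carrier R. z \<otimes> x = x \<otimes> z}"
 define C where "C y = {z \<in> carrier R. z \<otimes> y = y \<otimes> z}" for y
 have inv_comm: "c \<otimes> y = y \<otimes> c" if "x \<in> carrier R" "c \<in> carrier R" "y \<in> carrier R" "c \<otimes> x = \<one>" "x \<otimes> y = y \<otimes> x" for x c y
 proof -
  have "c \<otimes> y = c \<otimes> (y \<otimes> x) \<otimes> c" using lr[of x c] that by (simp add: m_assoc)
  also have "\<dots> = (c \<otimes> x) \<otimes> y \<otimes> c" unfolding that(5)[symmetric] using that(1-3) by (simp add: m_assoc)
  finally show ?thesis using that by simp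
 qed
 have mult_comm: "u \<otimes> v \<otimes> y = y \<otimes> (u \<otimes> v)"
  if "u \<in> carrier R" "v \<in> carrier R" "y \<in> carrier R" "u \<otimes> y = y \<otimes> u" "v \<otimes> y = y \<otimes> v" for u v y
 proof -
  have "u \<otimes> v \<otimes> y = u \<otimes> (y \<otimes> v)" using that m_assoc by simp
  also have "\<dots> = u \<otimes> y \<otimes> v" using that(1-3) m_assoc by simp
  finally show ?thesis using that m_assoc by simp
 qed
 \<comment> \<open>The centre \<open>Z\<close> and the centralizers \<open>C y\<close> are division
   rings, and the larger rings are vector spaces over them, so every size that occurs is a power of
   \<open>q\<close>.\<close>
 have powC: "EX m. card D = card K ^ m" if KD: "K <= D" and D: "D \<in> insert (carrier R) (C ` carrier R)"
  and K: "K \<in> insert Z (C ` carrier R)" for K D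
 proof (rule card_power_of_division_subring[OF fin KD])
  show "D <= carrier R" using D by (auto simp: C_def)
  show "\<zero> \<in> K" using K by (auto simp: C_def Z_def)
  show "\<one> \<in> K" using K by (auto simp: C_def Z_def)
  show "\<one> ~= \<zero>" by fact
  show "a \<ominus> b \<in> K" if "a \<in> K" "b \<in> K" for a b
   using K that by (auto simp: C_def Z_def minus_eq l_distr r_distr l_minus r_minus)
  show "a \<oplus> b \<in> K" if "a \<in> K" "b \<in> K" for a b
   using K that by (auto simp: C_def Z_def l_distr r_distr)
  show mK: "a \<otimes> b \<in> K" if "a \<in> K" "b \<in> K" for a b
   using K that by (auto simp: C_def Z_def intro!: mult_comm)
  show "EX b:K. b \<otimes> a = \<one>" if a: "a \<in> K" "a ~= \<zero>" for a
  proof -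
   have ac: "a \<in> carrier R" using a K by (auto simp: C_def Z_def)
   then obtain c where c: "c \<in> carrier R" "c \<otimes> a = \<one>" using sur a by blast
   have "c \<in> K" using K a ac c inv_comm[of a c] by (auto simp: C_def Z_def)
   thus ?thesis using c by blast
  qed
  show aD: "a \<oplus> b \<in> D" if "a \<in> D" "b \<in> D" for a b
   using D that by (auto simp: C_def Z_def l_distr r_distr)
  show "\<ominus> a \<in> D" if "a \<in> D" for a
   using D that by (auto simp: C_def Z_def l_minus r_minus)
  show "a \<otimes> b \<in> D" if "a \<in> K" "b \<in> D" for a b
  proof -
   have "a \<in> D" using that KD by auto
   thus ?thesis using D that KD by (auto simp: C_def intro!: mult_comm)
  qed
 qed
 have Zc: "Z <= carrier R" by (auto simp: Z_def)
 have zero_Z: "\<zero> \<in> Z" by (simp add: Z_def)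
 have "Z = carrier R"
 proof (rule ccontr)
  assume ZR: "Z ~= carrier R"
  define q where "q = card Z"
  have "{\<zero>, \<one>} <= Z" by (auto simp: Z_def)
  hence "card {\<zero>, \<one>} \<le> q" unfolding q_def using card_mono[OF finite_subset[OF Zc fin]] by simp
  hence q2: "q \<ge> 2" using nontriv by auto
  obtain n where n: "card (carrier R) = q ^ n" using powC[of Z "carrier R"] Zc by (auto simp: q_def)
  have "q < card (carrier R)" unfolding q_def using ZR Zc fin by (intro psubset_card_mono) auto
  hence "n ~= 0" "n ~= 1" using n q2 by (auto intro!: Nat.gr0I)
  hence n2: "n \<ge> 2" by auto
  obtain g :: int where g: "g dvd int q ^ n - 1" "\<not> g dvd int q - 1"
   "!!d. d dvd n ==> d < n ==> g * (int q ^ d - 1) dvd int q ^ n - 1"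
   using cyclotomic_value[OF q2 n2] by metis
  interpret G: group "units_of R" by (rule units_group)
  define conj where "conj = (%g. \<lambda>h\<in>carrier (units_of R). g \<otimes>\<^bsub>units_of R\<^esub> h \<otimes>\<^bsub>units_of R\<^esub> inv\<^bsub>units_of R\<^esub> g)"
  interpret A: group_action "units_of R" "carrier (units_of R)" conj
   unfolding conj_def by (rule G.action_by_conjugation)
  have cG: "carrier (units_of R) = carrier R - {\<zero>}" by (simp add: units_of_carrier units)
  have ordG: "int (order (units_of R)) = int q ^ n - 1"
  proof -
   have "card (carrier R) \<ge> 1" using fin zero_closed by (metis One_nat_def Suc_leI card_gt_0_iff empty_iff)
   moreover have "card (carrier R - {\<zero>}) = card (carrier R) - 1" by (rule card_Diff_singleton) simp
   ultimately show ?thesis unfolding order_def cG n[symmetric] by (simp add: of_nat_diff n[symmetric])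
  qed
  \<comment> \<open>The class of \<open>x\<close> has size \<open>(q ^ n - 1) / (q ^ d - 1)\<close>,
    where \<open>q ^ d\<close> is the size of the centralizer and \<open>d\<close> is a proper
    divisor of \<open>n\<close>. This is the quotient that \<open>g\<close> was built to
    divide.\<close>
  have orb: "g dvd int (card (orbit (units_of R) conj x))" if x: "x \<in> carrier R" "x \<notin> Z" for x
  proof -
   have x0: "x \<in> carrier (units_of R)" using x zero_Z unfolding cG by blast
   have "stabilizer (units_of R) conj x = C x - {\<zero>}"
   proof -
    have "(u \<otimes>\<^bsub>units_of R\<^esub> x \<otimes>\<^bsub>units_of R\<^esub> inv\<^bsub>units_of R\<^esub> u = x) \<longleftrightarrow> u \<otimes> x = x \<otimes> u" if u: "u \<in> carrier (units_of R)" for u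
     using G.inv_solve_right'[OF x0 G.m_closed[OF u x0] u] unfolding units_of_mult by metis
    hence "conj u x = x \<longleftrightarrow> u \<otimes> x = x \<otimes> u" if "u \<in> carrier R - {\<zero>}" for u
     using that cG x0 unfolding conj_def by simp
    thus ?thesis unfolding stabilizer_def C_def cG by blast
   qed
   moreover have "\<zero> \<in> C x" using x by (simp add: C_def)
   moreover have finC: "finite (C x)" using fin by (simp add: C_def)
   moreover have Cx1: "card (C x) \<ge> 1" using \<open>\<zero> \<in> C x\<close> finC by (metis One_nat_def Suc_leI card_gt_0_iff empty_iff)
   ultimately have st: "int (card (stabilizer (units_of R) conj x)) = int (card (C x)) - 1"
    by (simp add: of_nat_diff)
   have ZC: "Z <= C x" using x by (auto simp: Z_def C_def)
   then obtain d where d: "card (C x) = q ^ d" using powC[of Z "C x"] x by (auto simp: q_def)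
   have CR: "C x <= carrier R" by (auto simp: C_def)
   then obtain e where e: "card (carrier R) = card (C x) ^ e" using powC[of "C x" "carrier R"] x by auto
   have "q ^ n = q ^ (d * e)" using n d e unfolding power_mult by metis
   hence nde: "n = d * e" using q2 by simp
   have "C x ~= carrier R" using x by (force simp: C_def Z_def)
   hence "card (C x) < card (carrier R)" using CR fin by (intro psubset_card_mono) auto
   hence "d < n" using n d q2 by simp
   have "g * (int q ^ d - 1) dvd int q ^ n - 1" using g(3)[OF _ \<open>d < n\<close>] nde by simp
   moreover have "int (card (orbit (units_of R) conj x)) * (int q ^ d - 1) = int q ^ n - 1"
   proof -
    have "int (card (orbit (units_of R) conj x)) * int (card (stabilizer (units_of R) conj x)) = int (order (units_of R))"
     using A.orbit_stabilizer_theorem[OF x0] by (metis of_nat_mult)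
    thus ?thesis unfolding st ordG d by simp
   qed
   ultimately have "g * (int q ^ d - 1) dvd int (card (orbit (units_of R) conj x)) * (int q ^ d - 1)" by simp
   moreover have "int q ^ d - 1 ~= 0"
   proof -
    have "q \<le> card (C x)" unfolding q_def using ZC finC by (intro card_mono)
    hence "q ^ d \<ge> 2" using d q2 by simp
    hence "int (q ^ d) \<ge> 2" by linarith
    thus ?thesis by simp
   qed
   ultimately show ?thesis by simp
  qed
  define M where "M = carrier R - Z"
  have xorb: "x \<in> orbit (units_of R) conj x" if "x \<in> M" for x
   using that zero_Z unfolding M_def by (intro A.orbit_refl) (auto simp: cG)
  have orbM: "orbit (units_of R) conj x <= M" if x: "x \<in> M" for x
  proof
   fix y assume y: "y \<in> orbit (units_of R) conj x"
   have x0: "x \<in> carrier (units_of R)" using x zero_Z unfolding cG M_def by blast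
   obtain u where u: "u \<in> carrier (units_of R)" "conj u x = y" using y unfolding orbit_def by auto
   have yG: "y \<in> carrier (units_of R)" using A.element_image[OF u(1) x0 u(2)] .
   have "y \<notin> Z"
   proof
    assume "y \<in> Z"
    have yy: "y = u \<otimes>\<^bsub>units_of R\<^esub> x \<otimes>\<^bsub>units_of R\<^esub> inv\<^bsub>units_of R\<^esub> u" using u x0 by (simp add: conj_def)
    hence "y \<otimes>\<^bsub>units_of R\<^esub> u = u \<otimes>\<^bsub>units_of R\<^esub> x" using u x0 yG by (simp add: G.m_assoc)
    moreover have "y \<otimes>\<^bsub>units_of R\<^esub> u = u \<otimes>\<^bsub>units_of R\<^esub> y" using \<open>y \<in> Z\<close> u cG by (simp add: units_of_mult Z_def)
    ultimately have "u \<otimes>\<^bsub>units_of R\<^esub> x = u \<otimes>\<^bsub>units_of R\<^esub> y" by simp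
    hence "x = y" using u(1) x0 yG by (metis G.inv_closed G.l_inv G.l_one G.m_assoc)
    thus False using \<open>y \<in> Z\<close> x by (simp add: M_def)
   qed
   thus "y \<in> M" using yG cG by (simp add: M_def)
  qed
  define \<O> where "\<O> = orbit (units_of R) conj ` M"
  have dj: "disjnt X Y" if XY: "X \<in> \<O>" "Y \<in> \<O>" "X ~= Y" for X Y
  proof -
   have "M <= carrier (units_of R)" unfolding M_def cG by (auto simp: Z_def)
   hence "X \<in> orbits (units_of R) (carrier (units_of R)) conj" "Y \<in> orbits (units_of R) (carrier (units_of R)) conj"
    using XY(1,2) unfolding \<O>_def orbits_def by blast+
   thus "disjnt X Y" using A.disjoint_union[of X Y] XY(3) unfolding disjnt_def by simp
  qed
  have XM: "X <= M" if "X \<in> \<O>" for X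
   using that orbM unfolding \<O>_def by (elim imageE) simp
  have fX: "finite X" if "X \<in> \<O>" for X
   by (rule finite_subset[OF XM[OF that]]) (simp add: M_def fin)
  have "M <= \<Union>\<O>" unfolding \<O>_def using xorb by blast
  hence "\<Union>\<O> = M" using XM by blast
  moreover have "card (\<Union>\<O>) = sum card \<O>"
   using dj fX by (intro card_Union_disjoint pairwiseI)
  moreover have "g dvd (\<Sum>X\<in>\<O>. int (card X))"
   unfolding \<O>_def using orb by (intro dvd_sum) (auto simp: M_def)
  ultimately have gM: "g dvd int (card M)" by (metis of_nat_sum)
  moreover have "int (card M) = int q ^ n - int q"
   unfolding M_def using card_Diff_subset[OF finite_subset[OF Zc fin] Zc] n q_def card_mono[OF fin Zc]
   by (simp add: of_nat_diff)
  ultimately have "g dvd int q ^ n - int q" by simp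
  from dvd_diff[OF g(1) this] have "g dvd (int q ^ n - 1) - (int q ^ n - int q)" .
  thus False using g(2) by simp
 qed
 thus ?thesis using a b by (auto simp: Z_def)
qed

section \<open>Characters of finite abelian groups of prime exponent\<close>

locale finite_exponent_group = comm_group G for G (structure) +
 fixes p :: nat
 assumes fin: "finite (carrier G)" and prime_p: "prime p"
  and expo: "x \<in> carrier G ==> x [^] p = \<one>"
begin

text \<open>Extensional functions, so that a character is determined by its values on the group and
  there are only finitely many of them.\<close>

definition chars :: "('a => complex) set" where
 "chars = {h \<in> extensional (carrier G). h \<one> = 1 &
  (ALL x:carrier G. ALL y:carrier G. h (x \<otimes> y) = h x * h y)}"

lemma p_pos: "p > 0" "p > 1"
 using prime_p by (auto simp: prime_gt_0_nat intro: prime_gt_1_nat[simplified])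

lemma char_pow: "h \<in> chars ==> x \<in> carrier G ==> h (x [^] (n::nat)) = h x ^ n"
 by (induction n) (auto simp: chars_def)

lemma char_root: "h \<in> chars ==> x \<in> carrier G ==> h x ^ p = 1"
 using char_pow[of h x p] expo by (auto simp: chars_def)

lemma char_norm: "h \<in> chars ==> x \<in> carrier G ==> norm (h x) = 1"
 using char_root power_eq_1_iff[of "h x" p] p_pos by auto

lemma char_inv:
 assumes "h \<in> chars" "x \<in> carrier G"
 shows "h (inv x) = cnj (h x)"
proof -
 have "h (inv x \<otimes> x) = h (inv x) * h x" using assms unfolding chars_def by blast
 hence "h (inv x) * h x = 1" using assms by (simp add: chars_def)
 moreover have "cnj (h x) * h x = 1" using char_norm[OF assms] complex_norm_square[of "h x"]
  by (simp add: mult.commute)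
 moreover have "h x ~= 0" using char_norm[OF assms] by auto
 ultimately show ?thesis by (metis mult_right_cancel)
qed

lemma char_mult: "h \<in> chars ==> x \<in> carrier G ==> y \<in> carrier G ==> h (x \<otimes> y) = h x * h y"
 by (auto simp: chars_def)

lemma finite_roots: "finite {z::complex. z ^ p = 1}" "card {z::complex. z ^ p = 1} = p"
 using finite_roots_unity[of p] card_roots_unity_eq[of p] p_pos by auto

lemma finite_chars: "finite chars"
proof (rule finite_subset)
 show "chars <= carrier G \<rightarrow>\<^sub>E {z. z ^ p = 1}"
  using char_root by (auto simp: chars_def PiE_def)
 show "finite (carrier G \<rightarrow>\<^sub>E {z::complex. z ^ p = 1})" by (rule finite_PiE[OF fin]) (rule finite_roots)
qed

definition trivial_char :: "'a => complex" where "trivial_char = (\<lambda>x\<in>carrier G. 1)"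

lemma trivial_char: "trivial_char \<in> chars"
 by (auto simp: chars_def trivial_char_def)

lemma pow_cong:
 assumes "x \<in> carrier G" "[a = b] (mod p)"
 shows "x [^] a = x [^] b"
proof -
 have "x [^] a = x [^] (a mod p)" for a
 proof -
  have "x [^] a = x [^] (p * (a div p) + a mod p)" by simp
  also have "\<dots> = x [^] (p * (a div p)) \<otimes> x [^] (a mod p)"
   using assms by (simp add: nat_pow_mult del: mult_div_mod_eq)
  also have "x [^] (p * (a div p)) = (x [^] p) [^] (a div p)"
   using assms by (simp add: nat_pow_pow)
  finally show ?thesis using assms expo by simp
 qed
 thus ?thesis using assms by (metis cong_def)
qed

lemma pow_mult_p: "x \<in> carrier G ==> x [^] (p * k) = \<one>"
 using expo[of x] nat_pow_pow[of x p k] by simp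

text \<open>A subgroup \<open>S\<close> maximal among those not containing \<open>x\<close> has
  index \<open>p\<close>, and the powers of \<open>x\<close> represent its cosets. The character
  sends the coset of the \<open>i\<close>-th power to \<open>w ^ i\<close>, for a primitive
  \<open>p\<close>-th root of unity \<open>w\<close>.\<close>

lemma separating_char:
 assumes x: "x \<in> carrier G" "x ~= \<one>"
 shows "EX h:chars. h x ~= 1"
proof -
 define A where "A = {S. subgroup S G & x \<notin> S}"
 have "A <= Pow (carrier G)" by (auto simp: A_def dest: subgroup.subset)
 hence "finite A" by (rule finite_subset) (simp add: fin)
 moreover have "{\<one>} \<in> A" using x by (simp add: A_def triv_subgroup)
 ultimately obtain S where S: "S \<in> A" and Smax: "!!S'. S' \<in> A ==> S <= S' ==> S = S'"
  using finite_has_maximal2[of A "{\<one>}"] by metis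
 have sg: "subgroup S G" and xS: "x \<notin> S" using S by (auto simp: A_def)
 interpret S: subgroup S G by (rule sg)
 have xp: "x [^] i \<in> carrier G" for i :: nat using x by simp
 have Spow: "z [^] n \<in> S" if "z \<in> S" for z and n :: nat
  using that by (induction n) auto
 \<comment> \<open>For \<open>i\<close> prime to \<open>p\<close>, a power of \<open>x [^] i\<close>
   is \<open>x\<close> itself, which is not in \<open>S\<close>.\<close>
 have pdvd: "p dvd i" if "x [^] (i::nat) \<in> S" for i
 proof (rule ccontr)
  assume "\<not> p dvd i"
  hence "coprime i p" using prime_imp_coprime[OF prime_p] by (simp add: coprime_commute)
  then obtain u where u: "[i * u = 1] (mod p)" by (metis One_nat_def cong_solve_coprime_nat)
  have "x [^] (i * u) \<in> S" using Spow[OF that, of u] x by (simp add: nat_pow_pow)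
  moreover have "x [^] (i * u) = x [^] (1::nat)" using pow_cong[OF x(1) u] .
  ultimately show False using xS x by simp
 qed
 have idx_unique: "[a = b] (mod p)" if y: "y \<in> carrier G" "y \<otimes> inv (x [^] a) \<in> S" "y \<otimes> inv (x [^] b) \<in> S" for y and a b :: nat
 proof -
  have *: "[a = b] (mod p)" if y: "y \<otimes> inv (x [^] a) \<in> S" "y \<otimes> inv (x [^] b) \<in> S" and le: "b \<le> a" for a b :: nat
  proof -
   have "inv (y \<otimes> inv (x [^] a)) \<otimes> (y \<otimes> inv (x [^] b)) \<in> S" using y by simp
   moreover have "inv (y \<otimes> inv (x [^] a)) \<otimes> (y \<otimes> inv (x [^] b)) = x [^] a \<otimes> inv (x [^] b)"
   proof -
    have "inv (y \<otimes> inv (x [^] a)) \<otimes> (y \<otimes> inv (x [^] b)) = (inv y \<otimes> y) \<otimes> (x [^] a \<otimes> inv (x [^] b))"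
     using \<open>y \<in> carrier G\<close> xp by (simp add: inv_mult m_ac del: l_inv r_inv Units_l_inv Units_r_inv)
    thus ?thesis unfolding l_inv[OF \<open>y \<in> carrier G\<close>] using xp by simp
   qed
   moreover have "x [^] a = x [^] (a - b) \<otimes> x [^] b" using le x by (simp add: nat_pow_mult)
   ultimately have "x [^] (a - b) \<in> S" using xp by (simp add: m_assoc)
   hence "p dvd (a - b)" by (rule pdvd)
   thus ?thesis using le by (simp add: cong_altdef_nat)
  qed
  show ?thesis
  proof (cases "b \<le> a")
   case True
   thus ?thesis using * y by blast
  next
   case False
   thus ?thesis using *[of b a] y by (simp add: cong_sym)
  qed
 qed
 \<comment> \<open>For \<open>y\<close> outside \<open>S\<close>, the group generated by
   \<open>S\<close> and \<open>y\<close> contains \<open>x\<close> by maximality. In the resulting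
   equation for \<open>x\<close> the exponent of \<open>y\<close> is invertible modulo
   \<open>p\<close>, so it can be solved for \<open>y\<close>.\<close>
 have cover: "EX i<p. y \<otimes> inv (x [^] i) \<in> S" if y: "y \<in> carrier G" for y
 proof (cases "y \<in> S")
  case True
  thus ?thesis using p_pos y by (intro exI[of _ 0]) simp
 next
  case False
  define S' where "S' = {s \<otimes> y [^] j | s j. s \<in> S & j \<in> (UNIV :: nat set)}"
  have S'I: "s \<otimes> y [^] j \<in> S'" if "s \<in> S" for s and j :: nat
   using that unfolding S'_def by blast
  have S'E: "EX s:S. EX j::nat. a = s \<otimes> y [^] j" if "a \<in> S'" for a
   using that unfolding S'_def by blast
  have S'sub: "subgroup S' G"
  proof (rule subgroupI)
   show "S' <= carrier G"
   proof
    fix a assume "a \<in> S'"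
    thus "a \<in> carrier G" using S'E[of a] y by auto
   qed
   show "S' ~= {}" using S'I[OF S.one_closed] by blast
  next
   fix a assume "a \<in> S'"
   then obtain s j where a: "a = s \<otimes> y [^] (j::nat)" "s \<in> S" using S'E by blast
   have "(s \<otimes> y [^] j) \<otimes> (inv s \<otimes> y [^] (p * j - j)) = (s \<otimes> inv s) \<otimes> (y [^] j \<otimes> y [^] (p * j - j))"
    using y a(2) by (simp add: m_ac del: r_inv Units_r_inv)
   also have "y [^] j \<otimes> y [^] (p * j - j) = y [^] (p * j)" using y p_pos by (simp add: nat_pow_mult)
   also have "\<dots> = \<one>" by (rule pow_mult_p[OF y])
   finally have "a \<otimes> (inv s \<otimes> y [^] (p * j - j)) = \<one>" using a by simp
   hence "inv a = inv s \<otimes> y [^] (p * j - j)" using a y by (intro comm_inv_char) auto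
   thus "inv a \<in> S'" using S'I[OF S.m_inv_closed[OF a(2)]] by simp
  next
   fix a b assume ab: "a \<in> S'" "b \<in> S'"
   obtain s j where a: "a = s \<otimes> y [^] (j::nat)" "s \<in> S" using S'E ab by blast
   obtain s' j' where b: "b = s' \<otimes> y [^] (j'::nat)" "s' \<in> S" using S'E ab by blast
   have "a \<otimes> b = (s \<otimes> s') \<otimes> (y [^] (j + j'))" unfolding nat_pow_mult[OF y, symmetric] using a b y by (simp add: m_ac)
   thus "a \<otimes> b \<in> S'" using S'I[OF S.m_closed[OF a(2) b(2)]] by simp
  qed
  have "S <= S'"
  proof
   fix s assume s: "s \<in> S"
   thus "s \<in> S'" using S'I[OF s, of 0] by simp
  qed
  moreover have "y \<in> S'" using S'I[OF S.one_closed, of 1] y by simp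
  ultimately have "S' \<notin> A" using Smax[of S'] False by blast
  hence "x \<in> S'" using S'sub by (simp add: A_def)
  then obtain s j where xs: "x = s \<otimes> y [^] (j::nat)" "s \<in> S" using S'E by blast
  have "\<not> p dvd j"
  proof
   assume "p dvd j"
   then obtain k where "j = p * k" by auto
   hence "y [^] j = \<one>" using pow_mult_p[OF y] by simp
   thus False using xs xS by simp
  qed
  hence "coprime j p" using prime_imp_coprime[OF prime_p] by (simp add: coprime_commute)
  then obtain u where u: "[j * u = 1] (mod p)" by (metis One_nat_def cong_solve_coprime_nat)
  have "y = y [^] (j * u)" using pow_cong[OF y u] y by simp
  also have "\<dots> = (y [^] j) [^] u" using y by (simp add: nat_pow_pow)
  also have "y [^] j = x \<otimes> inv s"
  proof -
   have "x \<otimes> inv s = (s \<otimes> inv s) \<otimes> y [^] j" using xs y by (simp add: m_ac del: r_inv Units_r_inv)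
   thus ?thesis using xs y by simp
  qed
  finally have "y = x [^] u \<otimes> (inv s) [^] u" using x xs(2) by (simp add: nat_pow_distrib)
  moreover have "x [^] u = x [^] (u mod p)" using pow_cong[OF x(1), of u "u mod p"] by (simp add: cong_def)
  ultimately have "y = x [^] (u mod p) \<otimes> (inv s) [^] u" by metis
  hence "y \<otimes> inv (x [^] (u mod p)) = (x [^] (u mod p) \<otimes> inv (x [^] (u mod p))) \<otimes> (inv s) [^] u"
   using xp[of "u mod p"] xs(2) by (simp add: m_ac del: r_inv Units_r_inv)
  hence "y \<otimes> inv (x [^] (u mod p)) = (inv s) [^] u" using xp xs(2) by simp
  thus ?thesis using Spow[of "inv s" u] xs(2) p_pos by (intro exI[of _ "u mod p"]) auto
 qed
 define i where "i y = (SOME i. i < p & y \<otimes> inv (x [^] i) \<in> S)" for y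
 have i: "y \<otimes> inv (x [^] i y) \<in> S" if "y \<in> carrier G" for y
  using someI_ex[OF cover[OF that, unfolded Bex_def]] by (simp add: i_def)
 define w where "w = cis (2 * pi / real p)"
 have wp: "w ^ p = 1" unfolding w_def Complex.DeMoivre using p_pos by simp
 have wcong: "w ^ a = w ^ b" if "[a = b] (mod p)" for a b
 proof -
  have "w ^ c = w ^ (c mod p)" for c
  proof -
   have "w ^ c = w ^ (p * (c div p) + c mod p)" by simp
   also have "\<dots> = (w ^ p) ^ (c div p) * w ^ (c mod p)" unfolding power_add power_mult ..
   finally show ?thesis unfolding wp by simp
  qed
  thus ?thesis using that by (metis cong_def)
 qed
 have w1: "w ~= 1"
 proof
  assume "w = 1"
  hence "cos (2 * pi / real p) = 1" by (simp add: w_def complex_eq_iff)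
  then obtain j :: int where j: "2 * pi / real p = of_int j * 2 * pi" by (auto simp: cos_one_2pi_int)
  hence "(2 * pi) * (1 / real p) = (2 * pi) * of_int j" by (simp add: mult_ac)
  hence "1 / real p = of_int j" by (subst (asm) mult_left_cancel) auto
  moreover have "0 < 1 / real p" "1 / real p < 1" using p_pos by auto
  ultimately have "0 < j" "j < 1" by auto
  thus False by simp
 qed
 define h where "h = (\<lambda>y\<in>carrier G. w ^ i y)"
 have "h (y \<otimes> z) = h y * h z" if y: "y \<in> carrier G" "z \<in> carrier G" for y z
 proof -
  have "(y \<otimes> inv (x [^] i y)) \<otimes> (z \<otimes> inv (x [^] i z)) \<in> S" using i y by simp
  moreover have "(y \<otimes> inv (x [^] i y)) \<otimes> (z \<otimes> inv (x [^] i z)) = (y \<otimes> z) \<otimes> inv (x [^] (i y + i z))"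
   unfolding nat_pow_mult[OF x(1), symmetric] using y xp by (simp add: inv_mult m_ac)
  ultimately have "[i (y \<otimes> z) = i y + i z] (mod p)" using idx_unique[of "y \<otimes> z" "i (y \<otimes> z)" "i y + i z"] i y by simp
  thus ?thesis using y wcong by (simp add: h_def power_add[symmetric])
 qed
 moreover have "h \<one> = 1"
 proof -
  have "[i \<one> = 0] (mod p)" using idx_unique[of \<one> "i \<one>" 0] i by simp
  thus ?thesis using wcong[of "i \<one>" 0] by (simp add: h_def)
 qed
 ultimately have "h \<in> chars" by (auto simp: chars_def h_def)
 moreover have "h x ~= 1"
 proof -
  have "[i x = 1] (mod p)" using idx_unique[of x "i x" 1] i x by simp
  thus ?thesis using wcong[of "i x" 1] w1 x by (simp add: h_def)
 qed
 ultimately show ?thesis by blast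
qed

end

context finite_exponent_group
begin

lemma sum_char_translate:
 assumes "f \<in> carrier G \<rightarrow> (UNIV :: complex set)" "y \<in> carrier G"
 shows "(\<Sum>x\<in>carrier G. f (y \<otimes> x)) = (\<Sum>x\<in>carrier G. f x)"
proof (rule sum.reindex_bij_witness[of _ "%x. inv y \<otimes> x" "%x. y \<otimes> x"])
qed (use assms in \<open>auto simp: m_assoc[symmetric]\<close>)

lemma sum_nontrivial_char:
 assumes h: "h \<in> chars" "h ~= trivial_char"
 shows "(\<Sum>x\<in>carrier G. h x) = 0"
proof -
 have "EX y:carrier G. h y ~= 1"
 proof (rule ccontr)
  assume neg: "\<not> (EX y:carrier G. h y ~= 1)"
  hence "h y = 1" if "y \<in> carrier G" for y using that by blast
  hence "h = trivial_char" using h unfolding trivial_char_def chars_def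
   by (intro extensionalityI[of _ "carrier G"]) auto
  thus False using h by simp
 qed
 then obtain y where y: "y \<in> carrier G" "h y ~= 1" by blast
 have "(\<Sum>x\<in>carrier G. h x) = (\<Sum>x\<in>carrier G. h (y \<otimes> x))" using sum_char_translate[of h y] y by simp
 also have "\<dots> = h y * (\<Sum>x\<in>carrier G. h x)"
  using h y by (simp add: char_mult sum_distrib_left)
 finally have "(1 - h y) * (\<Sum>x\<in>carrier G. h x) = 0" by (simp add: algebra_simps)
 thus ?thesis using y by simp
qed

text \<open>Multiplication by a character \<open>h0\<close> with \<open>h0 x ~= 1\<close> permutes
  the characters and multiplies the sum by \<open>h0 x\<close>.\<close>

lemma sum_over_chars:
 assumes x: "x \<in> carrier G" "x ~= \<one>"
 shows "(\<Sum>h\<in>chars. h x) = 0"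
proof -
 obtain h0 where h0: "h0 \<in> chars" "h0 x ~= 1" using separating_char x by blast
 define mul where "mul a b = (\<lambda>x\<in>carrier G. a x * b x)" for a b :: "'a => complex"
 define cj where "cj a = (\<lambda>x\<in>carrier G. cnj (a x))" for a :: "'a => complex"
 have mul: "mul a b \<in> chars" if "a \<in> chars" "b \<in> chars" for a b
  using that by (auto simp: chars_def mul_def)
 have cj: "cj a \<in> chars" if "a \<in> chars" for a
  using that by (auto simp: chars_def cj_def)
 have inv1: "mul a (mul (cj a) b) = b" if ab: "a \<in> chars" "b \<in> chars" for a b
 proof (rule extensionalityI[of _ "carrier G"])
  show "b \<in> extensional (carrier G)" using ab by (simp add: chars_def)
  fix z assume z: "z \<in> carrier G"
  have "a z * cnj (a z) = 1" using char_norm[OF ab(1) z] complex_norm_square[of "a z"] by simp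
  hence "a z * cnj (a z) * b z = b z" by simp
  thus "mul a (mul (cj a) b) z = b z" using z by (simp add: mul_def cj_def mult.assoc)
 qed (simp add: mul_def)
 have inv2: "mul (cj a) (mul a b) = b" if ab: "a \<in> chars" "b \<in> chars" for a b
 proof -
  have "mul (cj a) (mul a b) = mul a (mul (cj a) b)" by (rule ext) (simp add: mul_def cj_def mult_ac)
  thus ?thesis using inv1[OF ab] by simp
 qed
 have "(\<Sum>h\<in>chars. h x) = (\<Sum>h\<in>chars. mul h0 h x)"
  by (rule sum.reindex_bij_witness[of _ "%h. mul h0 h" "%h. mul (cj h0) h"])
   (use inv1 inv2 mul cj h0 in auto)
 also have "\<dots> = h0 x * (\<Sum>h\<in>chars. h x)" using x by (simp add: mul_def sum_distrib_left)
 finally have "(1 - h0 x) * (\<Sum>h\<in>chars. h x) = 0" by (simp add: algebra_simps)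
 thus ?thesis using h0 by simp
qed

lemma sum_over_chars_eq:
 assumes "x \<in> carrier G"
 shows "(\<Sum>h\<in>chars. h x) = (if x = \<one> then of_nat (card chars) else 0)"
 using sum_over_chars[OF assms] by (auto simp: chars_def)

text \<open>The two orthogonality relations evaluate the same double sum of \<open>h x\<close> over
  all characters and all elements.\<close>

lemma card_chars: "card chars = card (carrier G)"
proof -
 have "(\<Sum>h\<in>chars. \<Sum>x\<in>carrier G. h x) = (\<Sum>h\<in>chars. if h = trivial_char then of_nat (card (carrier G)) else 0)"
  by (rule sum.cong) (auto simp: sum_nontrivial_char, simp add: trivial_char_def)
 also have "\<dots> = of_nat (card (carrier G))" using finite_chars trivial_char by simp
 finally have 1: "(\<Sum>h\<in>chars. \<Sum>x\<in>carrier G. h x) = of_nat (card (carrier G))" .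
 have "(\<Sum>x\<in>carrier G. \<Sum>h\<in>chars. h x) = (\<Sum>x\<in>carrier G. if x = \<one> then of_nat (card chars) else 0)"
  by (rule sum.cong) (auto simp: sum_over_chars_eq)
 also have "\<dots> = of_nat (card chars)" using fin by simp
 finally show ?thesis using 1 sum.swap[of "%h x. h x" "carrier G" chars] by (metis of_nat_eq_iff)
qed

text \<open>Up to conjugation and normalisation, the Fourier coefficient of the indicator function
  of \<open>B\<close>.\<close>

definition fourier :: "'a set => ('a => complex) => complex" where
 "fourier B h = (\<Sum>b\<in>B. h b)"

lemma fourier_norm_square:
 assumes "B <= carrier G" "h \<in> chars"
 shows "of_real (norm (fourier B h) ^ 2) = (\<Sum>b\<in>B. \<Sum>c\<in>B. h (b \<otimes> inv c))"
proof -
 have "of_real (norm (fourier B h) ^ 2) = fourier B h * cnj (fourier B h)" using complex_norm_square[of "fourier B h"] by simp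
 also have "\<dots> = (\<Sum>b\<in>B. \<Sum>c\<in>B. h b * cnj (h c))" unfolding fourier_def cnj_sum sum_product ..
 also have "\<dots> = (\<Sum>b\<in>B. \<Sum>c\<in>B. h (b \<otimes> inv c))"
 proof (intro sum.cong refl)
  fix b c assume "b \<in> B" "c \<in> B"
  hence "b \<in> carrier G" "c \<in> carrier G" using assms by auto
  thus "h b * cnj (h c) = h (b \<otimes> inv c)" using assms(2) by (simp add: char_mult char_inv)
 qed
 finally show ?thesis .
qed

lemma parseval:
 assumes B: "B <= carrier G"
 shows "(\<Sum>h\<in>chars. norm (fourier B h) ^ 2) = real (card (carrier G)) * real (card B)"
proof -
 have finB: "finite B" by (rule finite_subset[OF B fin])
 have "of_real (\<Sum>h\<in>chars. norm (fourier B h) ^ 2) = (\<Sum>h\<in>chars. \<Sum>b\<in>B. \<Sum>c\<in>B. h (b \<otimes> inv c))"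
  unfolding of_real_sum by (intro sum.cong refl fourier_norm_square B)
 also have "\<dots> = (\<Sum>b\<in>B. \<Sum>h\<in>chars. \<Sum>c\<in>B. h (b \<otimes> inv c))" by (rule sum.swap)
 also have "\<dots> = (\<Sum>b\<in>B. \<Sum>c\<in>B. \<Sum>h\<in>chars. h (b \<otimes> inv c))" by (rule sum.cong[OF refl], rule sum.swap)
 also have "\<dots> = (\<Sum>b\<in>B. \<Sum>c\<in>B. if c = b then of_nat (card chars) else 0)"
 proof (intro sum.cong refl)
  fix b c assume "b \<in> B" "c \<in> B"
  hence bc: "b \<in> carrier G" "c \<in> carrier G" using assms by auto
  hence "b \<otimes> inv c = \<one> \<longleftrightarrow> c = b" using inv_solve_right'[of \<one> b c] by auto
  thus "(\<Sum>h\<in>chars. h (b \<otimes> inv c)) = (if c = b then of_nat (card chars) else 0)"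
   using bc by (simp add: sum_over_chars_eq)
 qed
 also have "\<dots> = (\<Sum>b\<in>B. of_nat (card chars))" using finB by (intro sum.cong refl) simp
 also have "\<dots> = of_real (real (card (carrier G)) * real (card B))" by (simp add: card_chars)
 finally show ?thesis by (simp only: of_real_eq_iff)
qed

section \<open>Bogolyubov's lemma for finite groups and, by compactness, for infinite ones\<close>

text \<open>Up to the factor \<open>card (carrier G)\<close>, the number of ways to write
  \<open>x\<close> as a product of two quotients from \<open>B\<close> is the sum of
  \<open>norm (fourier B h) ^ 4 * h (inv x)\<close>. When all large coefficients occur with
  \<open>h x = 1\<close>, the trivial character alone contributes the fourth power of
  \<open>card B\<close>, and the small coefficients cannot cancel it.\<close>

lemma bogolyubov_finite:
 assumes B: "B <= carrier G" and N: "card (carrier G) \<le> N * card B"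
 shows "EX S. S <= chars & card S \<le> 2 * N ^ 2 &
  (ALL x:carrier G. (ALL h:S. h x = 1) -->
   (EX a:B. EX b:B. EX c:B. EX d:B. x = (a \<otimes> inv b) \<otimes> (c \<otimes> inv d)))"
proof -
 have finB: "finite B" by (rule finite_subset[OF B fin])
 have "card (carrier G) > 0" using fin one_closed card_gt_0_iff by blast
 hence B0: "card B > 0" and N0: "N > 0" using N by (auto intro: Nat.gr0I)
 define \<beta> where "\<beta> = real (card B)"
 have \<beta>0: "\<beta> > 0" using B0 by (simp add: \<beta>_def)
 \<comment> \<open>The threshold serves two estimates: by Parseval the total mass is at most
   \<open>N * \<beta> ^ 2\<close>, so at most \<open>2 * N ^ 2\<close> characters reach it; and the
   characters below it contribute at most half of \<open>\<beta> ^ 4\<close>.\<close>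
 define S where "S = {h \<in> chars. norm (fourier B h) ^ 2 \<ge> \<beta> ^ 2 / (2 * real N)}"
 have finS: "finite S" "S <= chars" using finite_chars by (auto simp: S_def)
 have total: "(\<Sum>h\<in>chars. norm (fourier B h) ^ 2) \<le> real N * \<beta> ^ 2"
 proof -
  have "real (card (carrier G)) \<le> real N * \<beta>" using N unfolding \<beta>_def by (metis of_nat_le_iff of_nat_mult)
  thus ?thesis unfolding parseval[OF B] using \<beta>0 by (simp add: \<beta>_def[symmetric] power2_eq_square)
 qed
 have "real (card S) * (\<beta> ^ 2 / (2 * real N)) = (\<Sum>h\<in>S. \<beta> ^ 2 / (2 * real N))" by simp
 also have "\<dots> \<le> (\<Sum>h\<in>S. norm (fourier B h) ^ 2)" by (rule sum_mono) (simp add: S_def)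
 also have "\<dots> \<le> (\<Sum>h\<in>chars. norm (fourier B h) ^ 2)" by (rule sum_mono2[OF finite_chars finS(2)]) simp
 finally have "real (card S) * (\<beta> ^ 2 / (2 * real N)) \<le> real N * \<beta> ^ 2" using total by linarith
 hence "(real (card S) / (2 * real N)) * \<beta> ^ 2 \<le> real N * \<beta> ^ 2" by simp
 hence "real (card S) / (2 * real N) \<le> real N" by (rule mult_right_le_imp_le) (use \<beta>0 in simp)
 hence "real (card S) \<le> real (2 * N ^ 2)" using N0 by (simp add: field_simps power2_eq_square)
 hence cS: "card S \<le> 2 * N ^ 2" by (simp only: of_nat_le_iff)
 have main: "EX a:B. EX b:B. EX c:B. EX d:B. x = (a \<otimes> inv b) \<otimes> (c \<otimes> inv d)"
  if x: "x \<in> carrier G" "!!h. h \<in> S ==> h x = 1" for x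
 proof (rule ccontr)
  assume neg: "\<not> ?thesis"
  define F where "F h = norm (fourier B h) ^ 2" for h
  \<comment> \<open>Expanding the fourth power turns the sum into character sums at the elements
    \<open>a b^-1 c d^-1 x^-1\<close>. They all vanish by orthogonality if \<open>x\<close> has no
    representation.\<close>
  have "(\<Sum>h\<in>chars. of_real (F h ^ 2) * h (inv x)) = (\<Sum>h\<in>chars. \<Sum>a\<in>B. \<Sum>b\<in>B. \<Sum>c\<in>B. \<Sum>d\<in>B. h ((a \<otimes> inv b) \<otimes> (c \<otimes> inv d) \<otimes> inv x))"
  proof (intro sum.cong refl)
   fix h assume h: "h \<in> chars"
   have "of_real (F h ^ 2) * h (inv x) = (\<Sum>a\<in>B. \<Sum>b\<in>B. h (a \<otimes> inv b)) * (\<Sum>c\<in>B. \<Sum>d\<in>B. h (c \<otimes> inv d)) * h (inv x)"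
    unfolding F_def fourier_norm_square[OF B h, symmetric] by (simp add: power2_eq_square)
   also have "\<dots> = (\<Sum>a\<in>B. \<Sum>b\<in>B. h (a \<otimes> inv b) * ((\<Sum>c\<in>B. \<Sum>d\<in>B. h (c \<otimes> inv d)) * h (inv x)))"
    by (simp only: mult.assoc sum_distrib_right)
   also have "\<dots> = (\<Sum>a\<in>B. \<Sum>b\<in>B. \<Sum>c\<in>B. \<Sum>d\<in>B. h (a \<otimes> inv b) * (h (c \<otimes> inv d) * h (inv x)))"
    by (simp only: sum_distrib_left sum_distrib_right)
   also have "\<dots> = (\<Sum>a\<in>B. \<Sum>b\<in>B. \<Sum>c\<in>B. \<Sum>d\<in>B. h ((a \<otimes> inv b) \<otimes> (c \<otimes> inv d) \<otimes> inv x))"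
   proof (intro sum.cong refl)
    fix a b c d assume "a \<in> B" "b \<in> B" "c \<in> B" "d \<in> B"
    hence "a \<in> carrier G" "b \<in> carrier G" "c \<in> carrier G" "d \<in> carrier G" using B by auto
    thus "h (a \<otimes> inv b) * (h (c \<otimes> inv d) * h (inv x)) = h ((a \<otimes> inv b) \<otimes> (c \<otimes> inv d) \<otimes> inv x)"
     using h x by (simp add: char_mult mult.assoc)
   qed
   finally show "of_real (F h ^ 2) * h (inv x) = (\<Sum>a\<in>B. \<Sum>b\<in>B. \<Sum>c\<in>B. \<Sum>d\<in>B. h ((a \<otimes> inv b) \<otimes> (c \<otimes> inv d) \<otimes> inv x))" .
  qed
  also have "\<dots> = (\<Sum>a\<in>B. \<Sum>h\<in>chars. \<Sum>b\<in>B. \<Sum>c\<in>B. \<Sum>d\<in>B. h ((a \<otimes> inv b) \<otimes> (c \<otimes> inv d) \<otimes> inv x))"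
   by (rule sum.swap)
  also have "\<dots> = (\<Sum>a\<in>B. \<Sum>b\<in>B. \<Sum>h\<in>chars. \<Sum>c\<in>B. \<Sum>d\<in>B. h ((a \<otimes> inv b) \<otimes> (c \<otimes> inv d) \<otimes> inv x))"
   by (rule sum.cong[OF refl], rule sum.swap)
  also have "\<dots> = (\<Sum>a\<in>B. \<Sum>b\<in>B. \<Sum>c\<in>B. \<Sum>h\<in>chars. \<Sum>d\<in>B. h ((a \<otimes> inv b) \<otimes> (c \<otimes> inv d) \<otimes> inv x))"
   by (rule sum.cong[OF refl], rule sum.cong[OF refl], rule sum.swap)
  also have "\<dots> = (\<Sum>a\<in>B. \<Sum>b\<in>B. \<Sum>c\<in>B. \<Sum>d\<in>B. \<Sum>h\<in>chars. h ((a \<otimes> inv b) \<otimes> (c \<otimes> inv d) \<otimes> inv x))"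
   by (rule sum.cong[OF refl], rule sum.cong[OF refl], rule sum.cong[OF refl], rule sum.swap)
  also have "\<dots> = 0"
  proof (rule sum.neutral, rule ballI, rule sum.neutral, rule ballI, rule sum.neutral, rule ballI, rule sum.neutral, rule ballI)
   fix a b c d assume abcd: "a \<in> B" "b \<in> B" "c \<in> B" "d \<in> B"
   hence c: "a \<in> carrier G" "b \<in> carrier G" "c \<in> carrier G" "d \<in> carrier G" using B by auto
   have "(a \<otimes> inv b) \<otimes> (c \<otimes> inv d) ~= x" using neg abcd by blast
   hence "(a \<otimes> inv b) \<otimes> (c \<otimes> inv d) \<otimes> inv x ~= \<one>" using c x
    by (metis inv_closed inv_equality inv_inv m_closed)
   thus "(\<Sum>h\<in>chars. h ((a \<otimes> inv b) \<otimes> (c \<otimes> inv d) \<otimes> inv x)) = 0"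
    using c x by (intro sum_over_chars) auto
  qed
  finally have zero: "Re (\<Sum>h\<in>chars. of_real (F h ^ 2) * h (inv x)) = 0" by simp
  have Re: "Re (\<Sum>h\<in>chars. of_real (F h ^ 2) * h (inv x)) = (\<Sum>h\<in>chars. F h ^ 2 * Re (h (inv x)))"
   by simp
  have tS: "trivial_char \<in> S"
  proof -
   have "fourier B trivial_char = of_nat (card B)"
    unfolding fourier_def using B by (simp add: trivial_char_def subset_iff)
   hence "norm (fourier B trivial_char) ^ 2 = \<beta> ^ 2" by (simp add: \<beta>_def)
   moreover have "\<beta> ^ 2 / (2 * real N) \<le> \<beta> ^ 2" using N0 \<beta>0 by (simp add: field_simps)
   ultimately show ?thesis using trivial_char by (simp add: S_def)
  qed
  have Ft: "F trivial_char = \<beta> ^ 2"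
   unfolding F_def fourier_def \<beta>_def using B by (simp add: trivial_char_def subset_iff)
  have "(\<Sum>h\<in>chars. F h ^ 2 * Re (h (inv x))) = (\<Sum>h\<in>S. F h ^ 2 * Re (h (inv x))) + (\<Sum>h\<in>chars - S. F h ^ 2 * Re (h (inv x)))"
   using sum.subset_diff[OF finS(2) finite_chars] by (simp add: add.commute)
  moreover have "(\<Sum>h\<in>S. F h ^ 2 * Re (h (inv x))) \<ge> \<beta> ^ 4"
  proof -
   have "(\<Sum>h\<in>S. F h ^ 2 * Re (h (inv x))) = (\<Sum>h\<in>S. F h ^ 2)"
   proof (rule sum.cong[OF refl])
    fix h assume "h \<in> S"
    hence "h (inv x) = 1" using x finS char_inv[of h x] by auto
    thus "F h ^ 2 * Re (h (inv x)) = F h ^ 2" by simp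
   qed
   moreover have "(\<Sum>h\<in>S. F h ^ 2) \<ge> F trivial_char ^ 2"
    using tS finS by (intro member_le_sum) auto
   moreover have "F trivial_char ^ 2 = \<beta> ^ 4" unfolding Ft by (simp add: power_mult[symmetric])
   ultimately show ?thesis by simp
  qed
  moreover have "(\<Sum>h\<in>chars - S. F h ^ 2 * Re (h (inv x))) \<ge> - (\<beta> ^ 4 / 2)"
  proof -
   have "(\<Sum>h\<in>chars - S. - (F h * (\<beta> ^ 2 / (2 * real N)))) \<le> (\<Sum>h\<in>chars - S. F h ^ 2 * Re (h (inv x)))"
   proof (rule sum_mono)
    fix h assume h: "h \<in> chars - S"
    have "norm (h (inv x)) = 1" using h x by (simp add: char_norm)
    hence "- 1 \<le> Re (h (inv x))" using abs_Re_le_cmod[of "h (inv x)"] by linarith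
    hence "F h ^ 2 * (-1) \<le> F h ^ 2 * Re (h (inv x))" by (intro mult_left_mono) auto
    moreover have "F h * F h \<le> F h * (\<beta> ^ 2 / (2 * real N))"
     using h by (intro mult_left_mono) (auto simp: S_def F_def)
    ultimately show "- (F h * (\<beta> ^ 2 / (2 * real N))) \<le> F h ^ 2 * Re (h (inv x))"
     by (simp add: power2_eq_square)
   qed
   moreover have "(\<Sum>h\<in>chars - S. F h * (\<beta> ^ 2 / (2 * real N))) \<le> \<beta> ^ 4 / 2"
   proof -
    have "(\<Sum>h\<in>chars - S. F h * (\<beta> ^ 2 / (2 * real N))) = (\<Sum>h\<in>chars - S. F h) * (\<beta> ^ 2 / (2 * real N))"
     by (simp only: sum_distrib_right)
    also have "\<dots> \<le> (real N * \<beta> ^ 2) * (\<beta> ^ 2 / (2 * real N))"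
    proof (rule mult_right_mono)
     have "(\<Sum>h\<in>chars - S. F h) \<le> (\<Sum>h\<in>chars. F h)"
      by (rule sum_mono2[OF finite_chars]) (auto simp: F_def)
     thus "(\<Sum>h\<in>chars - S. F h) \<le> real N * \<beta> ^ 2" using total unfolding F_def by linarith
    qed simp
    also have "\<dots> = \<beta> ^ 4 / 2" using N0 by (simp add: field_simps power_mult[symmetric] power_add[symmetric])
    finally show ?thesis .
   qed
   ultimately show ?thesis by (simp add: sum_negf)
  qed
  ultimately have "(\<Sum>h\<in>chars. F h ^ 2 * Re (h (inv x))) \<ge> \<beta> ^ 4 / 2" by linarith
  moreover have "\<beta> ^ 4 > 0" using \<beta>0 by simp
  ultimately show False using zero Re by linarith
 qed
 show ?thesis
 proof (intro exI[of _ S] conjI ballI impI)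
  show "S <= chars" "card S \<le> 2 * N ^ 2" by (rule finS(2), rule cS)
  fix x assume "x \<in> carrier G" "ALL h:S. h x = 1"
  thus "EX a:B. EX b:B. EX c:B. EX d:B. x = (a \<otimes> inv b) \<otimes> (c \<otimes> inv d)" by (intro main) auto
 qed
qed

text \<open>The colour of \<open>x\<close> encodes the values at \<open>x\<close> of the large
  characters, which are \<open>p\<close>-th roots of unity; the subgroup that they annihilate is the
  class of the identity. In this form, with a number of colours depending only on \<open>p\<close>
  and \<open>N\<close>, the result can be passed to infinite groups by compactness.\<close>

lemma bogolyubov_colouring:
 assumes B: "B <= carrier G" and N: "card (carrier G) \<le> N * card B"
 shows "EX c :: 'a => nat. c ` carrier G <= {..< p ^ (2 * N ^ 2)} &
  (ALL x:carrier G. ALL y:carrier G. c x = c y -->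
   (EX a:B. EX b:B. EX d:B. EX e:B. x \<otimes> inv y = (a \<otimes> inv b) \<otimes> (d \<otimes> inv e))) &
  (ALL x:carrier G. ALL y:carrier G. ALL x':carrier G. ALL y':carrier G.
   x \<otimes> inv y = x' \<otimes> inv y' --> (c x = c y \<longleftrightarrow> c x' = c y'))"
proof -
 obtain S where S: "S <= chars" "card S \<le> 2 * N ^ 2"
  "!!x. x \<in> carrier G ==> (ALL h:S. h x = 1) ==>
   (EX a:B. EX b:B. EX c:B. EX d:B. x = (a \<otimes> inv b) \<otimes> (c \<otimes> inv d))"
  using bogolyubov_finite[OF assms] by metis
 have finS: "finite S" by (rule finite_subset[OF S(1) finite_chars])
 define T where "T = S \<rightarrow>\<^sub>E {z::complex. z ^ p = 1}"
 have "card T = p ^ card S" unfolding T_def using finS by (simp add: card_PiE finite_roots)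
 also have "\<dots> \<le> p ^ (2 * N ^ 2)" using p_pos S(2) by (intro power_increasing) auto
 finally have "card T \<le> card {..< p ^ (2 * N ^ 2)}" by simp
 moreover have "finite T" unfolding T_def by (rule finite_PiE[OF finS]) (rule finite_roots)
 ultimately obtain j where j: "inj_on j T" "j ` T <= {..< p ^ (2 * N ^ 2)}"
  using card_le_inj[of T "{..< p ^ (2 * N ^ 2)}"] by auto
 define e where "e x = (\<lambda>h\<in>S. h x)" for x
 have eT: "e x \<in> T" if "x \<in> carrier G" for x
  unfolding T_def e_def using char_root[OF _ that] S(1) by auto
 have ee: "j (e x) = j (e y) \<longleftrightarrow> (ALL h:S. h (x \<otimes> inv y) = 1)" if xy: "x \<in> carrier G" "y \<in> carrier G" for x y
 proof -
  have "j (e x) = j (e y) \<longleftrightarrow> e x = e y" using inj_onD[OF j(1)] eT[OF xy(1)] eT[OF xy(2)] by metis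
  also have "\<dots> \<longleftrightarrow> (ALL h:S. h x = h y)" unfolding e_def fun_eq_iff restrict_def by auto
  also have "\<dots> \<longleftrightarrow> (ALL h:S. h (x \<otimes> inv y) = 1)"
  proof (rule ball_cong[OF refl])
   fix h assume "h \<in> S"
   hence h: "h \<in> chars" using S by auto
   have "x = (x \<otimes> inv y) \<otimes> y" using xy by (simp add: m_assoc)
   hence "h x = h (x \<otimes> inv y) * h y" using h xy by (metis char_mult inv_closed m_closed)
   moreover have "h y ~= 0" using char_norm[OF h xy(2)] by auto
   ultimately show "h x = h y \<longleftrightarrow> h (x \<otimes> inv y) = 1" by simp
  qed
  finally show ?thesis .
 qed
 show ?thesis
 proof (intro exI[of _ "%x. j (e x)"] conjI ballI impI)
  show "(%x. j (e x)) ` carrier G <= {..< p ^ (2 * N ^ 2)}" using j eT by blast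
  fix x y assume xy: "x \<in> carrier G" "y \<in> carrier G"
  show "EX a:B. EX b:B. EX d:B. EX e:B. x \<otimes> inv y = (a \<otimes> inv b) \<otimes> (d \<otimes> inv e)" if "j (e x) = j (e y)"
   using S(3)[of "x \<otimes> inv y"] that ee[OF xy] xy by simp
  fix x' y' assume "x' \<in> carrier G" "y' \<in> carrier G" "x \<otimes> inv y = x' \<otimes> inv y'"
  thus "j (e x) = j (e y) \<longleftrightarrow> j (e x') = j (e y')" using ee xy by simp
 qed
qed

end

lemma (in comm_group) finite_subgroup_containing:
 assumes p: "p > 0" and expo: "!!x. x \<in> carrier G ==> x [^] (p::nat) = \<one>" and E: "finite E" "E <= carrier G"
 shows "EX F. subgroup F G & finite F & E <= F"
 using E
proof (induction E)
 case empty
 thus ?case using triv_subgroup by (intro exI[of _ "{\<one>}"]) simp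
next
 case (insert x E)
 then obtain F where F: "subgroup F G" "finite F" "E <= F" by auto
 have x: "x \<in> carrier G" using insert by simp
 define C where "C = (%i. x [^] i) ` {..<p}"
 have cmod: "x [^] (n::nat) = x [^] (n mod p)" for n
 proof -
  have "x [^] n = x [^] (p * (n div p) + n mod p)" by simp
  also have "\<dots> = x [^] (p * (n div p)) \<otimes> x [^] (n mod p)"
   using x by (simp add: nat_pow_mult del: mult_div_mod_eq)
  also have "x [^] (p * (n div p)) = (x [^] p) [^] (n div p)" using x by (simp add: nat_pow_pow)
  finally show ?thesis using x expo[OF x] by simp
 qed
 have Cn: "x [^] (n::nat) \<in> C" for n
  unfolding C_def by (subst cmod) (use p in auto)
 have C: "subgroup C G"
 proof (rule subgroupI)
  show "C <= carrier G" using x by (auto simp: C_def)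
  show "C ~= {}" using Cn by blast
 next
  fix a assume "a \<in> C"
  then obtain i where i: "a = x [^] i" "i < p" by (auto simp: C_def)
  hence "a \<otimes> x [^] (p - i) = x [^] p" using x by (simp add: nat_pow_mult)
  hence "inv a = x [^] (p - i)" using x expo[OF x] i by (intro comm_inv_char) auto
  thus "inv a \<in> C" using Cn by simp
 next
  fix a b assume "a \<in> C" "b \<in> C"
  then obtain i j where "a = x [^] (i::nat)" "b = x [^] (j::nat)" by (auto simp: C_def)
  hence "a \<otimes> b = x [^] (i + j)" using x by (simp add: nat_pow_mult)
  thus "a \<otimes> b \<in> C" using Cn by simp
 qed
 have "subgroup (C <#> F) G" by (rule mult_subgroups[OF C F(1)])
 moreover have "finite (C <#> F)" unfolding set_mult_def C_def using F(2) by simp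
 moreover have "insert x E <= C <#> F"
 proof
  fix y assume y: "y \<in> insert x E"
  show "y \<in> C <#> F"
  proof (cases "y = x")
   case True
   have "x = x [^] (1::nat) \<otimes> \<one>" using x by simp
   thus ?thesis using Cn[of 1] subgroup.one_closed[OF F(1)] True unfolding set_mult_def by blast
  next
   case False
   hence "y \<in> F" "y \<in> carrier G" using y F insert.prems by auto
   hence "y = x [^] (0::nat) \<otimes> y" by simp
   thus ?thesis using Cn[of 0] \<open>y \<in> F\<close> unfolding set_mult_def by blast
  qed
 qed
 ultimately show ?case by blast
qed

text \<open>Both requirements on a colouring used below involve at most four points, so each defines
  a closed set in the product of finite discrete spaces.\<close>

lemma closedin_finitely_many_coordinates:
 fixes X :: "('i => nat) topology"
 assumes X: "X = product_topology (%_. discrete_topology {..<D}) I" and i: "i1 \<in> I" "i2 \<in> I" "i3 \<in> I" "i4 \<in> I"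
 shows "closedin X {c \<in> topspace X. P (c i1) (c i2) (c i3) (c i4)}"
proof -
 have op: "openin X {c \<in> topspace X. c i = v}" if "i \<in> I" for i v
 proof (cases "v < D")
  case True
  have "continuous_map X (discrete_topology {..<D}) (%c. c i)"
   unfolding X using that by (rule continuous_map_product_projection)
  hence "openin X {c \<in> topspace X. c i \<in> {v}}"
   using True by (intro openin_continuous_map_preimage[where Y = "discrete_topology {..<D}"]) auto
  thus ?thesis by simp
 next
  case False
  have "c i ~= v" if "c \<in> topspace X" for c
  proof -
   have "c i \<in> {..<D}" using that \<open>i \<in> I\<close> unfolding X by auto
   thus ?thesis using False by auto
  qed
  hence "{c \<in> topspace X. c i = v} = {}" by blast
  thus ?thesis by (metis openin_empty)
 qed
 have "openin X {c \<in> topspace X. \<not> P (c i1) (c i2) (c i3) (c i4)}"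
 proof (subst openin_subopen, intro ballI)
  fix c assume c: "c \<in> {c \<in> topspace X. \<not> P (c i1) (c i2) (c i3) (c i4)}"
  let ?U = "{d \<in> topspace X. d i1 = c i1} \<inter> {d \<in> topspace X. d i2 = c i2} \<inter> {d \<in> topspace X. d i3 = c i3} \<inter> {d \<in> topspace X. d i4 = c i4}"
  have "openin X ?U" using i by (intro openin_Int op)
  moreover have "c \<in> ?U" using c by simp
  moreover have "?U <= {c \<in> topspace X. \<not> P (c i1) (c i2) (c i3) (c i4)}" using c by auto
  ultimately show "EX T. openin X T & c \<in> T & T <= {c \<in> topspace X. \<not> P (c i1) (c i2) (c i3) (c i4)}" by blast
 qed
 moreover have eq: "{c \<in> topspace X. P (c i1) (c i2) (c i3) (c i4)} = topspace X - {c \<in> topspace X. \<not> P (c i1) (c i2) (c i3) (c i4)}" by blast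
 ultimately show ?thesis unfolding eq by (intro closedin_diff closedin_topspace)
qed

text \<open>Colourings of the finite subgroups, all with the same number \<open>D\<close> of
  colours, are glued by compactness of the space of colourings. The class of the identity in a limit
  colouring is the subgroup \<open>M\<close>, and the other colour classes are its cosets.\<close>

theorem (in comm_group) bogolyubov:
 assumes p: "prime (p::nat)" and expo: "!!x. x \<in> carrier G ==> x [^] p = \<one>"
  and B: "B <= carrier G" and T: "finite T" "T <= carrier G" "carrier G <= T <#> B"
 shows "EX M. subgroup M G & (EX F. finite F & F <= carrier G & carrier G <= F <#> M) &
  (ALL x:M. EX a:B. EX b:B. EX c:B. EX d:B. x = (a \<otimes> inv b) \<otimes> (c \<otimes> inv d))"
proof -
 define N where "N = card T"
 define D where "D = p ^ (2 * N ^ 2)"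
 define Q where "Q x \<longleftrightarrow> (EX a:B. EX b:B. EX c:B. EX d:B. x = (a \<otimes> inv b) \<otimes> (c \<otimes> inv d))" for x
 have p0: "p > 0" using p by (simp add: prime_gt_0_nat)
 have fincase: "EX c. c ` F <= {..<D} & (ALL x:F. ALL y:F. c x = c y --> Q (x \<otimes> inv y)) &
  (ALL x:F. ALL y:F. ALL x':F. ALL y':F. x \<otimes> inv y = x' \<otimes> inv y' --> (c x = c y \<longleftrightarrow> c x' = c y'))"
  if F: "subgroup F G" "finite F" for F
 proof -
  have Fc: "F <= carrier G" using F subgroup.subset by blast
  let ?K = "G\<lparr>carrier := F\<rparr>"
  interpret F: comm_group ?K
   using subgroup.subgroup_is_group[OF F(1) is_group]
   by (rule group.group_comm_groupI) (use Fc in \<open>auto intro!: m_comm\<close>)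
  interpret FE: finite_exponent_group "G\<lparr>carrier := F\<rparr>" p
  proof
   show "finite (carrier (G\<lparr>carrier := F\<rparr>))" using F by simp
   show "prime p" by fact
   fix x assume "x \<in> carrier (G\<lparr>carrier := F\<rparr>)"
   hence "x \<in> carrier G" using F subgroup.subset by fastforce
   thus "x [^]\<^bsub>G\<lparr>carrier := F\<rparr>\<^esub> p = \<one>\<^bsub>G\<lparr>carrier := F\<rparr>\<^esub>"
    using expo by (simp add: nat_pow_consistent[symmetric])
  qed
  have inv_F: "inv\<^bsub>G\<lparr>carrier := F\<rparr>\<^esub> x = inv x" if "x \<in> F" for x using m_inv_consistent[OF F(1) that] .
  \<comment> \<open>The \<open>N\<close> translates of \<open>B\<close> cover \<open>F\<close>, so
    one of them meets \<open>F\<close> in at least the fraction \<open>1 / N\<close>. It may replace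
    \<open>B\<close>, because \<open>t\<close> cancels in quotients.\<close>
  have "EX t:T. card F \<le> N * card {x \<in> F. EX b:B. x = t \<otimes> b}"
  proof (rule ccontr)
   assume neg: "\<not> ?thesis"
   have F0: "card F > 0" using F subgroup.one_closed[OF F(1)] card_gt_0_iff by blast
   have "F <= (\<Union>t\<in>T. {x \<in> F. EX b:B. x = t \<otimes> b})"
   proof
    fix x assume x: "x \<in> F"
    hence "x \<in> T <#> B" using Fc T(3) by blast
    thus "x \<in> (\<Union>t\<in>T. {x \<in> F. EX b:B. x = t \<otimes> b})" using x unfolding set_mult_def by blast
   qed
   hence "card F \<le> card (\<Union>t\<in>T. {x \<in> F. EX b:B. x = t \<otimes> b})"
    using F T by (intro card_mono finite_UN_I) auto
   also have "\<dots> \<le> (\<Sum>t\<in>T. card {x \<in> F. EX b:B. x = t \<otimes> b})" by (rule card_UN_le[OF T(1)])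
   finally have le: "card F \<le> (\<Sum>t\<in>T. card {x \<in> F. EX b:B. x = t \<otimes> b})" .
   have "T ~= {}" using T(3) one_closed by (auto simp: set_mult_def)
   have "N * (\<Sum>t\<in>T. card {x \<in> F. EX b:B. x = t \<otimes> b}) = (\<Sum>t\<in>T. N * card {x \<in> F. EX b:B. x = t \<otimes> b})"
    by (rule sum_distrib_left)
   also have "\<dots> < (\<Sum>t\<in>T. card F)" using neg T(1) \<open>T ~= {}\<close> by (intro sum_strict_mono) auto
   also have "\<dots> = N * card F" by (simp add: N_def)
   finally show False using le by (simp add: mult_less_cancel1)
  qed
  then obtain t where t: "t \<in> T" "card F \<le> N * card {x \<in> F. EX b:B. x = t \<otimes> b}" by blast
  have tc: "t \<in> carrier G" using t T by blast
  let ?B = "{x \<in> F. EX b:B. x = t \<otimes> b}"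
  have "?B <= carrier ?K" "card (carrier ?K) \<le> N * card ?B" using t(2) by auto
  from FE.bogolyubov_colouring[OF this] obtain c :: "'a => nat" where cK: "c ` carrier ?K <= {..<p ^ (2 * N ^ 2)} &
   (ALL x:carrier ?K. ALL y:carrier ?K. c x = c y --> (EX a:?B. EX b:?B. EX d:?B. EX e:?B. x \<otimes>\<^bsub>?K\<^esub> inv\<^bsub>?K\<^esub> y =
    (a \<otimes>\<^bsub>?K\<^esub> inv\<^bsub>?K\<^esub> b) \<otimes>\<^bsub>?K\<^esub> (d \<otimes>\<^bsub>?K\<^esub> inv\<^bsub>?K\<^esub> e))) &
   (ALL x:carrier ?K. ALL y:carrier ?K. ALL x':carrier ?K. ALL y':carrier ?K. x \<otimes>\<^bsub>?K\<^esub> inv\<^bsub>?K\<^esub> y = x' \<otimes>\<^bsub>?K\<^esub> inv\<^bsub>?K\<^esub> y' --> (c x = c y \<longleftrightarrow> c x' = c y'))"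
   ..
  have carK: "carrier ?K = F" by simp
  note c = conjunct1[OF cK, unfolded carK, folded D_def] conjunct1[OF conjunct2[OF cK], unfolded carK] conjunct2[OF conjunct2[OF cK], unfolded carK]
  have "Q (x \<otimes> inv y)" if xy: "x \<in> F" "y \<in> F" "c x = c y" for x y
  proof -
   obtain a b d e where abde: "a \<in> ?B" "b \<in> ?B" "d \<in> ?B" "e \<in> ?B" and
    "x \<otimes>\<^bsub>G\<lparr>carrier := F\<rparr>\<^esub> inv\<^bsub>G\<lparr>carrier := F\<rparr>\<^esub> y =
    (a \<otimes>\<^bsub>G\<lparr>carrier := F\<rparr>\<^esub> inv\<^bsub>G\<lparr>carrier := F\<rparr>\<^esub> b) \<otimes>\<^bsub>G\<lparr>carrier := F\<rparr>\<^esub> (d \<otimes>\<^bsub>G\<lparr>carrier := F\<rparr>\<^esub> inv\<^bsub>G\<lparr>carrier := F\<rparr>\<^esub> e)"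
    using c(2)[rule_format, OF xy] by blast
   hence eq: "x \<otimes> inv y = (a \<otimes> inv b) \<otimes> (d \<otimes> inv e)" using inv_F xy by simp
   obtain a' b' d' e' where B': "a' \<in> B" "b' \<in> B" "d' \<in> B" "e' \<in> B"
    and "a = t \<otimes> a'" "b = t \<otimes> b'" "d = t \<otimes> d'" "e = t \<otimes> e'" using abde by blast
   moreover have q: "(t \<otimes> u) \<otimes> inv (t \<otimes> v) = u \<otimes> inv v" if "u \<in> B" "v \<in> B" for u v
   proof -
    have uv: "u \<in> carrier G" "v \<in> carrier G" using that B by auto
    have "(t \<otimes> u) \<otimes> inv (t \<otimes> v) = (t \<otimes> inv t) \<otimes> (u \<otimes> inv v)"
     using uv tc by (simp add: inv_mult m_ac del: r_inv Units_r_inv)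
    thus ?thesis using uv tc by simp
   qed
   ultimately have "x \<otimes> inv y = (a' \<otimes> inv b') \<otimes> (d' \<otimes> inv e')" using eq q by simp
   thus ?thesis unfolding Q_def using B' by blast
  qed
  moreover have "c x = c y \<longleftrightarrow> c x' = c y'"
   if "x \<in> F" "y \<in> F" "x' \<in> F" "y' \<in> F" "x \<otimes> inv y = x' \<otimes> inv y'" for x y x' y'
   by (rule c(3)[rule_format, OF that(1-4)]) (use that inv_F in simp)
  ultimately show ?thesis using c(1) by (intro exI[of _ c]) blast
 qed
 define X where "X = product_topology (%_. discrete_topology {..<D}) (carrier G)"
 have Xc: "compact_space X" unfolding X_def compact_space_product_topology by (simp add: compact_space_discrete_topology)
 have topX: "c \<in> topspace X \<longleftrightarrow> c \<in> carrier G \<rightarrow>\<^sub>E {..<D}" for c by (simp add: X_def)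
 define Q1 where "Q1 x y = {c \<in> topspace X. c x = c y --> Q (x \<otimes> inv y)}" for x y
 define Q2 where "Q2 x y x' y' = {c \<in> topspace X. x \<otimes> inv y = x' \<otimes> inv y' --> (c x = c y \<longleftrightarrow> c x' = c y')}" for x y x' y'
 define fam where "fam E = {C. (EX x:E. EX y:E. C = Q1 x y) \<or> (EX x:E. EX y:E. EX x':E. EX y':E. C = Q2 x y x' y')}" for E
 have cl: "closedin X C" if "C \<in> fam (carrier G)" for C
 proof -
  from that consider x y where "x \<in> carrier G" "y \<in> carrier G" "C = Q1 x y"
   | x y x' y' where "x \<in> carrier G" "y \<in> carrier G" "x' \<in> carrier G" "y' \<in> carrier G" "C = Q2 x y x' y'"
   unfolding fam_def by blast
  thus ?thesis
  proof cases
   case (1 x y)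
   thus ?thesis unfolding Q1_def
    using closedin_finitely_many_coordinates[OF X_def, of x y x x "%a b _ _. a = b --> Q (x \<otimes> inv y)"] by simp
  next
   case (2 x y x' y')
   thus ?thesis unfolding Q2_def
    using closedin_finitely_many_coordinates[OF X_def, of x y x' y' "%a b c d. x \<otimes> inv y = x' \<otimes> inv y' --> (a = b \<longleftrightarrow> c = d)"] by simp
  qed
 qed
 have fip: "\<Inter>\<F> ~= {}" if \<F>: "finite \<F>" "\<F> <= fam (carrier G)" for \<F>
 proof -
  have "EX E. finite E & E <= carrier G & \<F> <= fam E"
   using \<F>
  proof (induction \<F>)
   case empty
   thus ?case by auto
  next
   case (insert C \<F>)
   then obtain E where E: "finite E" "E <= carrier G" "\<F> <= fam E" by auto
   have mono: "fam E <= fam E'" if "E <= E'" for E E' unfolding fam_def using that by blast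
   from insert.prems consider x y where "x \<in> carrier G" "y \<in> carrier G" "C = Q1 x y"
    | x y x' y' where "x \<in> carrier G" "y \<in> carrier G" "x' \<in> carrier G" "y' \<in> carrier G" "C = Q2 x y x' y'"
    unfolding fam_def mem_Collect_eq insert_subset by blast
   thus ?case
   proof cases
    case (1 x y)
    hence "C \<in> fam ({x, y} \<union> E)" unfolding fam_def by blast
    thus ?thesis using 1 E mono[of E "{x, y} \<union> E"] by (intro exI[of _ "{x, y} \<union> E"]) auto
   next
    case (2 x y x' y')
    hence "C \<in> fam ({x, y, x', y'} \<union> E)" unfolding fam_def by blast
    thus ?thesis using 2 E mono[of E "{x, y, x', y'} \<union> E"] by (intro exI[of _ "{x, y, x', y'} \<union> E"]) auto
   qed
  qed
  then obtain E where E: "finite E" "E <= carrier G" "\<F> <= fam E" by blast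
  obtain F where F: "subgroup F G" "finite F" "E <= F" using finite_subgroup_containing[OF p0 expo E(1,2)] by blast
  obtain c where c: "c ` F <= {..<D}" "ALL x:F. ALL y:F. c x = c y --> Q (x \<otimes> inv y)"
   "ALL x:F. ALL y:F. ALL x':F. ALL y':F. x \<otimes> inv y = x' \<otimes> inv y' --> (c x = c y \<longleftrightarrow> c x' = c y')"
   using fincase[OF F(1,2)] by blast
  \<comment> \<open>Outside \<open>F\<close> any colour below \<open>D\<close> will do; 0 is one
    because \<open>D > 0\<close>.\<close>
  define d where "d = (\<lambda>x\<in>carrier G. if x \<in> F then c x else 0)"
  have FG: "F <= carrier G" using F subgroup.subset by blast
  have dc: "d x = c x" if "x \<in> E" for x using that F FG by (auto simp: d_def)
  have "D > 0" unfolding D_def using p0 by simp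
  hence dX: "d \<in> topspace X" unfolding topX d_def using subsetD[OF c(1) imageI] by auto
  have "d \<in> C" if "C \<in> \<F>" for C
  proof -
   have "C \<in> fam E" using that E(3) by (rule subsetD[rotated])
   then consider x y where "x \<in> E" "y \<in> E" "C = Q1 x y"
    | x y x' y' where "x \<in> E" "y \<in> E" "x' \<in> E" "y' \<in> E" "C = Q2 x y x' y'"
    unfolding fam_def by blast
   thus ?thesis
   proof cases
    case (1 x y)
    thus ?thesis using dX dc c(2) F unfolding Q1_def by auto
   next
    case (2 x y x' y')
    hence "x \<in> F" "y \<in> F" "x' \<in> F" "y' \<in> F" using F by auto
    thus ?thesis using dX 2 dc c(3)[rule_format, of x y x' y'] unfolding Q2_def by simp
   qed
  qed
  thus ?thesis by blast
 qed
 have "\<Inter>(fam (carrier G)) ~= {}" using Xc cl fip unfolding compact_space_fip by blast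
 then obtain c where cfam: "c \<in> \<Inter>(fam (carrier G))" by blast
 have cQ1: "c \<in> Q1 x y" if "x \<in> carrier G" "y \<in> carrier G" for x y
  by (rule InterD[OF cfam]) (use that in \<open>auto simp: fam_def\<close>)
 have cQ2: "c \<in> Q2 x y x' y'" if "x \<in> carrier G" "y \<in> carrier G" "x' \<in> carrier G" "y' \<in> carrier G" for x y x' y'
  by (rule InterD[OF cfam]) (use that in \<open>unfold fam_def, blast\<close>)
 have cX: "c \<in> carrier G \<rightarrow>\<^sub>E {..<D}" using cQ1[OF one_closed one_closed] topX by (simp add: Q1_def)
 \<comment> \<open>By \<open>Q2\<close>, whether two colours agree depends only on the quotient of
   the two points. This makes the class of the identity a subgroup and gives it at most
   \<open>D\<close> cosets.\<close>
 define M where "M = {x \<in> carrier G. c x = c \<one>}"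
 have quot: "c x = c y \<longleftrightarrow> x \<otimes> inv y \<in> M" if "x \<in> carrier G" "y \<in> carrier G" for x y
  using cQ2[OF that, of "x \<otimes> inv y" \<one>] that unfolding Q2_def M_def by simp
 have M: "subgroup M G"
 proof (rule subgroupI)
  show "M <= carrier G" "M ~= {}" by (auto simp: M_def)
  show "inv a \<in> M" if "a \<in> M" for a
   using that quot[of \<one> a] by (simp add: M_def)
  show "a \<otimes> b \<in> M" if "a \<in> M" "b \<in> M" for a b
  proof -
   have ab: "a \<in> carrier G" "b \<in> carrier G" using that by (auto simp: M_def)
   hence "(a \<otimes> b) \<otimes> inv b \<in> M" using that by (simp add: m_assoc)
   hence "c (a \<otimes> b) = c b" using quot[of "a \<otimes> b" b] ab by simp
   thus ?thesis using that by (simp add: M_def)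
  qed
 qed
 moreover have "EX F. finite F & F <= carrier G & carrier G <= F <#> M"
 proof -
  define r where "r n = (SOME x. x \<in> carrier G & c x = n)" for n
  define F where "F = r ` (c ` carrier G)"
  have r: "r (c x) \<in> carrier G & c (r (c x)) = c x" if "x \<in> carrier G" for x
   unfolding r_def by (rule someI[of _ x]) (use that in simp)
  have "c ` carrier G <= {..<D}" using cX by auto
  hence "finite F" unfolding F_def by (meson finite_imageI finite_lessThan finite_subset)
  moreover have "F <= carrier G" unfolding F_def using r by blast
  moreover have "carrier G <= F <#> M"
  proof
   fix x assume x: "x \<in> carrier G"
   have "x \<otimes> inv (r (c x)) \<in> M" using quot[of x "r (c x)"] r[OF x] x by simp
   moreover have "x = r (c x) \<otimes> (x \<otimes> inv (r (c x)))"
   proof -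
    have "r (c x) \<otimes> (x \<otimes> inv (r (c x))) = (r (c x) \<otimes> inv (r (c x))) \<otimes> x"
     using r[OF x] x by (simp add: m_ac del: r_inv Units_r_inv)
    thus ?thesis using r[OF x] x by simp
   qed
   moreover have "r (c x) \<in> F" unfolding F_def using x by blast
   ultimately show "x \<in> F <#> M" unfolding set_mult_def by blast
  qed
  ultimately show ?thesis by blast
 qed
 moreover have "Q x" if "x \<in> M" for x
  using that cQ1[of x \<one>] unfolding Q1_def M_def by simp
 ultimately show ?thesis unfolding Q_def by blast
qed

section \<open>Subgroups of an abelian group up to finite index\<close>

context comm_group
begin

lemma set_mult_iff: "x \<in> A <#> B \<longleftrightarrow> (EX a:A. EX b:B. x = a \<otimes> b)"
 by (auto simp: set_mult_def)

lemma set_mult_I: "a \<in> A ==> b \<in> B ==> a \<otimes> b \<in> A <#> B"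
 by (auto simp: set_mult_def)

lemma set_mult_upper1: "A <= carrier G ==> subgroup B G ==> A <= A <#> B"
proof
 fix a assume a: "A <= carrier G" "subgroup B G" "a \<in> A"
 hence "a \<otimes> \<one> \<in> A <#> B" by (intro set_mult_I subgroup.one_closed)
 thus "a \<in> A <#> B" using a by auto
qed

lemma set_mult_upper2: "subgroup A G ==> B <= carrier G ==> B <= A <#> B"
proof
 fix a assume a: "subgroup A G" "B <= carrier G" "a \<in> B"
 hence "\<one> \<otimes> a \<in> A <#> B" by (intro set_mult_I subgroup.one_closed)
 thus "a \<in> A <#> B" using a by auto
qed

lemma set_mult_least: "subgroup C G ==> A <= C ==> B <= C ==> A <#> B <= C"
 by (auto simp: set_mult_iff intro!: subgroup.m_closed)

lemma modular_law:
 assumes "subgroup C G" "A <= C" "B <= carrier G"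
 shows "(A <#> B) \<inter> C = A <#> (B \<inter> C)"
proof
 have Cc: "C <= carrier G" using assms subgroup.subset by blast
 show "(A <#> B) \<inter> C <= A <#> (B \<inter> C)"
 proof
  fix x assume x: "x \<in> (A <#> B) \<inter> C"
  then obtain a b where ab: "a \<in> A" "b \<in> B" "x = a \<otimes> b" by (auto simp: set_mult_iff)
  hence c: "a \<in> carrier G" "b \<in> carrier G" "a \<in> C" using assms Cc by auto
  have "inv a \<otimes> x \<in> C" by (rule subgroup.m_closed[OF assms(1) subgroup.m_inv_closed[OF assms(1) c(3)]]) (use x in simp)
  moreover have "inv a \<otimes> x = b" using ab c by (simp add: m_assoc[symmetric])
  ultimately show "x \<in> A <#> (B \<inter> C)" using ab by (auto simp: set_mult_iff)
 qed
 show "A <#> (B \<inter> C) <= (A <#> B) \<inter> C"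
 proof
  fix x assume "x \<in> A <#> (B \<inter> C)"
  then obtain a b where ab: "a \<in> A" "b \<in> B" "b \<in> C" "x = a \<otimes> b" by (auto simp: set_mult_iff)
  thus "x \<in> (A <#> B) \<inter> C" using assms by (auto simp: set_mult_iff intro: subgroup.m_closed)
 qed
qed

text \<open>For subgroups this says that \<open>A \<inter> B\<close> has finite index in
  \<open>A\<close>. Counting by finitely many representatives taken from \<open>A\<close> avoids
  quotient groups.\<close>

definition alm :: "'a set => 'a set => bool" where
 "alm A B \<longleftrightarrow> (EX F. finite F & F <= A & (ALL a:A. EX f:F. inv f \<otimes> a \<in> B))"

lemma almI':
 assumes "finite F" "F <= A" "!!a. a \<in> A ==> EX f:F. inv f \<otimes> a \<in> B"
 shows "alm A B"
 unfolding alm_def by (intro exI[of _ F] conjI ballI assms)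

lemma almE:
 assumes "alm A B"
 obtains F where "finite F" "F <= A" "!!a. a \<in> A ==> EX f:F. inv f \<otimes> a \<in> B"
proof -
 from assms obtain F where "finite F & F <= A & (ALL a:A. EX f:F. inv f \<otimes> a \<in> B)" unfolding alm_def ..
 thus ?thesis by (intro that[of F]) simp_all
qed

text \<open>A representative \<open>f\<close> outside \<open>A\<close> is exchanged for an element
  of \<open>A\<close> in the same coset of \<open>B\<close>, if there is one, and dropped
  otherwise.\<close>

lemma almI:
 assumes A: "subgroup A G" and B: "subgroup B G" and F: "finite F" "F <= carrier G" "!!a. a \<in> A ==> EX f:F. inv f \<otimes> a \<in> B"
 shows "alm A B"
proof -
 have Ac: "A <= carrier G" using A subgroup.subset by blast
 define r where "r f = (SOME a. a \<in> A & inv f \<otimes> a \<in> B)" for f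
 define F' where "F' = {f \<in> F. EX a:A. inv f \<otimes> a \<in> B}"
 have r: "r f \<in> A & inv f \<otimes> r f \<in> B" if f: "f \<in> F'" for f
 proof -
  have "EX a. a \<in> A & inv f \<otimes> a \<in> B" using f unfolding F'_def by blast
  thus ?thesis unfolding r_def by (rule someI_ex)
 qed
 have "EX f:r ` F'. inv f \<otimes> a \<in> B" if a: "a \<in> A" for a
 proof -
  obtain f where f: "f \<in> F" "inv f \<otimes> a \<in> B" using F(3)[OF a] by blast
  hence fF: "f \<in> F'" using a unfolding F'_def by blast
  have c: "f \<in> carrier G" "a \<in> carrier G" "r f \<in> carrier G" using f F a r[OF fF] Ac by auto
  have "inv (inv f \<otimes> r f) \<otimes> (inv f \<otimes> a) \<in> B"
   by (rule subgroup.m_closed[OF B subgroup.m_inv_closed[OF B conjunct2[OF r[OF fF]]] f(2)])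
  moreover have "inv (inv f \<otimes> r f) \<otimes> (inv f \<otimes> a) = (f \<otimes> inv f) \<otimes> (inv (r f) \<otimes> a)"
   using c by (simp add: inv_mult m_ac del: r_inv Units_r_inv)
  ultimately have "inv (r f) \<otimes> a \<in> B" using c by simp
  thus ?thesis using fF by blast
 qed
 moreover have "finite (r ` F')" "r ` F' <= A" using F(1) r unfolding F'_def by auto
 ultimately show ?thesis by (intro almI'[of "r ` F'"])
qed

lemma alm_subset:
 assumes "subgroup A G" "A <= B" shows "alm A B"
proof -
 have "inv \<one> \<otimes> a \<in> B" if "a \<in> A" for a
  using subsetD[OF assms(2) that] subgroup.mem_carrier[OF assms(1) that] by simp
 thus ?thesis using subgroup.one_closed[OF assms(1)] by (intro almI'[of "{\<one>}"]) auto
qed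

lemma alm_Int:
 assumes "subgroup A G" "alm A B" shows "alm A (A \<inter> B)"
proof -
 obtain F where F: "finite F" "F <= A" "!!a. a \<in> A ==> EX f:F. inv f \<otimes> a \<in> B" by (rule almE[OF assms(2)], rule that)
 have "EX f:F. inv f \<otimes> a \<in> A \<inter> B" if a: "a \<in> A" for a
 proof -
  obtain f where f: "f \<in> F" "inv f \<otimes> a \<in> B" using F(3) a by blast
  hence "inv f \<otimes> a \<in> A"
   by (intro subgroup.m_closed[OF assms(1)] subgroup.m_inv_closed[OF assms(1)] a subsetD[OF F(2)])
  thus ?thesis using f by blast
 qed
 thus ?thesis by (intro almI'[OF F(1,2)])
qed

lemma alm_trans:
 assumes A: "subgroup A G" and B: "subgroup B G" and C: "subgroup C G" and AB: "alm A B" and BC: "alm B C"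
 shows "alm A C"
proof -
 obtain F where F: "finite F" "F <= A" "!!a. a \<in> A ==> EX f:F. inv f \<otimes> a \<in> B" by (rule almE[OF AB], rule that)
 obtain F' where F': "finite F'" "F' <= B" "!!a. a \<in> B ==> EX f:F'. inv f \<otimes> a \<in> C" by (rule almE[OF BC], rule that)
 have c: "A <= carrier G" "B <= carrier G" using A B subgroup.subset by blast+
 show ?thesis
 proof (rule almI[OF A C])
  have eq: "F <#> F' = (%(a, b). a \<otimes> b) ` (F \<times> F')" unfolding set_mult_def by auto
  show "finite (F <#> F')" unfolding eq using F(1) F'(1) by simp
  show "F <#> F' <= carrier G" using F(2) F'(2) c by (intro set_mult_closed) auto
  fix a assume a: "a \<in> A"
  then obtain f where f: "f \<in> F" "inv f \<otimes> a \<in> B" using F by blast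
  then obtain f' where f': "f' \<in> F'" "inv f' \<otimes> (inv f \<otimes> a) \<in> C" using F' by blast
  have "inv (f \<otimes> f') \<otimes> a = inv f' \<otimes> (inv f \<otimes> a)"
   using f f' a F(2) F'(2) c by (simp add: subset_iff inv_mult m_ac)
  hence "inv (f \<otimes> f') \<otimes> a \<in> C" using f' by simp
  thus "EX f:F <#> F'. inv f \<otimes> a \<in> C" using set_mult_I[OF f(1) f'(1)] by blast
 qed
qed

lemma alm_super:
 assumes "alm A B" "B <= B'" shows "alm A B'"
proof -
 obtain F where F: "finite F" "F <= A" "!!a. a \<in> A ==> EX f:F. inv f \<otimes> a \<in> B" by (rule almE[OF assms(1)], rule that)
 have "EX f:F. inv f \<otimes> a \<in> B'" if "a \<in> A" for a using F(3)[OF that] assms(2) by blast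
 thus ?thesis by (intro almI'[OF F(1,2)])
qed

lemma set_mult_commute_subgroups: "A <= carrier G ==> B <= carrier G ==> A <#> B = B <#> A"
proof -
 have "A <#> B <= B <#> A" if "A <= carrier G" "B <= carrier G" for A B
 proof
  fix x assume "x \<in> A <#> B"
  then obtain a b where ab: "a \<in> A" "b \<in> B" "x = a \<otimes> b" by (auto simp: set_mult_iff)
  hence "x = b \<otimes> a" using that by (simp add: m_comm subset_iff)
  thus "x \<in> B <#> A" using ab set_mult_I by simp
 qed
 thus "A <= carrier G ==> B <= carrier G ==> A <#> B = B <#> A" by blast
qed

lemma alm_mono:
 assumes "subgroup A G" "subgroup A' G" "subgroup B G" "A' <= A" "alm A B" "B <= B'"
 shows "alm A' B'"
proof -
 have "alm A' B" using alm_trans[OF assms(2,1,3) alm_subset[OF assms(2,4)] assms(5)] .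
 thus ?thesis by (rule alm_super[OF _ assms(6)])
qed

lemma alm_Int_both:
 assumes "subgroup A G" "subgroup B G" "subgroup C G" "alm A B" "alm A C"
 shows "alm A (B \<inter> C)"
proof -
 have AB: "subgroup (A \<inter> B) G" "subgroup (B \<inter> C) G" "subgroup (A \<inter> B \<inter> C) G" by (intro subgroups_Inter_pair assms)+
 have "alm (A \<inter> B) C" by (rule alm_mono[OF assms(1) AB(1) assms(3) Int_lower1 assms(5) subset_refl])
 hence 1: "alm (A \<inter> B) (A \<inter> B \<inter> C)" by (rule alm_Int[OF AB(1)])
 have "alm A (A \<inter> B \<inter> C)" by (rule alm_trans[OF assms(1) AB(1,3) alm_Int[OF assms(1,4)] 1])
 thus ?thesis by (rule alm_super) blast
qed

lemma alm_set_mult_mono: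
 assumes "subgroup A G" "subgroup B G" "subgroup C G" "alm A B"
 shows "alm (A <#> C) (B <#> C)"
proof -
 obtain F where F: "finite F" "F <= A" "!!a. a \<in> A ==> EX f:F. inv f \<otimes> a \<in> B" by (rule almE[OF assms(4)], rule that)
 have c: "A <= carrier G" "C <= carrier G" using assms subgroup.subset by blast+
 have "F <= A <#> C" using F(2) set_mult_upper1[OF c(1) assms(3)] by blast
 moreover have "EX f:F. inv f \<otimes> x \<in> B <#> C" if "x \<in> A <#> C" for x
 proof -
  obtain a d where ad: "a \<in> A" "d \<in> C" "x = a \<otimes> d" using \<open>x \<in> A <#> C\<close> by (auto simp: set_mult_iff)
  obtain f where f: "f \<in> F" "inv f \<otimes> a \<in> B" using F ad by blast
  have "inv f \<otimes> x = (inv f \<otimes> a) \<otimes> d" using ad f F(2) c by (auto simp: m_assoc subset_iff)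
  hence "inv f \<otimes> x \<in> B <#> C" using set_mult_I[OF f(2) ad(2)] by simp
  thus ?thesis using f(1) by blast
 qed
 ultimately show ?thesis by (intro almI'[OF F(1)])
qed

lemma set_mult_self: "subgroup A G ==> A <#> A = A"
 by (intro subset_antisym set_mult_least set_mult_upper1 subgroup.subset) auto

lemma alm_set_mult_least:
 assumes "subgroup A G" "subgroup B G" "subgroup C G" "alm A C" "alm B C"
 shows "alm (A <#> B) C"
proof -
 have s: "subgroup (A <#> B) G" "subgroup (C <#> B) G" using assms mult_subgroups by auto
 have 1: "alm (A <#> B) (C <#> B)" by (rule alm_set_mult_mono[OF assms(1,3,2,4)])
 have "alm (B <#> C) (C <#> C)" by (rule alm_set_mult_mono[OF assms(2,3,3,5)])
 hence 2: "alm (C <#> B) C" unfolding set_mult_self[OF assms(3)]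
  using set_mult_commute_subgroups[OF subgroup.subset[OF assms(2)] subgroup.subset[OF assms(3)]] by simp
 show ?thesis by (rule alm_trans[OF s assms(3) 1 2])
qed

lemma finite_alm:
 assumes "subgroup A G" "subgroup B G" "finite A" shows "alm A B"
proof -
 have "inv a \<otimes> a \<in> B" if "a \<in> A" for a
  using subgroup.one_closed[OF assms(2)] subgroup.mem_carrier[OF assms(1) that] by simp
 thus ?thesis by (intro almI'[OF assms(3) subset_refl]) blast
qed

lemma alm_finite:
 assumes "A <= carrier G" "alm A B" "finite B" shows "finite A"
proof -
 obtain F where F: "finite F" "F <= A" "!!a. a \<in> A ==> EX f:F. inv f \<otimes> a \<in> B" by (rule almE[OF assms(2)], rule that)
 have "A <= (%(f, b). f \<otimes> b) ` (F \<times> B)"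
 proof
  fix a assume a: "a \<in> A"
  then obtain f where f: "f \<in> F" "inv f \<otimes> a \<in> B" using F by blast
  have "a = f \<otimes> (inv f \<otimes> a)" using f F(2) a assms(1) by (simp add: subset_iff m_assoc[symmetric])
  thus "a \<in> (%(f, b). f \<otimes> b) ` (F \<times> B)" using f by (auto intro!: rev_image_eqI[of "(f, inv f \<otimes> a)"])
 qed
 thus ?thesis by (rule finite_subset) (use F(1) assms(3) in simp)
qed

definition comm_eq :: "'a set => 'a set => bool" where
 "comm_eq A B \<longleftrightarrow> alm A B & alm B A"

lemma comm_eq_sym: "comm_eq A B ==> comm_eq B A" by (simp add: comm_eq_def)

lemma comm_eq_trans: "subgroup A G ==> subgroup B G ==> subgroup C G ==> comm_eq A B ==> comm_eq B C ==> comm_eq A C"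
 unfolding comm_eq_def using alm_trans[of A B C] alm_trans[of C B A] by simp

lemma comm_eq_refl: "subgroup A G ==> comm_eq A A" by (simp add: comm_eq_def alm_subset)

text \<open>Countably many commensurability classes, with representatives from the family
  itself.\<close>

definition cc :: "'a set set => bool" where
 "cc \<L> \<longleftrightarrow> (EX \<C>. countable \<C> & \<C> <= \<L> & (ALL L:\<L>. EX M:\<C>. comm_eq L M))"

text \<open>Classes are counted along a map \<open>f\<close>: countably many values and, for each
  value, countably many representatives. The latter may lie outside the family and are exchanged for
  members of it afterwards.\<close>

lemma ccI:
 assumes sub: "!!L. L \<in> \<L> ==> subgroup L G"
  and f: "countable (f ` \<L>)"
  and fib: "!!n. n \<in> f ` \<L> ==> EX \<C>. countable \<C> & \<C> <= {L. subgroup L G} & (ALL L:\<L>. f L = n --> (EX M:\<C>. comm_eq L M))"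
 shows "cc \<L>"
proof -
 have "ALL n:f ` \<L>. EX \<C>. countable \<C> & \<C> <= {L. subgroup L G} & (ALL L:\<L>. f L = n --> (EX M:\<C>. comm_eq L M))"
  using fib by blast
 from bchoice[OF this] obtain \<C> where C': "ALL n:f ` \<L>. countable (\<C> n) & \<C> n <= {L. subgroup L G} & (ALL L:\<L>. f L = n --> (EX M:\<C> n. comm_eq L M))" ..
 have C: "countable (\<C> n)" "\<C> n <= {L. subgroup L G}" "!!L. L \<in> \<L> ==> f L = n ==> EX M:\<C> n. comm_eq L M"
  if "n \<in> f ` \<L>" for n
  using bspec[OF C' that] by simp_all
 define D where "D = (\<Union>n\<in>f ` \<L>. \<C> n)"
 have "countable D" unfolding D_def using f C(1) by (intro countable_UN) auto
 have Ds: "subgroup M G" if "M \<in> D" for M using that C(2) unfolding D_def by blast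
 define D' where "D' = {M \<in> D. EX L:\<L>. comm_eq L M}"
 define g where "g M = (SOME L. L \<in> \<L> & comm_eq L M)" for M
 have g: "g M \<in> \<L> & comm_eq (g M) M" if "M \<in> D'" for M
  unfolding g_def by (rule someI_ex) (use that in \<open>auto simp: D'_def\<close>)
 have "countable (g ` D')" by (rule countable_image, rule countable_subset[OF _ \<open>countable D\<close>]) (simp add: D'_def)
 moreover have "g ` D' <= \<L>" using g by blast
 moreover have "EX M:g ` D'. comm_eq L M" if L: "L \<in> \<L>" for L
 proof -
  obtain M where M: "M \<in> \<C> (f L)" "comm_eq L M" using C(3)[OF imageI[OF L] L refl] by blast
  hence MD: "M \<in> D'" using L unfolding D'_def D_def by blast
  hence "subgroup M G" using Ds unfolding D'_def by blast
  hence "comm_eq L (g M)"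
   using comm_eq_trans[OF sub[OF L] _ sub M(2) comm_eq_sym, of "g M"] g[OF MD] by simp
  thus ?thesis using MD by blast
 qed
 ultimately show ?thesis unfolding cc_def by (intro exI[of _ "g ` D'"] conjI ballI)
qed

lemma cc_imp: "cc \<L> ==> EX \<C>. countable \<C> & \<C> <= \<L> & (ALL L:\<L>. EX M:\<C>. comm_eq L M)"
 by (simp add: cc_def)

end

section \<open>Closed subgroups of compact abelian groups\<close>

locale compact_abelian_group = comm_group H for H :: "'a monoid" (structure) +
 fixes T :: "'a topology"
 assumes topspace_T: "topspace T = carrier H"
  and compact_T: "compact_space T" and Hausdorff_T: "Hausdorff_space T"
  and mult_cont: "continuous_map (prod_topology T T) T (%(x, y). x \<otimes> y)"
  and inv_cont: "continuous_map T T (%x. inv x)"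
begin

definition csub :: "'a set => bool" where
 "csub A \<longleftrightarrow> subgroup A H & closedin T A"

lemma csubD: "csub A ==> subgroup A H" "csub A ==> closedin T A" "csub A ==> A <= carrier H"
 by (auto simp: csub_def dest: subgroup.subset)

lemma csub_Int: "csub A ==> csub B ==> csub (A \<inter> B)"
 by (simp add: csub_def subgroups_Inter_pair closedin_Int)

lemma csub_Inter:
 assumes "\<A> ~= {}" "!!A. A \<in> \<A> ==> csub A" shows "csub (\<Inter>\<A>)"
 unfolding csub_def using assms csubD by (intro conjI subgroups_Inter closedin_Inter) auto

lemma csub_carrier: "csub (carrier H)"
 using closedin_topspace[of T] subgroup_self by (simp add: csub_def topspace_T)

lemma csub_one: "csub {\<one>}"
proof -
 have "closedin T {\<one>}" using Hausdorff_T topspace_T by (simp add: closedin_Hausdorff_singleton)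
 thus ?thesis by (simp add: csub_def triv_subgroup)
qed

lemma compactin_closed: "closedin T A ==> compactin T A"
 using compact_T closedin_compact_space by blast

lemma closed_compactin: "compactin T A ==> closedin T A"
 using Hausdorff_T compactin_imp_closedin by blast

lemma closedin_set_mult:
 assumes "closedin T A" "closedin T B" shows "closedin T (A <#> B)"
proof -
 have "A <#> B = (%(x, y). x \<otimes> y) ` (A \<times> B)" unfolding set_mult_def by auto
 moreover have "compactin (prod_topology T T) (A \<times> B)"
  using assms compactin_closed by (simp add: compactin_Times)
 ultimately have "compactin T (A <#> B)" using image_compactin[OF _ mult_cont] by metis
 thus ?thesis by (rule closed_compactin)
qed

lemma csub_set_mult: "csub A ==> csub B ==> csub (A <#> B)"
 by (simp add: csub_def closedin_set_mult mult_subgroups)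

lemma translation_cont:
 assumes "g \<in> carrier H" shows "continuous_map T T (%x. g \<otimes> x)"
proof -
 have "continuous_map T (prod_topology T T) (%x. (g, x))"
  using assms by (intro continuous_map_pairedI) (auto simp: topspace_T)
 from continuous_map_compose[OF this mult_cont] show ?thesis by (simp add: o_def)
qed

lemma closedin_translation:
 assumes "g \<in> carrier H" "closedin T A" shows "closedin T ((%x. g \<otimes> x) ` A)"
 by (rule closed_compactin, rule image_compactin[OF compactin_closed[OF assms(2)] translation_cont[OF assms(1)]])

lemma translation_image:
 assumes "g \<in> carrier H" "A <= carrier H"
 shows "(%x. g \<otimes> x) ` A = {x \<in> carrier H. inv g \<otimes> x \<in> A}"
proof
 show "(%x. g \<otimes> x) ` A <= {x \<in> carrier H. inv g \<otimes> x \<in> A}"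
  using assms by (auto simp: m_assoc[symmetric] subset_iff)
 show "{x \<in> carrier H. inv g \<otimes> x \<in> A} <= (%x. g \<otimes> x) ` A"
 proof
  fix x assume x: "x \<in> {x \<in> carrier H. inv g \<otimes> x \<in> A}"
  hence "x = g \<otimes> (inv g \<otimes> x)" using assms by (simp add: m_assoc[symmetric])
  thus "x \<in> (%x. g \<otimes> x) ` A" using x by blast
 qed
qed

lemma openin_translation:
 assumes "g \<in> carrier H" "openin T U" shows "openin T ((%x. g \<otimes> x) ` U)"
proof -
 have "U <= carrier H" using assms openin_subset topspace_T by blast
 hence "(%x. g \<otimes> x) ` U = {x \<in> topspace T. inv g \<otimes> x \<in> U}" using translation_image assms topspace_T by simp
 thus ?thesis using openin_continuous_map_preimage[OF translation_cont assms(2), of "inv g"] assms by simp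
qed

lemma csub_finite_extension:
 assumes B: "csub B" and C: "subgroup C H" and BC: "B <= C" "alm C B"
 shows "csub C"
proof -
 obtain F where F: "finite F" "F <= C" "!!a. a \<in> C ==> EX f:F. inv f \<otimes> a \<in> B" by (rule almE[OF BC(2)], rule that)
 have Cc: "C <= carrier H" using C by (rule subgroup.subset)
 have Bc: "B <= carrier H" using csubD(3)[OF B] .
 have "C = (\<Union>f\<in>F. (%x. f \<otimes> x) ` B)"
 proof
  show "C <= (\<Union>f\<in>F. (%x. f \<otimes> x) ` B)"
  proof
   fix a assume a: "a \<in> C"
   then obtain f where f: "f \<in> F" "inv f \<otimes> a \<in> B" using F(3) by blast
   have "f \<in> carrier H" "a \<in> carrier H" using f(1) F(2) Cc a by blast+
   hence "a \<in> (%x. f \<otimes> x) ` B" using translation_image[of f B] Bc f(2) by simp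
   thus "a \<in> (\<Union>f\<in>F. (%x. f \<otimes> x) ` B)" using f by blast
  qed
  show "(\<Union>f\<in>F. (%x. f \<otimes> x) ` B) <= C" using F(2) BC(1) subgroup.m_closed[OF C] by auto
 qed
 moreover have "closedin T (\<Union>f\<in>F. (%x. f \<otimes> x) ` B)"
 proof (rule closedin_Union)
  fix S assume "S \<in> (%f. (%x. f \<otimes> x) ` B) ` F"
  then obtain f where "f \<in> F" "S = (%x. f \<otimes> x) ` B" by blast
  thus "closedin T S" using closedin_translation[of f B] F(2) Cc csubD(2)[OF B] by blast
 qed (use F(1) in simp)
 ultimately show ?thesis using C by (simp add: csub_def)
qed

text \<open>The difference is the part in \<open>V\<close> of finitely many other cosets of
  \<open>Z\<close>: a closed subgroup of finite index is relatively open.\<close>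

lemma closedin_diff_csub:
 assumes V: "csub V" and Z: "csub Z" and VZ: "alm V Z"
 shows "closedin T (V - Z)"
proof -
 obtain F where F: "finite F" "F <= V" "!!a. a \<in> V ==> EX f:F. inv f \<otimes> a \<in> Z" by (rule almE[OF VZ], rule that)
 note Vc = csubD(3)[OF V] and Zc = csubD(3)[OF Z]
 have "V - Z = V \<inter> (\<Union>f\<in>F - Z. (%x. f \<otimes> x) ` Z)"
 proof
  show "V - Z <= V \<inter> (\<Union>f\<in>F - Z. (%x. f \<otimes> x) ` Z)"
  proof
   fix a assume a: "a \<in> V - Z"
   then obtain f where f: "f \<in> F" "inv f \<otimes> a \<in> Z" using F(3) by blast
   have fc: "f \<in> carrier H" "a \<in> carrier H" using f F(2) Vc a by auto
   have "f \<notin> Z"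
   proof
    assume "f \<in> Z"
    hence "f \<otimes> (inv f \<otimes> a) \<in> Z" using f subgroup.m_closed[OF csubD(1)[OF Z]] by blast
    thus False using a fc by (simp add: m_assoc[symmetric])
   qed
   moreover have "a \<in> (%x. f \<otimes> x) ` Z" using translation_image[OF fc(1) Zc] f fc by simp
   ultimately show "a \<in> V \<inter> (\<Union>f\<in>F - Z. (%x. f \<otimes> x) ` Z)" using f a by blast
  qed
  show "V \<inter> (\<Union>f\<in>F - Z. (%x. f \<otimes> x) ` Z) <= V - Z"
  proof
   fix a assume a: "a \<in> V \<inter> (\<Union>f\<in>F - Z. (%x. f \<otimes> x) ` Z)"
   then obtain f z where f: "f \<in> F" "f \<notin> Z" "z \<in> Z" "a = f \<otimes> z" by blast
   have fc: "f \<in> carrier H" "z \<in> carrier H" using f F(2) Vc Zc by auto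
   have "a \<notin> Z"
   proof
    assume "a \<in> Z"
    hence "a \<otimes> inv z \<in> Z" using f subgroup.m_closed[OF csubD(1)[OF Z]] subgroup.m_inv_closed[OF csubD(1)[OF Z]] by blast
    thus False using f fc by (simp add: m_assoc)
   qed
   thus "a \<in> V - Z" using a by blast
  qed
 qed
 moreover have "closedin T (\<Union>f\<in>F - Z. (%x. f \<otimes> x) ` Z)"
 proof (rule closedin_Union)
  fix S assume "S \<in> (%f. (%x. f \<otimes> x) ` Z) ` (F - Z)"
  then obtain f where "f \<in> F" "S = (%x. f \<otimes> x) ` Z" by blast
  thus "closedin T S" using closedin_translation[of f Z] F(2) Vc csubD(2)[OF Z] by blast
 qed (use F(1) in simp)
 ultimately show ?thesis using closedin_Int csubD(2)[OF V] by metis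
qed

text \<open>Finite index of \<open>Z\<close> makes the sets \<open>W n - Z\<close> closed. They
  decrease and have empty intersection, so by compactness one of them is empty.\<close>

lemma csub_nest:
 assumes W: "!!n. csub (W n)" "!!n. W (Suc n) <= W n" "W 0 <= V" and V: "csub V" "csub Z" "alm V Z"
  and sub: "(\<Inter>n. W n) <= Z"
 shows "EX n. W n <= Z"
proof (rule ccontr)
 assume neg: "\<not> (EX n. W n <= Z)"
 have dec: "decseq W" using W(2) by (rule decseq_SucI)
 have "W n <= V" for n using decseqD[OF dec, of 0 n] W(3) by simp
 hence eq: "W n - Z = W n \<inter> (V - Z)" for n by blast
 have "(\<Inter>n. W n - Z) ~= {}"
 proof (rule compact_space_imp_nest[OF compact_T])
  show "closedin T (W n - Z)" for n unfolding eq
   by (intro closedin_Int csubD(2)[OF W(1)] closedin_diff_csub V)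
  show "W n - Z ~= {}" for n using neg by blast
  show "decseq (%n. W n - Z)" using dec unfolding decseq_def by blast
 qed
 thus False using sub by blast
qed

text \<open>Some member has interior in \<open>A\<close>, and finitely many translates of that
  interior cover the compact group \<open>A\<close>. Phrasing the result with quotients of two
  elements of \<open>C\<close> makes it apply to families of cosets and of subgroups alike.\<close>

lemma baire_cover:
 assumes A: "csub A" and \<C>: "countable \<C>" "!!C. C \<in> \<C> ==> closedin T C" "A <= \<Union>\<C>"
 shows "EX C:\<C>. EX F. finite F & F <= A & (ALL a:A. EX f:F. EX c:C. EX c':C. inv f \<otimes> a = inv c \<otimes> c')"
proof -
 define X where "X = subtopology T A"
 have Ac: "A <= carrier H" by (rule csubD(3)[OF A])
 have topX: "topspace X = A" using Ac by (simp add: X_def topspace_T Int_absorb1)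
 have cX: "compact_space X" unfolding X_def using compactin_closed[OF csubD(2)[OF A]] compact_space_subtopology by blast
 have hX: "Hausdorff_space X" unfolding X_def by (rule Hausdorff_space_subtopology[OF Hausdorff_T])
 have lX: "locally_compact_space X & regular_space X"
  using cX hX compact_imp_locally_compact_space compact_Hausdorff_imp_regular_space by blast
 have "EX C:\<C>. X interior_of (A \<inter> C) ~= {}"
 proof (rule ccontr)
  assume neg: "\<not> ?thesis"
  have "X interior_of \<Union>((\<inter>) A ` \<C>) = {}"
  proof (rule Baire_category_alt)
   show "completely_metrizable_space X \<or> locally_compact_space X & regular_space X" using lX by blast
   show "countable ((\<inter>) A ` \<C>)" using \<C>(1) by simp
   fix T' assume "T' \<in> (\<inter>) A ` \<C>"
   then obtain C where C: "C \<in> \<C>" "T' = A \<inter> C" by blast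
   have "closedin X T'" unfolding X_def C(2) closedin_subtopology using \<C>(2)[OF C(1)] by blast
   thus "closedin X T' & X interior_of T' = {}" using neg C by blast
  qed
  moreover have "\<Union>((\<inter>) A ` \<C>) = topspace X" using \<C>(3) topX by blast
  ultimately have "topspace X = {}" by simp
  thus False using topX subgroup.one_closed[OF csubD(1)[OF A]] by blast
 qed
 then obtain C u where C: "C \<in> \<C>" "u \<in> X interior_of (A \<inter> C)" by blast
 define U where "U = X interior_of (A \<inter> C)"
 have U: "openin X U" "U <= A \<inter> C" "u \<in> U" using C interior_of_subset[of X "A \<inter> C"] by (auto simp: U_def)
 obtain U' where U': "openin T U'" "U = U' \<inter> A" using U(1) unfolding X_def openin_subtopology by blast
 have uA: "u \<in> A" using U by blast
 hence uc: "u \<in> carrier H" using Ac by blast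
 \<comment> \<open>The translate of \<open>U'\<close> that moves the interior point \<open>u\<close>
   to \<open>a\<close>.\<close>
 define V where "V a = (%x. (a \<otimes> inv u) \<otimes> x) ` U'" for a
 have U'c: "U' <= carrier H" using openin_subset[OF U'(1)] topspace_T by simp
 have opV: "openin T (V a)" if "a \<in> A" for a
  unfolding V_def by (rule openin_translation[OF _ U'(1)]) (use that Ac uc in auto)
 have aV: "a \<in> V a" if "a \<in> A" for a
 proof -
  have ac: "a \<in> carrier H" using that Ac by blast
  have "a = (a \<otimes> inv u) \<otimes> u" using ac uc by (simp add: m_assoc)
  moreover have "u \<in> U'" using U U' by blast
  ultimately show ?thesis unfolding V_def by (rule image_eqI)
 qed
 have "compactin T A" by (rule compactin_closed[OF csubD(2)[OF A]])
 moreover have "!!W. W \<in> V ` A ==> openin T W" using opV by blast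
 moreover have "A <= \<Union>(V ` A)" using aV by blast
 ultimately obtain \<F> where \<F>: "finite \<F>" "\<F> <= V ` A" "A <= \<Union>\<F>" using compactinD[of T A "V ` A"] by blast
 then obtain F where F: "finite F" "F <= A" "\<F> = V ` F" by (meson finite_subset_image)
 have "EX f:F. EX c:C. EX c':C. inv f \<otimes> a = inv c \<otimes> c'" if a: "a \<in> A" for a
 proof -
  obtain f where f: "f \<in> F" "a \<in> V f" using \<F>(3) F a by blast
  then obtain x where x: "x \<in> U'" "a = (f \<otimes> inv u) \<otimes> x" unfolding V_def by blast
  have c: "f \<in> carrier H" "a \<in> carrier H" "x \<in> carrier H" "f \<in> A" using f F Ac a x U'c by auto
  have "inv f \<otimes> a = (f \<otimes> inv f) \<otimes> (inv u \<otimes> x)" unfolding x(2) using c uc by (simp add: m_ac del: r_inv Units_r_inv)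
  hence eq: "inv f \<otimes> a = inv u \<otimes> x" using c uc by simp
  have "x = u \<otimes> (inv f \<otimes> a)" unfolding eq using c uc by (simp add: m_assoc[symmetric])
  moreover have "u \<otimes> (inv f \<otimes> a) \<in> A"
   by (intro subgroup.m_closed[OF csubD(1)[OF A]] subgroup.m_inv_closed[OF csubD(1)[OF A]] uA a c)
  ultimately have "x \<in> C" using x U U' by auto
  moreover have "u \<in> C" using U by blast
  ultimately show ?thesis using f(1) eq by blast
 qed
 hence "ALL a:A. EX f:F. EX c:C. EX c':C. inv f \<otimes> a = inv c \<otimes> c'" by simp
 thus ?thesis using F(1,2) by (intro bexI[OF _ C(1)] exI[of _ F] conjI)
qed

text \<open>For closed subgroups, countable index is finite index, by Baire.\<close>

lemma alm_of_countable_cosets: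
 assumes A: "csub A" and B: "csub B" and D: "countable D" "D <= carrier H" "!!a. a \<in> A ==> EX d:D. inv d \<otimes> a \<in> B"
 shows "alm A B"
proof -
 note Bc = csubD(3)[OF B] and Ac = csubD(3)[OF A]
 have 1: "countable ((%d. (%x. d \<otimes> x) ` B) ` D)" using D(1) by simp
 have 2: "closedin T C" if "C \<in> (%d. (%x. d \<otimes> x) ` B) ` D" for C
  using that D(2) closedin_translation[OF _ csubD(2)[OF B]] by auto
 have 3: "A <= \<Union>((%d. (%x. d \<otimes> x) ` B) ` D)"
 proof
  fix a assume a: "a \<in> A"
  then obtain d where d: "d \<in> D" "inv d \<otimes> a \<in> B" using D(3) by blast
  have "d \<in> carrier H" "a \<in> carrier H" using d(1) D(2) Ac a by blast+
  hence "a \<in> (%x. d \<otimes> x) ` B" using translation_image[of d B] Bc d(2) by simp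
  thus "a \<in> \<Union>((%d. (%x. d \<otimes> x) ` B) ` D)" using d by blast
 qed
 obtain C F where CF: "C \<in> (%d. (%x. d \<otimes> x) ` B) ` D" "finite F" "F <= A"
  "ALL a:A. EX f:F. EX c:C. EX c':C. inv f \<otimes> a = inv c \<otimes> c'"
  using baire_cover[OF A 1 2 3] by blast
 then obtain d where d: "d \<in> D" "C = (%x. d \<otimes> x) ` B" by blast
 have dc: "d \<in> carrier H" using d D by blast
 show ?thesis
 proof (rule almI'[OF CF(2,3)])
  fix a assume "a \<in> A"
  then obtain f c c' where f: "f \<in> F" "c \<in> C" "c' \<in> C" "inv f \<otimes> a = inv c \<otimes> c'" using CF(4) by blast
  obtain b b' where b: "b \<in> B" "c = d \<otimes> b" "b' \<in> B" "c' = d \<otimes> b'" using f d by blast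
  have bc: "b \<in> carrier H" "b' \<in> carrier H" using b Bc by auto
  have "inv c \<otimes> c' = (d \<otimes> inv d) \<otimes> (inv b \<otimes> b')" unfolding b using bc dc by (simp add: inv_mult m_ac del: r_inv Units_r_inv)
  hence "inv f \<otimes> a = inv b \<otimes> b'" using f(4) bc dc by simp
  also have "\<dots> \<in> B" by (intro subgroup.m_closed[OF csubD(1)[OF B]] subgroup.m_inv_closed[OF csubD(1)[OF B]] b)
  finally show "EX f:F. inv f \<otimes> a \<in> B" using f(1) by blast
 qed
qed

lemma alm_of_countable_union:
 assumes A: "csub A" and B: "!!n :: nat. csub (B n)" and cov: "A <= (\<Union>n. B n)"
 shows "EX n. alm A (B n)"
proof -
 have 1: "countable (range B)" by simp
 have 2: "closedin T C" if "C \<in> range B" for C using that csubD(2)[OF B] by auto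
 obtain C F where CF: "C \<in> range B" "finite F" "F <= A"
  "ALL a:A. EX f:F. EX c:C. EX c':C. inv f \<otimes> a = inv c \<otimes> c'"
  using baire_cover[OF A 1 2 cov] by blast
 then obtain n where n: "C = B n" by blast
 have "EX f:F. inv f \<otimes> a \<in> B n" if "a \<in> A" for a
 proof -
  obtain f c c' where f: "f \<in> F" "c \<in> C" "c' \<in> C" "inv f \<otimes> a = inv c \<otimes> c'" using CF(4) \<open>a \<in> A\<close> by blast
  have "inv c \<otimes> c' \<in> B n" using f n by (intro subgroup.m_closed[OF csubD(1)[OF B]] subgroup.m_inv_closed[OF csubD(1)[OF B]]) auto
  thus ?thesis using f by (intro bexI[of _ f]) simp_all
 qed
 hence "alm A (B n)" by (rule almI'[OF CF(2,3)])
 thus ?thesis ..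
qed

lemma countable_csub_finite:
 assumes "csub A" "countable A" shows "finite A"
proof -
 have "alm A {\<one>}"
 proof (rule alm_of_countable_cosets[OF assms(1) csub_one assms(2) csubD(3)[OF assms(1)]])
  fix a assume "a \<in> A"
  hence "inv a \<otimes> a \<in> {\<one>}" using csubD(3)[OF assms(1)] by auto
  thus "EX d:A. inv d \<otimes> a \<in> {\<one>}" using \<open>a \<in> A\<close> by blast
 qed
 thus ?thesis using alm_finite[OF csubD(3)[OF assms(1)]] by blast
qed

text \<open>Such a \<open>Y\<close> is compact and relatively open in \<open>V\<close>, hence cut
  out of \<open>V\<close> by a finite union of basic open sets.\<close>

lemma countable_finite_index:
 assumes sc: "second_countable T" and V: "csub V"
 shows "countable {Y. csub Y & Y <= V & alm V Y}"
proof -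
 obtain \<B> where \<B>: "countable \<B>" "!!U. U \<in> \<B> ==> openin T U"
  "!!U x. openin T U ==> x \<in> U ==> EX W:\<B>. x \<in> W & W <= U"
  using sc unfolding second_countable_def by metis
 have "{Y. csub Y & Y <= V & alm V Y} <= (%\<F>. V \<inter> \<Union>\<F>) ` {\<F>. finite \<F> & \<F> <= \<B>}"
 proof
  fix Y assume "Y \<in> {Y. csub Y & Y <= V & alm V Y}"
  hence Y: "csub Y" "Y <= V" "alm V Y" by auto
  define U where "U = topspace T - (V - Y)"
  have U: "openin T U" unfolding U_def using closedin_diff_csub[OF V Y(1,3)] by blast
  have YU: "Y = V \<inter> U" unfolding U_def using Y(2) csubD(3)[OF V] topspace_T by blast
  have Uall: "!!W. W \<in> {W \<in> \<B>. W <= U} ==> openin T W" using \<B>(2) by simp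
  have cov: "Y <= \<Union>{W \<in> \<B>. W <= U}" using \<B>(3)[OF U] YU by blast
  from compactinD[OF compactin_closed[OF csubD(2)[OF Y(1)]] Uall cov]
  obtain \<F> where "finite \<F> & \<F> <= {W \<in> \<B>. W <= U} & Y <= \<Union>\<F>" ..
  hence \<F>: "finite \<F>" "\<F> <= {W \<in> \<B>. W <= U}" "Y <= \<Union>\<F>" by simp_all
  have "Y = V \<inter> \<Union>\<F>" using \<F>(2,3) YU by blast
  moreover have "\<F> \<in> {\<F>. finite \<F> & \<F> <= \<B>}" using \<F> by blast
  ultimately show "Y \<in> (%\<F>. V \<inter> \<Union>\<F>) ` {\<F>. finite \<F> & \<F> <= \<B>}" by (rule image_eqI)
 qed
 moreover have "countable ((%\<F>. V \<inter> \<Union>\<F>) ` {\<F>. finite \<F> & \<F> <= \<B>})"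
  by (intro countable_image countable_Collect_finite_subset \<B>(1))
 ultimately show ?thesis by (rule countable_subset)
qed

lemma div_cont: "continuous_map (prod_topology T T) T (%(x, y). x \<otimes> inv y)"
proof -
 have 1: "continuous_map (prod_topology T T) (prod_topology T T) (%z. (fst z, inv (snd z)))"
 proof (rule continuous_map_pairedI)
  show "continuous_map (prod_topology T T) T fst" by (rule continuous_map_fst)
  show "continuous_map (prod_topology T T) T (%z. inv (snd z))"
   using continuous_map_compose[OF continuous_map_snd inv_cont, of T] by (simp add: o_def)
 qed
 from continuous_map_compose[OF 1 mult_cont] show ?thesis by (simp add: o_def case_prod_unfold)
qed

lemma nbhd_div:
 assumes U: "openin T U" "\<one> \<in> U"
 shows "EX W. openin T W & \<one> \<in> W & (ALL a:W. ALL b:W. a \<otimes> inv b \<in> U)"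
proof -
 define P where "P = {z \<in> topspace (prod_topology T T). (case z of (x, y) => x \<otimes> inv y) \<in> U}"
 have oP: "openin (prod_topology T T) P" unfolding P_def by (rule openin_continuous_map_preimage[OF div_cont U(1)])
 have "(\<one>, \<one>) \<in> P" unfolding P_def using U by (simp add: topspace_T)
 with oP[unfolded openin_prod_topology_alt, rule_format]
 obtain W1 W2 where "openin T W1 & openin T W2 & \<one> \<in> W1 & \<one> \<in> W2 & W1 \<times> W2 <= P" by metis
 hence W: "openin T W1" "openin T W2" "\<one> \<in> W1" "\<one> \<in> W2" "W1 \<times> W2 <= P" by simp_all
 have "a \<otimes> inv b \<in> U" if "a \<in> W1 \<inter> W2" "b \<in> W1 \<inter> W2" for a b
 proof -
  have "(a, b) \<in> P" using W(5) that by blast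
  thus ?thesis unfolding P_def by simp
 qed
 thus ?thesis using W by (intro exI[of _ "W1 \<inter> W2"]) auto
qed

lemma subgroup_closure:
 assumes M: "subgroup M H" shows "csub (T closure_of M)"
proof -
 have Mc: "M <= topspace T" using subgroup.subset[OF M] topspace_T by simp
 have im: "(%(x, y). x \<otimes> inv y) ` (M \<times> M) <= M"
  using subgroup.m_closed[OF M] subgroup.m_inv_closed[OF M] by auto
 have "(%(x, y). x \<otimes> inv y) ` (prod_topology T T closure_of (M \<times> M)) <= T closure_of ((%(x, y). x \<otimes> inv y) ` (M \<times> M))"
  by (rule continuous_map_image_closure_subset[OF div_cont])
 also have "\<dots> <= T closure_of M" by (rule closure_of_mono[OF im])
 finally have cl: "(%(x, y). x \<otimes> inv y) ` (prod_topology T T closure_of (M \<times> M)) <= T closure_of M" .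
 have *: "a \<otimes> inv b \<in> T closure_of M" if "a \<in> T closure_of M" "b \<in> T closure_of M" for a b
 proof -
  have "(a, b) \<in> prod_topology T T closure_of (M \<times> M)" using that by (simp add: closure_of_Times)
  from subsetD[OF cl imageI[OF this]] show ?thesis by simp
 qed
 have sub: "T closure_of M <= carrier H" using closure_of_subset_topspace[of T M] topspace_T by simp
 have one: "\<one> \<in> T closure_of M" using closure_of_subset[OF Mc] subgroup.one_closed[OF M] by blast
 have "subgroup (T closure_of M) H"
 proof (rule subgroupI)
  show "T closure_of M <= carrier H" "T closure_of M ~= {}" using sub one by auto
  show inv: "inv a \<in> T closure_of M" if "a \<in> T closure_of M" for a
  proof -
   have "a \<in> carrier H" using sub that by blast
   thus ?thesis using *[OF one that] by simp
  qed
  show "a \<otimes> b \<in> T closure_of M" if "a \<in> T closure_of M" "b \<in> T closure_of M" for a b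
  proof -
   have "b \<in> carrier H" using sub that by blast
   thus ?thesis using *[OF that(1) inv[OF that(2)]] by simp
  qed
 qed
 thus ?thesis by (simp add: csub_def)
qed

text \<open>By compactness finitely many translates of a small neighbourhood \<open>B0\<close> cover
  \<open>V\<close>, so Bogolyubov's lemma gives a subgroup of finite index inside the products of
  two quotients from \<open>B0\<close>, which lie in \<open>U\<close>.\<close>

lemma finite_index_in_nbhd:
 assumes V: "csub V" and p: "prime (p::nat)" and expo: "!!x. x \<in> V ==> x [^] p = \<one>" and U: "openin T U" "\<one> \<in> U"
 shows "EX Y. csub Y & Y <= V & Y <= U & alm V Y"
proof -
 note Vs = csubD(1)[OF V] and Vc = csubD(3)[OF V]
 have reg: "regular_space T" using compact_T Hausdorff_T compact_Hausdorff_imp_regular_space by blast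
 \<comment> \<open>The subgroup will lie in \<open>U1\<close>; the closed set \<open>C\<close>
   between \<open>U1\<close> and \<open>U\<close> keeps its closure inside \<open>U\<close>.\<close>
 obtain U1 C where U1: "openin T U1" "closedin T C" "\<one> \<in> U1" "U1 <= C" "C <= U"
  using reg U unfolding neighbourhood_base_of_closedin[symmetric] neighbourhood_base_of by metis
 obtain W where W: "openin T W" "\<one> \<in> W" "!!a b. a \<in> W ==> b \<in> W ==> a \<otimes> inv b \<in> U1" using nbhd_div[OF U1(1,3)] by blast
 obtain W' where W': "openin T W'" "\<one> \<in> W'" "!!a b. a \<in> W' ==> b \<in> W' ==> a \<otimes> inv b \<in> W" using nbhd_div[OF W(1,2)] by blast
 obtain B0 where B0: "openin T B0" "\<one> \<in> B0" "!!a b. a \<in> B0 ==> b \<in> B0 ==> a \<otimes> inv b \<in> W'" using nbhd_div[OF W'(1,2)] by blast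
 have B0c: "B0 <= carrier H" using openin_subset[OF B0(1)] topspace_T by simp
 let ?K = "H\<lparr>carrier := V\<rparr>"
 interpret K: comm_group ?K
  using subgroup.subgroup_is_group[OF Vs is_group]
  by (rule group.group_comm_groupI) (use Vc in \<open>auto intro!: m_comm\<close>)
 have invK: "inv\<^bsub>?K\<^esub> x = inv x" if "x \<in> V" for x using m_inv_consistent[OF Vs that] .
 have opV: "openin T ((%x. t \<otimes> x) ` B0)" if "t \<in> V" for t
  using openin_translation[OF _ B0(1)] that Vc by blast
 have tV: "t \<in> (%x. t \<otimes> x) ` B0" if "t \<in> V" for t
 proof (rule image_eqI[of _ _ \<one>])
  show "t = t \<otimes> \<one>" using that Vc by auto
 qed (rule B0(2))
 have opn: "!!S. S \<in> (%t. (%x. t \<otimes> x) ` B0) ` V ==> openin T S" using opV by blast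
 have cov: "V <= \<Union>((%t. (%x. t \<otimes> x) ` B0) ` V)" using tV by blast
 obtain \<F> where \<F>: "finite \<F>" "\<F> <= (%t. (%x. t \<otimes> x) ` B0) ` V" "V <= \<Union>\<F>"
  using compactinD[OF compactin_closed[OF csubD(2)[OF V]] opn cov] by blast
 obtain Q where Q: "finite Q" "Q <= V" "\<F> = (%t. (%x. t \<otimes> x) ` B0) ` Q"
  using \<F>(1,2) by (meson finite_subset_image)
 have covK: "carrier ?K <= Q <#>\<^bsub>?K\<^esub> (V \<inter> B0)"
 proof
  fix x assume "x \<in> carrier ?K"
  hence x: "x \<in> V" by simp
  then obtain t b where tb: "t \<in> Q" "b \<in> B0" "x = t \<otimes> b" using \<F>(3) Q(3) by blast
  have c: "t \<in> carrier H" "b \<in> carrier H" using tb Q(2) Vc B0c by auto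
  have "b = inv t \<otimes> x" unfolding tb(3) using c by (simp add: m_assoc[symmetric])
  also have "\<dots> \<in> V" using tb Q(2) x by (intro subgroup.m_closed[OF Vs] subgroup.m_inv_closed[OF Vs]) auto
  finally show "x \<in> Q <#>\<^bsub>?K\<^esub> (V \<inter> B0)" unfolding set_mult_def using tb by auto
 qed
 have "x [^]\<^bsub>?K\<^esub> p = \<one>\<^bsub>?K\<^esub>" if "x \<in> carrier ?K" for x
  using expo that by (simp add: nat_pow_consistent[symmetric])
 moreover have "V \<inter> B0 <= carrier ?K" "Q <= carrier ?K" using Q by auto
 ultimately obtain M where M: "subgroup M ?K" "EX F. finite F & F <= carrier ?K & carrier ?K <= F <#>\<^bsub>?K\<^esub> M"
  "ALL x:M. EX a:V \<inter> B0. EX b:V \<inter> B0. EX c:V \<inter> B0. EX d:V \<inter> B0.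
   x = (a \<otimes>\<^bsub>?K\<^esub> inv\<^bsub>?K\<^esub> b) \<otimes>\<^bsub>?K\<^esub> (c \<otimes>\<^bsub>?K\<^esub> inv\<^bsub>?K\<^esub> d)"
  using K.bogolyubov[OF p _ _ Q(1) _ covK] by metis
 have MH: "subgroup M H" by (rule incl_subgroup[OF Vs M(1)])
 have MV: "M <= V" using subgroup.subset[OF M(1)] by simp
 have MU1: "M <= U1"
 proof
  fix x assume "x \<in> M"
  then obtain a b c d where abcd: "a \<in> V \<inter> B0" "b \<in> V \<inter> B0" "c \<in> V \<inter> B0" "d \<in> V \<inter> B0"
   "x = (a \<otimes>\<^bsub>?K\<^esub> inv\<^bsub>?K\<^esub> b) \<otimes>\<^bsub>?K\<^esub> (c \<otimes>\<^bsub>?K\<^esub> inv\<^bsub>?K\<^esub> d)" using M(3) by blast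
  hence x: "x = (a \<otimes> inv b) \<otimes> (c \<otimes> inv d)" using invK by simp
  have cc: "a \<in> carrier H" "b \<in> carrier H" "c \<in> carrier H" "d \<in> carrier H" using abcd B0c by auto
  have "\<one> \<otimes> inv (c \<otimes> inv d) \<in> W" using W'(3)[OF W'(2) B0(3)] abcd by blast
  moreover have "a \<otimes> inv b \<in> W"
  proof -
   have "(a \<otimes> inv b) \<otimes> inv \<one> \<in> W" using W'(3)[OF B0(3) W'(2)] abcd by blast
   thus ?thesis using cc by simp
  qed
  ultimately have "(a \<otimes> inv b) \<otimes> inv (\<one> \<otimes> inv (c \<otimes> inv d)) \<in> U1" by (intro W(3))
  thus "x \<in> U1" unfolding x using cc by simp
 qed
 obtain F where F: "finite F" "F <= V" "V <= F <#>\<^bsub>?K\<^esub> M" using M(2) by auto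
 have "alm V M"
 proof (rule almI'[OF F(1,2)])
  fix a assume "a \<in> V"
  then obtain f m where fm: "f \<in> F" "m \<in> M" "a = f \<otimes> m" using F(3) unfolding set_mult_def by auto
  hence c: "f \<in> carrier H" "m \<in> carrier H" using F Vc MV by auto
  have "inv f \<otimes> a = m" unfolding fm(3) using c by (simp add: m_assoc[symmetric])
  thus "EX f:F. inv f \<otimes> a \<in> M" using fm by blast
 qed
 hence "alm V (T closure_of M)"
  by (rule alm_super) (use closure_of_subset[of M T] MV Vc topspace_T in auto)
 moreover have "T closure_of M <= V" by (rule closure_of_minimal[OF MV csubD(2)[OF V]])
 moreover have "T closure_of M <= U" using closure_of_minimal[of M C T] MU1 U1 by blast
 ultimately show ?thesis using subgroup_closure[OF MH] by blast
qed

text \<open>Removing the finitely many nontrivial points of \<open>E\<close> leaves a neighbourhood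
  of the identity. This is the source of all trivial intersections below.\<close>

lemma avoid_finite:
 assumes V: "csub V" and p: "prime (p::nat)" and expo: "!!x. x \<in> V ==> x [^] p = \<one>" and E: "finite E"
 shows "EX Y. csub Y & Y <= V & alm V Y & Y \<inter> E <= {\<one>}"
proof -
 have fE: "finite ((E - {\<one>}) \<inter> topspace T)" using E by simp
 have "closedin T ((E - {\<one>}) \<inter> topspace T)"
  using Hausdorff_imp_t1_space[OF Hausdorff_T] fE unfolding t1_space_closedin_finite by blast
 hence "openin T (topspace T - (E - {\<one>}) \<inter> topspace T)" by blast
 moreover have "\<one> \<in> topspace T - (E - {\<one>}) \<inter> topspace T" using topspace_T by simp
 ultimately obtain Y where Y: "csub Y" "Y <= V" "Y <= topspace T - (E - {\<one>}) \<inter> topspace T" "alm V Y"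
  using finite_index_in_nbhd[OF V p expo] by blast
 hence "Y \<inter> E <= {\<one>}" by blast
 thus ?thesis using Y by blast
qed

end

section \<open>Invariant closed subgroups and atoms\<close>

text \<open>A directed family of sets of automorphisms, each closed under composition and inversion
  as maps on \<open>H\<close>, takes the place of a topological group. On \<open>H Mod K\<close>
  only the sets preserving \<open>K\<close> act, and the locale survives this restriction.\<close>

locale inv_setting = compact_abelian_group H T for H :: "'a monoid" (structure) and T +
 fixes act :: "'g => 'a => 'a" and SS :: "'g set set"
 assumes SS_nonempty: "SS ~= {}"
  and directed: "P \<in> SS ==> Q \<in> SS ==> EX R:SS. R <= P & R <= Q"
  and act_hom: "P \<in> SS ==> g \<in> P ==> act g \<in> hom H H"
  and act_cont: "P \<in> SS ==> g \<in> P ==> continuous_map T T (act g)"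
  and act_inverse: "P \<in> SS ==> g \<in> P ==> EX g':P. ALL h:carrier H. act g' (act g h) = h & act g (act g' h) = h"
  and act_comp: "P \<in> SS ==> g \<in> P ==> g' \<in> P ==> EX g'':P. ALL h:carrier H. act g'' h = act g (act g' h)"
  and point_stab: "h \<in> carrier H ==> EX P:SS. ALL g:P. act g h = h"
  and countable_orbits: "P \<in> SS ==> EX C. countable C & C <= carrier H & (ALL h:carrier H. EX c:C. EX g:P. h = act g c)"
  and finite_index_stab: "P \<in> SS ==> csub L ==> (!!g. g \<in> P ==> act g ` L <= L) ==>
   csub Y ==> Y <= L ==> alm L Y ==> EX Q:SS. ALL g:Q. act g ` Y <= Y"
  and second_countable_T: "second_countable T"
begin

definition invar :: "'g set => 'a set => bool" where
 "invar P L \<longleftrightarrow> (ALL g:P. act g ` L <= L)"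

lemma invarD: "invar P L ==> g \<in> P ==> x \<in> L ==> act g x \<in> L"
 unfolding invar_def by blast

lemma invarI: "(!!g x. g \<in> P ==> x \<in> L ==> act g x \<in> L) ==> invar P L"
 unfolding invar_def by blast

lemma invar_mono: "invar P L ==> Q <= P ==> invar Q L"
 unfolding invar_def by blast

definition LL :: "'a set set" where
 "LL = {L. csub L & (EX P:SS. invar P L)}"

lemma LLD: "L \<in> LL ==> csub L" "L \<in> LL ==> subgroup L H" "L \<in> LL ==> L <= carrier H"
 by (auto simp: LL_def dest: csubD)

lemma LL_invar: "L \<in> LL ==> EX P:SS. invar P L"
 by (simp add: LL_def)

lemma LLI: "csub L ==> P \<in> SS ==> invar P L ==> L \<in> LL"
 unfolding LL_def by blast

lemma act_closed: "P \<in> SS ==> g \<in> P ==> h \<in> carrier H ==> act g h \<in> carrier H"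
 using act_hom by (auto simp: hom_def)

lemma act_mult: "P \<in> SS ==> g \<in> P ==> h \<in> carrier H ==> k \<in> carrier H ==> act g (h \<otimes> k) = act g h \<otimes> act g k"
 using act_hom by (auto simp: hom_def)

lemma act_one: "P \<in> SS ==> g \<in> P ==> act g \<one> = \<one>"
 using act_hom hom_one[OF _ is_group is_group] by blast

lemma act_m_inv:
 assumes "P \<in> SS" "g \<in> P" "h \<in> carrier H" shows "act g (inv h) = inv (act g h)"
proof -
 have "act g h \<otimes> act g (inv h) = \<one>" using act_mult[OF assms(1-3) inv_closed[OF assms(3)]] act_one assms by simp
 thus ?thesis using act_closed[OF assms(1,2)] assms(3) by (intro comm_inv_char[symmetric]) auto
qed

lemma act_pow: "P \<in> SS ==> g \<in> P ==> h \<in> carrier H ==> act g (h [^] (n::nat)) = act g h [^] n"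
 by (induction n) (simp_all add: act_one act_mult)

lemma common_P:
 assumes "finite \<L>" "\<L> <= LL"
 shows "EX P:SS. ALL L:\<L>. invar P L"
 using assms
proof (induction \<L>)
 case empty
 thus ?case using SS_nonempty by blast
next
 case (insert L \<L>)
 then obtain P where P: "P \<in> SS" "ALL L:\<L>. invar P L" by blast
 obtain Q where Q: "Q \<in> SS" "invar Q L" using LL_invar insert.prems by blast
 obtain R where R: "R \<in> SS" "R <= P" "R <= Q" using directed[OF P(1) Q(1)] by blast
 have "ALL M:insert L \<L>. invar R M" using P Q R invar_mono by blast
 thus ?case using R(1) by blast
qed

lemma invar_Int: "invar P L ==> invar P M ==> invar P (L \<inter> M)"
 unfolding invar_def by blast

lemma invar_set_mult:
 assumes P: "P \<in> SS" and inv: "invar P L" "invar P M" and c: "L <= carrier H" "M <= carrier H"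
 shows "invar P (L <#> M)"
proof (rule invarI)
 fix g x assume g: "g \<in> P" and "x \<in> L <#> M"
 then obtain l m where lm: "l \<in> L" "m \<in> M" "x = l \<otimes> m" by (auto simp: set_mult_iff)
 hence "act g x = act g l \<otimes> act g m" using act_mult[OF P g] c by (simp add: subset_iff)
 thus "act g x \<in> L <#> M" using set_mult_I[OF invarD[OF inv(1) g lm(1)] invarD[OF inv(2) g lm(2)]] by simp
qed

lemma LL_two:
 assumes "L \<in> LL" "M \<in> LL" obtains P where "P \<in> SS" "invar P L" "invar P M"
 using common_P[of "{L, M}"] assms by auto

lemma LL_Int: assumes "L \<in> LL" "M \<in> LL" shows "L \<inter> M \<in> LL"
proof -
 obtain P where "P \<in> SS" "invar P L" "invar P M" using assms by (rule LL_two)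
 thus ?thesis using csub_Int LLD(1) assms invar_Int by (intro LLI[of _ P]) auto
qed

lemma LL_set_mult: assumes "L \<in> LL" "M \<in> LL" shows "L <#> M \<in> LL"
proof -
 obtain P where P: "P \<in> SS" "invar P L" "invar P M" using assms by (rule LL_two)
 show ?thesis
  by (rule LLI[OF csub_set_mult[OF LLD(1)[OF assms(1)] LLD(1)[OF assms(2)]] P(1) invar_set_mult[OF P LLD(3)[OF assms(1)] LLD(3)[OF assms(2)]]])
qed

lemma LL_finite_index: assumes L: "L \<in> LL" and Y: "csub Y" "Y <= L" "alm L Y" shows "Y \<in> LL"
proof -
 obtain P where P: "P \<in> SS" "invar P L" using LL_invar[OF L] by blast
 obtain Q where "Q \<in> SS" "ALL g:Q. act g ` Y <= Y"
  using finite_index_stab[OF P(1) LLD(1)[OF L] _ Y] P(2) unfolding invar_def by blast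
 thus ?thesis by (intro LLI[OF Y(1)]) (auto simp: invar_def)
qed

text \<open>A fixed point is its own orbit under \<open>P\<close>, so there are countably many, and
  a countable closed subgroup is finite.\<close>

lemma finite_Fix:
 assumes P: "P \<in> SS" shows "finite {h \<in> carrier H. ALL g:P. act g h = h}"
proof -
 let ?F = "{h \<in> carrier H. ALL g:P. act g h = h}"
 have sub: "subgroup ?F H"
 proof (rule subgroupI)
  show "?F ~= {}" using act_one[OF P] by blast
  show "inv a \<in> ?F" if "a \<in> ?F" for a using that act_m_inv[OF P] by simp
  show "a \<otimes> b \<in> ?F" if "a \<in> ?F" "b \<in> ?F" for a b using that act_mult[OF P] by simp
 qed auto
 have "?F = (\<Inter>g\<in>P. {h \<in> topspace T. act g h = h}) \<inter> topspace T" using topspace_T by blast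
 moreover have "closedin T ((\<Inter>g\<in>P. {h \<in> topspace T. act g h = h}) \<inter> topspace T)"
 proof (cases "P = {}")
  case False
  have "closedin T {h \<in> topspace T. act g h = h}" if "g \<in> P" for g
   using closedin_continuous_maps_eq[OF Hausdorff_T act_cont[OF P that] continuous_map_id] by (simp add: id_def)
  thus ?thesis using False by (intro closedin_Int closedin_INT closedin_topspace) auto
 qed simp
 ultimately have cs: "csub ?F" using sub by (simp add: csub_def)
 obtain C where C: "countable C" "ALL h:carrier H. EX c:C. EX g:P. h = act g c" "C <= carrier H" using countable_orbits[OF P] by blast
 have "?F <= C"
 proof
  fix h assume h: "h \<in> ?F"
  then obtain c g where cg: "c \<in> C" "g \<in> P" "h = act g c" using C(2) by blast
  obtain g' where g': "g' \<in> P" "ALL k:carrier H. act g' (act g k) = k & act g (act g' k) = k" using act_inverse[OF P cg(2)] by blast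
  have "act g' h = c" using cg g'(2) C(3) by auto
  thus "h \<in> C" using h g'(1) cg(1) by auto
 qed
 hence "countable ?F" using C(1) countable_subset by blast
 thus ?thesis using countable_csub_finite[OF cs] by blast
qed

text \<open>The powers of \<open>h\<close> are fixed by any \<open>P\<close> that fixes
  \<open>h\<close>, so they lie in a finite group.\<close>

lemma torsion:
 assumes h: "h \<in> carrier H" shows "EX n::nat. n > 0 & h [^] n = \<one>"
proof -
 obtain P where P: "P \<in> SS" "ALL g:P. act g h = h" using point_stab[OF h] by blast
 let ?F = "{h \<in> carrier H. ALL g:P. act g h = h}"
 have "range (%n::nat. h [^] n) <= ?F" using act_pow[OF P(1) _ h] P(2) h by auto
 hence "finite (range (%n::nat. h [^] n))" using finite_Fix[OF P(1)] by (rule finite_subset)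
 hence "\<not> inj (%n::nat. h [^] n)" using finite_imageD[of "%n::nat. h [^] n" UNIV] infinite_UNIV_nat by blast
 then obtain i j :: nat where ij: "i < j" "h [^] i = h [^] j" unfolding inj_on_def by (metis UNIV_I nat_neq_iff)
 have "h [^] i \<otimes> h [^] (j - i) = h [^] j" using ij(1) h by (simp add: nat_pow_mult)
 hence "h [^] i \<otimes> h [^] (j - i) = h [^] i" using ij(2) by simp
 hence "h [^] (j - i) = \<one>" using h l_cancel_one[of "h [^] i" "h [^] (j - i)"] by simp
 thus ?thesis using ij(1) by (intro exI[of _ "j - i"]) simp
qed

text \<open>Otherwise countably many finite orbits would cover \<open>V\<close>, and a countable
  closed subgroup is finite.\<close>

lemma infinite_orbit:
 assumes P: "P \<in> SS" and V: "csub V" "infinite V"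
 shows "EX y:V. infinite ((%g. act g y) ` P)"
proof (rule ccontr)
 assume neg: "\<not> ?thesis"
 obtain C where C: "countable C" "ALL h:carrier H. EX c:C. EX g:P. h = act g c" "C <= carrier H" using countable_orbits[OF P] by blast
 define D where "D = {c \<in> C. finite ((%g. act g c) ` P)}"
 have cov: "V <= (\<Union>c\<in>D. (%g. act g c) ` P)"
 proof
  fix y assume y: "y \<in> V"
  hence yc: "y \<in> carrier H" using csubD(3)[OF V(1)] by blast
  then obtain c g where cg: "c \<in> C" "g \<in> P" "y = act g c" using C(2) by blast
  obtain g' where g': "g' \<in> P" "ALL k:carrier H. act g' (act g k) = k & act g (act g' k) = k" using act_inverse[OF P cg(2)] by blast
  have c: "c = act g' y" using cg g'(2) C(3) by auto
  have "(%g. act g c) ` P <= (%g. act g y) ` P"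
  proof
   fix z assume "z \<in> (%g. act g c) ` P"
   then obtain k where k: "k \<in> P" "z = act k (act g' y)" using c by blast
   obtain k' where "k' \<in> P" "ALL h:carrier H. act k' h = act k (act g' h)" using act_comp[OF P k(1) g'(1)] by blast
   thus "z \<in> (%g. act g y) ` P" using k yc by force
  qed
  moreover have "finite ((%g. act g y) ` P)" using neg y by blast
  ultimately have "c \<in> D" unfolding D_def using cg(1) finite_subset by blast
  thus "y \<in> (\<Union>c\<in>D. (%g. act g c) ` P)" using cg by blast
 qed
 have "countable D" unfolding D_def by (rule countable_subset[OF _ C(1)]) simp
 hence "countable (\<Union>c\<in>D. (%g. act g c) ` P)"
  by (rule countable_UN) (auto simp: D_def intro: countable_finite)
 hence "countable V" using cov countable_subset by blast
 thus False using countable_csub_finite[OF V(1)] V(2) by blast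
qed

lemma pow_cont: "continuous_map T T (%x. x [^] (n::nat))"
proof (induction n)
 case 0
 thus ?case by (simp add: topspace_T)
next
 case (Suc n)
 have "continuous_map T (prod_topology T T) (%x. (x [^] n, x))"
  by (intro continuous_map_pairedI Suc) simp
 from continuous_map_compose[OF this mult_cont] show ?case by (simp add: o_def)
qed

definition tors :: "nat => 'a set => 'a set" where "tors n V = {h \<in> V. h [^] n = \<one>}"

lemma csub_tors: assumes "csub V" shows "csub (tors n V)"
proof -
 have "closedin T {x \<in> topspace T. x [^] n \<in> {\<one>}}"
  by (rule closedin_continuous_map_preimage[OF pow_cont csubD(2)[OF csub_one]])
 hence "closedin T (V \<inter> {x \<in> topspace T. x [^] n \<in> {\<one>}})" using csubD(2)[OF assms] closedin_Int by blast
 moreover have "V \<inter> {x \<in> topspace T. x [^] n \<in> {\<one>}} = tors n V" using csubD(3)[OF assms] topspace_T by (auto simp: tors_def)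
 moreover have "subgroup (tors n V) H"
 proof (rule subgroupI)
  show "tors n V <= carrier H" using csubD(3)[OF assms] by (auto simp: tors_def)
  show "tors n V ~= {}" using subgroup.one_closed[OF csubD(1)[OF assms]] by (auto simp: tors_def)
  show "inv a \<in> tors n V" if "a \<in> tors n V" for a
   using that csubD(3)[OF assms] subgroup.m_inv_closed[OF csubD(1)[OF assms]] by (auto simp: tors_def nat_pow_inv subset_iff)
  show "a \<otimes> b \<in> tors n V" if "a \<in> tors n V" "b \<in> tors n V" for a b
   using that csubD(3)[OF assms] subgroup.m_closed[OF csubD(1)[OF assms]] by (auto simp: tors_def nat_pow_distrib subset_iff)
 qed
 ultimately show ?thesis by (simp add: csub_def)
qed

lemma LL_tors: assumes "V \<in> LL" shows "tors n V \<in> LL"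
proof -
 obtain P where P: "P \<in> SS" "invar P V" using LL_invar[OF assms] by blast
 have "invar P (tors n V)"
 proof (rule invarI)
  fix g x assume g: "g \<in> P" "x \<in> tors n V"
  hence x: "x \<in> carrier H" "x \<in> V" "x [^] n = \<one>" using LLD(3)[OF assms] by (auto simp: tors_def)
  hence "act g x [^] n = \<one>" using act_pow[OF P(1) g(1) x(1), of n] act_one[OF P(1) g(1)] by simp
  thus "act g x \<in> tors n V" using invarD[OF P(2) g(1) x(2)] by (simp add: tors_def)
 qed
 thus ?thesis by (rule LLI[OF csub_tors[OF LLD(1)[OF assms]] P(1)])
qed

definition atom :: "'a set => bool" where
 "atom L \<longleftrightarrow> L \<in> LL & infinite L & (ALL C:LL. C <= L --> finite C \<or> alm L C)"

lemma atomD: "atom L ==> L \<in> LL" "atom L ==> infinite L"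
 by (auto simp: atom_def)

lemma atom_dichotomy:
 assumes "atom L" "C \<in> LL" shows "finite (L \<inter> C) \<or> alm L C"
proof -
 have "L \<inter> C \<in> LL" using LL_Int atomD(1) assms by blast
 hence "finite (L \<inter> C) \<or> alm L (L \<inter> C)" using assms unfolding atom_def by blast
 thus ?thesis using alm_super[of L "L \<inter> C" C] by blast
qed

lemma alm_infinite_Int: "L \<in> LL ==> infinite L ==> C \<in> LL ==> alm L C ==> infinite (L \<inter> C)"
 using alm_finite[OF LLD(3) alm_Int[OF LLD(2)]] by blast

lemma alm_infinite: "L \<in> LL ==> infinite L ==> alm L C ==> infinite C"
 using alm_finite[OF LLD(3)] by blast

lemma atom_alm_comm_eq:
 assumes "L \<in> LL" "infinite L" "atom V" "alm L V" shows "comm_eq L V"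
proof -
 have "infinite (V \<inter> L)" using alm_infinite_Int[OF assms(1,2) atomD(1)[OF assms(3)] assms(4)] by (simp add: Int_commute)
 hence "alm V L" using atom_dichotomy[OF assms(3,1)] by blast
 thus ?thesis using assms(4) by (simp add: comm_eq_def)
qed

lemma atom_comm_eq:
 assumes V: "atom V" and L: "L \<in> LL" "comm_eq V L" shows "atom L"
 unfolding atom_def
proof (intro conjI ballI impI)
 note VL = atomD(1)[OF V]
 show "L \<in> LL" by fact
 show "infinite L" using alm_infinite[OF VL atomD(2)[OF V]] L(2) by (simp add: comm_eq_def)
 fix C assume C: "C \<in> LL" "C <= L"
 have "alm C V" using alm_mono[OF LLD(2)[OF L(1)] LLD(2)[OF C(1)] LLD(2)[OF VL] C(2) _ subset_refl] L(2) by (simp add: comm_eq_def)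
 show "finite C \<or> alm L C"
 proof (cases "finite C")
  case False
  hence "infinite (V \<inter> C)" using alm_infinite_Int[OF C(1) False VL \<open>alm C V\<close>] by (simp add: Int_commute)
  hence "alm V C" using atom_dichotomy[OF V C(1)] by blast
  moreover have "alm L V" using L(2) by (simp add: comm_eq_def)
  ultimately show ?thesis using alm_trans[OF LLD(2)[OF L(1)] LLD(2)[OF VL] LLD(2)[OF C(1)]] by blast
 qed simp
qed

lemma atom_subset: "atom V ==> Y \<in> LL ==> Y <= V ==> infinite Y ==> atom Y & comm_eq V Y"
 using atom_comm_eq atom_alm_comm_eq alm_subset[OF LLD(2)] comm_eq_sym by blast

definition patom :: "'a set => bool" where
 "patom V \<longleftrightarrow> atom V & (EX p::nat. prime p & (ALL x:V. x [^] p = \<one>))"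

text \<open>The \<open>p\<close>-th power maps the \<open>p * m\<close>-torsion into the
  \<open>m\<close>-torsion, with fibres contained in cosets of the \<open>p\<close>-torsion.\<close>

lemma tors_mult_infinite:
 assumes V: "V \<in> LL" and inf: "infinite (tors (p * m) V)"
 shows "infinite (tors p V) \<or> infinite (tors m V)"
proof (rule ccontr)
 assume "\<not> ?thesis"
 hence fin: "finite (tors p V)" "finite (tors m V)" by auto
 note Vc = LLD(3)[OF V]
 define r where "r y = (SOME x. x \<in> tors (p * m) V & x [^] p = y)" for y
 have "tors (p * m) V <= (%(y, z). r y \<otimes> z) ` (tors m V \<times> tors p V)"
 proof
  fix x assume x: "x \<in> tors (p * m) V"
  hence xc: "x \<in> carrier H" "x \<in> V" using Vc by (auto simp: tors_def)
  have y: "x [^] p \<in> tors m V"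
  proof -
   have "x [^] p \<in> V" using xc(2) by (induction p) (auto intro: subgroup.m_closed[OF LLD(2)[OF V]] subgroup.one_closed[OF LLD(2)[OF V]])
   thus ?thesis using x xc by (simp add: tors_def nat_pow_pow)
  qed
  have r: "r (x [^] p) \<in> tors (p * m) V & r (x [^] p) [^] p = x [^] p"
   unfolding r_def by (rule someI[of _ x]) (use x in simp)
  hence rc: "r (x [^] p) \<in> carrier H" "r (x [^] p) \<in> V" using Vc by (auto simp: tors_def)
  define z where "z = inv (r (x [^] p)) \<otimes> x"
  have "z [^] p = inv (r (x [^] p) [^] p) \<otimes> x [^] p" using rc xc by (simp add: z_def nat_pow_distrib nat_pow_inv)
  also have "\<dots> = \<one>" using r xc by simp
  finally have "z \<in> tors p V" unfolding tors_def z_def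
   using rc xc by (auto intro!: subgroup.m_closed[OF LLD(2)[OF V]] subgroup.m_inv_closed[OF LLD(2)[OF V]])
  moreover have "x = r (x [^] p) \<otimes> z" unfolding z_def using rc xc by (simp add: m_assoc[symmetric])
  ultimately show "x \<in> (%(y, z). r y \<otimes> z) ` (tors m V \<times> tors p V)"
   using y by (intro rev_image_eqI[of "(x [^] p, z)"]) auto
 qed
 hence "finite (tors (p * m) V)" by (rule finite_subset) (use fin in simp)
 thus False using inf by blast
qed

lemma prime_torsion:
 assumes V: "V \<in> LL" and "n > 0" "infinite (tors n V)"
 shows "EX p. prime p & infinite (tors p V)"
 using assms(2,3)
proof (induction n rule: less_induct)
 case (less n)
 show ?case
 proof (cases "n = 1")
  case True
  have "tors n V <= {\<one>}" using LLD(3)[OF V] True by (auto simp: tors_def)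
  hence "finite (tors n V)" by (rule finite_subset) simp
  thus ?thesis using less by blast
 next
  case False
  then obtain p where p: "prime p" "p dvd n" using prime_factor_nat by blast
  then obtain m where m: "n = p * m" by blast
  hence "m > 0" "m < n" using less.prems p by (auto simp: prime_gt_Suc_0_nat)
  thus ?thesis using tors_mult_infinite[OF V less.prems(2)[unfolded m]] p(1) less.IH[of m] by blast
 qed
qed

text \<open>The subgroups of elements of bounded order cover \<open>V\<close>, so by Baire one of
  them is infinite; then the \<open>p\<close>-torsion is infinite for some prime \<open>p\<close>,
  and an infinite subgroup of an atom in \<open>LL\<close> is commensurable with the atom.\<close>

lemma atom_patom: assumes V: "atom V" shows "EX V'. patom V' & V' <= V & comm_eq V V'"
proof -
 note VL = atomD(1)[OF V]
 \<comment> \<open>The exponent 0 is excluded because \<open>tors 0 V\<close> is all of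
   \<open>V\<close>.\<close>
 have "V <= (\<Union>n. tors (Suc n) V)"
 proof
  fix h assume h: "h \<in> V"
  then obtain n :: nat where "n > 0" "h [^] n = \<one>" using torsion LLD(3)[OF VL] by blast
  hence "h \<in> tors (Suc (n - 1)) V" using h by (simp add: tors_def)
  thus "h \<in> (\<Union>n. tors (Suc n) V)" by blast
 qed
 then obtain n where "alm V (tors (Suc n) V)"
  using alm_of_countable_union[OF LLD(1)[OF VL] csub_tors[OF LLD(1)[OF VL]]] by blast
 hence "infinite (tors (Suc n) V)" using alm_infinite[OF VL atomD(2)[OF V]] by blast
 then obtain p where p: "prime p" "infinite (tors p V)" using prime_torsion[OF VL, of "Suc n"] by blast
 have "tors p V <= V" by (auto simp: tors_def)
 hence "atom (tors p V) & comm_eq V (tors p V)" using atom_subset[OF V LL_tors[OF VL] _ p(2)] by blast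
 moreover have "ALL x:tors p V. x [^] p = \<one>" by (simp add: tors_def)
 ultimately show ?thesis using p(1) \<open>tors p V <= V\<close> unfolding patom_def by blast
qed

lemma patom_finite_index:
 assumes V: "patom V" and Y: "csub Y" "Y <= V" "alm V Y" shows "patom Y & comm_eq V Y"
proof -
 have VL: "V \<in> LL" "atom V" "infinite V" using V atomD by (auto simp: patom_def)
 have "Y \<in> LL" by (rule LL_finite_index[OF VL(1) Y])
 moreover have "infinite Y" by (rule alm_infinite[OF VL(1,3) Y(3)])
 ultimately have "atom Y & comm_eq V Y" using atom_subset[OF VL(2) _ Y(2)] by blast
 thus ?thesis using V Y(2) unfolding patom_def by blast
qed

lemma patom_avoid:
 assumes V: "patom V" and E: "finite E" shows "EX Y. patom Y & Y <= V & comm_eq V Y & Y \<inter> E <= {\<one>}"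
proof -
 obtain p :: nat where p: "prime p" "!!x. x \<in> V ==> x [^] p = \<one>" using V unfolding patom_def by blast
 have "V \<in> LL" using V atomD by (auto simp: patom_def)
 then obtain Y where Y: "csub Y" "Y <= V" "alm V Y" "Y \<inter> E <= {\<one>}" using avoid_finite[OF LLD(1) p E] by blast
 thus ?thesis using patom_finite_index[OF V Y(1-3)] by blast
qed

end

text \<open>The group \<open>D\<close> contains the projection of \<open>N\<close> to
  \<open>W2\<close> along \<open>W1\<close>. If it were finite, \<open>N\<close> would be almost
  contained in \<open>W1\<close>, against the finiteness of \<open>N \<inter> W1\<close>.\<close>

lemma (in inv_setting) alm_set_mult_of_graph:
 assumes W: "W1 \<in> LL" "atom W2" and N: "N \<in> LL" "infinite N" "N <= W1 <#> W2" "finite (N \<inter> W1)"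
 shows "alm W2 (N <#> W1)"
proof (rule ccontr)
 assume neg: "\<not> alm W2 (N <#> W1)"
 note W2 = atomD(1)[OF W(2)]
 define D where "D = W2 \<inter> (N <#> W1)"
 have DL: "D \<in> LL" unfolding D_def by (intro LL_Int LL_set_mult W2 W N)
 have "finite D" using atom_dichotomy[OF W(2) LL_set_mult[OF N(1) W(1)]] neg unfolding D_def by blast
 hence "alm D W1" by (rule finite_alm[OF LLD(2)[OF DL] LLD(2)[OF W(1)]])
 hence 1: "alm (W1 <#> D) W1"
  by (rule alm_set_mult_least[OF LLD(2)[OF W(1)] LLD(2)[OF DL] LLD(2)[OF W(1)] alm_subset[OF LLD(2)[OF W(1)] subset_refl]])
 have "N <= W1 <#> D"
 proof
  fix n assume n: "n \<in> N"
  hence "n \<in> W1 <#> W2" using N(3) by blast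
  then obtain u v where uv: "u \<in> W1" "v \<in> W2" "n = u \<otimes> v" unfolding set_mult_iff by blast
  have c: "u \<in> carrier H" "v \<in> carrier H" "n \<in> carrier H" using uv n LLD(3) W W2 N by blast+
  have "n \<otimes> inv u = (u \<otimes> inv u) \<otimes> v" unfolding uv(3) using c by (simp add: m_ac del: r_inv Units_r_inv)
  hence "v = n \<otimes> inv u" using c by simp
  hence "v \<in> N <#> W1" using set_mult_I[OF n subgroup.m_inv_closed[OF LLD(2)[OF W(1)] uv(1)]] by simp
  hence "v \<in> D" unfolding D_def using uv(2) by blast
  thus "n \<in> W1 <#> D" using set_mult_I[OF uv(1)] uv(3) by simp
 qed
 hence "alm N W1"
  using alm_mono[OF LLD(2)[OF LL_set_mult[OF W(1) DL]] LLD(2)[OF N(1)] LLD(2)[OF W(1)] _ 1 subset_refl] by blast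
 thus False using alm_infinite_Int[OF N(1,2) W(1)] N(4) by blast
qed

section \<open>Atoms inside the sum of two atoms, as graphs\<close>

locale pair_setting = inv_setting H T act SS for H :: "'a monoid" (structure) and T and act :: "'g => 'a => 'a" and SS +
 fixes V1 V2 :: "'a set"
 assumes V1: "patom V1" and V2: "patom V2" and V12: "V1 \<inter> V2 <= {\<one>}"
begin

lemma aV: "atom V1" "atom V2" "V1 \<in> LL" "V2 \<in> LL" "subgroup V1 H" "subgroup V2 H" "V1 <= carrier H" "V2 <= carrier H"
 using V1 V2 atomD LLD unfolding patom_def by blast+

text \<open>Trivial intersection with \<open>V2\<close> makes the relation between the components a
  partial function on \<open>V1\<close>; trivial intersection with \<open>V1\<close> makes it
  injective.\<close>

definition graph :: "'a set => bool" where
 "graph M \<longleftrightarrow> atom M & M <= V1 <#> V2 & M \<inter> V1 <= {\<one>} & M \<inter> V2 <= {\<one>}"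

lemma graphD: "graph M ==> atom M" "graph M ==> M \<in> LL" "graph M ==> subgroup M H" "graph M ==> M <= carrier H" "graph M ==> infinite M"
 using atomD LLD unfolding graph_def by blast+

text \<open>A graph \<open>M\<close> is the graph of a partial isomorphism from \<open>V1\<close> to \<open>V2\<close> (up to sign in \<open>V2\<close>);
  \<open>rel M N\<close> is the graph of the composition of the first with the inverse of the second one.\<close>

definition rel :: "'a set => 'a set => 'a => 'a => bool" where
 "rel M N x a \<longleftrightarrow> x \<in> V1 & a \<in> V1 & (EX y:V2. x \<otimes> inv y \<in> M & a \<otimes> inv y \<in> N)"

lemma rel_sym: "rel M N x a ==> rel N M a x"
 unfolding rel_def by blast

lemma quot_left:
 assumes "subgroup M H" "x \<in> carrier H" "y \<in> carrier H" "y' \<in> carrier H" "x \<otimes> inv y \<in> M" "x \<otimes> inv y' \<in> M"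
 shows "y \<otimes> inv y' \<in> M"
proof -
 have "inv (x \<otimes> inv y) \<otimes> (x \<otimes> inv y') \<in> M" by (intro subgroup.m_closed subgroup.m_inv_closed assms)
 moreover have "inv (x \<otimes> inv y) \<otimes> (x \<otimes> inv y') = (x \<otimes> inv x) \<otimes> (y \<otimes> inv y')"
  using assms(2-4) by (simp add: inv_mult m_ac del: r_inv Units_r_inv)
 ultimately show ?thesis using assms(2-4) by simp
qed

lemma quot_right:
 assumes "subgroup M H" "y \<in> carrier H" "a \<in> carrier H" "a' \<in> carrier H" "a \<otimes> inv y \<in> M" "a' \<otimes> inv y \<in> M"
 shows "a \<otimes> inv a' \<in> M"
proof -
 have "(a \<otimes> inv y) \<otimes> inv (a' \<otimes> inv y) \<in> M" by (intro subgroup.m_closed subgroup.m_inv_closed assms)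
 moreover have "(a \<otimes> inv y) \<otimes> inv (a' \<otimes> inv y) = (y \<otimes> inv y) \<otimes> (a \<otimes> inv a')"
  using assms(2-4) by (simp add: inv_mult m_ac del: r_inv Units_r_inv)
 ultimately show ?thesis using assms(2-4) by simp
qed

lemma eq_of_quot: "a \<in> carrier H ==> b \<in> carrier H ==> a \<otimes> inv b = \<one> ==> a = b"
 using inv_solve_right'[of \<one> a b] by simp

lemma quot_in: "subgroup V H ==> a \<in> V ==> b \<in> V ==> a \<otimes> inv b \<in> V"
 by (intro subgroup.m_closed subgroup.m_inv_closed)

lemma eq_in_V1:
 assumes "graph M" "a \<in> V1" "b \<in> V1" "a \<otimes> inv b \<in> M" shows "a = b"
proof -
 have "a \<otimes> inv b \<in> M \<inter> V1" using quot_in[OF aV(5) assms(2,3)] assms(4) by blast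
 hence "a \<otimes> inv b = \<one>" using assms(1) unfolding graph_def by blast
 thus ?thesis using eq_of_quot assms aV(7) by blast
qed

lemma eq_in_V2:
 assumes "graph M" "a \<in> V2" "b \<in> V2" "a \<otimes> inv b \<in> M" shows "a = b"
proof -
 have "a \<otimes> inv b \<in> M \<inter> V2" using quot_in[OF aV(6) assms(2,3)] assms(4) by blast
 hence "a \<otimes> inv b = \<one>" using assms(1) unfolding graph_def by blast
 thus ?thesis using eq_of_quot assms aV(8) by blast
qed

lemma carV: "x \<in> V1 ==> x \<in> carrier H" "y \<in> V2 ==> y \<in> carrier H"
 using aV by blast+

lemma rel_fun:
 assumes M: "graph M" "graph N" and r: "rel M N x a" "rel M N x a'" shows "a = a'"
proof -
 obtain y where y: "y \<in> V2" "x \<otimes> inv y \<in> M" "a \<otimes> inv y \<in> N" using r(1) unfolding rel_def by blast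
 obtain y' where y': "y' \<in> V2" "x \<otimes> inv y' \<in> M" "a' \<otimes> inv y' \<in> N" using r(2) unfolding rel_def by blast
 have xa: "x \<in> V1" "a \<in> V1" "a' \<in> V1" using r unfolding rel_def by blast+
 have "y \<otimes> inv y' \<in> M" by (rule quot_left[OF graphD(3)[OF M(1)] carV(1)[OF xa(1)] carV(2)[OF y(1)] carV(2)[OF y'(1)] y(2) y'(2)])
 hence "y = y'" by (rule eq_in_V2[OF M(1) y(1) y'(1)])
 hence "a \<otimes> inv a' \<in> N" using quot_right[OF graphD(3)[OF M(2)] carV(2)[OF y(1)] carV(1)[OF xa(2)] carV(1)[OF xa(3)] y(3)] y'(3) by simp
 thus ?thesis by (rule eq_in_V1[OF M(2) xa(2,3)])
qed

lemma rel_mult: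
 assumes M: "subgroup M H" "subgroup N H" and r: "rel M N x a" "rel M N x' a'" shows "rel M N (x \<otimes> x') (a \<otimes> a')"
proof -
 obtain y where y: "y \<in> V2" "x \<otimes> inv y \<in> M" "a \<otimes> inv y \<in> N" using r(1) unfolding rel_def by blast
 obtain y' where y': "y' \<in> V2" "x' \<otimes> inv y' \<in> M" "a' \<otimes> inv y' \<in> N" using r(2) unfolding rel_def by blast
 have xa: "x \<in> V1" "a \<in> V1" "x' \<in> V1" "a' \<in> V1" using r unfolding rel_def by blast+
 have eq: "(u \<otimes> u') \<otimes> inv (y \<otimes> y') = (u \<otimes> inv y) \<otimes> (u' \<otimes> inv y')" if "u \<in> V1" "u' \<in> V1" for u u'
  using carV(1)[OF that(1)] carV(1)[OF that(2)] carV(2)[OF y(1)] carV(2)[OF y'(1)] by (simp add: inv_mult m_ac)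
 have 1: "(x \<otimes> x') \<otimes> inv (y \<otimes> y') \<in> M" unfolding eq[OF xa(1,3)] by (rule subgroup.m_closed[OF M(1) y(2) y'(2)])
 have 2: "(a \<otimes> a') \<otimes> inv (y \<otimes> y') \<in> N" unfolding eq[OF xa(2,4)] by (rule subgroup.m_closed[OF M(2) y(3) y'(3)])
 show ?thesis unfolding rel_def
  by (intro conjI bexI[of _ "y \<otimes> y'"] 1 2 subgroup.m_closed[OF aV(5)] subgroup.m_closed[OF aV(6)] xa y(1) y'(1))
qed

lemma rel_act:
 assumes P: "P \<in> SS" "g \<in> P" "invar P V1" "invar P V2" "invar P M" "invar P N" and r: "rel M N x a"
 shows "rel M N (act g x) (act g a)"
proof -
 obtain y where y: "y \<in> V2" "x \<otimes> inv y \<in> M" "a \<otimes> inv y \<in> N" using r unfolding rel_def by blast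
 have xa: "x \<in> V1" "a \<in> V1" using r unfolding rel_def by blast+
 have eq: "act g (u \<otimes> inv y) = act g u \<otimes> inv (act g y)" if "u \<in> V1" for u
  using act_mult[OF P(1,2) carV(1)[OF that] inv_closed[OF carV(2)[OF y(1)]]] act_m_inv[OF P(1,2) carV(2)[OF y(1)]] by simp
 have "act g x \<otimes> inv (act g y) \<in> M" "act g a \<otimes> inv (act g y) \<in> N"
  using invarD[OF P(5,2) y(2)] invarD[OF P(6,2) y(3)] eq xa by simp_all
 thus ?thesis unfolding rel_def using invarD[OF P(3,2)] invarD[OF P(4,2)] xa y(1) by blast
qed

text \<open>The preimage of \<open>A\<close> under the partial map \<open>rel M N\<close>, by
  \<open>tr_iff\<close>. Writing it with sums and intersections gives membership in
  \<open>LL\<close> and invariance at once.\<close>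

definition tr :: "'a set => 'a set => 'a set => 'a set" where
 "tr M N A = V1 \<inter> (M <#> (V2 \<inter> (N <#> A)))"

lemma tr_iff:
 assumes M: "subgroup M H" "subgroup N H" and A: "A <= V1"
 shows "x \<in> tr M N A \<longleftrightarrow> (EX a:A. rel M N x a)"
proof
 assume "x \<in> tr M N A"
 hence x: "x \<in> V1" "x \<in> M <#> (V2 \<inter> (N <#> A))" unfolding tr_def by blast+
 from x(2) obtain m y where m: "m \<in> M" "y \<in> V2 \<inter> (N <#> A)" "x = m \<otimes> y" unfolding set_mult_iff by blast
 have y2: "y \<in> V2" "y \<in> N <#> A" using m(2) by blast+
 from y2(2) obtain n a where n: "n \<in> N" "a \<in> A" "y = n \<otimes> a" unfolding set_mult_iff by blast
 note n = n y2(1)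
 have c: "m \<in> carrier H" "n \<in> carrier H" "y \<in> carrier H" "a \<in> carrier H" "a \<in> V1"
  using subgroup.mem_carrier[OF M(1) m(1)] subgroup.mem_carrier[OF M(2) n(1)] carV n A by blast+
 have 1: "x \<otimes> inv y = m" unfolding m(3) using c by (simp add: m_assoc)
 have "a \<otimes> inv y = (a \<otimes> inv a) \<otimes> inv n" unfolding n(3) using c by (simp add: inv_mult m_ac del: r_inv Units_r_inv)
 hence "a \<otimes> inv y = inv n" using c by simp
 hence 2: "a \<otimes> inv y \<in> N" using subgroup.m_inv_closed[OF M(2) n(1)] by simp
 show "EX a:A. rel M N x a" unfolding rel_def using x(1) c(5) n m(1) 1 2 by blast
next
 assume "EX a:A. rel M N x a"
 then obtain a y where a: "a \<in> A" "x \<in> V1" "a \<in> V1" "y \<in> V2" "x \<otimes> inv y \<in> M" "a \<otimes> inv y \<in> N" unfolding rel_def by blast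
 note c = carV(1)[OF a(2)] carV(1)[OF a(3)] carV(2)[OF a(4)]
 have "inv (a \<otimes> inv y) \<otimes> a = (a \<otimes> inv a) \<otimes> y" using c by (simp add: inv_mult m_ac del: r_inv l_inv Units_r_inv Units_l_inv)
 hence "y = inv (a \<otimes> inv y) \<otimes> a" using c by simp
 hence "y \<in> N <#> A" using set_mult_I[OF subgroup.m_inv_closed[OF M(2) a(6)] a(1)] by simp
 hence y: "y \<in> V2 \<inter> (N <#> A)" using a(4) by blast
 have "x = (x \<otimes> inv y) \<otimes> y" using c by (simp add: m_assoc)
 hence "x \<in> M <#> (V2 \<inter> (N <#> A))" using set_mult_I[OF a(5) y] by simp
 thus "x \<in> tr M N A" unfolding tr_def using a(2) by blast
qed

lemma tr_LL: "graph M ==> graph N ==> A \<in> LL ==> tr M N A \<in> LL"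
 unfolding tr_def
 by (rule LL_Int[OF aV(3) LL_set_mult[OF graphD(2) LL_Int[OF aV(4) LL_set_mult[OF graphD(2)]]]])

lemma tr_sub: "tr M N A <= V1"
 unfolding tr_def by blast

lemma tr_mono: "A <= B ==> tr M N A <= tr M N B"
 unfolding tr_def by (intro Int_mono mono_set_mult subset_refl)

lemma tr_invar:
 assumes "P \<in> SS" "invar P V1" "invar P V2" "invar P M" "invar P N" "invar P A" "M <= carrier H" "N <= carrier H" "A <= carrier H"
 shows "invar P (tr M N A)"
proof -
 have "invar P (N <#> A)" by (rule invar_set_mult[OF assms(1,5,6,8,9)])
 hence "invar P (V2 \<inter> (N <#> A))" by (rule invar_Int[OF assms(3)])
 moreover have "V2 \<inter> (N <#> A) <= carrier H" using aV(8) by blast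
 ultimately have "invar P (M <#> (V2 \<inter> (N <#> A)))" using invar_set_mult[OF assms(1,4) _ assms(7)] by blast
 thus ?thesis unfolding tr_def by (rule invar_Int[OF assms(2)])
qed

lemma V2_alm: assumes N: "graph N" shows "alm V2 (N <#> V1)"
proof -
 have "finite (N \<inter> V1)" by (rule finite_subset[of _ "{\<one>}"]) (use N in \<open>auto simp: graph_def\<close>)
 moreover have "N <= V1 <#> V2" using N unfolding graph_def by blast
 ultimately show ?thesis by (intro alm_set_mult_of_graph[OF aV(3,2) graphD(2,5)[OF N]])
qed

lemma V1_alm: assumes N: "graph N" shows "alm V1 (N <#> V2)"
proof -
 have "finite (N \<inter> V2)" by (rule finite_subset[of _ "{\<one>}"]) (use N in \<open>auto simp: graph_def\<close>)
 moreover have "N <= V2 <#> V1" using N set_mult_commute_subgroups[OF aV(7,8)] unfolding graph_def by blast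
 ultimately show ?thesis by (intro alm_set_mult_of_graph[OF aV(4,1) graphD(2,5)[OF N]])
qed

text \<open>The projections of a graph have finite index in \<open>V1\<close> and in
  \<open>V2\<close>, so pulling back along each of the two graphs preserves finite index.\<close>

lemma tr_alm:
 assumes M: "graph M" and N: "graph N" and A: "A \<in> LL" "alm V1 A"
 shows "alm V1 (tr M N A)"
proof -
 define B where "B = V2 \<inter> (N <#> A)"
 have BL: "B \<in> LL" unfolding B_def by (intro LL_Int LL_set_mult aV graphD N A)
 have NA: "N <#> A \<in> LL" "N <#> V1 \<in> LL" by (intro LL_set_mult aV graphD N A)+
 have MB: "M <#> B \<in> LL" "M <#> V2 \<in> LL" by (intro LL_set_mult aV graphD M BL)+
 have "alm (V1 <#> N) (A <#> N)" by (rule alm_set_mult_mono[OF aV(5) LLD(2)[OF A(1)] graphD(3)[OF N] A(2)])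
 hence "alm (N <#> V1) (N <#> A)"
  using set_mult_commute_subgroups[OF aV(7) graphD(4)[OF N]] set_mult_commute_subgroups[OF LLD(3)[OF A(1)] graphD(4)[OF N]] by simp
 hence "alm V2 (N <#> A)" using alm_trans[OF aV(6) LLD(2)[OF NA(2)] LLD(2)[OF NA(1)] V2_alm[OF N]] by blast
 hence "alm V2 B" unfolding B_def by (rule alm_Int[OF aV(6)])
 hence "alm (V2 <#> M) (B <#> M)" by (rule alm_set_mult_mono[OF aV(6) LLD(2)[OF BL] graphD(3)[OF M]])
 hence "alm (M <#> V2) (M <#> B)"
  using set_mult_commute_subgroups[OF aV(8) graphD(4)[OF M]] set_mult_commute_subgroups[OF LLD(3)[OF BL] graphD(4)[OF M]] by simp
 hence "alm V1 (M <#> B)" using alm_trans[OF aV(5) LLD(2)[OF MB(2)] LLD(2)[OF MB(1)] V1_alm[OF M]] by blast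
 thus ?thesis unfolding tr_def B_def[symmetric] by (rule alm_Int[OF aV(5)])
qed

text \<open>The partial map \<open>rel M N\<close> of \<open>V1\<close> to itself is defined on a
  subgroup of finite index. Either the points with infinitely many iterates form a subgroup of
  finite index, mapped into itself, or they are finite in number; then orbits leave a suitable
  \<open>Y0\<close>, and it is the inverse map that stabilizes a subgroup.\<close>

lemma stable_subgroup:
 assumes M: "graph M" and N: "graph N"
 shows "EX Y. csub Y & Y <= V1 & alm V1 Y & (Y <= tr M N Y \<or> Y <= tr N M Y)"
proof -
 \<comment> \<open>\<open>W n\<close> is the domain of the \<open>n\<close>-th iterate of
   \<open>rel M N\<close>.\<close>
 define W where "W n = (tr M N ^^ n) V1" for n :: nat
 have W0: "W 0 = V1" and WS: "W (Suc n) = tr M N (W n)" for n by (simp_all add: W_def)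
 have WL: "W n \<in> LL" for n by (induction n) (simp_all add: W0 WS aV tr_LL M N)
 have dec: "W (Suc n) <= W n" for n
 proof (induction n)
  case 0 thus ?case by (simp add: W0 WS tr_sub)
 next
  case (Suc n)
  hence "tr M N (W (Suc n)) <= tr M N (W n)" by (rule tr_mono)
  thus ?case by (simp add: WS)
 qed
 have WV: "W n <= V1" for n by (cases n) (simp_all add: W0 WS tr_sub)
 obtain P where P: "P \<in> SS" "invar P V1" "invar P V2" "invar P M" "invar P N"
  using common_P[of "{V1, V2, M, N}"] aV graphD(2)[OF M] graphD(2)[OF N] by auto
 have WP: "invar P (W n)" for n
  by (induction n) (simp_all add: W0 WS P tr_invar graphD(4)[OF M] graphD(4)[OF N] LLD(3)[OF WL])
 define I where "I = (\<Inter>n. W n)"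
 have IL: "I \<in> LL"
 proof (rule LLI[OF _ P(1)])
  show "csub I" unfolding I_def by (rule csub_Inter) (use LLD(1)[OF WL] in auto)
  show "invar P I" unfolding I_def by (rule invarI) (use invarD[OF WP] in blast)
 qed
 have IV: "I <= V1" unfolding I_def using W0 by blast
 show ?thesis
 proof (cases "finite I")
  case False
  hence "alm V1 I" using aV(1) IL IV unfolding atom_def by blast
  moreover have "I <= tr M N I"
  proof
   fix x assume x: "x \<in> I"
   have ex: "EX a:W n. rel M N x a" for n
    using x tr_iff[OF graphD(3)[OF M] graphD(3)[OF N] WV, of x n] WS[of n] unfolding I_def by blast
   then obtain a where a: "rel M N x a" by blast
   have "a \<in> W n" for n using ex[of n] rel_fun[OF M N a] by blast
   hence "a \<in> I" unfolding I_def by blast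
   thus "x \<in> tr M N I" using tr_iff[OF graphD(3)[OF M] graphD(3)[OF N] IV] a by blast
  qed
  ultimately show ?thesis using LLD(1)[OF IL] IV by blast
 next
  case True
  then obtain Y0 where Y0: "patom Y0" "Y0 <= V1" "comm_eq V1 Y0" "Y0 \<inter> I <= {\<one>}" using patom_avoid[OF V1] by blast
  have Y0L: "Y0 \<in> LL" using Y0(1) atomD unfolding patom_def by blast
  have Y0a: "alm V1 Y0" using Y0(3) unfolding comm_eq_def by blast
  \<comment> \<open>The points of \<open>Y0\<close> whose first \<open>n\<close> images exist and
    stay in \<open>Y0\<close>. Common points of all these sets lie in \<open>Y0 \<inter> I\<close>,
    which is trivial.\<close>
  define W' where "W' n = ((%A. Y0 \<inter> tr M N A) ^^ n) Y0" for n :: nat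
  have W'0: "W' 0 = Y0" and W'S: "W' (Suc n) = Y0 \<inter> tr M N (W' n)" for n by (simp_all add: W'_def)
  have W'L: "W' n \<in> LL" for n by (induction n) (simp_all add: W'0 W'S Y0L tr_LL M N LL_Int)
  have W'Y: "W' n <= Y0" for n by (cases n) (simp_all add: W'0 W'S)
  have dec': "W' (Suc n) <= W' n" for n
  proof (induction n)
   case 0 thus ?case by (simp add: W'0 W'S)
  next
   case (Suc n)
   hence "tr M N (W' (Suc n)) <= tr M N (W' n)" by (rule tr_mono)
   thus ?case unfolding W'S[of "Suc n"] W'S[of n] using W'S[of n] by auto
  qed
  have W'W: "W' n <= W n" for n
  proof (induction n)
   case 0 thus ?case using Y0(2) by (simp add: W0 W'0)
  next
   case (Suc n)
   thus ?case using tr_mono[OF Suc, of M N] by (simp add: W'S WS le_infI2)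
  qed
  have W'a: "alm V1 (W' n)" for n
  proof (induction n)
   case 0 thus ?case by (simp add: W'0 Y0a)
  next
   case (Suc n)
   thus ?case unfolding W'S using LLD(2)[OF Y0L] LLD(2)[OF tr_LL[OF M N W'L]] tr_alm[OF M N W'L Suc] Y0a
    by (intro alm_Int_both aV(5))
  qed
  \<comment> \<open>The points that have a preimage in \<open>Y0\<close>. They form a subgroup of
    finite index, so compactness puts some \<open>W' n\<close> inside it.\<close>
  define Z where "Z = tr N M Y0"
  have ZL: "Z \<in> LL" unfolding Z_def by (rule tr_LL[OF N M Y0L])
  have "(\<Inter>n. W' n) <= Y0 \<inter> I" unfolding I_def using W'W W'Y by blast
  hence "(\<Inter>n. W' n) <= Z" using Y0(4) subgroup.one_closed[OF LLD(2)[OF ZL]] by blast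
  moreover have "W' 0 <= V1" using W'0 Y0(2) by simp
  ultimately obtain n where n: "W' n <= Z"
   using csub_nest[where W = W' and V = V1 and Z = Z, OF LLD(1)[OF W'L] dec' _ LLD(1)[OF aV(3)] LLD(1)[OF ZL] tr_alm[OF N M Y0L Y0a, folded Z_def]] by blast
  have W'V: "W' k <= V1" for k using W'Y Y0(2) by blast
  \<comment> \<open>For \<open>y\<close> in \<open>W' n\<close>, the preimage \<open>x\<close> in
    \<open>Y0\<close> has an orbit in \<open>Y0\<close> that is one step longer, so \<open>x\<close>
    lies in \<open>W' (Suc n)\<close> and hence in \<open>W' n\<close>.\<close>
  have "W' n <= tr N M (W' n)"
  proof
   fix y assume y: "y \<in> W' n"
   hence "y \<in> tr N M Y0" using n Z_def by blast
   then obtain x where x: "x \<in> Y0" "rel N M y x" using tr_iff[OF graphD(3)[OF N] graphD(3)[OF M] Y0(2)] by blast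
   hence "x \<in> tr M N (W' n)" using tr_iff[OF graphD(3)[OF M] graphD(3)[OF N] W'V] rel_sym y by blast
   hence "x \<in> W' n" using x(1) W'S[of n] dec'[of n] by blast
   thus "y \<in> tr N M (W' n)" using tr_iff[OF graphD(3)[OF N] graphD(3)[OF M] W'V] x(2) by blast
  qed
  thus ?thesis using LLD(1)[OF W'L] W'V W'a by blast
 qed
qed

text \<open>As \<open>N\<close> is a graph, \<open>a\<close> determines the second component
  \<open>y\<close>, so every pair in \<open>S\<close> gives an element \<open>x y^-1\<close> of both
  \<open>L\<close> and \<open>L'\<close>. Different pairs give different elements because
  \<open>V1 \<inter> V2\<close> is trivial; thus \<open>L \<inter> L'\<close> is infinite.\<close>

lemma comm_eq_of_agreement:
 assumes L: "graph L" "graph L'" and N: "graph N" and S: "infinite S" "!!x a. (x, a) \<in> S ==> rel L N x a & rel L' N x a"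
 shows "comm_eq L L'"
proof -
 have ex: "EX y. y \<in> V2 & fst s \<otimes> inv y \<in> L & fst s \<otimes> inv y \<in> L'" if s: "s \<in> S" for s :: "'a \<times> 'a"
 proof -
  obtain x a where xa: "s = (x, a)" by (cases s)
  hence r: "rel L N x a" "rel L' N x a" using S(2) s by auto
  obtain y where y: "y \<in> V2" "x \<otimes> inv y \<in> L" "a \<otimes> inv y \<in> N" using r(1) unfolding rel_def by blast
  obtain y' where y': "y' \<in> V2" "x \<otimes> inv y' \<in> L'" "a \<otimes> inv y' \<in> N" using r(2) unfolding rel_def by blast
  have aV1: "a \<in> V1" using r unfolding rel_def by blast
  have "y \<otimes> inv y' \<in> N" by (rule quot_left[OF graphD(3)[OF N] carV(1)[OF aV1] carV(2)[OF y(1)] carV(2)[OF y'(1)] y(3) y'(3)])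
  hence "y = y'" by (rule eq_in_V2[OF N y(1) y'(1)])
  thus ?thesis using y y' xa by auto
 qed
 define Y where "Y s = (SOME y. y \<in> V2 & fst s \<otimes> inv y \<in> L & fst s \<otimes> inv y \<in> L')" for s :: "'a \<times> 'a"
 have Y: "Y s \<in> V2 & fst s \<otimes> inv (Y s) \<in> L & fst s \<otimes> inv (Y s) \<in> L'" if "s \<in> S" for s
  unfolding Y_def by (rule someI_ex[OF ex[OF that]])
 have inj: "inj_on (%s. fst s \<otimes> inv (Y s)) S"
 proof (rule inj_onI)
  fix s t assume st: "s \<in> S" "t \<in> S" "fst s \<otimes> inv (Y s) = fst t \<otimes> inv (Y t)"
  obtain x a u b where xa: "s = (x, a)" "t = (u, b)" by (metis surj_pair)
  have r: "rel L N x a" "rel L N u b" using S(2) st xa by auto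
  hence V: "x \<in> V1" "u \<in> V1" unfolding rel_def by blast+
  note c = carV(1)[OF V(1)] carV(1)[OF V(2)]
  have d: "Y s \<in> V2" "Y t \<in> V2" using Y st by auto
  note e = carV(2)[OF d(1)] carV(2)[OF d(2)]
  have "x \<otimes> inv u = (x \<otimes> inv (Y s)) \<otimes> (Y s \<otimes> inv u)"
  proof -
   have "(x \<otimes> inv (Y s)) \<otimes> (Y s \<otimes> inv u) = (Y s \<otimes> inv (Y s)) \<otimes> (x \<otimes> inv u)"
    using c e by (simp add: m_ac del: r_inv l_inv Units_r_inv Units_l_inv)
   thus ?thesis using c e by simp
  qed
  also have "x \<otimes> inv (Y s) = u \<otimes> inv (Y t)" using st(3) xa by simp
  also have "(u \<otimes> inv (Y t)) \<otimes> (Y s \<otimes> inv u) = (u \<otimes> inv u) \<otimes> (Y s \<otimes> inv (Y t))"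
   using c e by (simp add: m_ac del: r_inv l_inv Units_r_inv Units_l_inv)
  finally have "x \<otimes> inv u = Y s \<otimes> inv (Y t)" using c e by simp
  hence "x \<otimes> inv u \<in> V1 \<inter> V2" using quot_in[OF aV(5) V] quot_in[OF aV(6) d] by auto
  hence "x \<otimes> inv u = \<one>" using V12 by blast
  hence "x = u" by (rule eq_of_quot[OF c])
  thus "s = t" using rel_fun[OF L(1) N] r xa by blast
 qed
 have "(%s. fst s \<otimes> inv (Y s)) ` S <= L \<inter> L'" using Y by blast
 hence inf: "infinite (L \<inter> L')" using S(1) finite_imageD[OF _ inj] finite_subset by blast
 hence "alm L L'" using atom_dichotomy[OF graphD(1)[OF L(1)] graphD(2)[OF L(2)]] by blast
 moreover have "alm L' L" using inf atom_dichotomy[OF graphD(1)[OF L(2)] graphD(2)[OF L(1)]] by (simp add: Int_commute)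
 ultimately show ?thesis by (simp add: comm_eq_def)
qed

end

section \<open>The ring of equivariant endomorphisms of an atom\<close>

text \<open>On \<open>A\<close> the map \<open>v\<close> factors through \<open>u\<close>.\<close>

lemma finite_image_factor:
 assumes "finite (u ` A)" "!!a b. a \<in> A ==> b \<in> A ==> u a = u b ==> v a = v b"
 shows "finite (v ` A)"
proof -
 have "v ` A <= (%t. v (SOME a. a \<in> A & u a = t)) ` (u ` A)"
 proof
  fix z assume "z \<in> v ` A"
  then obtain a where a: "a \<in> A" "z = v a" by blast
  define b where "b = (SOME b. b \<in> A & u b = u a)"
  have "b \<in> A & u b = u a" unfolding b_def by (rule someI[of _ a]) (use a in simp)
  hence "z = v b" using assms(2)[of a b] a by simp
  thus "z \<in> (%t. v (SOME a. a \<in> A & u a = t)) ` (u ` A)" using a(1) unfolding b_def by blast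
 qed
 thus ?thesis by (rule finite_subset) (use assms(1) in simp)
qed

definition (in monoid) endo_ring :: "'a set => ('a => 'a) set => ('a => 'a) ring" where
 "endo_ring Y E = \<lparr>carrier = E, mult = (%f g. compose Y f g), one = (\<lambda>x\<in>Y. x),
  zero = (\<lambda>x\<in>Y. \<one>), add = (%f g. \<lambda>x\<in>Y. f x \<otimes> g x)\<rparr>"

locale endo_setting = inv_setting H T act SS for H :: "'a monoid" (structure) and T and act :: "'g => 'a => 'a" and SS +
 fixes P and Y
 assumes P: "P \<in> SS" and Y: "atom Y" and inv_Y: "invar P Y"
  and residual: "y \<in> Y ==> y ~= \<one> ==> EX A. csub A & A <= Y & alm Y A & y \<notin> A"
begin

lemma YD: "Y \<in> LL" "csub Y" "subgroup Y H" "Y <= carrier H" "infinite Y"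
 using Y atomD LLD by blast+

lemma Ycar: "x \<in> Y ==> x \<in> carrier H" using YD(4) by blast

lemma Ym: "x \<in> Y ==> y \<in> Y ==> x \<otimes> y \<in> Y" by (rule subgroup.m_closed[OF YD(3)])
lemma Yi: "x \<in> Y ==> inv x \<in> Y" by (rule subgroup.m_inv_closed[OF YD(3)])
lemma Yo: "\<one> \<in> Y" by (rule subgroup.one_closed[OF YD(3)])
lemma Ya: "g \<in> P ==> x \<in> Y ==> act g x \<in> Y" by (rule invarD[OF inv_Y])

definition fi :: "'a set => bool" where "fi A \<longleftrightarrow> csub A & A <= Y & alm Y A"

lemma fi_Int: "fi A ==> fi B ==> fi (A \<inter> B)"
 unfolding fi_def using csub_Int alm_Int_both[OF YD(3)] csubD by blast

text \<open>Continuity at the identity for the topology of closed subgroups of finite index. The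
  maps obtained from graphs have it by \<open>tr_alm\<close>, and because of \<open>residual\<close>
  it is strong enough to make kernels closed.\<close>

definition cts :: "('a => 'a) => bool" where
 "cts f \<longleftrightarrow> (ALL A. fi A --> (EX B. fi B & f ` B <= A))"

definition endos :: "('a => 'a) set" where
 "endos = {f \<in> Y \<rightarrow>\<^sub>E Y. (ALL x:Y. ALL y:Y. f (x \<otimes> y) = f x \<otimes> f y) & cts f & (ALL g:P. ALL x:Y. f (act g x) = act g (f x))}"

lemma endoD:
 assumes "f \<in> endos"
 shows "x \<in> Y ==> f x \<in> Y" "x \<in> Y ==> y \<in> Y ==> f (x \<otimes> y) = f x \<otimes> f y" "cts f"
  "g \<in> P ==> x \<in> Y ==> f (act g x) = act g (f x)" "f \<in> extensional Y"
 using assms unfolding endos_def by (auto simp: PiE_def)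

lemma endoI:
 assumes "f \<in> extensional Y" "!!x. x \<in> Y ==> f x \<in> Y" "!!x y. x \<in> Y ==> y \<in> Y ==> f (x \<otimes> y) = f x \<otimes> f y" "cts f"
  "!!g x. g \<in> P ==> x \<in> Y ==> f (act g x) = act g (f x)"
 shows "f \<in> endos"
 using assms unfolding endos_def by (auto simp: PiE_def)

lemma endo_one: assumes "f \<in> endos" shows "f \<one> = \<one>"
proof -
 have "f (\<one> \<otimes> \<one>) = f \<one> \<otimes> f \<one>" by (rule endoD(2)[OF assms Yo Yo])
 hence "f \<one> \<otimes> f \<one> = f \<one>" by simp
 thus ?thesis using Ycar[OF endoD(1)[OF assms Yo]] by simp
qed

lemma endo_inv: assumes "f \<in> endos" "x \<in> Y" shows "f (inv x) = inv (f x)"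
proof -
 have "f x \<otimes> f (inv x) = \<one>" using endoD(2)[OF assms Yi[OF assms(2)]] endo_one[OF assms(1)] Ycar[OF assms(2)] by simp
 thus ?thesis using Ycar[OF endoD(1)[OF assms]] Ycar[OF endoD(1)[OF assms(1) Yi[OF assms(2)]]]
  by (intro comm_inv_char[symmetric])
qed

lemma cts_add: assumes "cts f" "cts g" shows "cts (\<lambda>x\<in>Y. f x \<otimes> g x)"
 unfolding cts_def
proof (intro allI impI)
 fix A assume A: "fi A"
 obtain B where B: "fi B" "f ` B <= A" using assms(1) A unfolding cts_def by blast
 obtain C where C: "fi C" "g ` C <= A" using assms(2) A unfolding cts_def by blast
 have "(\<lambda>x\<in>Y. f x \<otimes> g x) ` (B \<inter> C) <= A"
 proof clarify
  fix x assume x: "x \<in> B" "x \<in> C"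
  hence "x \<in> Y" using B(1) unfolding fi_def by blast
  moreover have "f x \<in> A" "g x \<in> A" using x B(2) C(2) by blast+
  hence "f x \<otimes> g x \<in> A" using A unfolding fi_def by (intro subgroup.m_closed[OF csubD(1)]) auto
  ultimately show "(\<lambda>x\<in>Y. f x \<otimes> g x) x \<in> A" by simp
 qed
 thus "EX B. fi B & (\<lambda>x\<in>Y. f x \<otimes> g x) ` B <= A" using fi_Int[OF B(1) C(1)] by blast
qed

lemma cts_neg: assumes "cts f" shows "cts (\<lambda>x\<in>Y. inv (f x))"
 unfolding cts_def
proof (intro allI impI)
 fix A assume A: "fi A"
 obtain B where B: "fi B" "f ` B <= A" using assms(1) A unfolding cts_def by blast
 have "(\<lambda>x\<in>Y. inv (f x)) ` B <= A"
 proof clarify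
  fix x assume x: "x \<in> B"
  hence "x \<in> Y" using B(1) unfolding fi_def by blast
  moreover have "f x \<in> A" using x B(2) by blast
  hence "inv (f x) \<in> A" using A unfolding fi_def by (intro subgroup.m_inv_closed[OF csubD(1)]) auto
  ultimately show "(\<lambda>x\<in>Y. inv (f x)) x \<in> A" by simp
 qed
 thus "EX B. fi B & (\<lambda>x\<in>Y. inv (f x)) ` B <= A" using B(1) by blast
qed

lemma cts_compose: assumes "cts f" "cts g" shows "cts (compose Y f g)"
 unfolding cts_def
proof (intro allI impI)
 fix A assume A: "fi A"
 obtain B where B: "fi B" "f ` B <= A" using assms(1) A unfolding cts_def by blast
 obtain C where C: "fi C" "g ` C <= B" using assms(2) B(1) unfolding cts_def by blast
 have "compose Y f g ` C <= A"
 proof clarify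
  fix x assume x: "x \<in> C"
  hence "x \<in> Y" using C(1) unfolding fi_def by blast
  thus "compose Y f g x \<in> A" using x B(2) C(2) by (auto simp: compose_def)
 qed
 thus "EX B. fi B & compose Y f g ` B <= A" using C(1) by blast
qed

lemma cts_id: "cts (\<lambda>x\<in>Y. x)"
 unfolding cts_def
proof (intro allI impI)
 fix A assume A: "fi A"
 hence "(\<lambda>x\<in>Y. x) ` A <= A" unfolding fi_def by auto
 thus "EX B. fi B & (\<lambda>x\<in>Y. x) ` B <= A" using A by blast
qed

lemma cts_zero: "cts (\<lambda>x\<in>Y. \<one>)"
 unfolding cts_def
proof (intro allI impI)
 fix A assume A: "fi A"
 hence "(\<lambda>x\<in>Y. \<one>) ` A <= A" using subgroup.one_closed csubD(1) unfolding fi_def by auto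
 thus "EX B. fi B & (\<lambda>x\<in>Y. \<one>) ` B <= A" using A by blast
qed

lemma endo_add: assumes f: "f \<in> endos" and g: "g \<in> endos" shows "(\<lambda>x\<in>Y. f x \<otimes> g x) \<in> endos"
proof (rule endoI)
 fix x y assume xy: "x \<in> Y" "y \<in> Y"
 show "(\<lambda>x\<in>Y. f x \<otimes> g x) (x \<otimes> y) = (\<lambda>x\<in>Y. f x \<otimes> g x) x \<otimes> (\<lambda>x\<in>Y. f x \<otimes> g x) y"
  using xy Ym[OF xy] endoD(2)[OF f xy] endoD(2)[OF g xy] Ycar[OF endoD(1)[OF f xy(1)]] Ycar[OF endoD(1)[OF f xy(2)]]
   Ycar[OF endoD(1)[OF g xy(1)]] Ycar[OF endoD(1)[OF g xy(2)]] by (simp add: m_ac)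
next
 fix h x assume h: "h \<in> P" "x \<in> Y"
 show "(\<lambda>x\<in>Y. f x \<otimes> g x) (act h x) = act h ((\<lambda>x\<in>Y. f x \<otimes> g x) x)"
  using h Ya[OF h] endoD(4)[OF f h] endoD(4)[OF g h] act_mult[OF P h(1) Ycar[OF endoD(1)[OF f h(2)]] Ycar[OF endoD(1)[OF g h(2)]]] by simp
qed (use cts_add[OF endoD(3)[OF f] endoD(3)[OF g]] Ym endoD(1)[OF f] endoD(1)[OF g] in auto)

lemma endo_neg: assumes f: "f \<in> endos" shows "(\<lambda>x\<in>Y. inv (f x)) \<in> endos"
proof (rule endoI)
 fix x y assume xy: "x \<in> Y" "y \<in> Y"
 show "(\<lambda>x\<in>Y. inv (f x)) (x \<otimes> y) = (\<lambda>x\<in>Y. inv (f x)) x \<otimes> (\<lambda>x\<in>Y. inv (f x)) y"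
  using xy Ym[OF xy] endoD(2)[OF f xy] Ycar[OF endoD(1)[OF f xy(1)]] Ycar[OF endoD(1)[OF f xy(2)]] by (simp add: inv_mult)
next
 fix h x assume h: "h \<in> P" "x \<in> Y"
 show "(\<lambda>x\<in>Y. inv (f x)) (act h x) = act h ((\<lambda>x\<in>Y. inv (f x)) x)"
  using h Ya[OF h] endoD(4)[OF f h] act_m_inv[OF P h(1) Ycar[OF endoD(1)[OF f h(2)]]] by simp
qed (use cts_neg[OF endoD(3)[OF f]] Yi endoD(1)[OF f] in auto)

lemma endo_compose: assumes f: "f \<in> endos" and g: "g \<in> endos" shows "compose Y f g \<in> endos"
proof (rule endoI)
 fix x y assume xy: "x \<in> Y" "y \<in> Y"
 show "compose Y f g (x \<otimes> y) = compose Y f g x \<otimes> compose Y f g y"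
  using xy Ym[OF xy] endoD(2)[OF g xy] endoD(2)[OF f endoD(1)[OF g xy(1)] endoD(1)[OF g xy(2)]] by (simp add: compose_def)
next
 fix h x assume h: "h \<in> P" "x \<in> Y"
 show "compose Y f g (act h x) = act h (compose Y f g x)"
  using h Ya[OF h] endoD(4)[OF g h] endoD(4)[OF f h(1) endoD(1)[OF g h(2)]] by (simp add: compose_def)
qed (use cts_compose[OF endoD(3)[OF f] endoD(3)[OF g]] endoD(1)[OF f] endoD(1)[OF g] in \<open>auto simp: compose_def\<close>)

lemma endo_id: "(\<lambda>x\<in>Y. x) \<in> endos"
 by (rule endoI) (use cts_id Ym Ya in auto)

lemma endo_zero: "(\<lambda>x\<in>Y. \<one>) \<in> endos"
 by (rule endoI) (use cts_zero Ym Ya Yo act_one[OF P] in auto)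

abbreviation "R \<equiv> endo_ring Y endos"

lemma R_simps: "carrier R = endos" "mult R = (%f g. compose Y f g)" "one R = (\<lambda>x\<in>Y. x)" "zero R = (\<lambda>x\<in>Y. \<one>)"
 "add R = (%f g. \<lambda>x\<in>Y. f x \<otimes> g x)"
 by (simp_all add: endo_ring_def)

lemma endo_eqI: "f \<in> extensional Y ==> g \<in> extensional Y ==> (!!x. x \<in> Y ==> f x = g x) ==> f = g"
 by (rule extensionalityI)

lemma ring_R: "ring R"
proof (rule ringI)
 show "abelian_group R"
 proof (rule abelian_groupI)
  fix f g assume fg: "f \<in> carrier R" "g \<in> carrier R"
  hence e: "f \<in> endos" "g \<in> endos" by (simp_all add: R_simps)
  show "f \<oplus>\<^bsub>R\<^esub> g \<in> carrier R" unfolding R_simps by (rule endo_add[OF e])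
  show "f \<oplus>\<^bsub>R\<^esub> g = g \<oplus>\<^bsub>R\<^esub> f" unfolding R_simps
   by (rule endo_eqI) (use Ycar endoD(1)[OF e(1)] endoD(1)[OF e(2)] in \<open>auto simp: m_comm\<close>)
  show "\<zero>\<^bsub>R\<^esub> \<oplus>\<^bsub>R\<^esub> f = f" unfolding R_simps
   by (rule endo_eqI) (use Ycar endoD(1,5)[OF e(1)] in auto)
  show "EX g:carrier R. g \<oplus>\<^bsub>R\<^esub> f = \<zero>\<^bsub>R\<^esub>"
  proof (rule bexI)
   show "(\<lambda>x\<in>Y. inv (f x)) \<oplus>\<^bsub>R\<^esub> f = \<zero>\<^bsub>R\<^esub>" unfolding R_simps
    by (rule endo_eqI) (use Ycar endoD(1)[OF e(1)] in auto)
   show "(\<lambda>x\<in>Y. inv (f x)) \<in> carrier R" unfolding R_simps by (rule endo_neg[OF e(1)])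
  qed
  fix h assume "h \<in> carrier R"
  hence h: "h \<in> endos" by (simp add: R_simps)
  show "f \<oplus>\<^bsub>R\<^esub> g \<oplus>\<^bsub>R\<^esub> h = f \<oplus>\<^bsub>R\<^esub> (g \<oplus>\<^bsub>R\<^esub> h)" unfolding R_simps
   by (rule endo_eqI) (use Ycar endoD(1)[OF e(1)] endoD(1)[OF e(2)] endoD(1)[OF h] in \<open>auto simp: m_assoc\<close>)
 qed (simp add: R_simps endo_zero)
 show "monoid R"
 proof (rule monoidI)
  fix f g assume fg: "f \<in> carrier R" "g \<in> carrier R"
  hence e: "f \<in> endos" "g \<in> endos" by (simp_all add: R_simps)
  show "f \<otimes>\<^bsub>R\<^esub> g \<in> carrier R" unfolding R_simps by (rule endo_compose[OF e])
  show "\<one>\<^bsub>R\<^esub> \<otimes>\<^bsub>R\<^esub> f = f" "f \<otimes>\<^bsub>R\<^esub> \<one>\<^bsub>R\<^esub> = f" unfolding R_simps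
   by (rule endo_eqI; use endoD(1,5)[OF e(1)] in \<open>auto simp: compose_def\<close>)+
  fix h assume "h \<in> carrier R"
  hence h: "h \<in> endos" by (simp add: R_simps)
  show "f \<otimes>\<^bsub>R\<^esub> g \<otimes>\<^bsub>R\<^esub> h = f \<otimes>\<^bsub>R\<^esub> (g \<otimes>\<^bsub>R\<^esub> h)" unfolding R_simps
   by (rule endo_eqI) (use endoD(1)[OF h] in \<open>auto simp: compose_def\<close>)
 qed (simp add: R_simps endo_id)
next
 fix f g h assume "f \<in> carrier R" "g \<in> carrier R" "h \<in> carrier R"
 hence e: "f \<in> endos" "g \<in> endos" "h \<in> endos" by (simp_all add: R_simps)
 show "(f \<oplus>\<^bsub>R\<^esub> g) \<otimes>\<^bsub>R\<^esub> h = f \<otimes>\<^bsub>R\<^esub> h \<oplus>\<^bsub>R\<^esub> g \<otimes>\<^bsub>R\<^esub> h" unfolding R_simps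
  by (rule endo_eqI) (use endoD(1)[OF e(3)] in \<open>auto simp: compose_def\<close>)
 show "h \<otimes>\<^bsub>R\<^esub> (f \<oplus>\<^bsub>R\<^esub> g) = h \<otimes>\<^bsub>R\<^esub> f \<oplus>\<^bsub>R\<^esub> h \<otimes>\<^bsub>R\<^esub> g" unfolding R_simps
  by (rule endo_eqI) (use endoD(1)[OF e(1)] endoD(1)[OF e(2)] endoD(2)[OF e(3)] in \<open>auto simp: compose_def\<close>)
qed

sublocale R: ring R by (rule ring_R)

definition ker :: "('a => 'a) => 'a set" where "ker f = {x \<in> Y. f x = \<one>}"

lemma preimage_fi: assumes f: "f \<in> endos" and A: "fi A" shows "fi {x \<in> Y. f x \<in> A}"
proof -
 obtain B where B: "fi B" "f ` B <= A" using endoD(3)[OF f] A unfolding cts_def by blast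
 have As: "subgroup A H" using A csubD(1) unfolding fi_def by blast
 have s: "subgroup {x \<in> Y. f x \<in> A} H"
 proof (rule subgroupI)
  show "{x \<in> Y. f x \<in> A} <= carrier H" using YD(4) by blast
  show "{x \<in> Y. f x \<in> A} ~= {}" using Yo endo_one[OF f] subgroup.one_closed[OF As] by auto
  show "inv a \<in> {x \<in> Y. f x \<in> A}" if "a \<in> {x \<in> Y. f x \<in> A}" for a
   using that Yi endo_inv[OF f] subgroup.m_inv_closed[OF As] by simp
  show "a \<otimes> b \<in> {x \<in> Y. f x \<in> A}" if "a \<in> {x \<in> Y. f x \<in> A}" "b \<in> {x \<in> Y. f x \<in> A}" for a b
   using that Ym endoD(2)[OF f] subgroup.m_closed[OF As] by simp
 qed
 have sub: "B <= {x \<in> Y. f x \<in> A}" using B unfolding fi_def by blast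
 have Bc: "csub B" "alm Y B" using B(1) unfolding fi_def by blast+
 have Ysub: "{x \<in> Y. f x \<in> A} <= Y" by blast
 have "alm {x \<in> Y. f x \<in> A} B" by (rule alm_mono[OF YD(3) s csubD(1)[OF Bc(1)] Ysub Bc(2) subset_refl])
 hence "csub {x \<in> Y. f x \<in> A}" by (rule csub_finite_extension[OF Bc(1) s sub])
 moreover have "alm Y {x \<in> Y. f x \<in> A}" by (rule alm_super[OF Bc(2) sub])
 ultimately show ?thesis unfolding fi_def using Ysub by blast
qed

lemma fi_Y: "fi Y" unfolding fi_def using YD alm_subset by blast

text \<open>By \<open>residual\<close> the kernel is the intersection of the preimages of all closed
  subgroups of finite index, and these preimages are closed.\<close>

lemma ker_LL: assumes f: "f \<in> endos" shows "ker f \<in> LL"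
proof -
 have eq: "ker f = \<Inter>{{x \<in> Y. f x \<in> A} | A. fi A}"
 proof
  show "ker f <= \<Inter>{{x \<in> Y. f x \<in> A} | A. fi A}"
   using subgroup.one_closed[OF csubD(1)] unfolding ker_def fi_def by auto
  show "\<Inter>{{x \<in> Y. f x \<in> A} | A. fi A} <= ker f"
  proof
   fix x assume x: "x \<in> \<Inter>{{x \<in> Y. f x \<in> A} | A. fi A}"
   hence all: "x \<in> Y & f x \<in> A" if "fi A" for A using that by blast
   have xY: "x \<in> Y" using all[OF fi_Y] by blast
   have "f x = \<one>"
   proof (rule ccontr)
    assume "f x ~= \<one>"
    then obtain A where "csub A & A <= Y & alm Y A & f x \<notin> A" using residual[OF endoD(1)[OF f xY]] by blast
    thus False using all[of A] unfolding fi_def by blast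
   qed
   thus "x \<in> ker f" unfolding ker_def using xY by blast
  qed
 qed
 have "csub (ker f)" unfolding eq
 proof (rule csub_Inter)
  show "{{x \<in> Y. f x \<in> A} | A. fi A} ~= {}" using fi_Y by blast
  fix B assume "B \<in> {{x \<in> Y. f x \<in> A} | A. fi A}"
  thus "csub B" using preimage_fi[OF f] unfolding fi_def[of B] fi_def[of "{x \<in> Y. f x \<in> _}"] by (auto simp: fi_def)
 qed
 moreover have "invar P (ker f)"
  by (rule invarI) (auto simp: ker_def Ya endoD(4)[OF f] act_one[OF P])
 ultimately show ?thesis using P by (intro LLI)
qed

lemma ker_alm: assumes "f \<in> endos" "infinite (ker f)" shows "fi (ker f)"
proof -
 have sub: "ker f <= Y" by (auto simp: ker_def)
 hence "alm Y (ker f)" using Y ker_LL[OF assms(1)] assms(2) unfolding atom_def by blast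
 thus ?thesis using sub LLD(1)[OF ker_LL[OF assms(1)]] unfolding fi_def by blast
qed

lemma fi_infinite: "fi A ==> infinite A"
 using alm_infinite[OF YD(1,5)] unfolding fi_def by blast

text \<open>In an atom an infinite kernel has finite index. So modulo \<open>I\<close> two
  endomorphisms are identified when they agree on a subgroup of finite index.\<close>

definition I :: "('a => 'a) set" where "I = {f \<in> endos. infinite (ker f)}"

lemma I_intro: "f \<in> endos ==> fi A ==> A <= ker f ==> f \<in> I"
 unfolding I_def using fi_infinite infinite_super by blast

lemma R_neg: assumes f: "f \<in> endos" shows "\<ominus>\<^bsub>R\<^esub> f = (\<lambda>x\<in>Y. inv (f x))"
proof -
 have "f \<oplus>\<^bsub>R\<^esub> (\<lambda>x\<in>Y. inv (f x)) = \<zero>\<^bsub>R\<^esub>" unfolding R_simps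
  by (rule endo_eqI) (use Ycar endoD(1)[OF f] in auto)
 thus ?thesis using R.minus_equality[of "(\<lambda>x\<in>Y. inv (f x))" f] f endo_neg[OF f] R.a_comm[of f "(\<lambda>x\<in>Y. inv (f x))"] by (simp add: R_simps(1))
qed

lemma ideal_I: "ideal I R"
proof (rule idealI[OF ring_R])
 show "subgroup I (add_monoid R)"
 proof (rule group.subgroupI)
  show "group (add_monoid R)" by (rule R.a_group)
  show "I <= carrier (add_monoid R)" by (auto simp: I_def R_simps)
  have "ker (\<lambda>x\<in>Y. \<one>) = Y" by (auto simp: ker_def)
  hence "(\<lambda>x\<in>Y. \<one>) \<in> I" using endo_zero YD(5) by (simp add: I_def)
  thus "I ~= {}" by blast
 next
  fix f assume f: "f \<in> I"
  hence fe: "f \<in> endos" by (simp add: I_def)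
  have "ker f <= ker (\<lambda>x\<in>Y. inv (f x))" by (auto simp: ker_def)
  hence "(\<lambda>x\<in>Y. inv (f x)) \<in> I" using f endo_neg[OF fe] infinite_super unfolding I_def by blast
  thus "inv\<^bsub>add_monoid R\<^esub> f \<in> I" using R_neg[OF fe] by (simp add: a_inv_def)
 next
  fix f g assume fg: "f \<in> I" "g \<in> I"
  hence e: "f \<in> endos" "g \<in> endos" "infinite (ker f)" "infinite (ker g)" by (simp_all add: I_def)
  have "ker f \<inter> ker g <= ker (\<lambda>x\<in>Y. f x \<otimes> g x)" by (auto simp: ker_def)
  hence "(\<lambda>x\<in>Y. f x \<otimes> g x) \<in> I"
   by (rule I_intro[OF endo_add[OF e(1,2)] fi_Int[OF ker_alm[OF e(1,3)] ker_alm[OF e(2,4)]]])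
  thus "f \<otimes>\<^bsub>add_monoid R\<^esub> g \<in> I" by (simp add: R_simps)
 qed
next
 fix a x assume "a \<in> I" "x \<in> carrier R"
 hence e: "a \<in> endos" "infinite (ker a)" "x \<in> endos" by (simp_all add: I_def R_simps)
 have "ker a <= ker (compose Y x a)" using endo_one[OF e(3)] by (auto simp: ker_def compose_def)
 thus "x \<otimes>\<^bsub>R\<^esub> a \<in> I" unfolding R_simps by (rule I_intro[OF endo_compose[OF e(3,1)] ker_alm[OF e(1,2)]])
 have "{y \<in> Y. x y \<in> ker a} <= ker (compose Y a x)" by (auto simp: ker_def compose_def)
 thus "a \<otimes>\<^bsub>R\<^esub> x \<in> I" unfolding R_simps
  by (rule I_intro[OF endo_compose[OF e(1,3)] preimage_fi[OF e(3) ker_alm[OF e(1,2)]]])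
qed

definition agree :: "('a => 'a) => ('a => 'a) => bool" where
 "agree f g \<longleftrightarrow> infinite {x \<in> Y. f x = g x}"

sublocale I: ideal I R by (rule ideal_I)

lemma agree_iff: assumes f: "f \<in> endos" and g: "g \<in> endos" shows "agree f g \<longleftrightarrow> I +>\<^bsub>R\<^esub> f = I +>\<^bsub>R\<^esub> g"
proof -
 have sub: "f \<ominus>\<^bsub>R\<^esub> g = (\<lambda>x\<in>Y. f x \<otimes> inv (g x))"
  unfolding R.minus_eq R_neg[OF g] by (simp add: R_simps cong: restrict_cong)
 have mem: "f \<ominus>\<^bsub>R\<^esub> g \<in> endos" using R.minus_closed[of f g] f g by (simp add: R_simps)
 have "ker (f \<ominus>\<^bsub>R\<^esub> g) = {x \<in> Y. f x = g x}"
 proof -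
  have "f x \<otimes> inv (g x) = \<one> \<longleftrightarrow> f x = g x" if "x \<in> Y" for x
   using inv_solve_right'[of \<one> "f x" "g x"] Ycar[OF endoD(1)[OF f that]] Ycar[OF endoD(1)[OF g that]] by simp
  thus ?thesis unfolding ker_def sub by auto
 qed
 hence "agree f g \<longleftrightarrow> f \<ominus>\<^bsub>R\<^esub> g \<in> I" unfolding agree_def I_def using mem by simp
 also have "\<dots> \<longleftrightarrow> I +>\<^bsub>R\<^esub> f = I +>\<^bsub>R\<^esub> g"
 proof
  have c: "f \<in> carrier R" "g \<in> carrier R" using f g by (simp_all add: R_simps(1))
  show "I +>\<^bsub>R\<^esub> f = I +>\<^bsub>R\<^esub> g" if "f \<ominus>\<^bsub>R\<^esub> g \<in> I"
   using I.a_rcos_module_minus[OF ring_R c(2,1)] that R.a_repr_independence[of f I g] I.a_subgroup c by simp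
  show "f \<ominus>\<^bsub>R\<^esub> g \<in> I" if "I +>\<^bsub>R\<^esub> f = I +>\<^bsub>R\<^esub> g"
   using I.a_rcos_module_minus[OF ring_R c(2,1)] that I.a_rcos_self[OF c(1)] by simp
 qed
 finally show ?thesis .
qed

text \<open>Take \<open>y\<close> with infinite orbit. By equivariance \<open>f y\<close> is fixed
  by the elements of \<open>P\<close> fixing \<open>y\<close>, which leaves finitely many values,
  and \<open>f y\<close> determines \<open>f\<close> on the orbit of \<open>y\<close>, hence modulo
  \<open>I\<close>.\<close>

lemma finite_quotient: "finite (carrier (R Quot I))"
proof -
 obtain y where y: "y \<in> Y" "infinite ((%g. act g y) ` P)" using infinite_orbit[OF P YD(2,5)] by blast
 obtain Q0 where Q0: "Q0 \<in> SS" "ALL g:Q0. act g y = y" using point_stab[OF Ycar[OF y(1)]] by blast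
 obtain Q where Q: "Q \<in> SS" "Q <= P" "Q <= Q0" using directed[OF P Q0(1)] by blast
 have "(%f. f y) ` endos <= {h \<in> carrier H. ALL g:Q. act g h = h}"
 proof clarify
  fix f assume f: "f \<in> endos"
  have "act g (f y) = f y" if "g \<in> Q" for g
  proof -
   have "g \<in> P" "act g y = y" using that Q Q0(2) by auto
   thus ?thesis using endoD(4)[OF f _ y(1), of g] by simp
  qed
  thus "f y \<in> carrier H & (ALL g:Q. act g (f y) = f y)" using Ycar[OF endoD(1)[OF f y(1)]] by blast
 qed
 hence fin: "finite ((%f. f y) ` endos)" using finite_Fix[OF Q(1)] by (rule finite_subset)
 have "finite ((%f. I +>\<^bsub>R\<^esub> f) ` endos)"
 proof (rule finite_image_factor[OF fin])
  fix f g assume fg: "f \<in> endos" "g \<in> endos" "f y = g y"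
  have "(%g. act g y) ` P <= {x \<in> Y. f x = g x}"
   using Ya y(1) endoD(4)[OF fg(1) _ y(1)] endoD(4)[OF fg(2) _ y(1)] fg(3) by auto
  hence "agree f g" unfolding agree_def using y(2) infinite_super by blast
  thus "I +>\<^bsub>R\<^esub> f = I +>\<^bsub>R\<^esub> g" using agree_iff[OF fg(1,2)] by blast
 qed
 moreover have "carrier (R Quot I) = (%f. I +>\<^bsub>R\<^esub> f) ` endos"
  unfolding FactRing_def A_RCOSETS_def' by (auto simp: R_simps(1))
 ultimately show ?thesis by simp
qed

text \<open>A composition of two maps with finite kernels has a finite kernel, so there are no zero
  divisors; commutativity is Wedderburn's theorem.\<close>

lemma quotient_domain: "domain (R Quot I)"
proof -
 interpret Q: ring "R Quot I" by (rule I.quotient_is_ring)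
 have car: "carrier (R Quot I) = (%f. I +>\<^bsub>R\<^esub> f) ` endos"
  unfolding FactRing_def A_RCOSETS_def' by (auto simp: R_simps(1))
 have zero: "\<zero>\<^bsub>R Quot I\<^esub> = I" by (simp add: FactRing_def)
 have inI: "I +>\<^bsub>R\<^esub> f = I \<longleftrightarrow> infinite (ker f)" if f: "f \<in> endos" for f
 proof -
  have "I +>\<^bsub>R\<^esub> \<zero>\<^bsub>R\<^esub> = I" using I.a_rcos_const[OF additive_subgroup.zero_closed[OF I.additive_subgroup_axioms]] .
  hence "I +>\<^bsub>R\<^esub> f = I \<longleftrightarrow> agree f \<zero>\<^bsub>R\<^esub>" using agree_iff[OF f endo_zero] by (simp add: R_simps(4))
  also have "{x \<in> Y. f x = \<zero>\<^bsub>R\<^esub> x} = ker f" unfolding ker_def by (auto simp: R_simps(4))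
  hence "agree f \<zero>\<^bsub>R\<^esub> \<longleftrightarrow> infinite (ker f)" unfolding agree_def by simp
  finally show ?thesis .
 qed
 have nontriv: "\<one>\<^bsub>R Quot I\<^esub> ~= \<zero>\<^bsub>R Quot I\<^esub>"
 proof -
  have "ker (\<lambda>x\<in>Y. x) <= {\<one>}" by (auto simp: ker_def)
  hence "finite (ker (\<lambda>x\<in>Y. x))" by (rule finite_subset) simp
  hence "I +>\<^bsub>R\<^esub> \<one>\<^bsub>R\<^esub> ~= I" using inI[OF endo_id] by (simp add: R_simps(3))
  thus ?thesis unfolding zero by (simp add: FactRing_def)
 qed
 have nzd: "a = \<zero>\<^bsub>R Quot I\<^esub> \<or> b = \<zero>\<^bsub>R Quot I\<^esub>" if ab: "a \<in> carrier (R Quot I)" "b \<in> carrier (R Quot I)" "a \<otimes>\<^bsub>R Quot I\<^esub> b = \<zero>\<^bsub>R Quot I\<^esub>" for a b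
 proof -
  obtain f g where fg: "f \<in> endos" "g \<in> endos" "a = I +>\<^bsub>R\<^esub> f" "b = I +>\<^bsub>R\<^esub> g" using ab(1,2) unfolding car by blast
  have "I +>\<^bsub>R\<^esub> (f \<otimes>\<^bsub>R\<^esub> g) = I"
   using ab(3) I.rcoset_mult_add[of f g] fg by (simp add: FactRing_def R_simps(1))
  hence inf: "infinite (ker (compose Y f g))" using inI[OF endo_compose[OF fg(1,2)]] by (simp add: R_simps(2))
  have "infinite (ker f) \<or> infinite (ker g)"
  proof (rule ccontr)
   assume "\<not> ?thesis"
   hence fin: "finite (ker f)" "finite (ker g)" by auto
   define r where "r z = (SOME x. x \<in> Y & g x = z)" for z
   have "ker (compose Y f g) <= (%(z, k). r z \<otimes> k) ` (ker f \<times> ker g)"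
   proof
    fix x assume "x \<in> ker (compose Y f g)"
    hence x: "x \<in> Y" "f (g x) = \<one>" by (auto simp: ker_def compose_def)
    have r: "r (g x) \<in> Y & g (r (g x)) = g x" unfolding r_def by (rule someI[of _ x]) (use x in simp)
    have rY: "r (g x) \<in> Y" using r by blast
    have c: "r (g x) \<in> carrier H" "x \<in> carrier H" "g x \<in> carrier H" using Ycar rY x(1) endoD(1)[OF fg(2) x(1)] by auto
    have k: "inv (r (g x)) \<otimes> x \<in> ker g"
     unfolding ker_def using endoD(2)[OF fg(2) Yi[OF rY] x(1)] endo_inv[OF fg(2) rY] r c Ym[OF Yi[OF rY] x(1)] by simp
    have "x = r (g x) \<otimes> (inv (r (g x)) \<otimes> x)" using c by (simp add: m_assoc[symmetric])
    moreover have "g x \<in> ker f" unfolding ker_def using x endoD(1)[OF fg(2) x(1)] by simp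
    ultimately show "x \<in> (%(z, k). r z \<otimes> k) ` (ker f \<times> ker g)" using k
     by (intro rev_image_eqI[of "(g x, inv (r (g x)) \<otimes> x)"]) auto
   qed
   hence "finite (ker (compose Y f g))" by (rule finite_subset) (use fin in simp)
   thus False using inf by blast
  qed
  thus ?thesis unfolding zero fg(3,4) using inI fg(1,2) by blast
 qed
 have comm: "a \<otimes>\<^bsub>R Quot I\<^esub> b = b \<otimes>\<^bsub>R Quot I\<^esub> a" if "a \<in> carrier (R Quot I)" "b \<in> carrier (R Quot I)" for a b
  by (rule Q.finite_integral_ring_commutative[OF finite_quotient nontriv nzd that])
 have "cring (R Quot I)"
  by (intro cring.intro comm_monoid.intro Q.ring_axioms Q.monoid_axioms comm_monoid_axioms.intro comm)
 thus ?thesis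
  by (intro domain.intro domain_axioms.intro nontriv nzd)
qed

lemma rcos_pow: assumes "f \<in> endos" shows "(I +>\<^bsub>R\<^esub> f) [^]\<^bsub>R Quot I\<^esub> (n::nat) = I +>\<^bsub>R\<^esub> (f [^]\<^bsub>R\<^esub> n)"
proof -
 interpret h: ring_hom_ring R "R Quot I" "(+>\<^bsub>R\<^esub>) I" by (rule I.rcos_ring_hom_ring)
 show ?thesis using h.hom_nat_pow[of f n] assms by (simp add: R_simps(1))
qed

lemma endo_pow: "f \<in> endos ==> f [^]\<^bsub>R\<^esub> (n::nat) \<in> endos"
 using R.nat_pow_closed[of f n] by (simp add: R_simps(1))

text \<open>Commutativity is essential here: only over a domain does the polynomial of degree
  \<open>m\<close> have at most \<open>m\<close> roots.\<close>

lemma roots_of_unity_bound: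
 assumes F: "finite F" "F <= endos" and m: "m > 0" "!!f. f \<in> F ==> agree (f [^]\<^bsub>R\<^esub> (m::nat)) (\<lambda>x\<in>Y. x)"
  and ne: "!!f g. f \<in> F ==> g \<in> F ==> f ~= g ==> \<not> agree f g"
 shows "card F \<le> m"
proof -
 interpret Q: domain "R Quot I" by (rule quotient_domain)
 let ?c = "%f. I +>\<^bsub>R\<^esub> f"
 let ?S = "{x \<in> carrier (R Quot I). x [^]\<^bsub>R Quot I\<^esub> m = \<one>\<^bsub>R Quot I\<^esub>}"
 have "?c ` F <= ?S"
 proof clarify
  fix f assume f: "f \<in> F"
  hence fe: "f \<in> endos" using F by blast
  have "?c f \<in> carrier (R Quot I)" using fe unfolding FactRing_def A_RCOSETS_def' by (auto simp: R_simps(1))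
  moreover have "?c f [^]\<^bsub>R Quot I\<^esub> m = \<one>\<^bsub>R Quot I\<^esub>"
   unfolding rcos_pow[OF fe] using m(2)[OF f] agree_iff[OF endo_pow[OF fe] endo_id, of m]
   by (simp add: FactRing_def R_simps(3))
  ultimately show "?c f \<in> carrier (R Quot I) & ?c f [^]\<^bsub>R Quot I\<^esub> m = \<one>\<^bsub>R Quot I\<^esub>" by blast
 qed
 moreover have "inj_on ?c F"
  by (rule inj_onI) (use ne agree_iff F(2) in blast)
 moreover have "finite ?S" using finite_quotient by simp
 ultimately have "card F \<le> card ?S" using card_inj_on_le by blast
 also have "\<dots> \<le> m" using Q.num_roots_le_deg[OF finite_quotient] m(1) by simp
 finally show ?thesis .
qed

text \<open>An injective endomorphism is nonzero in a finite domain, so two of its powers coincide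
  and can be cancelled.\<close>

lemma injective_endo_order:
 assumes f: "f \<in> endos" and inj: "!!x. x \<in> Y ==> f x = \<one> ==> x = \<one>"
 shows "EX m>0. agree (f [^]\<^bsub>R\<^esub> (m::nat)) (\<lambda>x\<in>Y. x)"
proof -
 interpret Q: domain "R Quot I" by (rule quotient_domain)
 let ?x = "I +>\<^bsub>R\<^esub> f"
 have xc: "?x \<in> carrier (R Quot I)" using f unfolding FactRing_def A_RCOSETS_def' by (auto simp: R_simps(1))
 have x0: "?x ~= \<zero>\<^bsub>R Quot I\<^esub>"
 proof
  assume "?x = \<zero>\<^bsub>R Quot I\<^esub>"
  hence "f \<in> I" using I.a_rcos_self[of f] f by (simp add: FactRing_def R_simps(1))
  hence "infinite (ker f)" by (simp add: I_def)
  moreover have "ker f <= {\<one>}" using inj by (auto simp: ker_def)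
  ultimately show False using finite_subset by blast
 qed
 have pow0: "?x [^]\<^bsub>R Quot I\<^esub> (n::nat) ~= \<zero>\<^bsub>R Quot I\<^esub>" for n
  by (induction n) (use x0 xc Q.integral in auto)
 have "range (%n::nat. ?x [^]\<^bsub>R Quot I\<^esub> n) <= carrier (R Quot I)" using xc by auto
 hence "finite (range (%n::nat. ?x [^]\<^bsub>R Quot I\<^esub> n))" using finite_quotient finite_subset by blast
 hence "\<not> inj (%n::nat. ?x [^]\<^bsub>R Quot I\<^esub> n)" using finite_imageD[of "%n::nat. ?x [^]\<^bsub>R Quot I\<^esub> n" UNIV] infinite_UNIV_nat by blast
 then obtain i j :: nat where ij: "i < j" "?x [^]\<^bsub>R Quot I\<^esub> i = ?x [^]\<^bsub>R Quot I\<^esub> j" unfolding inj_on_def by (metis UNIV_I nat_neq_iff)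
 have "?x [^]\<^bsub>R Quot I\<^esub> i \<otimes>\<^bsub>R Quot I\<^esub> ?x [^]\<^bsub>R Quot I\<^esub> (j - i) = ?x [^]\<^bsub>R Quot I\<^esub> j" using ij(1) xc by (simp add: Q.nat_pow_mult)
 hence "?x [^]\<^bsub>R Quot I\<^esub> i \<otimes>\<^bsub>R Quot I\<^esub> ?x [^]\<^bsub>R Quot I\<^esub> (j - i) = ?x [^]\<^bsub>R Quot I\<^esub> i \<otimes>\<^bsub>R Quot I\<^esub> \<one>\<^bsub>R Quot I\<^esub>"
  using ij(2) xc by simp
 hence "?x [^]\<^bsub>R Quot I\<^esub> (j - i) = \<one>\<^bsub>R Quot I\<^esub>"
  by (rule Q.m_lcancel[OF pow0[of i], THEN iffD1, rotated 3]) (use xc in auto)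
 hence "I +>\<^bsub>R\<^esub> (f [^]\<^bsub>R\<^esub> (j - i)) = I +>\<^bsub>R\<^esub> (\<lambda>x\<in>Y. x)" unfolding rcos_pow[OF f] by (simp add: FactRing_def R_simps(3))
 hence "agree (f [^]\<^bsub>R\<^esub> (j - i)) (\<lambda>x\<in>Y. x)" using agree_iff[OF endo_pow[OF f] endo_id] by blast
 thus ?thesis using ij(1) by (intro exI[of _ "j - i"]) simp
qed

end

section \<open>Countably many graphs up to commensurability\<close>

text \<open>Iterates on \<open>Y\<close> without reference to the ring of endomorphisms: that ring
  depends on the acting set \<open>P\<close>, and the order of a map found for one \<open>P\<close>
  is used again for another.\<close>

definition (in monoid) pw :: "'a set => ('a => 'a) => nat => ('a => 'a)" where
 "pw Y f n = ((%g. compose Y g f) ^^ n) (\<lambda>x\<in>Y. x)"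

context pair_setting
begin

definition em :: "'a set => 'a set => 'a set => 'a => 'a" where
 "em M N Y = (\<lambda>x\<in>Y. THE a. rel M N x a)"

definition stable :: "'a set => 'a set => 'a set => bool" where
 "stable M N Y \<longleftrightarrow> graph M & graph N & csub Y & Y <= V1 & alm V1 Y & Y <= tr M N Y"

lemma stable_em:
 assumes s: "stable M N Y" and x: "x \<in> Y"
 shows "em M N Y x \<in> Y" "rel M N x (em M N Y x)"
proof -
 have g: "graph M" "graph N" "Y <= V1" "x \<in> tr M N Y" using s x unfolding stable_def by blast+
 then obtain a where a: "a \<in> Y" "rel M N x a" using tr_iff[OF graphD(3)[OF g(1)] graphD(3)[OF g(2)] g(3)] by blast
 have "(THE a. rel M N x a) = a" by (rule the_equality[where P = "rel M N x", OF a(2)]) (rule rel_fun[OF g(1,2) _ a(2)])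
 hence "em M N Y x = a" using x by (simp add: em_def)
 thus "em M N Y x \<in> Y" "rel M N x (em M N Y x)" using a by simp_all
qed

lemma em_eq: "stable M N Y ==> x \<in> Y ==> rel M N x a ==> em M N Y x = a"
 using rel_fun stable_em(2) unfolding stable_def by blast

lemma stable_atom: assumes "stable M N Y" shows "patom Y"
 using patom_finite_index[OF V1] assms unfolding stable_def by blast

lemma stable_endo_setting:
 assumes s: "stable M N Y" and P: "P \<in> SS" "invar P Y"
 shows "endo_setting H T act SS P Y"
proof -
 have pY: "patom Y" by (rule stable_atom[OF s])
 show ?thesis
 proof
  show "P \<in> SS" "invar P Y" by fact+
  show "atom Y" using pY unfolding patom_def by blast
  fix y assume y: "y \<in> Y" "y ~= \<one>"
  obtain A where A: "patom A" "A <= Y" "comm_eq Y A" "A \<inter> {y} <= {\<one>}" using patom_avoid[OF pY, of "{y}"] by auto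
  have "csub A" using A(1) atomD LLD unfolding patom_def by blast
  moreover have "y \<notin> A" using A(4) y(2) by blast
  ultimately show "EX A. csub A & A <= Y & alm Y A & y \<notin> A" using A(2,3) unfolding comm_eq_def by blast
 qed
qed

lemma stable_endo:
 assumes s: "stable M N Y" and P: "P \<in> SS" "invar P Y" "invar P V1" "invar P V2" "invar P M" "invar P N"
 shows "em M N Y \<in> endo_setting.endos H T act P Y"
proof -
 interpret E: endo_setting H T act SS P Y by (rule stable_endo_setting[OF s P(1,2)])
 have g: "graph M" "graph N" "Y <= V1" "csub Y" "alm V1 Y" using s unfolding stable_def by blast+
 note MN = graphD(3)[OF g(1)] graphD(3)[OF g(2)]
 show ?thesis
 proof (rule E.endoI)
  show "em M N Y \<in> extensional Y" by (simp add: em_def)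
  show "em M N Y x \<in> Y" if "x \<in> Y" for x by (rule stable_em(1)[OF s that])
  show "em M N Y (x \<otimes> y) = em M N Y x \<otimes> em M N Y y" if "x \<in> Y" "y \<in> Y" for x y
   by (rule em_eq[OF s E.Ym[OF that] rel_mult[OF MN stable_em(2)[OF s that(1)] stable_em(2)[OF s that(2)]]])
  show "em M N Y (act h x) = act h (em M N Y x)" if "h \<in> P" "x \<in> Y" for h x
   by (rule em_eq[OF s E.Ya[OF that] rel_act[OF P(1) that(1) P(3-6) stable_em(2)[OF s that(2)]]])
  show "E.cts (em M N Y)"
   unfolding E.cts_def
  proof (intro allI impI)
   fix A assume "E.fi A"
   hence A: "csub A" "A <= Y" "alm Y A" unfolding E.fi_def by blast+
   have AL: "A \<in> LL" by (rule LL_finite_index[OF E.YD(1) A])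
   have "alm V1 A" by (rule alm_trans[OF aV(5) E.YD(3) csubD(1)[OF A(1)] g(5) A(3)])
   hence t: "alm V1 (tr M N A)" by (rule tr_alm[OF g(1,2) AL])
   have tL: "tr M N A \<in> LL" by (rule tr_LL[OF g(1,2) AL])
   have "alm Y (tr M N A)" by (rule alm_mono[OF aV(5) E.YD(3) LLD(2)[OF tL] g(3) t subset_refl])
   hence "E.fi (Y \<inter> tr M N A)" unfolding E.fi_def
    using csub_Int[OF g(4) LLD(1)[OF tL]] alm_Int[OF E.YD(3)] by blast
   moreover have "em M N Y ` (Y \<inter> tr M N A) <= A"
   proof clarify
    fix x assume x: "x \<in> Y" "x \<in> tr M N A"
    have "A <= V1" using A(2) g(3) by blast
    then obtain a where "a \<in> A" "rel M N x a" using x(2) tr_iff[OF MN] by blast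
    thus "em M N Y x \<in> A" using em_eq[OF s x(1)] by simp
   qed
   ultimately show "EX B. E.fi B & em M N Y ` B <= A" by blast
  qed
 qed
qed

lemma stable_common_P:
 assumes "finite \<F>" "\<F> <= LL"
 shows "EX P:SS. invar P V1 & invar P V2 & (ALL L:\<F>. invar P L)"
proof -
 have "insert V1 (insert V2 \<F>) <= LL" using assms(2) aV by blast
 thus ?thesis using common_P[of "insert V1 (insert V2 \<F>)"] assms(1) by auto
qed

text \<open>The endomorphism is injective, because the inverse relation \<open>rel N M\<close> is a
  function as well.\<close>

lemma stable_order:
 assumes s: "stable M N Y"
 shows "EX m>0. infinite {x \<in> Y. pw Y (em M N Y) m x = x}"
proof -
 have g: "graph M" "graph N" "Y <= V1" "csub Y" "alm V1 Y" using s unfolding stable_def by blast+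
 have "Y \<in> LL" using stable_atom[OF s] atomD unfolding patom_def by blast
 then obtain P where P: "P \<in> SS" "invar P V1" "invar P V2" "invar P M" "invar P N" "invar P Y"
  using stable_common_P[of "{M, N, Y}"] graphD(2)[OF g(1)] graphD(2)[OF g(2)] by auto
 interpret E: endo_setting H T act SS P Y by (rule stable_endo_setting[OF s P(1,6)])
 have e: "em M N Y \<in> E.endos" by (rule stable_endo[OF s P(1,6,2-5)])
 have rel1: "rel N M \<one> \<one>"
  unfolding rel_def using subgroup.one_closed[OF aV(5)] subgroup.one_closed[OF aV(6)]
   subgroup.one_closed[OF graphD(3)[OF g(1)]] subgroup.one_closed[OF graphD(3)[OF g(2)]] by force
 have "x = \<one>" if "x \<in> Y" "em M N Y x = \<one>" for x
  using rel_fun[OF g(2,1) rel_sym[OF stable_em(2)[OF s that(1)], unfolded that(2)] rel1] .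
 then obtain m where m: "m > 0" "E.agree (em M N Y [^]\<^bsub>E.R\<^esub> (m::nat)) (\<lambda>x\<in>Y. x)" using E.injective_endo_order[OF e] by blast
 have pe: "em M N Y [^]\<^bsub>E.R\<^esub> (n::nat) = pw Y (em M N Y) n" for n
  by (induction n) (simp_all add: pw_def E.R_simps(2,3))
 have "{x \<in> Y. pw Y (em M N Y) m x = (\<lambda>x\<in>Y. x) x} = {x \<in> Y. pw Y (em M N Y) m x = x}" by auto
 thus ?thesis using m unfolding E.agree_def pe by (intro exI[of _ m]) simp
qed

text \<open>With \<open>L0\<close>, \<open>Y\<close>, the direction \<open>b\<close> and the order
  \<open>m\<close> fixed, incommensurable graphs give different \<open>m\<close>-th roots of unity
  in one field. Finiteness of the family provides a single \<open>P\<close> under which all its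
  members are invariant.\<close>

lemma fibre_bound:
 assumes L0: "graph L0" and \<F>: "finite \<F>" and m: "m > 0"
  and st: "!!L. L \<in> \<F> ==> stable (if b then L else L0) (if b then L0 else L) Y"
  and ord: "!!L. L \<in> \<F> ==> infinite {x \<in> Y. pw Y (em (if b then L else L0) (if b then L0 else L) Y) m x = x}"
  and ne: "!!L L'. L \<in> \<F> ==> L' \<in> \<F> ==> L ~= L' ==> \<not> comm_eq L L'"
 shows "card \<F> \<le> m"
proof (cases "\<F> = {}")
 case False
 define e where "e L = em (if b then L else L0) (if b then L0 else L) Y" for L
 have gr: "graph L" if "L \<in> \<F>" for L using st[OF that] unfolding stable_def by (cases b) simp_all
 obtain L1 where L1: "L1 \<in> \<F>" using False by blast
 have YL: "Y \<in> LL" using stable_atom[OF st[OF L1]] atomD unfolding patom_def by blast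
 have "insert L0 (insert Y \<F>) <= LL" using graphD(2)[OF L0] YL gr graphD(2) by blast
 then obtain P where P: "P \<in> SS" "invar P V1" "invar P V2" "invar P L0" "invar P Y" "!!L. L \<in> \<F> ==> invar P L"
  using stable_common_P[of "insert L0 (insert Y \<F>)"] \<F> by auto
 interpret E: endo_setting H T act SS P Y by (rule stable_endo_setting[OF st[OF L1] P(1,5)])
 have ee: "e L \<in> E.endos" if "L \<in> \<F>" for L
  unfolding e_def by (rule stable_endo[OF st[OF that] P(1,5,2,3)]) (use P(4) P(6)[OF that] in \<open>cases b, simp_all\<close>)+
 have nagree: "L = L'" if LL': "L \<in> \<F>" "L' \<in> \<F>" "E.agree (e L) (e L')" for L L'
 proof (rule ccontr)
  assume "L ~= L'"
  define A where "A = {x \<in> Y. e L x = e L' x}"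
  have infA: "infinite A" using LL'(3) unfolding E.agree_def A_def .
  define S where "S = (%x. if b then (x, e L x) else (e L x, x)) ` A"
  have "inj_on (%x. if b then (x, e L x) else (e L x, x)) A" by (rule inj_onI) (cases b; simp)
  hence "infinite S" unfolding S_def using infA finite_imageD by blast
  moreover have "rel L L0 x a & rel L' L0 x a" if xa: "(x, a) \<in> S" for x a
  proof -
   obtain z where z: "z \<in> A" "(x, a) = (if b then (z, e L z) else (e L z, z))" using xa unfolding S_def by blast
   have zY: "z \<in> Y" "e L z = e L' z" using z(1) unfolding A_def by auto
   show ?thesis
    using stable_em(2)[OF st[OF LL'(1)] zY(1)] stable_em(2)[OF st[OF LL'(2)] zY(1)] zY(2) z(2)
    unfolding e_def by (cases b) (auto dest: rel_sym)
  qed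
  ultimately have "comm_eq L L'" by (rule comm_eq_of_agreement[OF gr[OF LL'(1)] gr[OF LL'(2)] L0])
  thus False using ne[OF LL'(1,2) \<open>L ~= L'\<close>] by blast
 qed
 have agr: "E.agree f f" for f unfolding E.agree_def using E.YD(5) by simp
 have inj: "inj_on e \<F>"
 proof (rule inj_onI)
  fix L L' assume "L \<in> \<F>" "L' \<in> \<F>" "e L = e L'"
  thus "L = L'" using nagree[of L L'] agr[of "e L"] by simp
 qed
 have pe: "f [^]\<^bsub>E.R\<^esub> (n::nat) = pw Y f n" for f n
  by (induction n) (simp_all add: pw_def E.R_simps(2,3))
 have "card (e ` \<F>) \<le> m"
 proof (rule E.roots_of_unity_bound[OF _ _ m])
  show "finite (e ` \<F>)" using \<F> by simp
  show "e ` \<F> <= E.endos" using ee by blast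
  fix f assume "f \<in> e ` \<F>"
  then obtain L where L: "L \<in> \<F>" "f = e L" by blast
  have "{x \<in> Y. pw Y f m x = (\<lambda>x\<in>Y. x) x} = {x \<in> Y. pw Y f m x = x}" by auto
  thus "E.agree (f [^]\<^bsub>E.R\<^esub> m) (\<lambda>x\<in>Y. x)" unfolding E.agree_def pe using ord[OF L(1)] unfolding L(2) e_def by simp
 next
  fix f g assume "f \<in> e ` \<F>" "g \<in> e ` \<F>" "f ~= g"
  thus "\<not> E.agree f g" using nagree by blast
 qed
 thus ?thesis using card_image[OF inj] by simp
qed simp

text \<open>Every graph is compared with one fixed graph \<open>L0\<close>. The data
  \<open>(b, Y, m)\<close>, namely the direction in which the comparison map stabilizes
  \<open>Y\<close>, the group \<open>Y\<close> and the order \<open>m\<close>, take countably many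
  values by \<open>countable_finite_index\<close>; the fibres are finite up to commensurability by
  \<open>fibre_bound\<close>.\<close>

lemma graphs_countable:
 shows "EX \<C>. countable \<C> & \<C> <= {L. graph L} & (ALL L. graph L --> (EX M:\<C>. comm_eq L M))"
proof (cases "EX L0. graph L0")
 case False
 thus ?thesis by (intro exI[of _ "{}"]) auto
next
 case True
 then obtain L0 where L0: "graph L0" by blast
 define good where "good L c \<longleftrightarrow> (case c of (b, Y, m) => stable (if b then L else L0) (if b then L0 else L) Y & m > 0 &
  infinite {x \<in> Y. pw Y (em (if b then L else L0) (if b then L0 else L) Y) m x = x})" for L and c :: "bool \<times> 'a set \<times> nat"
 have ex: "EX c. good L c" if L: "graph L" for L
 proof -
  obtain Y where Y: "csub Y" "Y <= V1" "alm V1 Y" "Y <= tr L L0 Y \<or> Y <= tr L0 L Y" using stable_subgroup[OF L L0] by blast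
  define b where "b \<longleftrightarrow> Y <= tr L L0 Y"
  have s: "stable (if b then L else L0) (if b then L0 else L) Y" using Y L L0 unfolding b_def stable_def by auto
  obtain m where "m > 0" "infinite {x \<in> Y. pw Y (em (if b then L else L0) (if b then L0 else L) Y) m x = x}"
   using stable_order[OF s] by blast
  hence "good L (b, Y, m)" unfolding good_def using s by simp
  thus ?thesis ..
 qed
 define f where "f L = (SOME c. good L c)" for L
 have f: "good L (f L)" if "graph L" for L unfolding f_def by (rule someI_ex[OF ex[OF that]])
 have "cc {L. graph L}"
 proof (rule ccI[of _ f])
  show "subgroup L H" if "L \<in> {L. graph L}" for L using that graphD(3) by blast
  have "f ` {L. graph L} <= UNIV \<times> {Y. csub Y & Y <= V1 & alm V1 Y} \<times> UNIV"
  proof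
   fix c assume "c \<in> f ` {L. graph L}"
   then obtain L where L: "graph L" "c = f L" by blast
   obtain b Y m where c: "c = (b, Y, m)" by (cases c)
   have "good L (b, Y, m)" using f[OF L(1)] L(2) c by simp
   hence "stable (if b then L else L0) (if b then L0 else L) Y" unfolding good_def by simp
   thus "c \<in> UNIV \<times> {Y. csub Y & Y <= V1 & alm V1 Y} \<times> UNIV" unfolding c stable_def by blast
  qed
  moreover have "countable (UNIV \<times> {Y. csub Y & Y <= V1 & alm V1 Y} \<times> UNIV :: (bool \<times> 'a set \<times> nat) set)"
   using countable_finite_index[OF second_countable_T LLD(1)[OF aV(3)]] by (intro countable_SIGMA) auto
  ultimately show "countable (f ` {L. graph L})" by (rule countable_subset)
  fix c assume "c \<in> f ` {L. graph L}"
  then obtain L1 where L1: "graph L1" "f L1 = c" by blast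
  obtain b Y m where c: "c = (b, Y, m)" by (cases c)
  define fib where "fib = {L. graph L & f L = c}"
  define ind where "ind \<F> \<longleftrightarrow> finite \<F> & \<F> <= fib & (ALL L:\<F>. ALL L':\<F>. L ~= L' --> \<not> comm_eq L L')" for \<F>
  have fibD: "stable (if b then L else L0) (if b then L0 else L) Y" "m > 0"
   "infinite {x \<in> Y. pw Y (em (if b then L else L0) (if b then L0 else L) Y) m x = x}" if "L \<in> fib" for L
   using f[of L] that unfolding fib_def c good_def by auto
  have "L1 \<in> fib" using L1 unfolding fib_def by simp
  have bound: "card \<F> \<le> m" if "ind \<F>" for \<F>
  proof (rule fibre_bound[OF L0])
   show "finite \<F>" using that unfolding ind_def by blast
   show "m > 0" by (rule fibD(2)[OF \<open>L1 \<in> fib\<close>])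
   fix L assume "L \<in> \<F>"
   hence "L \<in> fib" using that unfolding ind_def by blast
   thus "stable (if b then L else L0) (if b then L0 else L) Y"
    "infinite {x \<in> Y. pw Y (em (if b then L else L0) (if b then L0 else L) Y) m x = x}" using fibD by blast+
  next
   fix L L' assume "L \<in> \<F>" "L' \<in> \<F>" "L ~= L'"
   thus "\<not> comm_eq L L'" using that unfolding ind_def by blast
  qed
  have ind0: "ind {}" unfolding ind_def by simp
  \<comment> \<open>A pairwise incommensurable family of greatest size represents the whole fibre;
    the bound \<open>m\<close> on the sizes makes it exist.\<close>
  have "EX \<F>. ind \<F> & (ALL \<G>. ind \<G> --> card \<G> \<le> card \<F>)"
   using ex_has_greatest_nat[of ind "{}" card "Suc m", OF ind0] bound by (simp add: le_imp_less_Suc)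
  then obtain \<F> where \<F>: "ind \<F>" "!!\<G>. ind \<G> ==> card \<G> \<le> card \<F>" by blast
  have fin: "finite \<F>" using \<F>(1) unfolding ind_def by blast
  have "EX M:\<F>. comm_eq L M" if L: "graph L" "f L = c" for L
  proof (rule ccontr)
   assume neg: "\<not> ?thesis"
   have "L \<notin> \<F>" using neg comm_eq_refl[OF graphD(3)[OF L(1)]] by blast
   have "ind (insert L \<F>)" using \<F>(1) neg L comm_eq_sym unfolding ind_def fib_def by auto
   hence "card (insert L \<F>) \<le> card \<F>" by (rule \<F>(2))
   thus False using \<open>L \<notin> \<F>\<close> fin by simp
  qed
  moreover have "\<F> <= {L. subgroup L H}" using \<F>(1) graphD(3) unfolding ind_def fib_def by blast
  ultimately show "EX \<C>. countable \<C> & \<C> <= {L. subgroup L H} & (ALL L:{L. graph L}. f L = c --> (EX M:\<C>. comm_eq L M))"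
   using countable_finite[OF fin] by (intro exI[of _ \<F>]) simp
 qed
 thus ?thesis unfolding cc_def by simp
qed

end

section \<open>Counting all atoms\<close>

context inv_setting
begin

lemma cc_of_representatives:
 assumes "!!L. L \<in> \<L> ==> subgroup L H" "countable \<C>" "!!M. M \<in> \<C> ==> subgroup M H" "!!L. L \<in> \<L> ==> EX M:\<C>. comm_eq L M"
 shows "cc \<L>"
proof (rule ccI[of _ "%_. ()"])
 show "EX \<C>. countable \<C> & \<C> <= {L. subgroup L H} & (ALL L:\<L>. () = n --> (EX M:\<C>. comm_eq L M))" for n
  using assms by (intro exI[of _ \<C>]) auto
 show "countable ((%_. ()) ` \<L>)" by (rule countable_finite) simp
qed (rule assms(1))

lemma comm_eq_set_mult:
 assumes "subgroup A H" "subgroup A' H" "subgroup B H" "subgroup B' H" "alm A A'" "alm B B'"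
 shows "alm (A <#> B) (A' <#> B')"
proof -
 have 1: "alm (A <#> B) (A' <#> B)" by (rule alm_set_mult_mono[OF assms(1,2,3,5)])
 have "alm (B <#> A') (B' <#> A')" by (rule alm_set_mult_mono[OF assms(3,4,2,6)])
 hence 2: "alm (A' <#> B) (A' <#> B')"
  using set_mult_commute_subgroups[OF subgroup.subset[OF assms(3)] subgroup.subset[OF assms(2)]]
   set_mult_commute_subgroups[OF subgroup.subset[OF assms(4)] subgroup.subset[OF assms(2)]] by simp
 show ?thesis by (rule alm_trans[OF _ _ _ 1 2]) (intro mult_subgroups assms)+
qed

text \<open>With infinite intersection the sum is commensurable with \<open>V1\<close>. Otherwise
  the two atoms are replaced by commensurable ones of prime exponent that meet trivially, and an
  atom almost contained in the sum is commensurable with one of these or, once its finite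
  intersections with them are removed, with a graph.\<close>

lemma pair_atoms_cc:
 assumes V: "atom V1" "atom V2"
 shows "cc {L. atom L & alm L (V1 <#> V2)}"
proof (cases "finite (V1 \<inter> V2)")
 case False
 note s = LLD(2)[OF atomD(1)[OF V(1)]] LLD(2)[OF atomD(1)[OF V(2)]]
 have "alm V2 V1" using atom_dichotomy[OF V(2) atomD(1)[OF V(1)]] False by (simp add: Int_commute)
 hence VV: "alm (V1 <#> V2) V1" by (rule alm_set_mult_least[OF s(1,2,1) alm_subset[OF s(1) subset_refl]])
 show ?thesis
 proof (rule cc_of_representatives[of _ "{V1}"])
  fix L assume "L \<in> {L. atom L & alm L (V1 <#> V2)}"
  hence L: "atom L" "alm L (V1 <#> V2)" by auto
  have "alm L V1" by (rule alm_trans[OF LLD(2)[OF atomD(1)[OF L(1)]] mult_subgroups[OF s] s(1) L(2) VV])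
  hence "comm_eq L V1" by (rule atom_alm_comm_eq[OF atomD[OF L(1)] V(1)])
  thus "EX M:{V1}. comm_eq L M" by simp
 qed (use s LLD(2)[OF atomD(1)] in auto)
next
 case True
 obtain W1 where W1: "patom W1" "W1 <= V1" "comm_eq V1 W1" using atom_patom[OF V(1)] by blast
 obtain W2 where W2: "patom W2" "W2 <= V2" "comm_eq V2 W2" using atom_patom[OF V(2)] by blast
 obtain U1 where U1: "patom U1" "U1 <= W1" "comm_eq W1 U1" "U1 \<inter> (V1 \<inter> V2) <= {\<one>}" using patom_avoid[OF W1(1) True] by blast
 have a: "atom W1" "atom W2" "atom U1" using W1(1) W2(1) U1(1) unfolding patom_def by blast+
 note s = LLD(2)[OF atomD(1)[OF V(1)]] LLD(2)[OF atomD(1)[OF V(2)]] LLD(2)[OF atomD(1)[OF a(1)]] LLD(2)[OF atomD(1)[OF a(2)]] LLD(2)[OF atomD(1)[OF a(3)]]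
 have "U1 \<inter> W2 <= {\<one>}" using U1(2,4) W1(2) W2(2) by blast
 then interpret pair_setting H T act SS U1 W2 using U1(1) W2(1) by unfold_locales
 have "comm_eq V1 U1" by (rule comm_eq_trans[OF s(1,3,5) W1(3) U1(3)])
 hence VV: "alm (V1 <#> V2) (U1 <#> W2)" using W2(3) unfolding comm_eq_def by (intro comm_eq_set_mult s) auto
 obtain \<C> where \<C>: "countable \<C>" "\<C> <= {L. graph L}" "!!L. graph L ==> EX M:\<C>. comm_eq L M" using graphs_countable by blast
 show ?thesis
 proof (rule cc_of_representatives[of _ "{U1, W2} \<union> \<C>"])
  fix L assume "L \<in> {L. atom L & alm L (V1 <#> V2)}"
  hence L: "atom L" "alm L (V1 <#> V2)" by auto
  note LL1 = atomD(1)[OF L(1)]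
  have UW: "U1 <#> W2 \<in> LL" by (intro LL_set_mult atomD(1) a)
  have LUW: "alm L (U1 <#> W2)" by (rule alm_trans[OF LLD(2)[OF LL1] mult_subgroups[OF s(1,2)] LLD(2)[OF UW] L(2) VV])
  show "EX M:{U1, W2} \<union> \<C>. comm_eq L M"
  proof (cases "alm L U1 \<or> alm L W2")
   case True
   hence "comm_eq L U1 \<or> comm_eq L W2" using atom_alm_comm_eq[OF atomD[OF L(1)] a(3)] atom_alm_comm_eq[OF atomD[OF L(1)] a(2)] by blast
   thus ?thesis by blast
  next
   case False
   hence fin: "finite (L \<inter> U1)" "finite (L \<inter> W2)"
    using atom_dichotomy[OF L(1) atomD(1)[OF a(3)]] atom_dichotomy[OF L(1) atomD(1)[OF a(2)]] by blast+
   define L1 where "L1 = L \<inter> (U1 <#> W2)"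
   have L1L: "L1 \<in> LL" unfolding L1_def by (rule LL_Int[OF LL1 UW])
   have "infinite L1" unfolding L1_def by (rule alm_infinite_Int[OF LL1 atomD(2)[OF L(1)] UW LUW])
   hence L1: "atom L1" "comm_eq L L1" using atom_subset[OF L(1) L1L] unfolding L1_def by blast+
   obtain L2 where L2: "patom L2" "L2 <= L1" "comm_eq L1 L2" using atom_patom[OF L1(1)] by blast
   obtain L3 where L3: "patom L3" "L3 <= L2" "comm_eq L2 L3" "L3 \<inter> (L \<inter> U1 \<union> L \<inter> W2) <= {\<one>}"
    using patom_avoid[OF L2(1), of "L \<inter> U1 \<union> L \<inter> W2"] fin by blast
   have at: "atom L2" "atom L3" using L2(1) L3(1) unfolding patom_def by blast+
   note t = LLD(2)[OF LL1] LLD(2)[OF L1L] LLD(2)[OF atomD(1)[OF at(1)]] LLD(2)[OF atomD(1)[OF at(2)]]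
   have "comm_eq L L2" by (rule comm_eq_trans[OF t(1,2,3) L1(2) L2(3)])
   hence LL3: "comm_eq L L3" by (rule comm_eq_trans[OF t(1,3,4) _ L3(3)])
   have sub: "L3 <= L" "L3 <= U1 <#> W2" using L3(2) L2(2) unfolding L1_def by blast+
   have "graph L3" unfolding graph_def using at(2) sub L3(4) by blast
   then obtain M where M: "M \<in> \<C>" "comm_eq L3 M" using \<C>(3) by blast
   have "subgroup M H" using M(1) \<C>(2) graphD(3) by blast
   hence "comm_eq L M" by (rule comm_eq_trans[OF t(1,4) _ LL3 M(2)])
   thus ?thesis using M(1) by blast
  qed
 qed (use \<C> s graphD(3) LLD(2)[OF atomD(1)] in auto)
qed

text \<open>Modulo \<open>N\<close> both \<open>L\<close> and \<open>L0\<close> come from the single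
  atom \<open>V\<close>, and \<open>C\<close> records inside \<open>N\<close> the difference between
  them. So \<open>L\<close> is almost contained in the fixed \<open>L0\<close> plus a part of
  \<open>N\<close> that is finite or an atom, and the atoms of \<open>N\<close> are already
  counted.\<close>

lemma atom_exchange:
 assumes N: "N \<in> LL" and V: "atom V" and L: "atom L" "atom L0" "alm L (N <#> V)" "alm L0 (N <#> V)" "\<not> alm L0 N"
 defines "C \<equiv> N \<inter> (L <#> L0)"
 shows "finite C \<or> atom C" "alm L (L0 <#> C)" "C \<in> LL"
proof -
 note VL = atomD(1)[OF V] and LL1 = atomD(1)[OF L(1)] and L0L = atomD(1)[OF L(2)]
 have CL: "C \<in> LL" unfolding C_def by (intro LL_Int LL_set_mult N LL1 L0L)
 thus "C \<in> LL" .
 have LL0: "L <#> L0 \<in> LL" by (rule LL_set_mult[OF LL1 L0L])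
 have fin0: "finite (L0 \<inter> N)" using atom_dichotomy[OF L(2) N] L(5) by blast
 note s = LLD(2)[OF N] LLD(2)[OF VL] LLD(2)[OF LL1] LLD(2)[OF L0L] LLD(2)[OF CL]
 note c = LLD(3)[OF N] LLD(3)[OF VL] LLD(3)[OF LL1] LLD(3)[OF L0L] LLD(3)[OF CL]
 have "finite C \<or> alm C D" if D: "D \<in> LL" "D <= C" "infinite D" for D
 proof -
  have DL0: "D <#> L0 \<in> LL" by (rule LL_set_mult[OF D(1) L0L])
  have L0D: "L0 <= D <#> L0" "D <= D <#> L0"
   using set_mult_upper2[OF LLD(2)[OF D(1)] c(4)] set_mult_upper1[OF LLD(3)[OF D(1)] s(4)] by blast+
  have Dsub: "D <#> L0 <= L <#> L0"
   by (rule set_mult_least[OF LLD(2)[OF LL0]]) (use D(2) C_def set_mult_upper2[OF s(3) c(4)] in auto)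
  \<comment> \<open>By the modular law the subgroup \<open>D\<close> of \<open>C\<close> is traded
    for a subgroup of the atom \<open>L\<close>, to which the dichotomy applies.\<close>
  have m: "D <#> L0 = L0 <#> (L \<inter> (D <#> L0))"
  proof -
   have "(L0 <#> L) \<inter> (D <#> L0) = L0 <#> (L \<inter> (D <#> L0))" by (rule modular_law[OF LLD(2)[OF DL0] L0D(1) c(3)])
   moreover have "L0 <#> L = L <#> L0" by (rule set_mult_commute_subgroups[OF c(4,3)])
   ultimately show ?thesis using Dsub by auto
  qed
  have LD: "L \<inter> (D <#> L0) \<in> LL" by (rule LL_Int[OF LL1 DL0])
  have "\<not> finite (L \<inter> (D <#> L0))"
  proof
   assume "finite (L \<inter> (D <#> L0))"
   hence "alm (L \<inter> (D <#> L0)) L0" by (rule finite_alm[OF LLD(2)[OF LD] s(4)])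
   hence "alm (D <#> L0) L0" using m alm_set_mult_least[OF s(4) LLD(2)[OF LD] s(4) alm_subset[OF s(4) subset_refl]] by simp
   hence "alm D L0" using alm_mono[OF LLD(2)[OF DL0] LLD(2)[OF D(1)] s(4) L0D(2) _ subset_refl] by blast
   hence "infinite (D \<inter> L0)" by (rule alm_infinite_Int[OF D(1,3) L0L])
   moreover have "D \<inter> L0 <= L0 \<inter> N" using D(2) unfolding C_def by blast
   ultimately show False using finite_subset[OF _ fin0] by blast
  qed
  hence "alm L (D <#> L0)" using atom_dichotomy[OF L(1) DL0] by blast
  hence "alm (L <#> L0) (D <#> L0)"
   by (rule alm_set_mult_least[OF s(3,4) LLD(2)[OF DL0] _ alm_subset[OF s(4) L0D(1)]])
  hence "alm C (D <#> L0)"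
   using alm_mono[OF LLD(2)[OF LL0] s(5) LLD(2)[OF DL0] _ _ subset_refl] unfolding C_def by blast
  hence CC: "alm C (C \<inter> (D <#> L0))" by (rule alm_Int[OF s(5)])
  have "(D <#> L0) \<inter> C = D <#> (L0 \<inter> C)" by (rule modular_law[OF s(5) D(2) c(4)])
  moreover have L0C: "L0 \<inter> C \<in> LL" by (rule LL_Int[OF L0L CL])
  have "finite (L0 \<inter> C)" by (rule finite_subset[OF _ fin0]) (auto simp: C_def)
  hence "alm (L0 \<inter> C) D" by (rule finite_alm[OF LLD(2)[OF L0C] LLD(2)[OF D(1)]])
  hence "alm (D <#> (L0 \<inter> C)) D"
   by (rule alm_set_mult_least[OF LLD(2)[OF D(1)] LLD(2)[OF L0C] LLD(2)[OF D(1)] alm_subset[OF LLD(2)[OF D(1)] subset_refl]])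
  ultimately have "alm (C \<inter> (D <#> L0)) D" by (simp add: Int_commute)
  hence "alm C D" by (rule alm_trans[OF s(5) LLD(2)[OF LL_Int[OF CL DL0]] LLD(2)[OF D(1)] CC])
  thus ?thesis ..
 qed
 thus "finite C \<or> atom C" unfolding atom_def using CL by blast
 have NV: "N <#> V \<in> LL" "N <#> L0 \<in> LL" by (rule LL_set_mult[OF N VL], rule LL_set_mult[OF N L0L])
 have N_NL0: "N <= N <#> L0" "L0 <= N <#> L0" using set_mult_upper1[OF c(1) s(4)] set_mult_upper2[OF s(1) c(4)] by blast+
 \<comment> \<open>Exchange: otherwise the intersection of \<open>N <#> V\<close> and
   \<open>N <#> L0\<close> would be almost contained in \<open>N\<close>, and with it
   \<open>L0\<close>.\<close>
 have VNL0: "alm V (N <#> L0)"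
 proof (rule ccontr)
  assume "\<not> ?thesis"
  hence "finite (V \<inter> (N <#> L0))" using atom_dichotomy[OF V NV(2)] by blast
  moreover have VN: "V \<inter> (N <#> L0) \<in> LL" by (rule LL_Int[OF VL NV(2)])
  ultimately have "alm (V \<inter> (N <#> L0)) N" using finite_alm[OF LLD(2) s(1)] by blast
  hence "alm (N <#> (V \<inter> (N <#> L0))) N"
   by (rule alm_set_mult_least[OF s(1) LLD(2)[OF VN] s(1) alm_subset[OF s(1) subset_refl]])
  hence 1: "alm ((N <#> V) \<inter> (N <#> L0)) N" using modular_law[OF LLD(2)[OF NV(2)] N_NL0(1) c(2)] by simp
  have "alm L0 ((N <#> V) \<inter> (N <#> L0))"
   by (rule alm_Int_both[OF s(4) LLD(2)[OF NV(1)] LLD(2)[OF NV(2)] L(4) alm_subset[OF s(4) N_NL0(2)]])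
  hence "alm L0 N" by (rule alm_trans[OF s(4) LLD(2)[OF LL_Int[OF NV]] s(1) _ 1])
  thus False using L(5) by blast
 qed
 have "alm (N <#> V) (N <#> L0)" by (rule alm_set_mult_least[OF s(1,2) LLD(2)[OF NV(2)] alm_subset[OF s(1) N_NL0(1)] VNL0])
 hence LNL0: "alm L (N <#> L0)" by (rule alm_trans[OF s(3) LLD(2)[OF NV(1)] LLD(2)[OF NV(2)] L(3)])
 have "L <= L <#> L0" "L0 <= L <#> L0" using set_mult_upper1[OF c(3) s(4)] set_mult_upper2[OF s(3) c(4)] by blast+
 hence "alm L ((L0 <#> N) \<inter> (L <#> L0))"
  using alm_Int_both[OF s(3) LLD(2)[OF NV(2)] LLD(2)[OF LL0] LNL0 alm_subset[OF s(3)]]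
   set_mult_commute_subgroups[OF c(4,1)] by simp
 thus "alm L (L0 <#> C)" using modular_law[OF LLD(2)[OF LL0] \<open>L0 <= L <#> L0\<close> c(1)] unfolding C_def by simp
qed

lemma one_LL: "{\<one>} \<in> LL"
proof -
 obtain P where "P \<in> SS" using SS_nonempty by blast
 thus ?thesis using csub_one act_one by (intro LLI[of _ P]) (auto simp: invar_def)
qed

definition msum :: "'a set list => 'a set" where "msum Vs = foldr (<#>) Vs {\<one>}"

lemma msum_LL: "(!!V. V \<in> set Vs ==> atom V) ==> msum Vs \<in> LL"
proof (induction Vs)
 case Nil
 thus ?case using one_LL by (simp add: msum_def)
next
 case (Cons V Vs)
 have "V <#> msum Vs \<in> LL" by (rule LL_set_mult[OF atomD(1) Cons.IH]) (use Cons.prems in auto)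
 thus ?case by (simp add: msum_def)
qed

text \<open>In the inductive step one atom \<open>L0\<close> not almost contained in
  \<open>N\<close> is fixed. By \<open>atom_exchange\<close> any other such atom is commensurable
  with \<open>L0\<close> or almost contained in \<open>L0 <#> C\<close> for an atom \<open>C\<close>
  of \<open>N\<close>; countably many \<open>C\<close> suffice, and \<open>pair_atoms_cc\<close>
  counts the atoms for each.\<close>

lemma sum_atoms_cc: "(!!V. V \<in> set Vs ==> atom V) ==> cc {L. atom L & alm L (msum Vs)}"
proof (induction Vs)
 case Nil
 have "{L. atom L & alm L (msum [])} = {}"
  using alm_infinite[OF atomD(1) atomD(2)] unfolding msum_def by auto
 thus ?case unfolding cc_def by (intro exI[of _ "{}"]) simp
next
 case (Cons V Vs)
 define N where "N = msum Vs"
 have V: "atom V" and NL: "N \<in> LL" using Cons.prems msum_LL[of Vs] unfolding N_def by auto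
 have eq: "msum (V # Vs) = N <#> V" using set_mult_commute_subgroups[OF LLD(3)[OF atomD(1)[OF V]] LLD(3)[OF NL]]
  by (simp add: msum_def N_def)
 have "cc {L. atom L & alm L N}" using Cons.IH Cons.prems unfolding N_def by simp
 then obtain \<C> where \<C>: "countable \<C>" "\<C> <= {L. atom L & alm L N}" "!!L. atom L ==> alm L N ==> EX M:\<C>. comm_eq L M"
  unfolding cc_def by blast
 have sub: "subgroup L H" if "atom L" for L by (rule LLD(2)[OF atomD(1)[OF that]])
 show ?case unfolding eq
 proof (cases "EX L0. atom L0 & alm L0 (N <#> V) & \<not> alm L0 N")
  case False
  show "cc {L. atom L & alm L (N <#> V)}"
   by (rule cc_of_representatives[of _ \<C>]) (use False \<C> sub in auto)
 next
  case True
  then obtain L0 where L0: "atom L0" "alm L0 (N <#> V)" "\<not> alm L0 N" by blast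
  have "EX \<D>. countable \<D> & \<D> <= {L. atom L} & (ALL L. atom L & alm L (L0 <#> C) --> (EX M:\<D>. comm_eq L M))" if "C \<in> \<C>" for C
  proof -
   have "atom C" using that \<C>(2) by blast
   hence "cc {L. atom L & alm L (L0 <#> C)}" by (rule pair_atoms_cc[OF L0(1)])
   thus ?thesis unfolding cc_def by blast
  qed
  hence "ALL C:\<C>. EX \<D>. countable \<D> & \<D> <= {L. atom L} & (ALL L. atom L & alm L (L0 <#> C) --> (EX M:\<D>. comm_eq L M))" by blast
  from bchoice[OF this] obtain \<D> where \<D>': "ALL C:\<C>. countable (\<D> C) & \<D> C <= {L. atom L} & (ALL L. atom L & alm L (L0 <#> C) --> (EX M:\<D> C. comm_eq L M))" ..
  have \<D>: "countable (\<D> C)" "\<D> C <= {L. atom L}" "!!L. atom L ==> alm L (L0 <#> C) ==> EX M:\<D> C. comm_eq L M" if "C \<in> \<C>" for C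
   using bspec[OF \<D>' that] by simp_all
  show "cc {L. atom L & alm L (N <#> V)}"
  proof (rule cc_of_representatives[of _ "insert L0 (\<C> \<union> (\<Union>C\<in>\<C>. \<D> C))"])
   show "countable (insert L0 (\<C> \<union> (\<Union>C\<in>\<C>. \<D> C)))" using \<C>(1) \<D>(1) by simp
   show "subgroup M H" if "M \<in> insert L0 (\<C> \<union> (\<Union>C\<in>\<C>. \<D> C))" for M
    using that L0(1) \<C>(2) \<D>(2) sub by blast
   fix L assume "L \<in> {L. atom L & alm L (N <#> V)}"
   hence L: "atom L" "alm L (N <#> V)" by auto
   thus "subgroup L H" using sub by blast
   show "EX M:insert L0 (\<C> \<union> (\<Union>C\<in>\<C>. \<D> C)). comm_eq L M"
   proof (cases "alm L N")
    case True
    thus ?thesis using \<C>(3)[OF L(1)] by blast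
   next
    case False
    define C where "C = N \<inter> (L <#> L0)"
    note ex = atom_exchange[OF NL V L(1) L0(1) L(2) L0(2,3), folded C_def]
    show ?thesis
    proof (cases "finite C")
     case True
     hence "alm C L0" by (rule finite_alm[OF LLD(2)[OF ex(3)] sub[OF L0(1)]])
     hence "alm (L0 <#> C) L0"
      by (rule alm_set_mult_least[OF sub[OF L0(1)] LLD(2)[OF ex(3)] sub[OF L0(1)] alm_subset[OF sub[OF L0(1)] subset_refl]])
     hence "alm L L0" by (rule alm_trans[OF sub[OF L(1)] mult_subgroups[OF sub[OF L0(1)] LLD(2)[OF ex(3)]] sub[OF L0(1)] ex(2)])
     hence "comm_eq L L0" by (rule atom_alm_comm_eq[OF atomD[OF L(1)] L0(1)])
     thus ?thesis by blast
    next
     case False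
     hence aC: "atom C" using ex(1) by blast
     have "alm C N" by (rule alm_subset[OF sub[OF aC]]) (simp add: C_def)
     then obtain C' where C': "C' \<in> \<C>" "comm_eq C C'" using \<C>(3)[OF aC] by blast
     have aC': "atom C'" using C'(1) \<C>(2) by blast
     have "alm C C'" using C'(2) unfolding comm_eq_def by blast
     hence "alm (L0 <#> C) (L0 <#> C')"
      by (rule comm_eq_set_mult[OF sub[OF L0(1)] sub[OF L0(1)] sub[OF aC] sub[OF aC'] alm_subset[OF sub[OF L0(1)] subset_refl]])
     hence "alm L (L0 <#> C')"
      by (rule alm_trans[OF sub[OF L(1)] mult_subgroups[OF sub[OF L0(1)] sub[OF aC]] mult_subgroups[OF sub[OF L0(1)] sub[OF aC']] ex(2)])
     thus ?thesis using \<D>(3)[OF C'(1) L(1)] C'(1) by blast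
    qed
   qed
  qed
 qed
qed

text \<open>Descending chains starting at \<open>L\<close>, each of the \<open>n\<close> steps of
  infinite index. The last group only has to contain \<open>K\<close>, possibly with finite
  index.\<close>

primrec chain :: "nat => 'a set => 'a set => bool" where
 "chain 0 K L \<longleftrightarrow> K <= L"
| "chain (Suc n) K L \<longleftrightarrow> (EX P:LL. K <= P & P <= L & \<not> alm L P & chain n K P)"

lemma chain_mono_right:
 assumes "chain n K L" "L <= L'" "L \<in> LL" "L' \<in> LL" shows "chain n K L'"
proof (cases n)
 case (Suc m)
 then obtain P where P: "P \<in> LL" "K <= P" "P <= L" "\<not> alm L P" "chain m K P" using assms(1) by auto
 have "\<not> alm L' P" using alm_mono[OF LLD(2)[OF assms(4)] LLD(2)[OF assms(3)] LLD(2)[OF P(1)] assms(2) _ subset_refl] P(4) by blast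
 thus ?thesis using P assms(2) Suc by auto
qed (use assms in auto)

text \<open>If no finite sum of atoms almost contained every atom, adding a missing one again and
  again would produce arbitrarily long chains.\<close>

theorem atoms_cc:
 assumes "\<not> chain n {\<one>} (carrier H)"
 shows "cc {L. atom L}"
proof -
 have "EX Vs. (ALL V:set Vs. atom V) & (ALL L. atom L --> alm L (msum Vs))"
 proof (rule ccontr)
  assume neg: "\<not> ?thesis"
  have "EX Vs. (ALL V:set Vs. atom V) & chain k {\<one>} (msum Vs)" for k
  proof (induction k)
   case 0
   thus ?case by (intro exI[of _ "[]"]) (simp add: msum_def)
  next
   case (Suc k)
   then obtain Vs where Vs: "ALL V:set Vs. atom V" "chain k {\<one>} (msum Vs)" by blast
   then obtain L where L: "atom L" "\<not> alm L (msum Vs)" using neg by blast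
   have VL: "msum Vs \<in> LL" using Vs(1) by (intro msum_LL) blast
   have LL1: "L \<in> LL" by (rule atomD(1)[OF L(1)])
   have e: "msum (L # Vs) = L <#> msum Vs" by (simp add: msum_def)
   have LV: "L <#> msum Vs \<in> LL" by (rule LL_set_mult[OF LL1 VL])
   have "\<not> alm (L <#> msum Vs) (msum Vs)"
    using alm_mono[OF LLD(2)[OF LV] LLD(2)[OF LL1] LLD(2)[OF VL] set_mult_upper1[OF LLD(3)[OF LL1] LLD(2)[OF VL]] _ subset_refl] L(2) by blast
   moreover have "msum Vs <= L <#> msum Vs" by (rule set_mult_upper2[OF LLD(2)[OF LL1] LLD(3)[OF VL]])
   moreover have "{\<one>} <= msum Vs" using subgroup.one_closed[OF LLD(2)[OF VL]] by simp
   ultimately have "chain (Suc k) {\<one>} (msum (L # Vs))" unfolding e using Vs(2) VL by auto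
   thus ?case using Vs(1) L(1) by (intro exI[of _ "L # Vs"]) simp
  qed
  then obtain Vs where Vs: "ALL V:set Vs. atom V" "chain n {\<one>} (msum Vs)" by blast
  have VL: "msum Vs \<in> LL" using Vs(1) by (intro msum_LL) blast
  obtain P where "P \<in> SS" using SS_nonempty by blast
  hence "carrier H \<in> LL" using csub_carrier act_closed by (intro LLI[of _ P]) (auto simp: invar_def)
  hence "chain n {\<one>} (carrier H)" by (rule chain_mono_right[OF Vs(2) LLD(3)[OF VL] VL])
  thus False using assms by blast
 qed
 then obtain Vs where Vs: "ALL V:set Vs. atom V" "ALL L. atom L --> alm L (msum Vs)" by blast
 have "cc {L. atom L & alm L (msum Vs)}" using Vs(1) by (intro sum_atoms_cc) blast
 moreover have "{L. atom L & alm L (msum Vs)} = {L. atom L}" using Vs(2) by blast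
 ultimately show ?thesis by simp
qed

end

section \<open>Quotients of compact spaces and groups\<close>

text \<open>The saturation of a closed set \<open>C\<close> is a projection of the part of
  \<open>E\<close> over \<open>C\<close> along a compact factor. So \<open>q\<close> is a closed
  map, and closed continuous images of normal Hausdorff spaces are Hausdorff.\<close>

lemma compact_Hausdorff_quotient:
 assumes X: "compact_space X" "Hausdorff_space X" and cl: "closedin (prod_topology X X) E"
  and E: "!!s t. s \<in> topspace X ==> t \<in> topspace X ==> q s = q t \<longleftrightarrow> (s, t) \<in> E"
 shows "compact_space (quotient_topology X q)" "Hausdorff_space (quotient_topology X q)"
proof -
 let ?Q = "quotient_topology X q"
 have q: "quotient_map X ?Q q" by (rule quotient_map_quotient_topology)
 hence im: "q ` topspace X = topspace ?Q" by (simp add: quotient_map_def)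
 have cont: "continuous_map X ?Q q" by (rule quotient_imp_continuous_map[OF q])
 have clq: "closed_map X ?Q q"
  unfolding closed_map_def
 proof (intro allI impI)
  fix C assume C: "closedin X C"
  have Cs: "C <= topspace X" by (rule closedin_subset[OF C])
  have "{x \<in> topspace X. q x \<in> q ` C} = snd ` (E \<inter> (C \<times> topspace X))"
  proof
   show "{x \<in> topspace X. q x \<in> q ` C} <= snd ` (E \<inter> (C \<times> topspace X))"
   proof
    fix x assume "x \<in> {x \<in> topspace X. q x \<in> q ` C}"
    then obtain c where c: "x \<in> topspace X" "c \<in> C" "q c = q x" by auto
    hence "(c, x) \<in> E \<inter> (C \<times> topspace X)" using E Cs by blast
    thus "x \<in> snd ` (E \<inter> (C \<times> topspace X))" by (rule image_eqI[rotated]) simp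
   qed
   show "snd ` (E \<inter> (C \<times> topspace X)) <= {x \<in> topspace X. q x \<in> q ` C}"
   proof
    fix x assume "x \<in> snd ` (E \<inter> (C \<times> topspace X))"
    then obtain c where c: "(c, x) \<in> E" "c \<in> C" "x \<in> topspace X" by auto
    hence "q c = q x" using E Cs by blast
    thus "x \<in> {x \<in> topspace X. q x \<in> q ` C}" using c by (metis (mono_tags) image_eqI mem_Collect_eq)
   qed
  qed
  moreover have "closedin X (snd ` (E \<inter> (C \<times> topspace X)))"
   using closed_map_snd[OF X(1), of X] closedin_Int[OF cl, of "C \<times> topspace X"] C
   unfolding closed_map_def by (simp add: closedin_prod_Times_iff)
  ultimately have "closedin X {x \<in> topspace X. q x \<in> q ` C}" by simp
  moreover have "q ` C <= topspace ?Q" unfolding im[symmetric] by (rule image_mono[OF Cs])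
  moreover have "!!U. U <= topspace ?Q ==> closedin X {x \<in> topspace X. q x \<in> U} ==> closedin ?Q U"
   using q unfolding quotient_map_closedin by (elim conjE allE impE) (assumption, erule iffD1)
  ultimately show "closedin ?Q (q ` C)" by simp
 qed
 show "compact_space ?Q" unfolding compact_space_def im[symmetric]
  by (rule image_compactin[OF X(1)[unfolded compact_space_def] cont])
 show "Hausdorff_space ?Q"
  using normal_Hausdorff_space_closed_continuous_map_image[OF compact_Hausdorff_or_regular_imp_normal_space X(2) clq cont im] X by blast
qed

text \<open>The preimage of \<open>C\<close> is the projection of a closed part of the graph along
  the compact factor \<open>Y\<close>.\<close>

lemma closed_graph_continuous:
 assumes Y: "compact_space Y" and f: "!!x. x \<in> topspace X ==> f x \<in> topspace Y"
  and cl: "closedin (prod_topology X Y) {(x, f x) | x. x \<in> topspace X}"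
 shows "continuous_map X Y f"
 unfolding continuous_map_closedin
proof (intro conjI allI impI)
 show "f \<in> topspace X \<rightarrow> topspace Y" using f by blast
 fix C assume C: "closedin Y C"
 have "{x \<in> topspace X. f x \<in> C} = fst ` ({(x, f x) | x. x \<in> topspace X} \<inter> (topspace X \<times> C))" by force
 moreover have "closedin X (fst ` ({(x, f x) | x. x \<in> topspace X} \<inter> (topspace X \<times> C)))"
  using closed_map_fst[OF Y, of X] closedin_Int[OF cl, of "topspace X \<times> C"] C
  unfolding closed_map_def by (simp add: closedin_prod_Times_iff)
 ultimately show "closedin X {x \<in> topspace X. f x \<in> C}" by simp
qed

text \<open>Unlike bases, networks pass to continuous images, so this carries second countability to
  quotients and to unions of orbits. A base is obtained by choosing disjoint open supersets for
  every pair of members of the network that has some, and intersecting finitely many of them;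
  compactness of the complement of \<open>U\<close> shows that finitely many suffice.\<close>

lemma second_countable_of_network:
 assumes X: "compact_space X" "Hausdorff_space X" and N: "countable \<N>"
  and net: "!!U x. openin X U ==> x \<in> U ==> EX N:\<N>. x \<in> N & N <= U"
 shows "second_countable X"
proof -
 define sep where "sep = (%(M, N) (U, V). openin X U & openin X V & M <= U & N <= V & U \<inter> V = {})"
 define D where "D = {z \<in> \<N> \<times> \<N>. EX w. sep z w}"
 define s where "s z = (SOME w. sep z w)" for z
 have s: "sep z (s z)" if "z \<in> D" for z using that unfolding D_def s_def by (auto intro: someI)
 have s': "openin X (fst (s z))" "openin X (snd (s z))" "fst z <= fst (s z)" "snd z <= snd (s z)" "fst (s z) \<inter> snd (s z) = {}"
  if "z \<in> D" for z using s[OF that] unfolding sep_def by (auto simp: case_prod_unfold)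
 let ?B = "(%F. topspace X \<inter> (\<Inter>z\<in>F. fst (s z))) ` {F. finite F & F <= D}"
 have "countable D" unfolding D_def by (rule countable_subset[of _ "\<N> \<times> \<N>"]) (use N in auto)
 hence "countable ?B" by (intro countable_image countable_Collect_finite_subset)
 moreover have "openin X V" if V: "V \<in> ?B" for V
 proof -
  obtain F where F: "V = topspace X \<inter> (\<Inter>z\<in>F. fst (s z))" "F \<in> {F. finite F & F <= D}" by (rule imageE[OF V])
  hence F: "finite F" "F <= D" "V = topspace X \<inter> (\<Inter>z\<in>F. fst (s z))" by simp_all
  show ?thesis
  proof (cases "F = {}")
   case False
   show ?thesis unfolding F(3) by (intro openin_Int openin_topspace openin_INT2[OF F(1) False] s'(1) subsetD[OF F(2)])
  qed (use F(3) in simp)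
 qed
 moreover have "EX V:?B. x \<in> V & V <= U" if U: "openin X U" "x \<in> U" for U x
 proof -
  have xX: "x \<in> topspace X" using U openin_subset by blast
  have "compactin X (topspace X - U)" using closedin_compact_space[OF X(1)] U(1) by blast
  moreover have "!!V. V \<in> {snd (s z) | z. z \<in> D & x \<in> fst (s z)} ==> openin X V" using s'(2) by blast
  moreover have "topspace X - U <= \<Union>{snd (s z) | z. z \<in> D & x \<in> fst (s z)}"
  proof
   fix y assume y: "y \<in> topspace X - U"
   hence "y ~= x" using U(2) by blast
   hence "x \<in> topspace X & y \<in> topspace X & x ~= y" using xX y by blast
   from X(2)[unfolded Hausdorff_space_def, rule_format, OF this]
   obtain O1 O2 where O: "openin X O1" "openin X O2" "x \<in> O1" "y \<in> O2" "disjnt O1 O2" by (elim exE conjE)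
   obtain N1 where N1: "N1 \<in> \<N>" "x \<in> N1" "N1 <= O1" using net[OF O(1,3)] by blast
   obtain N2 where N2: "N2 \<in> \<N>" "y \<in> N2" "N2 <= O2" using net[OF O(2,4)] by blast
   have "sep (N1, N2) (O1, O2)" unfolding sep_def using O N1 N2 by (simp add: disjnt_def)
   hence z: "(N1, N2) \<in> D" unfolding D_def using N1(1) N2(1) by blast
   show "y \<in> \<Union>{snd (s z) | z. z \<in> D & x \<in> fst (s z)}" using s'(3,4)[OF z] N1(2) N2(2) z by auto
  qed
  ultimately obtain \<F> where F: "finite \<F>" "\<F> <= {snd (s z) | z. z \<in> D & x \<in> fst (s z)}" "topspace X - U <= \<Union>\<F>"
   by (metis (no_types, lifting) compactinD)
  have "\<F> <= (%z. snd (s z)) ` {z \<in> D. x \<in> fst (s z)}" using F(2) by blast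
  then obtain Z where Z: "finite Z" "Z <= {z \<in> D. x \<in> fst (s z)}" "\<F> = (%z. snd (s z)) ` Z" using F(1) by (meson finite_subset_image)
  let ?V = "topspace X \<inter> (\<Inter>z\<in>Z. fst (s z))"
  have "?V <= U"
  proof
   fix y assume y: "y \<in> ?V"
   show "y \<in> U"
   proof (rule ccontr)
    assume "y \<notin> U"
    then obtain z where z: "z \<in> Z" "y \<in> snd (s z)" using F(3) y Z(3) by blast
    thus False using s'(5)[of z] Z(2) y by blast
   qed
  qed
  moreover have "x \<in> ?V" using xX Z(2) by blast
  moreover have "?V \<in> ?B" by (rule imageI) (use Z(1,2) in auto)
  ultimately show ?thesis by (intro bexI[of _ ?V] conjI)
 qed
 ultimately show ?thesis unfolding second_countable_def by (intro exI[of _ ?B] conjI allI ballI impI) (assumption | elim conjE)+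
qed

context compact_abelian_group
begin

lemma coset_eq_iff:
 assumes K: "subgroup K H" and x: "x \<in> carrier H" "y \<in> carrier H"
 shows "K #> x = K #> y \<longleftrightarrow> x \<otimes> inv y \<in> K"
proof
 assume "K #> x = K #> y"
 hence "x \<in> K #> y" using rcos_self[OF x(1) K] by simp
 then obtain k where k: "k \<in> K" "x = k \<otimes> y" unfolding r_coset_def by blast
 hence "x \<otimes> inv y = k" using x subgroup.mem_carrier[OF K] by (simp add: m_assoc)
 thus "x \<otimes> inv y \<in> K" using k by simp
next
 assume k: "x \<otimes> inv y \<in> K"
 have "x = (x \<otimes> inv y) \<otimes> y" using x by (simp add: m_assoc)
 hence "x \<in> K #> y" using k unfolding r_coset_def by blast
 thus "K #> x = K #> y" using repr_independence[OF _ x(2) K] by simp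
qed

definition quot_top :: "'a set => 'a set topology" where
 "quot_top K = quotient_topology T (%x. K #> x)"

text \<open>The operations are continuous because their graphs are continuous images of compact
  sets, hence closed.\<close>

lemma quotient_group:
 assumes K: "csub K"
 shows "compact_abelian_group (H Mod K) (quot_top K)" "quotient_map T (quot_top K) (%x. K #> x)"
  "continuous_map T (quot_top K) (%x. K #> x)"
proof -
 let ?p = "%x. K #> x" and ?T = "quot_top K" and ?M = "H Mod K"
 note Ks = csubD(1)[OF K]
 have normal: "K \<lhd> H" by (rule subgroup_imp_normal[OF Ks])
 show q: "quotient_map T ?T ?p" unfolding quot_top_def by (rule quotient_map_quotient_topology)
 show cont: "continuous_map T ?T ?p" by (rule quotient_imp_continuous_map[OF q])
 have top: "topspace ?T = ?p ` carrier H" using q unfolding quotient_map_def topspace_T by blast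
 have carM: "carrier ?M = ?p ` carrier H" by (rule carrier_FactGroup)
 have cl: "closedin (prod_topology T T) {z \<in> topspace (prod_topology T T). (case z of (x, y) => x \<otimes> inv y) \<in> K}"
  by (rule closedin_continuous_map_preimage[OF div_cont csubD(2)[OF K]])
 note compact_Hausdorff_quotient[OF compact_T Hausdorff_T cl, of ?p, folded quot_top_def]
 hence Q: "compact_space ?T" "Hausdorff_space ?T" using coset_eq_iff[OF Ks] topspace_T by simp_all
 have closed_image: "closedin Z (f ` topspace Y)" if "compact_space Y" "Hausdorff_space Z" "continuous_map Y Z f" for f :: "'b => 'c" and Y Z
  by (rule compactin_imp_closedin[OF that(2) image_compactin[OF _ that(3)]]) (use that(1) in \<open>simp add: compact_space_def\<close>)
 have pp: "continuous_map (prod_topology T T) (prod_topology ?T ?T) (%z. (?p (fst z), ?p (snd z)))"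
  using continuous_map_compose[OF continuous_map_fst cont, of T] continuous_map_compose[OF continuous_map_snd cont, of T]
  by (intro continuous_map_pairedI) (simp_all add: o_def)
 show "compact_abelian_group ?M ?T"
 proof (intro compact_abelian_group.intro compact_abelian_group_axioms.intro)
  show "comm_group ?M" by (rule abelian_FactGroup[OF Ks])
  show "topspace ?T = carrier ?M" unfolding top carM ..
  show "compact_space ?T" "Hausdorff_space ?T" by (rule Q)+
  show "continuous_map ?T ?T (%a. inv\<^bsub>?M\<^esub> a)"
  proof (rule closed_graph_continuous[OF Q(1)])
   have iM: "inv\<^bsub>?M\<^esub> ?p x = ?p (inv x)" if "x \<in> carrier H" for x
    using normal.inv_FactGroup[OF normal imageI[OF that, of ?p, folded carM]] normal.rcos_inv[OF normal that] by simp
   show "inv\<^bsub>?M\<^esub> a \<in> topspace ?T" if "a \<in> topspace ?T" for a using that iM unfolding top by auto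
   have "continuous_map T (prod_topology ?T ?T) (%x. (?p x, ?p (inv x)))"
    using cont continuous_map_compose[OF inv_cont cont] by (intro continuous_map_pairedI) (simp_all add: o_def)
   from closed_image[OF compact_T Hausdorff_space_prod_topology[THEN iffD2, OF disjI2] this] Q(2)
   have "closedin (prod_topology ?T ?T) ((%x. (?p x, ?p (inv x))) ` carrier H)" unfolding topspace_T by simp
   moreover have "(%x. (?p x, ?p (inv x))) ` carrier H = {(a, inv\<^bsub>?M\<^esub> a) | a. a \<in> topspace ?T}" unfolding top using iM by force
   ultimately show "closedin (prod_topology ?T ?T) {(a, inv\<^bsub>?M\<^esub> a) | a. a \<in> topspace ?T}" by simp
  qed
  show "continuous_map (prod_topology ?T ?T) ?T (%(a, b). a \<otimes>\<^bsub>?M\<^esub> b)"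
  proof (rule closed_graph_continuous[OF Q(1)])
   have mM: "?p x \<otimes>\<^bsub>?M\<^esub> ?p y = ?p (x \<otimes> y)" if "x \<in> carrier H" "y \<in> carrier H" for x y using normal.rcos_sum[OF normal that] by simp
   show "(case z of (a, b) => a \<otimes>\<^bsub>?M\<^esub> b) \<in> topspace ?T" if "z \<in> topspace (prod_topology ?T ?T)" for z
    using that mM unfolding topspace_prod_topology top by auto
   let ?f = "%z. ((?p (fst z), ?p (snd z)), ?p (fst z \<otimes> snd z))"
   have "continuous_map (prod_topology T T) (prod_topology (prod_topology ?T ?T) ?T) ?f"
    using continuous_map_compose[OF mult_cont cont] by (intro continuous_map_pairedI[OF pp]) (simp add: o_def case_prod_unfold)
   from closed_image[OF _ _ this] Q(2) compact_T
   have "closedin (prod_topology (prod_topology ?T ?T) ?T) (?f ` (carrier H \<times> carrier H))"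
    unfolding topspace_prod_topology topspace_T by (simp add: compact_space_prod_topology Hausdorff_space_prod_topology)
   moreover have "topspace (prod_topology ?T ?T) = (%z. (?p (fst z), ?p (snd z))) ` (carrier H \<times> carrier H)"
    unfolding topspace_prod_topology top by force
   hence "{(z, case z of (a, b) => a \<otimes>\<^bsub>?M\<^esub> b) | z. z \<in> topspace (prod_topology ?T ?T)} = ?f ` (carrier H \<times> carrier H)"
    unfolding Setcompr_eq_image Collect_mem_eq by (simp only: image_image, intro image_cong) (auto simp: normal.rcos_sum[OF normal])
   ultimately show "closedin (prod_topology (prod_topology ?T ?T) ?T) {(z, case z of (a, b) => a \<otimes>\<^bsub>?M\<^esub> b) | z. z \<in> topspace (prod_topology ?T ?T)}" by simp
  qed
 qed
qed

end

section \<open>Minimal groups over a given one\<close>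

context inv_setting
begin

lemma chain_mono_left: "chain n K L ==> K' <= K ==> chain n K' L"
proof (induction n arbitrary: L)
 case (Suc n)
 then obtain P where P: "P \<in> LL" "K <= P" "P <= L" "\<not> alm L P" "chain n K P" by auto
 hence "chain n K' P" "K' <= P" using Suc by auto
 thus ?case using P by auto
qed auto

text \<open>The groups counted here are the preimages of the atoms of \<open>H Mod K\<close>. The
  proof transports closedness, invariance, finite index and chains along the projection
  \<open>?p\<close>, and verifies the assumptions of \<open>inv_setting\<close> for the
  quotient.\<close>

theorem relative_atoms_cc:
 assumes rank: "\<not> chain n {\<one>} (carrier H)" and K: "K \<in> LL"
 shows "cc {L \<in> LL. K <= L & \<not> alm L K & (ALL C:LL. K <= C & C <= L --> alm C K \<or> alm L C)}"
proof -
 let ?p = "%x. K #> x" and ?T = "quot_top K" and ?M = "H Mod K"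
 note Kl = LLD(1)[OF K] and Ks = LLD(2)[OF K] and Kc = LLD(3)[OF K]
 note quo = quotient_group[OF Kl]
 have normal: "K \<lhd> H" by (rule subgroup_imp_normal[OF Ks])
 interpret M: compact_abelian_group ?M ?T by (rule quo(1))
 have carM: "carrier ?M = ?p ` carrier H" by (rule carrier_FactGroup)
 have pm: "?p x \<otimes>\<^bsub>?M\<^esub> ?p y = ?p (x \<otimes> y)" if "x \<in> carrier H" "y \<in> carrier H" for x y
  using normal.rcos_sum[OF normal that] by simp
 have pc: "?p x \<in> carrier ?M" if "x \<in> carrier H" for x using that carM by blast
 have pi: "inv\<^bsub>?M\<^esub> ?p x = ?p (inv x)" if "x \<in> carrier H" for x
  using normal.inv_FactGroup[OF normal pc[OF that]] normal.rcos_inv[OF normal that] by simp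
 have p1: "\<one>\<^bsub>?M\<^esub> = ?p \<one>" using Kc by simp
 define pre where "pre \<A> = {x \<in> carrier H. ?p x \<in> \<A>}" for \<A> :: "'a set set"
 have pre_c: "pre \<A> <= carrier H" for \<A> unfolding pre_def by blast
 have p_pre: "?p ` pre \<A> = \<A>" if "\<A> <= carrier ?M" for \<A> using that unfolding pre_def carM by blast
 have K_pre: "K <= pre \<A>" if "\<one>\<^bsub>?M\<^esub> \<in> \<A>" for \<A>
 proof
  fix k assume k: "k \<in> K"
  hence "?p k = K" using coset_join2[OF _ Ks k] Kc by blast
  thus "k \<in> pre \<A>" unfolding pre_def using that k Kc by auto
 qed
 have pre_csub: "csub (pre \<A>)" if "M.csub \<A>" for \<A>
 proof -
  note As = M.csubD(1)[OF that]
  have "closedin T {x \<in> topspace T. ?p x \<in> \<A>}" by (rule closedin_continuous_map_preimage[OF quo(3) M.csubD(2)[OF that]])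
  hence "closedin T (pre \<A>)" unfolding pre_def topspace_T .
  moreover have "subgroup (pre \<A>) H"
  proof (rule subgroupI)
   show "pre \<A> <= carrier H" by (rule pre_c)
   show "pre \<A> ~= {}" using K_pre[OF subgroup.one_closed[OF As]] subgroup.one_closed[OF Ks] by blast
   show "inv a \<in> pre \<A>" if "a \<in> pre \<A>" for a
    using that subgroup.m_inv_closed[OF As, of "?p a"] pi[of a] unfolding pre_def by auto
   show "a \<otimes> b \<in> pre \<A>" if "a \<in> pre \<A>" "b \<in> pre \<A>" for a b
    using that subgroup.m_closed[OF As, of "?p a" "?p b"] pm[of a b] unfolding pre_def by auto
  qed
  ultimately show ?thesis by (simp add: csub_def)
 qed
 have pre_p: "pre (?p ` A) = A" if "subgroup A H" "K <= A" for A
 proof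
  show "A <= pre (?p ` A)" using subgroup.subset[OF that(1)] unfolding pre_def by blast
  show "pre (?p ` A) <= A"
  proof
   fix x assume "x \<in> pre (?p ` A)"
   then obtain a where a: "x \<in> carrier H" "a \<in> A" "?p x = ?p a" unfolding pre_def by blast
   have ac: "a \<in> carrier H" using a(2) subgroup.subset[OF that(1)] by blast
   have "x \<otimes> inv a \<in> A" using coset_eq_iff[OF Ks a(1) ac] a(3) that(2) by blast
   hence "(x \<otimes> inv a) \<otimes> a \<in> A" by (rule subgroup.m_closed[OF that(1) _ a(2)])
   thus "x \<in> A" using a(1) ac by (simp add: m_assoc)
  qed
 qed
 have p_csub: "M.csub (?p ` A)" if "csub A" for A
 proof -
  have "closedin ?T (?p ` A)" by (rule M.closed_compactin, rule image_compactin[OF compactin_closed[OF csubD(2)[OF that]] quo(3)])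
  moreover have "subgroup (?p ` A) ?M"
  proof (rule M.subgroupI)
   show "?p ` A <= carrier ?M" using csubD(3)[OF that] carM by blast
   show "?p ` A ~= {}" using subgroup.one_closed[OF csubD(1)[OF that]] by blast
   fix a b assume "a \<in> ?p ` A"
   then obtain x where x: "x \<in> A" "a = ?p x" by blast
   have xc: "x \<in> carrier H" using x csubD(3)[OF that] by blast
   show "inv\<^bsub>?M\<^esub> a \<in> ?p ` A" using x pi[OF xc] subgroup.m_inv_closed[OF csubD(1)[OF that] x(1)] by simp
   assume "b \<in> ?p ` A"
   then obtain y where y: "y \<in> A" "b = ?p y" by blast
   have yc: "y \<in> carrier H" using y csubD(3)[OF that] by blast
   show "a \<otimes>\<^bsub>?M\<^esub> b \<in> ?p ` A" unfolding x(2) y(2) pm[OF xc yc] by (rule imageI) (rule subgroup.m_closed[OF csubD(1)[OF that] x(1) y(1)])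
  qed
  ultimately show ?thesis by (simp add: M.csub_def)
 qed
 have alm_p: "M.alm (?p ` A) (?p ` B)" if AB: "subgroup A H" "alm A B" "B <= carrier H" for A B
 proof -
  obtain F where F: "finite F" "F <= A" "!!a. a \<in> A ==> EX f:F. inv f \<otimes> a \<in> B" by (rule almE[OF AB(2)], rule that)
  show ?thesis
  proof (rule M.almI'[of "?p ` F"])
   show "finite (?p ` F)" "?p ` F <= ?p ` A" using F by auto
   fix a assume "a \<in> ?p ` A"
   then obtain x where x: "x \<in> A" "a = ?p x" by blast
   obtain f where f: "f \<in> F" "inv f \<otimes> x \<in> B" using F(3)[OF x(1)] by blast
   have c: "f \<in> carrier H" "x \<in> carrier H" using f(1) F(2) x(1) subgroup.subset[OF AB(1)] by blast+
   have "inv\<^bsub>?M\<^esub> (?p f) \<otimes>\<^bsub>?M\<^esub> a = ?p (inv f \<otimes> x)" using pi[OF c(1)] pm[OF inv_closed[OF c(1)] c(2)] x(2) by simp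
   thus "EX f:?p ` F. inv\<^bsub>?M\<^esub> f \<otimes>\<^bsub>?M\<^esub> a \<in> ?p ` B" using f by (intro bexI[OF _ imageI[OF f(1)]]) simp
  qed
 qed
 have alm_pre: "alm (pre \<A>) (pre \<B>)" if AB: "M.csub \<A>" "M.csub \<B>" "M.alm \<A> \<B>" for \<A> \<B>
 proof -
  obtain F where F: "finite F" "F <= \<A>" "!!a. a \<in> \<A> ==> EX f:F. inv\<^bsub>?M\<^esub> f \<otimes>\<^bsub>?M\<^esub> a \<in> \<B>" by (rule M.almE[OF AB(3)], rule that)
  define r where "r f = (SOME x. x \<in> carrier H & ?p x = f)" for f
  have r: "r f \<in> carrier H & ?p (r f) = f" if "f \<in> F" for f
  proof -
   have "f \<in> ?p ` carrier H" using subsetD[OF M.csubD(3)[OF AB(1)] subsetD[OF F(2) that]] unfolding carM .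
   hence "EX x. x \<in> carrier H & ?p x = f" by auto
   thus ?thesis unfolding r_def by (rule someI_ex)
  qed
  show ?thesis
  proof (rule almI'[of "r ` F"])
   show "finite (r ` F)" using F by simp
   show "r ` F <= pre \<A>" using r F(2) unfolding pre_def by auto
   fix x assume x: "x \<in> pre \<A>"
   hence xc: "x \<in> carrier H" "?p x \<in> \<A>" unfolding pre_def by auto
   obtain f where f: "f \<in> F" "inv\<^bsub>?M\<^esub> f \<otimes>\<^bsub>?M\<^esub> ?p x \<in> \<B>" using F(3)[OF xc(2)] by blast
   note rf = r[OF f(1)]
   have "inv\<^bsub>?M\<^esub> f \<otimes>\<^bsub>?M\<^esub> ?p x = ?p (inv (r f) \<otimes> x)" using pi[of "r f"] pm[of "inv (r f)" x] rf xc by simp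
   hence "inv (r f) \<otimes> x \<in> pre \<B>" using f(2) rf xc unfolding pre_def by simp
   thus "EX f:r ` F. inv f \<otimes> x \<in> pre \<B>" using f(1) by blast
  qed
 qed
 \<comment> \<open>Exactly the acting sets that permute the cosets of \<open>K\<close>.\<close>
 define SK where "SK = {P \<in> SS. invar P K}"
 define act' where "act' g c = act g ` c" for g and c :: "'a set"
 have act': "act' g (?p x) = ?p (act g x)" if P: "P \<in> SK" "g \<in> P" and x: "x \<in> carrier H" for P g x
 proof -
  have PS: "P \<in> SS" "invar P K" using P unfolding SK_def by auto
  obtain g' where g': "g' \<in> P" "ALL h:carrier H. act g' (act g h) = h & act g (act g' h) = h" using act_inverse[OF PS(1) P(2)] by blast
  show ?thesis
  proof
   show "act' g (?p x) <= ?p (act g x)"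
   proof
    fix z assume "z \<in> act' g (?p x)"
    then obtain k where k: "k \<in> K" "z = act g (k \<otimes> x)" unfolding act'_def r_coset_def by blast
    hence "z = act g k \<otimes> act g x" using act_mult[OF PS(1) P(2) _ x] Kc by auto
    thus "z \<in> ?p (act g x)" using invarD[OF PS(2) P(2) k(1)] unfolding r_coset_def by blast
   qed
   show "?p (act g x) <= act' g (?p x)"
   proof
    fix z assume "z \<in> ?p (act g x)"
    then obtain k where k: "k \<in> K" "z = k \<otimes> act g x" unfolding r_coset_def by blast
    have kc: "k \<in> carrier H" using k(1) Kc by blast
    have k': "act g' k \<in> K" by (rule invarD[OF PS(2) g'(1) k(1)])
    have "act g (act g' k \<otimes> x) = act g (act g' k) \<otimes> act g x" using act_mult[OF PS(1) P(2) _ x] k' Kc by blast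
    hence "z = act g (act g' k \<otimes> x)" using g'(2) kc k(2) by simp
    thus "z \<in> act' g (?p x)" using k' unfolding act'_def r_coset_def by blast
   qed
  qed
 qed
 have SKS: "P \<in> SS" "invar P K" if "P \<in> SK" for P using that unfolding SK_def by auto
 interpret Q: inv_setting ?M ?T act' SK
 proof
  show "SK ~= {}" using LL_invar[OF K] unfolding SK_def by blast
  show "EX R:SK. R <= P & R <= Q" if PQ: "P \<in> SK" "Q \<in> SK" for P Q
  proof -
   obtain R where R: "R \<in> SS" "R <= P" "R <= Q" using directed[OF SKS(1)[OF PQ(1)] SKS(1)[OF PQ(2)]] by blast
   hence "R \<in> SK" unfolding SK_def using invar_mono[OF SKS(2)[OF PQ(1)]] by blast
   thus ?thesis using R by blast
  qed
  fix P g assume P: "P \<in> SK"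
  {
   assume g: "g \<in> P"
   note PS = SKS(1)[OF P]
   show "act' g \<in> hom ?M ?M"
   proof (rule homI)
    fix a b assume "a \<in> carrier ?M" "b \<in> carrier ?M"
    then obtain x y where xy: "x \<in> carrier H" "y \<in> carrier H" "a = ?p x" "b = ?p y" unfolding carM by blast
    show "act' g (a \<otimes>\<^bsub>?M\<^esub> b) = act' g a \<otimes>\<^bsub>?M\<^esub> act' g b"
     unfolding xy(3,4) pm[OF xy(1,2)] act'[OF P g m_closed[OF xy(1,2)]] act'[OF P g xy(1)] act'[OF P g xy(2)]
      pm[OF act_closed[OF PS g xy(1)] act_closed[OF PS g xy(2)]] act_mult[OF PS g xy(1,2)] ..
   next
    fix a assume "a \<in> carrier ?M"
    then obtain x where x: "x \<in> carrier H" "a = ?p x" unfolding carM by blast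
    show "act' g a \<in> carrier ?M" unfolding x(2) act'[OF P g x(1)] by (rule pc[OF act_closed[OF PS g x(1)]])
   qed
   show "continuous_map ?T ?T (act' g)"
   proof (rule continuous_compose_quotient_map[OF quo(2)])
    have "continuous_map T ?T (?p \<circ> act g)" by (rule continuous_map_compose[OF act_cont[OF PS g] quo(3)])
    moreover have "(?p \<circ> act g) x = (act' g \<circ> ?p) x" if "x \<in> topspace T" for x
     using act'[OF P g, of x] that topspace_T by simp
    ultimately show "continuous_map T ?T (act' g \<circ> ?p)" by (rule continuous_map_eq)
   qed
   obtain g' where g': "g' \<in> P" "ALL h:carrier H. act g' (act g h) = h & act g (act g' h) = h" using act_inverse[OF PS g] by blast
   have "act' g' (act' g a) = a & act' g (act' g' a) = a" if AA: "a \<in> carrier ?M" for a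
   proof -
    obtain x where x: "x \<in> carrier H" "a = ?p x" by (rule imageE[OF AA[unfolded carM]], rule that)
    have "act g' (act g x) = x" "act g (act g' x) = x" using g'(2) x(1) by simp_all
    thus ?thesis unfolding x(2) act'[OF P g x(1)] act'[OF P g'(1) x(1)] act'[OF P g'(1) act_closed[OF PS g x(1)]]
     act'[OF P g act_closed[OF PS g'(1) x(1)]] by simp
   qed
   thus "EX g':P. ALL h:carrier ?M. act' g' (act' g h) = h & act' g (act' g' h) = h" by (intro bexI[OF _ g'(1)] ballI)
   fix k assume k: "k \<in> P"
   obtain m where m: "m \<in> P" "ALL h:carrier H. act m h = act g (act k h)" using act_comp[OF PS g k] by blast
   have "act' m a = act' g (act' k a)" if AA: "a \<in> carrier ?M" for a
   proof -
    obtain x where x: "x \<in> carrier H" "a = ?p x" by (rule imageE[OF AA[unfolded carM]], rule that)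
    have "act m x = act g (act k x)" using m(2) x(1) by simp
    thus ?thesis unfolding x(2) act'[OF P m(1) x(1)] act'[OF P k x(1)] act'[OF P g act_closed[OF PS k x(1)]] by simp
   qed
   thus "EX g'':P. ALL h:carrier ?M. act' g'' h = act' g (act' k h)" by (intro bexI[OF _ m(1)] ballI)
  }
  obtain C where C: "countable C" "C <= carrier H" "ALL h:carrier H. EX c:C. EX g:P. h = act g c" using countable_orbits[OF SKS(1)[OF P]] by blast
  have "EX c:?p ` C. EX g:P. a = act' g c" if AA: "a \<in> carrier ?M" for a
  proof -
   obtain x where x: "x \<in> carrier H" "a = ?p x" by (rule imageE[OF AA[unfolded carM]], rule that)
   obtain c g where cg: "c \<in> C" "g \<in> P" "x = act g c" using C(3) x(1) by blast
   have "a = act' g (?p c)" using act'[OF P cg(2), of c] cg C(2) x(2) by auto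
   thus ?thesis using cg by blast
  qed
  thus "EX C. countable C & C <= carrier ?M & (ALL h:carrier ?M. EX c:C. EX g:P. h = act' g c)"
   using C(1,2) carM by (intro exI[of _ "?p ` C"]) auto
  fix \<L> \<Y> assume L: "M.csub \<L>" "!!g. g \<in> P ==> act' g ` \<L> <= \<L>" and Y: "M.csub \<Y>" "\<Y> <= \<L>" "M.alm \<L> \<Y>"
  have inv: "act g ` pre \<L> <= pre \<L>" if g: "g \<in> P" for g
  proof
   fix z assume "z \<in> act g ` pre \<L>"
   then obtain x where x: "x \<in> carrier H" "?p x \<in> \<L>" "z = act g x" unfolding pre_def by blast
   have "act' g (?p x) \<in> \<L>" using L(2)[OF g] x(2) by blast
   thus "z \<in> pre \<L>" unfolding pre_def using act'[OF P g x(1)] act_closed[OF SKS(1)[OF P] g x(1)] x(3) by simp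
  qed
  have "pre \<Y> <= pre \<L>" using Y(2) unfolding pre_def by blast
  then obtain Q where Q: "Q \<in> SS" "ALL g:Q. act g ` pre \<Y> <= pre \<Y>"
   using finite_index_stab[OF SKS(1)[OF P] pre_csub[OF L(1)] inv pre_csub[OF Y(1)] _ alm_pre[OF L(1) Y(1,3)]] by blast
  obtain R where R: "R \<in> SS" "R <= P" "R <= Q" using directed[OF SKS(1)[OF P] Q(1)] by blast
  have RK: "R \<in> SK" unfolding SK_def using invar_mono[OF SKS(2)[OF P] R(2)] R(1) by blast
  have "act' g ` \<Y> <= \<Y>" if g: "g \<in> R" for g
  proof
   fix b assume "b \<in> act' g ` \<Y>"
   then obtain a where a: "a \<in> \<Y>" "b = act' g a" by blast
   then obtain x where x: "x \<in> carrier H" "a = ?p x" using M.csubD(3)[OF Y(1)] unfolding carM by blast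
   hence "x \<in> pre \<Y>" using a(1) unfolding pre_def by simp
   hence "act g x \<in> pre \<Y>" using Q(2) R(3) g by blast
   thus "b \<in> \<Y>" using act'[OF RK g x(1)] a(2) x(2) unfolding pre_def by simp
  qed
  thus "EX Q:SK. ALL g:Q. act' g ` \<Y> <= \<Y>" using RK by blast
 next
  fix a assume "a \<in> carrier ?M"
  then obtain x where x: "x \<in> carrier H" "a = ?p x" unfolding carM by blast
  obtain P where P: "P \<in> SS" "ALL g:P. act g x = x" using point_stab[OF x(1)] by blast
  obtain P' where P': "P' \<in> SS" "invar P' K" using LL_invar[OF K] by blast
  obtain R where R: "R \<in> SS" "R <= P" "R <= P'" using directed[OF P(1) P'(1)] by blast
  have RK: "R \<in> SK" unfolding SK_def using invar_mono[OF P'(2) R(3)] R(1) by blast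
  have "act' g a = a" if "g \<in> R" for g using act'[OF RK that x(1)] P(2) R(2) that x(2) by auto
  thus "EX P:SK. ALL g:P. act' g a = a" using RK by blast
 next
  obtain \<B> where B: "countable \<B>" "!!U x. openin T U ==> x \<in> U ==> EX W:\<B>. x \<in> W & W <= U"
   using second_countable_T unfolding second_countable_def by metis
  \<comment> \<open>The images of a base of \<open>H\<close> form a network of the quotient.\<close>
  show "second_countable ?T"
  proof (rule second_countable_of_network[OF M.compact_T M.Hausdorff_T countable_image[OF B(1)]])
   fix U a assume U: "openin ?T U" "a \<in> U"
   have "a \<in> ?p ` carrier H" using openin_subset[OF U(1)] U(2) unfolding M.topspace_T carM by blast
   then obtain x where x: "a = ?p x" "x \<in> carrier H" by (rule imageE)
   obtain W where "W \<in> \<B>" "x \<in> W" "W <= {x \<in> topspace T. ?p x \<in> U}"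
    using B(2)[OF openin_continuous_map_preimage[OF quo(3) U(1)], of x] x U(2) topspace_T by auto
   thus "EX N:(`) ?p ` \<B>. a \<in> N & N <= U" using x(1) by (intro bexI[of _ "?p ` W"]) auto
  qed
 qed
 have pre_LL: "pre \<A> \<in> LL" if A: "\<A> \<in> Q.LL" for \<A>
 proof -
  obtain P where P: "P \<in> SK" "Q.invar P \<A>" using Q.LL_invar[OF A] by blast
  have "invar P (pre \<A>)"
  proof (rule invarI)
   fix g x assume g: "g \<in> P" and x: "x \<in> pre \<A>"
   hence xc: "x \<in> carrier H" "?p x \<in> \<A>" unfolding pre_def by auto
   show "act g x \<in> pre \<A>" unfolding pre_def
    using Q.invarD[OF P(2) g xc(2)] act'[OF P(1) g xc(1)] act_closed[OF SKS(1)[OF P(1)] g xc(1)] by simp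
  qed
  thus ?thesis by (rule LLI[OF pre_csub[OF Q.LLD(1)[OF A]] SKS(1)[OF P(1)]])
 qed
 have p_LL: "?p ` A \<in> Q.LL" if A: "A \<in> LL" for A
 proof -
  obtain P where P: "P \<in> SS" "invar P A" "invar P K" using LL_two[OF A K] by blast
  have PK: "P \<in> SK" using P unfolding SK_def by blast
  have "Q.invar P (?p ` A)"
  proof (rule Q.invarI)
   fix g a assume g: "g \<in> P" and "a \<in> ?p ` A"
   then obtain x where x: "x \<in> A" "a = ?p x" by blast
   have xc: "x \<in> carrier H" using x(1) LLD(3)[OF A] by blast
   show "act' g a \<in> ?p ` A" unfolding x(2) act'[OF PK g xc] using invarD[OF P(2) g x(1)] by blast
  qed
  thus ?thesis by (rule Q.LLI[OF p_csub[OF LLD(1)[OF A]] PK])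
 qed
 have chain_pre: "chain k K (pre \<A>)" if "Q.chain k {\<one>\<^bsub>?M\<^esub>} \<A>" "\<A> <= carrier ?M" for k \<A>
  using that
 proof (induction k arbitrary: \<A>)
  case 0
  thus ?case using K_pre[of \<A>] by simp
 next
  case (Suc k)
  then obtain \<P> where P: "\<P> \<in> Q.LL" "{\<one>\<^bsub>?M\<^esub>} <= \<P>" "\<P> <= \<A>" "\<not> M.alm \<A> \<P>" "Q.chain k {\<one>\<^bsub>?M\<^esub>} \<P>" by auto
  have "K <= pre \<P>" using K_pre P(2) by simp
  moreover have "pre \<P> <= pre \<A>" using P(3) unfolding pre_def by blast
  moreover have "\<not> alm (pre \<A>) (pre \<P>)"
  proof
   assume a: "alm (pre \<A>) (pre \<P>)"
   obtain F where F: "finite F" "F <= pre \<A>" "!!a. a \<in> pre \<A> ==> EX f:F. inv f \<otimes> a \<in> pre \<P>" by (rule almE[OF a], rule that)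
   have "M.alm \<A> \<P>"
   proof (rule M.almI'[of "?p ` F"])
    show "finite (?p ` F)" using F(1) by simp
    show "?p ` F <= \<A>" using F(2) unfolding pre_def by blast
    fix a assume "a \<in> \<A>"
    then obtain x where x: "x \<in> carrier H" "a = ?p x" using Suc.prems(2) unfolding carM by blast
    hence "x \<in> pre \<A>" using \<open>a \<in> \<A>\<close> unfolding pre_def by simp
    then obtain f where f: "f \<in> F" "inv f \<otimes> x \<in> pre \<P>" using F(3) by blast
    have fc: "f \<in> carrier H" using f(1) F(2) pre_c by blast
    have "inv\<^bsub>?M\<^esub> (?p f) \<otimes>\<^bsub>?M\<^esub> a = ?p (inv f \<otimes> x)" using pi[OF fc] pm[OF inv_closed[OF fc] x(1)] x(2) by simp
    moreover have "?p (inv f \<otimes> x) \<in> \<P>" using f(2) unfolding pre_def by simp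
    ultimately have "inv\<^bsub>?M\<^esub> (?p f) \<otimes>\<^bsub>?M\<^esub> a \<in> \<P>" by simp
    thus "EX f:?p ` F. inv\<^bsub>?M\<^esub> f \<otimes>\<^bsub>?M\<^esub> a \<in> \<P>" by (intro bexI[OF _ imageI[OF f(1)]])
   qed
   thus False using P(4) by blast
  qed
  ultimately show ?case using pre_LL[OF P(1)] Suc.IH[OF P(5) Q.LLD(3)[OF P(1)]] by auto
 qed
 have pre_car: "pre (carrier ?M) = carrier H" unfolding pre_def carM by blast
 \<comment> \<open>Chains in the quotient pull back to chains above \<open>K\<close>, so their
   length is bounded as well.\<close>
 have "\<not> Q.chain n {\<one>\<^bsub>?M\<^esub>} (carrier ?M)"
 proof
  assume "Q.chain n {\<one>\<^bsub>?M\<^esub>} (carrier ?M)"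
  hence "chain n K (carrier H)" using chain_pre[of n "carrier ?M"] pre_car by simp
  thus False using chain_mono_left[of n K "carrier H" "{\<one>}"] rank subgroup.one_closed[OF Ks] by simp
 qed
 hence "M.cc {L. Q.atom L}" by (rule Q.atoms_cc)
 then obtain \<C> where \<C>: "countable \<C>" "\<C> <= {L. Q.atom L}" "!!L. Q.atom L ==> EX N:\<C>. M.comm_eq L N"
  unfolding M.cc_def by blast
 have pre_one: "pre {\<one>\<^bsub>?M\<^esub>} = K"
 proof -
  have "?p ` K = {\<one>\<^bsub>?M\<^esub>}" using coset_join2[OF _ Ks] Kc subgroup.one_closed[OF Ks] by auto
  thus ?thesis using pre_p[OF Ks subset_refl] by simp
 qed
 show ?thesis
 proof (rule cc_of_representatives[of _ "pre ` \<C>"])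
  show "countable (pre ` \<C>)" using \<C>(1) by simp
  show "subgroup N H" if "N \<in> pre ` \<C>" for N
   using that \<C>(2) csubD(1)[OF pre_csub[OF Q.LLD(1)[OF Q.atomD(1)]]] by blast
  fix L assume "L \<in> {L \<in> LL. K <= L & \<not> alm L K & (ALL C:LL. K <= C & C <= L --> alm C K \<or> alm L C)}"
  hence L: "L \<in> LL" "K <= L" "\<not> alm L K" "!!C. C \<in> LL ==> K <= C ==> C <= L ==> alm C K \<or> alm L C" by blast+
  show "subgroup L H" by (rule LLD(2)[OF L(1)])
  note pL = p_LL[OF L(1)]
  have ppL: "pre (?p ` L) = L" by (rule pre_p[OF LLD(2)[OF L(1)] L(2)])
  have "Q.atom (?p ` L)"
   unfolding Q.atom_def
  proof (intro conjI ballI impI)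
   show "?p ` L \<in> Q.LL" by (rule pL)
   show "infinite (?p ` L)"
   proof
    assume "finite (?p ` L)"
    hence "M.alm (?p ` L) {\<one>\<^bsub>?M\<^esub>}" by (rule M.finite_alm[OF Q.LLD(2)[OF pL] M.csubD(1)[OF M.csub_one]])
    hence "alm (pre (?p ` L)) (pre {\<one>\<^bsub>?M\<^esub>})" by (rule alm_pre[OF Q.LLD(1)[OF pL] M.csub_one])
    thus False using L(3) unfolding ppL pre_one by blast
   qed
   fix C assume C: "C \<in> Q.LL" "C <= ?p ` L"
   have Cp: "?p ` pre C = C" by (rule p_pre[OF Q.LLD(3)[OF C(1)]])
   have "K <= pre C" by (rule K_pre[OF subgroup.one_closed[OF Q.LLD(2)[OF C(1)]]])
   moreover have "pre C <= L" using C(2) ppL unfolding pre_def by blast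
   ultimately have "alm (pre C) K \<or> alm L (pre C)" using L(4)[OF pre_LL[OF C(1)]] by blast
   thus "finite C \<or> M.alm (?p ` L) C"
   proof
    assume "alm (pre C) K"
    hence "M.alm (?p ` pre C) (?p ` K)" by (rule alm_p[OF LLD(2)[OF pre_LL[OF C(1)]] _ Kc])
    moreover have "?p ` K = {\<one>\<^bsub>?M\<^esub>}" using coset_join2[OF _ Ks] Kc subgroup.one_closed[OF Ks] by auto
    ultimately have "finite C" using M.alm_finite[OF Q.LLD(3)[OF C(1)]] unfolding Cp by simp
    thus ?thesis ..
   next
    assume "alm L (pre C)"
    hence "M.alm (?p ` L) (?p ` pre C)" by (rule alm_p[OF LLD(2)[OF L(1)] _ pre_c])
    thus ?thesis unfolding Cp ..
   qed
  qed
  then obtain N where N: "N \<in> \<C>" "M.comm_eq (?p ` L) N" using \<C>(3) by blast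
  have NL: "N \<in> Q.LL" using N(1) \<C>(2) Q.atomD(1) by blast
  have "comm_eq L (pre N)"
   using N(2) alm_pre[OF Q.LLD(1)[OF pL] Q.LLD(1)[OF NL]] alm_pre[OF Q.LLD(1)[OF NL] Q.LLD(1)[OF pL]]
   unfolding ppL M.comm_eq_def comm_eq_def by blast
  thus "EX N:pre ` \<C>. comm_eq L N" using N(1) by blast
 qed
qed

end

section \<open>A Polish group acting on a compact abelian group\<close>

text \<open>\<open>BB\<close> abstracts the pointwise stabilizers of finite subsets of
  \<open>X\<close>. Conjugates of its members need only contain members of
  \<open>BB\<close>.\<close>

locale compact_group_action = compact_abelian_group H T for H :: "'a monoid" (structure) and T +
 fixes G :: "'g monoid" and TG :: "'g topology" and act :: "'g => 'a => 'a" and BB :: "'g set set"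
 assumes polish: "polish_group G TG" and open_basis: "open_subgroup_basis G TG"
  and second_countable_H: "second_countable T"
  and action_cont: "continuous_map (prod_topology TG T) T (%(g, h). act g h)"
  and action_hom: "g \<in> carrier G ==> act g \<in> hom H H"
  and action_mult: "g \<in> carrier G ==> g' \<in> carrier G ==> h \<in> carrier H ==> act (g \<otimes>\<^bsub>G\<^esub> g') h = act g (act g' h)"
  and action_one: "h \<in> carrier H ==> act \<one>\<^bsub>G\<^esub> h = h"
  and BB_nonempty: "BB ~= {}"
  and BB_subgroup: "B \<in> BB ==> subgroup B G"
  and BB_directed: "B \<in> BB ==> B' \<in> BB ==> EX C:BB. C <= B & C <= B'"
  and BB_conj: "B \<in> BB ==> g \<in> carrier G ==> EX B':BB. ALL b:B'. inv\<^bsub>G\<^esub> g \<otimes>\<^bsub>G\<^esub> b \<otimes>\<^bsub>G\<^esub> g \<in> B"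
  and BB_fix: "h \<in> carrier H ==> EX B:BB. ALL g:B. act g h = h"
  and BB_orbits: "B \<in> BB ==> EX C. countable C & C <= carrier H & (ALL h:carrier H. EX c:C. EX g:B. h = act g c)"
begin

abbreviation gmult (infixl "\<cdot>" 70) where "g \<cdot> h \<equiv> g \<otimes>\<^bsub>G\<^esub> h"
abbreviation ginv ("inv\<^sub>G _" [81] 80) where "inv\<^sub>G g \<equiv> inv\<^bsub>G\<^esub> g"
abbreviation gone ("\<one>\<^sub>G") where "\<one>\<^sub>G \<equiv> \<one>\<^bsub>G\<^esub>"

sublocale G: group G using polish by (simp add: polish_group_def)

lemma top_G: "topspace TG = carrier G" using polish by (simp add: polish_group_def)

lemma mult_G: "continuous_map (prod_topology TG TG) TG (%(g, h). g \<cdot> h)"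
 and inv_G: "continuous_map TG TG (%g. inv\<^sub>G g)"
 and metrizable_G: "completely_metrizable_space TG" and second_countable_G: "second_countable TG"
 using polish by (simp_all add: polish_group_def)

definition osub :: "'g set => bool" where "osub W \<longleftrightarrow> subgroup W G & openin TG W"

lemma osubD: "osub W ==> subgroup W G" "osub W ==> openin TG W" "osub W ==> W <= carrier G" "osub W ==> \<one>\<^sub>G \<in> W"
 by (auto simp: osub_def dest: subgroup.subset subgroup.one_closed)

lemma osub_exists: "openin TG U ==> \<one>\<^sub>G \<in> U ==> EX W. osub W & W <= U"
 using open_basis unfolding open_subgroup_basis_def osub_def by blast

lemma osub_Int: "osub V ==> osub W ==> osub (V \<inter> W)"
 by (simp add: osub_def G.subgroups_Inter_pair openin_Int)

lemma osub_carrier: "osub (carrier G)"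
 using openin_topspace[of TG] G.subgroup_self by (simp add: osub_def top_G)

lemma left_cont: "g \<in> carrier G ==> continuous_map TG TG (%x. g \<cdot> x)"
proof -
 assume g: "g \<in> carrier G"
 have "continuous_map TG (prod_topology TG TG) (%x. (g, x))"
  using g by (intro continuous_map_pairedI) (auto simp: top_G)
 from continuous_map_compose[OF this mult_G] show ?thesis by (simp add: o_def)
qed

lemma right_cont: "g \<in> carrier G ==> continuous_map TG TG (%x. x \<cdot> g)"
proof -
 assume g: "g \<in> carrier G"
 have "continuous_map TG (prod_topology TG TG) (%x. (x, g))"
  using g by (intro continuous_map_pairedI) (auto simp: top_G)
 from continuous_map_compose[OF this mult_G] show ?thesis by (simp add: o_def)
qed

lemma conj_cont:
 assumes g: "g \<in> carrier G" shows "continuous_map TG TG (%x. inv\<^sub>G g \<cdot> x \<cdot> g)"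
 using continuous_map_compose[OF left_cont[OF G.inv_closed[OF g]] right_cont[OF g]] by (simp add: o_def)

lemma orbit_cont: "h \<in> carrier H ==> continuous_map TG T (%g. act g h)"
proof -
 assume h: "h \<in> carrier H"
 have "continuous_map TG (prod_topology TG T) (%g. (g, h))"
  using h by (intro continuous_map_pairedI) (auto simp: topspace_T)
 from continuous_map_compose[OF this action_cont] show ?thesis by (simp add: o_def)
qed

lemma action_cont_fixed: "g \<in> carrier G ==> continuous_map T T (act g)"
proof -
 assume g: "g \<in> carrier G"
 have "continuous_map T (prod_topology TG T) (%h. (g, h))"
  using g by (intro continuous_map_pairedI) (auto simp: top_G)
 from continuous_map_compose[OF this action_cont] show ?thesis by (simp add: o_def eta_contract_eq)
qed

lemma action_closed: "g \<in> carrier G ==> h \<in> carrier H ==> act g h \<in> carrier H"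
 using action_hom by (auto simp: hom_def)

lemma action_m: "g \<in> carrier G ==> h \<in> carrier H ==> k \<in> carrier H ==> act g (h \<otimes> k) = act g h \<otimes> act g k"
 using action_hom by (auto simp: hom_def)

lemma action_group_hom: "g \<in> carrier G ==> group_hom H H (act g)"
 using action_hom by (intro group_hom.intro group_hom_axioms.intro is_group)

lemma action_inv: "g \<in> carrier G ==> h \<in> carrier H ==> act g (inv h) = inv (act g h)"
 using group_hom.hom_inv[OF action_group_hom] by simp

lemma action_cancel:
 assumes "g \<in> carrier G" "h \<in> carrier H"
 shows "act (inv\<^sub>G g) (act g h) = h" "act g (act (inv\<^sub>G g) h) = h"
 using action_mult[of "inv\<^sub>G g" g h] action_mult[of g "inv\<^sub>G g" h] assms action_one[of h] by simp_all

lemma image_mult: "g \<in> carrier G ==> g' \<in> carrier G ==> L <= carrier H ==> act (g \<cdot> g') ` L = act g ` act g' ` L"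
 unfolding image_image by (rule image_cong) (auto intro!: action_mult)

lemma image_one: "L <= carrier H ==> act \<one>\<^sub>G ` L = L"
 using action_one by (force simp: subset_iff image_iff)

lemma image_cancel:
 assumes "g \<in> carrier G" "L <= carrier H"
 shows "act (inv\<^sub>G g) ` act g ` L = L" "act g ` act (inv\<^sub>G g) ` L = L"
 using image_mult[of "inv\<^sub>G g" g L] image_mult[of g "inv\<^sub>G g" L] assms image_one[of L] by simp_all

lemma image_closed: "g \<in> carrier G ==> L <= carrier H ==> act g ` L <= carrier H"
 using action_closed by blast

lemma mem_image_iff:
 assumes "g \<in> carrier G" "x \<in> carrier H" "L <= carrier H"
 shows "x \<in> act g ` L \<longleftrightarrow> act (inv\<^sub>G g) x \<in> L"
proof
 assume "x \<in> act g ` L"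
 then obtain l where l: "l \<in> L" "x = act g l" by blast
 hence "act (inv\<^sub>G g) x = l" using action_cancel(1)[OF assms(1)] assms(3) by blast
 thus "act (inv\<^sub>G g) x \<in> L" using l by simp
next
 assume a: "act (inv\<^sub>G g) x \<in> L"
 show "x \<in> act g ` L" by (rule image_eqI[OF _ a]) (simp add: action_cancel(2)[OF assms(1,2)])
qed

lemma csub_image:
 assumes g: "g \<in> carrier G" and L: "csub L" shows "csub (act g ` L)"
proof -
 have "subgroup (act g ` L) H" by (rule group_hom.subgroup_img_is_subgroup[OF action_group_hom[OF g] csubD(1)[OF L]])
 moreover have "closedin T (act g ` L)"
  by (rule closed_compactin, rule image_compactin[OF compactin_closed[OF csubD(2)[OF L]] action_cont_fixed[OF g]])
 ultimately show ?thesis by (simp add: csub_def)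
qed

lemma alm_image:
 assumes g: "g \<in> carrier G" and A: "A <= carrier H" and AB: "alm A B" shows "alm (act g ` A) (act g ` B)"
proof -
 obtain F where F: "finite F" "F <= A" "!!a. a \<in> A ==> EX f:F. inv f \<otimes> a \<in> B" by (rule almE[OF AB], rule that)
 show ?thesis
 proof (rule almI'[of "act g ` F"])
  show "finite (act g ` F)" "act g ` F <= act g ` A" using F by auto
  fix y assume "y \<in> act g ` A"
  then obtain a where a: "a \<in> A" "y = act g a" by blast
  obtain f where f: "f \<in> F" "inv f \<otimes> a \<in> B" using F(3)[OF a(1)] by blast
  have c: "f \<in> carrier H" "a \<in> carrier H" using f(1) F(2) a(1) A by blast+
  have "inv (act g f) \<otimes> y = act g (inv f \<otimes> a)" using action_m[OF g] action_inv[OF g] c a(2) by simp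
  also have "\<dots> \<in> act g ` B" using f(2) by (rule imageI)
  finally show "EX f:act g ` F. inv f \<otimes> y \<in> act g ` B" by (intro bexI[OF _ imageI[OF f(1)]])
 qed
qed

lemma comm_eq_image:
 assumes "g \<in> carrier G" "A <= carrier H" "B <= carrier H" "comm_eq A B" shows "comm_eq (act g ` A) (act g ` B)"
 using assms alm_image unfolding comm_eq_def by blast

lemma osub_cosets:
 assumes Q: "osub Q"
 shows "EX D. countable D & D <= carrier G & (ALL g:carrier G. EX d:D. inv\<^sub>G d \<cdot> g \<in> Q)"
proof -
 obtain D where D: "countable D" "D <= topspace TG" "TG closure_of D = topspace TG"
  using second_countable_imp_separable_space[OF second_countable_G] unfolding separable_space_def by blast
 have "EX d:D. inv\<^sub>G d \<cdot> g \<in> Q" if g: "g \<in> carrier G" for g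
 proof -
  let ?U = "{x \<in> topspace TG. inv\<^sub>G g \<cdot> x \<in> Q}"
  have "openin TG ?U" by (rule openin_continuous_map_preimage[OF left_cont[OF G.inv_closed[OF g]] osubD(2)[OF Q]])
  moreover have "g \<in> ?U" using g osubD(4)[OF Q] top_G by simp
  moreover have "g \<in> TG closure_of D" using D(3) g top_G by simp
  ultimately have "EX d. d \<in> D & d \<in> ?U" unfolding in_closure_of by (elim conjE allE[of _ ?U]) (rule mp, assumption, rule conjI)
  then obtain d where d: "d \<in> D" "d \<in> ?U" by (elim exE conjE)
  have dc: "d \<in> carrier G" using d top_G by simp
  have "inv\<^sub>G (inv\<^sub>G g \<cdot> d) \<in> Q" using d(2) subgroup.m_inv_closed[OF osubD(1)[OF Q]] by simp
  moreover have "inv\<^sub>G (inv\<^sub>G g \<cdot> d) = inv\<^sub>G d \<cdot> g" using g dc by (simp add: G.inv_mult_group)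
  ultimately show ?thesis using d(1) by auto
 qed
 thus ?thesis using D(1,2) top_G by (intro exI[of _ D]) simp
qed

definition SS :: "'g set set" where "SS = {W \<inter> B | W B. osub W & B \<in> BB}"

lemma SS_I: "osub W ==> B \<in> BB ==> W \<inter> B \<in> SS" unfolding SS_def by blast

lemma SS_E: assumes "P \<in> SS" obtains W B where "osub W" "B \<in> BB" "P = W \<inter> B"
 using assms unfolding SS_def by blast

lemma SS_subgroup: "P \<in> SS ==> subgroup P G"
 by (erule SS_E) (simp add: G.subgroups_Inter_pair osubD(1) BB_subgroup)

lemma SS_carrier: "P \<in> SS ==> P <= carrier G" using SS_subgroup subgroup.subset by blast

text \<open>An orbit of \<open>B\<close> splits into countably many orbits of
  \<open>W \<inter> B\<close>, since the open subgroup \<open>W\<close> has countably many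
  cosets.\<close>

lemma SS_orbits:
 assumes P: "P \<in> SS"
 shows "EX C. countable C & C <= carrier H & (ALL h:carrier H. EX c:C. EX g:P. h = act g c)"
proof -
 obtain W B where WB: "osub W" "B \<in> BB" "P = W \<inter> B" using P by (rule SS_E)
 note Bs = BB_subgroup[OF WB(2)] and Ws = osubD(1)[OF WB(1)]
 note Bc = subgroup.mem_carrier[OF Bs]
 obtain C where C: "countable C" "C <= carrier H" "ALL h:carrier H. EX c:C. EX g:B. h = act g c" using BB_orbits[OF WB(2)] by blast
 obtain D where D: "countable D" "D <= carrier G" "ALL g:carrier G. EX d:D. inv\<^sub>G d \<cdot> g \<in> W"
  using osub_cosets[OF WB(1)] by blast
 define e where "e d = (SOME b. b \<in> B & inv\<^sub>G d \<cdot> inv\<^sub>G b \<in> W)" for d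
 \<comment> \<open>If the coset of \<open>d\<close> contains no inverse of an element of
   \<open>B\<close>, then \<open>e d\<close> is an arbitrary value; the intersection with
   \<open>carrier H\<close> discards what it might produce.\<close>
 define C' where "C' = (%(d, c). act (e d) c) ` (D \<times> C) \<inter> carrier H"
 have "EX c:C'. EX g:P. h = act g c" if h: "h \<in> carrier H" for h
 proof -
  obtain c b where cb: "c \<in> C" "b \<in> B" "h = act b c" using C(3) h by blast
  have bc: "b \<in> carrier G" "c \<in> carrier H" using Bc[OF cb(2)] cb(1) C(2) by auto
  obtain d where d: "d \<in> D" "inv\<^sub>G d \<cdot> inv\<^sub>G b \<in> W" using D(3) G.inv_closed[OF bc(1)] by blast
  have dc: "d \<in> carrier G" using d D(2) by blast
  have "EX b. b \<in> B & inv\<^sub>G d \<cdot> inv\<^sub>G b \<in> W" using d(2) cb(2) by blast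
  hence e: "e d \<in> B" "inv\<^sub>G d \<cdot> inv\<^sub>G (e d) \<in> W" unfolding e_def by (rule someI2_ex, simp)+
  note ec = Bc[OF e(1)]
  let ?g = "b \<cdot> inv\<^sub>G (e d)"
  have "inv\<^sub>G (inv\<^sub>G d \<cdot> inv\<^sub>G b) \<cdot> (inv\<^sub>G d \<cdot> inv\<^sub>G (e d)) \<in> W"
   by (intro subgroup.m_closed[OF Ws] subgroup.m_inv_closed[OF Ws] d(2) e(2))
  moreover have "inv\<^sub>G (inv\<^sub>G d \<cdot> inv\<^sub>G b) \<cdot> (inv\<^sub>G d \<cdot> inv\<^sub>G (e d)) = ?g"
  proof -
   have "d \<cdot> (inv\<^sub>G d \<cdot> inv\<^sub>G e d) = inv\<^sub>G e d"
    using dc ec G.m_assoc[of d "inv\<^sub>G d" "inv\<^sub>G e d"] by simp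
   thus ?thesis using bc ec dc by (simp add: G.inv_mult_group G.m_assoc)
  qed
  moreover have "?g \<in> B" by (intro subgroup.m_closed[OF Bs] subgroup.m_inv_closed[OF Bs] cb e)
  ultimately have gP: "?g \<in> P" using WB(3) by simp
  have "act ?g (act (e d) c) = act (?g \<cdot> e d) c" using bc ec by (simp add: action_mult)
  also have "?g \<cdot> e d = b" using bc ec by (simp add: G.m_assoc)
  finally have "h = act ?g (act (e d) c)" using cb(3) by simp
  moreover have "act (e d) c \<in> C'" unfolding C'_def using d(1) cb(1) action_closed[OF ec bc(2)] by auto
  ultimately show ?thesis using gP by blast
 qed
 moreover have "countable C'" unfolding C'_def using C(1) D(1) by (intro countable_Int1 countable_image countable_SIGMA)
 moreover have "C' <= carrier H" unfolding C'_def by blast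
 ultimately show ?thesis by (intro exI[of _ C'] conjI ballI)
qed

text \<open>\<open>Y\<close> is compact and avoids the closed set \<open>L - Y\<close>; by the tube
  lemma this persists near the identity. An element that also preserves \<open>L\<close> therefore
  preserves \<open>Y\<close>.\<close>

lemma preserves_finite_index:
 assumes L: "csub L" and Y: "csub Y" "alm L Y"
 shows "EX W. osub W & (ALL g:W. ALL y:Y. act g y \<notin> L - Y)"
proof -
 define U where "U = topspace T - (L - Y)"
 have U: "openin T U" unfolding U_def using closedin_diff_csub[OF L Y] by blast
 define O' where "O' = {z \<in> topspace (prod_topology TG T). (case z of (g, h) => act g h) \<in> U}"
 have oO: "openin (prod_topology TG T) O'" unfolding O'_def by (rule openin_continuous_map_preimage[OF action_cont U])
 have "{\<one>\<^sub>G} \<times> Y <= O'"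
  unfolding O'_def U_def using csubD(3)[OF Y(1)] action_one by (auto simp: top_G topspace_T subset_iff)
 from tube_lemma_right[OF oO compactin_closed[OF csubD(2)[OF Y(1)]] _ this]
 obtain V V' where V: "openin TG V" "\<one>\<^sub>G \<in> V" "Y <= V'" "V \<times> V' <= O'" using top_G G.one_closed by metis
 obtain W where W: "osub W" "W <= V" using osub_exists[OF V(1,2)] by blast
 have "act g y \<notin> L - Y" if "g \<in> W" "y \<in> Y" for g y
 proof -
  have "(g, y) \<in> O'" using that W(2) V(3,4) by blast
  thus ?thesis unfolding O'_def U_def by simp
 qed
 thus ?thesis using W(1) by blast
qed

sublocale inv: inv_setting H T act SS
proof
 show "SS ~= {}" using BB_nonempty osub_carrier SS_I by blast
 show "EX R:SS. R <= P & R <= Q" if PQ: "P \<in> SS" "Q \<in> SS" for P Q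
 proof -
  obtain W B where WB: "osub W" "B \<in> BB" "P = W \<inter> B" using PQ(1) by (rule SS_E)
  obtain W' B' where WB': "osub W'" "B' \<in> BB" "Q = W' \<inter> B'" using PQ(2) by (rule SS_E)
  obtain C where C: "C \<in> BB" "C <= B" "C <= B'" using BB_directed[OF WB(2) WB'(2)] by blast
  have "(W \<inter> W') \<inter> C <= P" "(W \<inter> W') \<inter> C <= Q" using C(2,3) unfolding WB(3) WB'(3) by auto
  thus ?thesis by (intro bexI[OF _ SS_I[OF osub_Int[OF WB(1) WB'(1)] C(1)]] conjI)
 qed
 fix P g assume P: "P \<in> SS"
 { assume g: "g \<in> P"
  note gc = subsetD[OF SS_carrier[OF P] g]
  show "act g \<in> hom H H" by (rule action_hom[OF gc])
  show "continuous_map T T (act g)" by (rule action_cont_fixed[OF gc])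
  show "EX g':P. ALL h:carrier H. act g' (act g h) = h & act g (act g' h) = h"
   using action_cancel[OF gc] subgroup.m_inv_closed[OF SS_subgroup[OF P] g] by (intro bexI[of _ "inv\<^sub>G g"]) simp_all
  fix k assume k: "k \<in> P"
  show "EX g'':P. ALL h:carrier H. act g'' h = act g (act k h)"
   using action_mult[OF gc subsetD[OF SS_carrier[OF P] k]] subgroup.m_closed[OF SS_subgroup[OF P] g k]
   by (intro bexI[of _ "g \<cdot> k"]) simp_all }
 show "EX C. countable C & C <= carrier H & (ALL h:carrier H. EX c:C. EX g:P. h = act g c)" by (rule SS_orbits[OF P])
 fix L Y assume L: "csub L" "!!g. g \<in> P ==> act g ` L <= L" and Y: "csub Y" "Y <= L" "alm L Y"
 obtain W B where WB: "osub W" "B \<in> BB" "P = W \<inter> B" using P by (rule SS_E)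
 obtain W' where W': "osub W'" "ALL g:W'. ALL y:Y. act g y \<notin> L - Y" using preserves_finite_index[OF L(1) Y(1,3)] by blast
 have "act g y \<in> Y" if "g \<in> (W \<inter> W') \<inter> B" "y \<in> Y" for g y
 proof -
  have "act g y \<in> L" using L(2)[of g] that WB(3) Y(2) by blast
  thus ?thesis using W'(2) that by blast
 qed
 thus "EX Q:SS. ALL g:Q. act g ` Y <= Y" using SS_I[OF osub_Int[OF WB(1) W'(1)] WB(2)] by blast
next
 fix h assume "h \<in> carrier H"
 then obtain B where "B \<in> BB" "ALL g:B. act g h = h" using BB_fix by blast
 thus "EX P:SS. ALL g:P. act g h = h" using SS_I[OF osub_carrier] by blast
qed (rule second_countable_H)

abbreviation "LL \<equiv> inv.LL"

lemma invar_eq: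
 assumes P: "subgroup P G" and L: "L <= carrier H" and inv: "!!g. g \<in> P ==> act g ` L <= L" and g: "g \<in> P"
 shows "act g ` L = L"
proof -
 have gc: "g \<in> carrier G" using P g by (rule subgroup.mem_carrier)
 have "act g ` act (inv\<^sub>G g) ` L <= act g ` L" by (intro image_mono inv subgroup.m_inv_closed[OF P g])
 thus ?thesis using image_cancel(2)[OF gc L] inv[OF g] by simp
qed

lemma LL_image:
 assumes g: "g \<in> carrier G" and L: "L \<in> LL" shows "act g ` L \<in> LL"
proof -
 obtain P where P: "P \<in> SS" "inv.invar P L" using inv.LL_invar[OF L] by blast
 obtain W B where WB: "osub W" "B \<in> BB" "P = W \<inter> B" using P(1) by (rule SS_E)
 obtain B' where B': "B' \<in> BB" "ALL b:B'. inv\<^sub>G g \<cdot> b \<cdot> g \<in> B" using BB_conj[OF WB(2) g] by blast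
 let ?U = "{x \<in> topspace TG. inv\<^sub>G g \<cdot> x \<cdot> g \<in> W}"
 have "openin TG ?U" by (rule openin_continuous_map_preimage[OF conj_cont[OF g] osubD(2)[OF WB(1)]])
 moreover have "\<one>\<^sub>G \<in> ?U" using g osubD(4)[OF WB(1)] top_G by simp
 ultimately obtain W' where W': "osub W'" "W' <= ?U" using osub_exists by blast
 show ?thesis
 proof (rule inv.LLI[OF csub_image[OF g inv.LLD(1)[OF L]] SS_I[OF W'(1) B'(1)]], rule inv.invarI)
  fix x y assume x: "x \<in> W' \<inter> B'" and "y \<in> act g ` L"
  then obtain l where l: "l \<in> L" "y = act g l" by blast
  have c: "x \<in> carrier G" "l \<in> carrier H" using x W'(2) top_G l inv.LLD(3)[OF L] by blast+
  have "inv\<^sub>G g \<cdot> x \<cdot> g \<in> P" using x W'(2) B'(2) WB(3) by blast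
  hence "act (inv\<^sub>G g \<cdot> x \<cdot> g) l \<in> L" using inv.invarD[OF P(2)] l(1) by blast
  moreover have "act g (act (inv\<^sub>G g \<cdot> x \<cdot> g) l) = act x y"
   using c g l(2) by (simp add: action_mult action_closed action_cancel)
  ultimately show "act x y \<in> act g ` L" by (metis imageI)
 qed
qed

end

section \<open>Bounded index as a closed condition on the group element\<close>

context comm_group
begin

text \<open>The index of \<open>A \<inter> B\<close> in \<open>A\<close> is at most \<open>r\<close>, in a form that is visibly a closed
  condition when \<open>B\<close> varies over the translates of a closed subgroup.\<close>

definition idx_le :: "nat => 'a set => 'a set => bool" where
 "idx_le r A B \<longleftrightarrow> (ALL f. (ALL i<=r. f i \<in> A) --> (EX i j. i < j & j \<le> r & inv (f i) \<otimes> f j \<in> B))"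

lemma idx_leD: "idx_le r A B ==> (!!i. i \<le> r ==> f i \<in> A) ==> EX i j. i < j & j \<le> r & inv (f i) \<otimes> f j \<in> B"
 by (simp add: idx_le_def)

lemma inv_mult_mem_sym:
 assumes B: "subgroup B G" and xy: "x \<in> carrier G" "y \<in> carrier G" "inv x \<otimes> y \<in> B" shows "inv y \<otimes> x \<in> B"
proof -
 have "inv (inv x \<otimes> y) = inv y \<otimes> x" using xy by (simp add: inv_mult m_comm)
 thus ?thesis using subgroup.m_inv_closed[OF B xy(3)] by simp
qed

lemma inv_mult_mem_trans:
 assumes B: "subgroup B G" and xy: "x \<in> carrier G" "y \<in> carrier G" "z \<in> carrier G" "inv x \<otimes> y \<in> B" "inv y \<otimes> z \<in> B"
 shows "inv x \<otimes> z \<in> B"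
proof -
 have "y \<otimes> (inv y \<otimes> z) = z" using xy m_assoc[of y "inv y" z] by simp
 hence "(inv x \<otimes> y) \<otimes> (inv y \<otimes> z) = inv x \<otimes> z" using xy by (simp add: m_assoc)
 thus ?thesis using subgroup.m_closed[OF B xy(4,5)] by simp
qed

lemma alm_imp_idx_le:
 assumes A: "A <= carrier G" and B: "subgroup B G" and AB: "alm A B" shows "EX r. idx_le r A B"
proof -
 obtain F where F: "finite F" "F <= A" "!!a. a \<in> A ==> EX f:F. inv f \<otimes> a \<in> B" by (rule almE[OF AB], rule that)
 have "EX i j. i < j & j \<le> card F & inv (f i) \<otimes> f j \<in> B" if f: "ALL i<=card F. f i \<in> A" for f
 proof -
  define c where "c i = (SOME x. x \<in> F & inv x \<otimes> f i \<in> B)" for i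
  have c: "c i \<in> F & inv (c i) \<otimes> f i \<in> B" if "i \<le> card F" for i
  proof -
   have "EX x. x \<in> F & inv x \<otimes> f i \<in> B" using F(3) f that by blast
   thus ?thesis unfolding c_def by (rule someI_ex)
  qed
  have "\<not> inj_on c {..card F}"
  proof
   assume "inj_on c {..card F}"
   hence "card {..card F} \<le> card F" using c F(1) by (intro card_inj_on_le[of c]) auto
   thus False by simp
  qed
  then obtain i j where ij: "i \<le> card F" "j \<le> card F" "i ~= j" "c i = c j" unfolding inj_on_def by auto
  have *: "inv (f i) \<otimes> f j \<in> B" if ij: "i \<le> card F" "j \<le> card F" "c i = c j" for i j
  proof -
   have m: "f i \<in> carrier G" "f j \<in> carrier G" "c i \<in> carrier G" using f ij c[of i] A F(2) by blast+
   show ?thesis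
    using inv_mult_mem_trans[OF B m(1,3,2) inv_mult_mem_sym[OF B m(3,1)]] c[OF ij(1)] c[OF ij(2)] ij(3) by simp
  qed
  show ?thesis using *[OF ij(1,2,4)] *[OF ij(2,1) ij(4)[symmetric]] ij(1,2,3) by (metis nat_neq_iff)
 qed
 thus ?thesis unfolding idx_le_def by blast
qed

text \<open>If finitely many cosets never sufficed, elements in pairwise different cosets could be
  chosen greedily, one more than \<open>r\<close> allows.\<close>

lemma idx_le_imp_alm:
 assumes A: "A <= carrier G" and B: "subgroup B G" and AB: "idx_le r A B" shows "alm A B"
proof (rule ccontr)
 assume neg: "\<not> alm A B"
 have "EX f. (ALL i<n. f i \<in> A) & (ALL i j. i < j & j < n --> inv (f i) \<otimes> f j \<notin> B)" for n :: nat
 proof (induction n)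
  case (Suc n)
  then obtain f where f: "ALL i<n. f i \<in> A" "ALL i j. i < j & j < n --> inv (f i) \<otimes> f j \<notin> B" by blast
  have "EX a:A. ALL x:f ` {..<n}. inv x \<otimes> a \<notin> B"
  proof (rule ccontr)
   assume "\<not> ?thesis"
   hence "!!a. a \<in> A ==> EX x:f ` {..<n}. inv x \<otimes> a \<in> B" by blast
   hence "alm A B" using f(1) by (intro almI'[of "f ` {..<n}"]) auto
   thus False using neg by contradiction
  qed
  then obtain a where a: "a \<in> A" "!!i. i < n ==> inv (f i) \<otimes> a \<notin> B" by blast
  have "(ALL i<Suc n. (f(n := a)) i \<in> A)" using f(1) a(1) by (simp add: less_Suc_eq)
  moreover have "inv ((f(n := a)) i) \<otimes> (f(n := a)) j \<notin> B" if "i < j" "j < Suc n" for i j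
   using that f(2) a(2)[of i] by (cases "j = n") auto
  ultimately show ?case by blast
 qed simp
 from this[of "Suc r"] obtain f where f: "ALL i<Suc r. f i \<in> A" "ALL i j. i < j & j < Suc r --> inv (f i) \<otimes> f j \<notin> B" by blast
 have "EX i j. i < j & j \<le> r & inv (f i) \<otimes> f j \<in> B" by (rule idx_leD[OF AB]) (use f(1) in auto)
 thus False using f(2) by (meson le_imp_less_Suc)
qed

text \<open>The \<open>r\<close> elements \<open>n i\<close> of \<open>M \<inter> M'\<close> exhaust
  the cosets of \<open>B\<close> that meet \<open>M\<close>, and likewise those that meet
  \<open>M'\<close>. A product from \<open>M\<close> and \<open>M'\<close> is thus congruent to some
  \<open>n i \<otimes> n j\<close>, which is again in \<open>M\<close> and hence congruent to some
  \<open>n k\<close>: the sum meets no further cosets.\<close>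

lemma idx_le_set_mult:
 assumes M: "subgroup M G" "subgroup M' G" and B: "subgroup B G" and r: "idx_le r M B" "idx_le r M' B"
  and n: "!!i. i < r ==> n i \<in> M \<inter> M'" "!!i j. i < j ==> j < r ==> inv (n i) \<otimes> n j \<notin> B"
 shows "idx_le r (M <#> M') B"
proof -
 note Mc = subgroup.mem_carrier[OF M(1)] and Mc' = subgroup.mem_carrier[OF M(2)] and Bc = subgroup.mem_carrier[OF B]
 have nc: "n i \<in> carrier G" if "i < r" for i using n(1)[OF that] Mc by blast
 have near: "EX i<r. inv (n i) \<otimes> m \<in> B" if L: "subgroup L G" "idx_le r L B" "!!i. i < r ==> n i \<in> L" and m: "m \<in> L" for L m
 proof -
  have "EX i j. i < j & j \<le> r & inv ((n(r := m)) i) \<otimes> (n(r := m)) j \<in> B"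
   by (rule idx_leD[OF L(2)]) (use L(3) m in simp)
  then obtain i j where ij: "i < j" "j \<le> r" "inv ((n(r := m)) i) \<otimes> (n(r := m)) j \<in> B" by (elim exE conjE)
  have "j = r" using n(2)[of i j] ij by (cases "j = r") auto
  thus ?thesis using ij by auto
 qed
 have near2: "EX i<r. inv (n i) \<otimes> x \<in> B" if x: "x \<in> M <#> M'" for x
 proof -
  obtain m m' where m: "m \<in> M" "m' \<in> M'" "x = m \<otimes> m'" using x by (auto simp: set_mult_iff)
  obtain i where i: "i < r" "inv (n i) \<otimes> m \<in> B" using near[OF M(1) r(1) _ m(1)] n(1) by blast
  obtain j where j: "j < r" "inv (n j) \<otimes> m' \<in> B" using near[OF M(2) r(2) _ m(2)] n(1) by blast
  have "n i \<otimes> n j \<in> M" by (rule subgroup.m_closed[OF M(1)]) (use n(1) i j in auto)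
  then obtain k where k: "k < r" "inv (n k) \<otimes> (n i \<otimes> n j) \<in> B" using near[OF M(1) r(1)] n(1) by blast
  have c: "m \<in> carrier G" "m' \<in> carrier G" "n i \<in> carrier G" "n j \<in> carrier G" "n k \<in> carrier G"
   using Mc[OF m(1)] Mc'[OF m(2)] nc i(1) j(1) k(1) by auto
  have "inv (n i \<otimes> n j) \<otimes> x = (inv (n i) \<otimes> m) \<otimes> (inv (n j) \<otimes> m')"
   unfolding m(3) using c by (simp add: inv_mult m_ac)
  hence "inv (n i \<otimes> n j) \<otimes> x \<in> B" using subgroup.m_closed[OF B i(2) j(2)] by simp
  hence "inv (n k) \<otimes> x \<in> B" using inv_mult_mem_trans[OF B _ _ _ k(2)] c m(3) by simp
  thus ?thesis using k(1) by blast
 qed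
 show ?thesis
  unfolding idx_le_def
 proof (intro allI impI)
  fix f assume f: "ALL i<=r. f i \<in> M <#> M'"
  have fc: "f i \<in> carrier G" if "i \<le> r" for i
   using f that set_mult_closed[OF subgroup.subset[OF M(1)] subgroup.subset[OF M(2)]] by blast
  define c where "c i = (SOME k. k < r & inv (n k) \<otimes> f i \<in> B)" for i
  have c: "c i < r & inv (n (c i)) \<otimes> f i \<in> B" if "i \<le> r" for i
  proof -
   have "EX k. k < r & inv (n k) \<otimes> f i \<in> B" using near2 f that by blast
   thus ?thesis unfolding c_def by (rule someI_ex)
  qed
  have "\<not> inj_on c {..r}"
  proof
   assume "inj_on c {..r}"
   hence "card {..r} \<le> card {..<r}" using c by (intro card_inj_on_le[of c]) auto
   thus False by simp
  qed
  then obtain i j where ij: "i \<le> r" "j \<le> r" "i ~= j" "c i = c j" unfolding inj_on_def by auto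
  have *: "inv (f i) \<otimes> f j \<in> B" if ij: "i \<le> r" "j \<le> r" "c i = c j" for i j
  proof -
   have m: "f i \<in> carrier G" "f j \<in> carrier G" "n (c i) \<in> carrier G" using fc ij nc c[OF ij(1)] by auto
   show ?thesis
    using inv_mult_mem_trans[OF B m(1,3,2) inv_mult_mem_sym[OF B m(3,1)]] c[OF ij(1)] c[OF ij(2)] ij(3) by simp
  qed
  show "EX i j. i < j & j \<le> r & inv (f i) \<otimes> f j \<in> B" using *[OF ij(1,2,4)] *[OF ij(2,1) ij(4)[symmetric]] ij(1,2,3) by (metis nat_neq_iff)
 qed
qed

end

context compact_group_action
begin

lemma idx_le_image:
 assumes g: "g \<in> carrier G" and A: "A <= carrier H" and AB: "idx_le r A B"
 shows "idx_le r (act g ` A) (act g ` B)"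
 unfolding idx_le_def
proof (intro allI impI)
 fix f assume f: "ALL i<=r. f i \<in> act g ` A"
 hence "ALL i. EX a. i \<le> r --> a \<in> A & f i = act g a" by blast
 then obtain a where a: "!!i. i \<le> r ==> a i \<in> A & f i = act g (a i)" by metis
 obtain i j where ij: "i < j" "j \<le> r" "inv (a i) \<otimes> a j \<in> B" using idx_leD[OF AB, of a] a by blast
 have c: "a i \<in> carrier H" "a j \<in> carrier H" using a[of i] a[of j] ij A by auto
 have "inv (f i) \<otimes> f j = act g (inv (a i) \<otimes> a j)" using a[of i] a[of j] ij c action_m[OF g] action_inv[OF g] by simp
 show "EX i j. i < j & j \<le> r & inv (f i) \<otimes> f j \<in> act g ` B"
  using ij \<open>inv (f i) \<otimes> f j = act g (inv (a i) \<otimes> a j)\<close> by (intro exI[of _ i] exI[of _ j]) simp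
qed

lemma closedin_idx_le_aux:
 assumes L: "csub L" and x: "x \<in> carrier H"
 shows "closedin TG {g \<in> carrier G. x \<in> act g ` L}"
proof -
 have "closedin TG {g \<in> topspace TG. act (inv\<^sub>G g) x \<in> L}"
  using closedin_continuous_map_preimage[OF continuous_map_compose[OF inv_G orbit_cont[OF x]] csubD(2)[OF L]] by (simp add: o_def)
 moreover have "{g \<in> topspace TG. act (inv\<^sub>G g) x \<in> L} = {g \<in> carrier G. x \<in> act g ` L}"
  using mem_image_iff[OF _ x csubD(3)[OF L]] top_G by auto
 ultimately show ?thesis by simp
qed

text \<open>For each list of \<open>r + 1\<close> elements the condition is a finite union of closed
  sets; all lists together give an intersection.\<close>

lemma closedin_idx_le:
 assumes L: "csub L" and M: "M <= carrier H"
 shows "closedin TG {g \<in> carrier G. idx_le r M (act g ` L)}"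
proof -
 let ?C = "%f. \<Union>z\<in>{(i, j). i < j & j \<le> r}. {g \<in> carrier G. inv (f (fst z)) \<otimes> f (snd z) \<in> act g ` L}"
 let ?F = "{f. ALL i<=r. f i \<in> M}"
 have fin: "finite {(i, j). i < j & j \<le> r}" by (rule finite_subset[of _ "{..r} \<times> {..r}"]) auto
 have "{g \<in> carrier G. idx_le r M (act g ` L)} = topspace TG \<inter> (\<Inter>f\<in>?F. ?C f)"
  unfolding idx_le_def top_G by auto
 moreover have "closedin TG (topspace TG \<inter> (\<Inter>f\<in>?F. ?C f))"
 proof (cases "?F = {}")
  case False
  have "closedin TG (?C f)" if f: "f \<in> ?F" for f
  proof (rule closedin_Union)
   show "finite ((%z. {g \<in> carrier G. inv (f (fst z)) \<otimes> f (snd z) \<in> act g ` L}) ` {(i, j). i < j & j \<le> r})" using fin by (rule finite_imageI)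
   fix S assume "S \<in> (%z. {g \<in> carrier G. inv (f (fst z)) \<otimes> f (snd z) \<in> act g ` L}) ` {(i, j). i < j & j \<le> r}"
   then obtain i j where ij: "i < j" "j \<le> r" "S = {g \<in> carrier G. inv (f i) \<otimes> f j \<in> act g ` L}" by auto
   have "f i \<in> carrier H" "f j \<in> carrier H" using f ij M by auto
   thus "closedin TG S" unfolding ij(3) by (intro closedin_idx_le_aux[OF L]) simp
  qed
  thus ?thesis by (intro closedin_Int closedin_INT[OF False] closedin_topspace)
 next
  case True
  have "topspace TG \<inter> (\<Inter>f\<in>{}. ?C f) = topspace TG" by simp
  thus ?thesis unfolding True by (simp only: closedin_topspace)
 qed
 ultimately show ?thesis by simp
qed

lemma closedin_idx_le':
 assumes L: "csub L" and M: "csub M"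
 shows "closedin TG {g \<in> carrier G. idx_le r (act g ` L) M}"
proof -
 have "idx_le r (act g ` L) M \<longleftrightarrow> idx_le r L (act (inv\<^sub>G g) ` M)" if g: "g \<in> carrier G" for g
 proof
  assume "idx_le r (act g ` L) M"
  from idx_le_image[OF G.inv_closed[OF g] image_closed[OF g csubD(3)[OF L]] this]
  show "idx_le r L (act (inv\<^sub>G g) ` M)" using image_cancel[OF g csubD(3)[OF L]] by simp
 next
  assume "idx_le r L (act (inv\<^sub>G g) ` M)"
  from idx_le_image[OF g csubD(3)[OF L] this]
  show "idx_le r (act g ` L) M" using image_cancel[OF g csubD(3)[OF M]] by simp
 qed
 hence "{g \<in> carrier G. idx_le r (act g ` L) M} = {g \<in> topspace TG. inv\<^sub>G g \<in> {g \<in> carrier G. idx_le r L (act g ` M)}}"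
  using top_G by auto
 thus ?thesis using closedin_continuous_map_preimage[OF inv_G closedin_idx_le[OF M csubD(3)[OF L]]] by simp
qed

section \<open>From countably many translates to an open stabilizer\<close>

definition good :: "'a set => bool" where
 "good L \<longleftrightarrow> (EX \<C>. countable \<C> & (ALL M:\<C>. csub M) & (ALL g:carrier G. EX M:\<C>. comm_eq (act g ` L) M))"

text \<open>Baire category turns countability into a bound for the index that is uniform near the identity.\<close>

lemma good_uniform:
 assumes L: "csub L" and gd: "good L"
 shows "EX W M r. osub W & csub M & comm_eq L M & (ALL w:W. idx_le r M (act w ` L) & comm_eq (act w ` L) L)"
proof -
 obtain \<C> where C: "countable \<C>" "!!M. M \<in> \<C> ==> csub M" "!!g. g \<in> carrier G ==> EX M:\<C>. comm_eq (act g ` L) M"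
  using gd unfolding good_def by blast
 note Lc = csubD(3)[OF L]
 \<comment> \<open>Bounds for the index in both directions. The sets \<open>E z\<close> cover
   \<open>G\<close>, as each translate of \<open>L\<close> is commensurable with a member of the
   countable family.\<close>
 define E where "E = (%(M, r, s). {g \<in> carrier G. idx_le r M (act g ` L)} \<inter> {g \<in> carrier G. idx_le s (act g ` L) M})"
 let ?I = "\<C> \<times> (UNIV :: nat set) \<times> (UNIV :: nat set)"
 have clE: "closedin TG (E z)" if "z \<in> ?I" for z
  unfolding E_def using that closedin_idx_le[OF L csubD(3)[OF C(2)]] closedin_idx_le'[OF L C(2)] by auto
 have "EX z:?I. TG interior_of (E z) ~= {}"
 proof (rule ccontr)
  assume neg: "\<not> ?thesis"
  have "TG interior_of \<Union>(E ` ?I) = {}"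
  proof (rule Baire_category_alt)
   show "completely_metrizable_space TG \<or> locally_compact_space TG & regular_space TG" using metrizable_G by blast
   show "countable (E ` ?I)" using C(1) by (intro countable_image countable_SIGMA) auto
   fix A assume "A \<in> E ` ?I"
   thus "closedin TG A & TG interior_of A = {}" using clE neg by blast
  qed
  moreover have "\<Union>(E ` ?I) = topspace TG"
  proof
   show "\<Union>(E ` ?I) <= topspace TG" unfolding E_def top_G by auto
   show "topspace TG <= \<Union>(E ` ?I)"
   proof
    fix g assume "g \<in> topspace TG"
    hence g: "g \<in> carrier G" using top_G by simp
    obtain M where M: "M \<in> \<C>" "comm_eq (act g ` L) M" using C(3)[OF g] by blast
    note gL = csub_image[OF g L] and Mc = C(2)[OF M(1)]
    obtain r where r: "idx_le r M (act g ` L)"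
     using alm_imp_idx_le[OF csubD(3)[OF Mc] csubD(1)[OF gL]] M(2) unfolding comm_eq_def by blast
    obtain s where s: "idx_le s (act g ` L) M"
     using alm_imp_idx_le[OF csubD(3)[OF gL] csubD(1)[OF Mc]] M(2) unfolding comm_eq_def by blast
    have "g \<in> E (M, r, s)" unfolding E_def using r s g by simp
    thus "g \<in> \<Union>(E ` ?I)" using M(1) by blast
   qed
  qed
  ultimately have "topspace TG = {}" by simp
  thus False using top_G G.one_closed by blast
 qed
 then obtain M r s g0 where z: "M \<in> \<C>" "g0 \<in> TG interior_of (E (M, r, s))" by auto
 have g0E: "g0 \<in> E (M, r, s)" by (rule subsetD[OF interior_of_subset z(2)])
 hence g0: "g0 \<in> carrier G" unfolding E_def by simp
 note Mc = C(2)[OF z(1)] and g0i = G.inv_closed[OF g0]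
 let ?U = "{w \<in> topspace TG. g0 \<cdot> w \<in> TG interior_of (E (M, r, s))}"
 have "openin TG ?U" by (rule openin_continuous_map_preimage[OF left_cont[OF g0] openin_interior_of])
 moreover have "\<one>\<^sub>G \<in> ?U" using z(2) g0 top_G by simp
 ultimately obtain W where W: "osub W" "W <= ?U" using osub_exists by blast
 \<comment> \<open>Translating back by \<open>g0\<close> moves the interior point to the
   identity.\<close>
 let ?M = "act (inv\<^sub>G g0) ` M"
 have M': "csub ?M" by (rule csub_image[OF g0i Mc])
 have key: "idx_le r ?M (act w ` L) & idx_le s (act w ` L) ?M" if w: "w \<in> W" for w
 proof -
  have wc: "w \<in> carrier G" using osubD(3)[OF W(1)] w by blast
  have "g0 \<cdot> w \<in> TG interior_of (E (M, r, s))" using subsetD[OF W(2) w] by simp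
  hence "g0 \<cdot> w \<in> E (M, r, s)" by (rule subsetD[OF interior_of_subset])
  hence e: "idx_le r M (act (g0 \<cdot> w) ` L)" "idx_le s (act (g0 \<cdot> w) ` L) M" unfolding E_def by simp_all
  have eq: "act (inv\<^sub>G g0) ` act (g0 \<cdot> w) ` L = act w ` L"
   using image_mult[OF g0 wc Lc] image_cancel(1)[OF g0 image_closed[OF wc Lc]] by simp
  show ?thesis using idx_le_image[OF g0i csubD(3)[OF Mc] e(1)]
    idx_le_image[OF g0i image_closed[OF G.m_closed[OF g0 wc] Lc] e(2)] unfolding eq by blast
 qed
 have ceq: "comm_eq (act w ` L) ?M" if w: "w \<in> W" for w
 proof -
  have wc: "w \<in> carrier G" using osubD(3)[OF W(1)] w by blast
  note wL = csub_image[OF wc L]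
  show ?thesis using key[OF w] idx_le_imp_alm[OF csubD(3)[OF M'] csubD(1)[OF wL]] idx_le_imp_alm[OF csubD(3)[OF wL] csubD(1)[OF M']]
   unfolding comm_eq_def by blast
 qed
 have LM: "comm_eq L ?M" using ceq[OF osubD(4)[OF W(1)]] image_one[OF Lc] by simp
 have "comm_eq (act w ` L) L" if w: "w \<in> W" for w
 proof -
  have wc: "w \<in> carrier G" using osubD(3)[OF W(1)] w by blast
  show ?thesis by (rule comm_eq_trans[OF csubD(1)[OF csub_image[OF wc L]] csubD(1)[OF M'] csubD(1)[OF L] ceq[OF w] comm_eq_sym[OF LM]])
 qed
 thus ?thesis using W(1) M' LM key by blast
qed

end

context compact_group_action
begin

text \<open>The greatest member \<open>K\<close> of \<open>MM\<close> contains each of its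
  translates that is again in \<open>MM\<close>. This applies to elements close to the identity and
  to all elements stabilizing \<open>L\<close>, because the definition of \<open>MM\<close> refers
  only to \<open>L\<close> and to neighbourhoods of the identity.\<close>

lemma good_imp_invariant:
 assumes L: "csub L" and gd: "good L"
 shows "EX K. csub K & comm_eq K L & (EX W. osub W & (ALL g:W. act g ` K <= K)) &
  (ALL g:carrier G. act g ` L = L --> act g ` K <= K)"
proof -
 note Lc = csubD(3)[OF L] and Ls = csubD(1)[OF L]
 obtain W0 M0 r0 where W0: "osub W0" "csub M0" "comm_eq L M0"
  "!!w. w \<in> W0 ==> idx_le r0 M0 (act w ` L)" "!!w. w \<in> W0 ==> comm_eq (act w ` L) L"
  using good_uniform[OF L gd] by blast
 note W0s = osubD(1)[OF W0(1)] and W0c = subsetD[OF osubD(3)[OF W0(1)]]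
 \<comment> \<open>\<open>U\<close> may be any nonempty open set inside \<open>W0\<close>, not only
   a neighbourhood of the identity; so minimality of \<open>r\<close> can be invoked at every place
   in \<open>W0\<close>.\<close>
 define P where "P r \<longleftrightarrow> (EX M U. csub M & alm L M & openin TG U & U ~= {} & U <= W0 & (ALL w:U. idx_le r M (act w ` L)))" for r
 have "P r0" unfolding P_def using W0 osubD(2,4)[OF W0(1)] unfolding comm_eq_def by blast
 define r where "r = (LEAST r. P r)"
 have Pr: "P r" unfolding r_def using \<open>P r0\<close> by (rule LeastI)
 have least: "r \<le> s" if "P s" for s unfolding r_def using that by (rule Least_le)
 define MM where "MM = {M. csub M & alm L M & (EX U. openin TG U & \<one>\<^sub>G \<in> U & U <= W0 & (ALL w:U. idx_le r M (act w ` L)))}"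
 have MM_I: "M \<in> MM" if "csub M" "alm L M" "openin TG U" "\<one>\<^sub>G \<in> U" "U <= W0" "!!w. w \<in> U ==> idx_le r M (act w ` L)" for M U
  unfolding MM_def using that by blast
 have MM_csub: "csub M" if "M \<in> MM" for M using that unfolding MM_def by simp
 have MM_alm: "alm L M" if "M \<in> MM" for M using that unfolding MM_def by simp
 have MM_U: "EX U. openin TG U & \<one>\<^sub>G \<in> U & U <= W0 & (ALL w:U. idx_le r M (act w ` L))" if "M \<in> MM" for M
  using that unfolding MM_def by simp
 have alm_L_image: "alm L (act g ` M)" if g: "g \<in> W0" and M: "csub M" "alm L M" for g M
 proof -
  note gc = W0c[OF g]
  have "alm L (act g ` L)" using W0(5)[OF g] unfolding comm_eq_def by simp
  thus ?thesis
   by (rule alm_trans[OF Ls csubD(1)[OF csub_image[OF gc L]] csubD(1)[OF csub_image[OF gc M(1)]] _ alm_image[OF gc Lc M(2)]])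
 qed
 have translate: "act g ` M \<in> MM"
  if g: "g \<in> W0" and M: "csub M" "alm L M" and U: "openin TG U" "inv\<^sub>G g \<in> U" "U <= W0" "!!w. w \<in> U ==> idx_le r M (act w ` L)" for g M U
 proof (rule MM_I[OF csub_image[OF W0c[OF g] M(1)] alm_L_image[OF g M]])
  note gc = W0c[OF g]
  let ?U = "{x \<in> topspace TG. inv\<^sub>G g \<cdot> x \<in> U}"
  show "openin TG ?U" by (rule openin_continuous_map_preimage[OF left_cont[OF G.inv_closed[OF gc]] U(1)])
  show "\<one>\<^sub>G \<in> ?U" using gc U(2) top_G by simp
  show "?U <= W0"
  proof
   fix x assume x: "x \<in> ?U"
   hence xc: "x \<in> carrier G" "inv\<^sub>G g \<cdot> x \<in> W0" using U(3) top_G by auto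
   have "g \<cdot> (inv\<^sub>G g \<cdot> x) = x" using gc xc(1) G.m_assoc[of g "inv\<^sub>G g" x] by simp
   thus "x \<in> W0" using subgroup.m_closed[OF W0s g xc(2)] by simp
  qed
  fix w assume "w \<in> ?U"
  hence w: "w \<in> carrier G" "inv\<^sub>G g \<cdot> w \<in> U" using top_G by auto
  have "act g ` act (inv\<^sub>G g \<cdot> w) ` L = act w ` L"
   using image_mult[OF G.inv_closed[OF gc] w(1) Lc] image_cancel(2)[OF gc image_closed[OF w(1) Lc]] by simp
  thus "idx_le r (act g ` M) (act w ` L)" using idx_le_image[OF gc csubD(3)[OF M(1)] U(4)[OF w(2)]] by simp
 qed
 have nonempty: "EX M. M \<in> MM"
 proof -
  obtain M U where M: "csub M" "alm L M" "openin TG U" "U ~= {}" "U <= W0" "ALL w:U. idx_le r M (act w ` L)"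
   using Pr unfolding P_def by blast
  obtain g where g: "g \<in> U" using M(4) by blast
  hence g': "g \<in> W0" "g \<in> carrier G" using M(5) W0c by blast+
  have "inv\<^sub>G (inv\<^sub>G g) \<in> U" using g g'(2) by simp
  hence "act (inv\<^sub>G g) ` M \<in> MM"
   using translate[OF subgroup.m_inv_closed[OF W0s g'(1)] M(1-3) _ M(5)] M(6) by blast
  thus ?thesis ..
 qed
 \<comment> \<open>Suppose that the sum violates the bound at \<open>w\<close>, hence on an open set
   \<open>V\<close>. By minimality of \<open>r\<close> there is a \<open>v\<close> in
   \<open>V\<close> at which \<open>M \<inter> M'\<close> meets at least \<open>r\<close> cosets,
   and then \<open>idx_le_set_mult\<close> gives the bound for the sum at \<open>v\<close> after
   all.\<close>
 have sums: "M <#> M' \<in> MM" if MM: "M \<in> MM" "M' \<in> MM" for M M'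
 proof -
  obtain U where U: "openin TG U" "\<one>\<^sub>G \<in> U" "U <= W0" "ALL w:U. idx_le r M (act w ` L)" using MM_U[OF MM(1)] by blast
  obtain U' where U': "openin TG U'" "\<one>\<^sub>G \<in> U'" "U' <= W0" "ALL w:U'. idx_le r M' (act w ` L)" using MM_U[OF MM(2)] by blast
  note M = MM_csub[OF MM(1)] and M' = MM_csub[OF MM(2)]
  note Ms = csubD(1)[OF M] and Ms' = csubD(1)[OF M']
  show ?thesis
  proof (rule MM_I[OF csub_set_mult[OF M M']])
   show "alm L (M <#> M')" by (rule alm_super[OF MM_alm[OF MM(1)] set_mult_upper1[OF csubD(3)[OF M] Ms']])
   show "openin TG (U \<inter> U')" "\<one>\<^sub>G \<in> U \<inter> U'" "U \<inter> U' <= W0" using U U' by auto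
   fix w assume w: "w \<in> U \<inter> U'"
   show "idx_le r (M <#> M') (act w ` L)"
   proof (rule ccontr)
    assume neg: "\<not> ?thesis"
    define V where "V = U \<inter> U' - {g \<in> carrier G. idx_le r (M <#> M') (act g ` L)}"
    have oV: "openin TG V" unfolding V_def
     by (intro openin_diff openin_Int U(1) U'(1) closedin_idx_le L csubD(3) csub_set_mult M M')
    have wV: "w \<in> V" unfolding V_def using w neg by blast
    have VW: "V <= W0" unfolding V_def using U(3) by blast
    have N: "csub (M \<inter> M')" "alm L (M \<inter> M')" using csub_Int[OF M M'] alm_Int_both[OF Ls Ms Ms'] MM_alm MM by blast+
    \<comment> \<open>There are no indices \<open>i < j\<close> up to 0, so \<open>idx_le 0\<close>
      fails for every subgroup and \<open>r - 1\<close> is smaller than \<open>r\<close>.\<close>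
    have "r ~= 0"
    proof
     assume "r = 0"
     hence "idx_le 0 M (act w ` L)" using U(4) w by blast
     thus False using idx_leD[of 0 M "act w ` L" "%_. \<one>"] subgroup.one_closed[OF Ms] by auto
    qed
    hence "\<not> P (r - 1)" using least[of "r - 1"] by linarith
    then obtain v where v: "v \<in> V" "\<not> idx_le (r - 1) (M \<inter> M') (act v ` L)"
     unfolding P_def using N oV wV VW by blast
    have vc: "v \<in> carrier G" using v(1) VW W0c by blast
    obtain n where n: "ALL i<=r - 1. n i \<in> M \<inter> M'" "!!i j. i < j ==> j \<le> r - 1 ==> inv (n i) \<otimes> n j \<notin> act v ` L"
     using v(2) unfolding idx_le_def by blast
    have "idx_le r (M <#> M') (act v ` L)"
    proof (rule idx_le_set_mult[OF Ms Ms' csubD(1)[OF csub_image[OF vc L]], of r n])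
     show "idx_le r M (act v ` L)" "idx_le r M' (act v ` L)" using v(1) U(4) U'(4) unfolding V_def by auto
     show "n i \<in> M \<inter> M'" if "i < r" for i using n(1) that by simp
     show "inv (n i) \<otimes> n j \<notin> act v ` L" if "i < j" "j < r" for i j using n(2)[OF that(1)] that(2) by simp
    qed
    thus False using v(1) vc unfolding V_def by blast
   qed
  qed
 qed
 have upper: "M <= M <#> M'" "M' <= M <#> M'" if "M \<in> MM" "M' \<in> MM" for M M'
  using set_mult_upper1[OF csubD(3)[OF MM_csub[OF that(1)]] csubD(1)[OF MM_csub[OF that(2)]]]
   set_mult_upper2[OF csubD(1)[OF MM_csub[OF that(1)]] csubD(3)[OF MM_csub[OF that(2)]]] by auto
 have capture: "EX M:MM. F <= M" if "finite F" "F <= \<Union>MM" for F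
  using that
 proof (induction F)
  case empty
  thus ?case using nonempty by blast
 next
  case (insert x F)
  then obtain M where M: "M \<in> MM" "F <= M" by blast
  obtain M' where M': "M' \<in> MM" "x \<in> M'" using insert.prems by blast
  have "insert x F <= M <#> M'" using upper[OF M(1) M'(1)] M(2) M'(2) by blast
  thus ?case using sums[OF M(1) M'(1)] by blast
 qed
 have idx1: "idx_le r M L" if "M \<in> MM" for M using MM_U[OF that] image_one[OF Lc] by metis
 obtain M1 where M1: "M1 \<in> MM" using nonempty by blast
 have "idx_le r (\<Union>MM) L"
  unfolding idx_le_def
 proof (intro allI impI)
  fix f assume f: "ALL i<=r. f i \<in> \<Union>MM"
  have "finite (f ` {..r})" "f ` {..r} <= \<Union>MM" using f by auto
  from capture[OF this] obtain M where M: "M \<in> MM" "f ` {..r} <= M" by blast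
  thus "EX i j. i < j & j \<le> r & inv (f i) \<otimes> f j \<in> L" using idx_leD[OF idx1[OF M(1)], of f] by blast
 qed
 moreover have Uc: "\<Union>MM <= carrier H" using csubD(3)[OF MM_csub] by blast
 ultimately have UL: "alm (\<Union>MM) L" by (intro idx_le_imp_alm[OF _ Ls])
 obtain F where F: "finite F" "F <= \<Union>MM" "!!a. a \<in> \<Union>MM ==> EX f:F. inv f \<otimes> a \<in> L" by (rule almE[OF UL], rule that)
 obtain FL where FL: "finite FL" "FL <= L" "!!a. a \<in> L ==> EX f:FL. inv f \<otimes> a \<in> M1" by (rule almE[OF MM_alm[OF M1]], rule that)
 \<comment> \<open>One element of \<open>\<Union>MM\<close> from each coset of \<open>M1\<close>
   that meets it. There are finitely many such cosets, so a single \<open>M2\<close> contains all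
   chosen elements, and adding \<open>M1\<close> yields everything.\<close>
 define R where "R z = (SOME x. x \<in> \<Union>MM & inv (fst z \<otimes> snd z) \<otimes> x \<in> M1)" for z
 define Z where "Z = {z \<in> F \<times> FL. EX x. x \<in> \<Union>MM & inv (fst z \<otimes> snd z) \<otimes> x \<in> M1}"
 have R: "R z \<in> \<Union>MM & inv (fst z \<otimes> snd z) \<otimes> R z \<in> M1" if "z \<in> Z" for z
  unfolding R_def by (rule someI_ex) (use that in \<open>simp add: Z_def\<close>)
 have "finite (R ` Z)" unfolding Z_def using F(1) FL(1) by simp
 moreover have "R ` Z <= \<Union>MM" using R by blast
 ultimately obtain M2 where M2: "M2 \<in> MM" "R ` Z <= M2" using capture by blast
 define K where "K = M1 <#> M2"
 have K: "K \<in> MM" unfolding K_def by (rule sums[OF M1 M2(1)])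
 note Ks = csubD(1)[OF MM_csub[OF K]]
 have max: "M <= K" if M: "M \<in> MM" for M
 proof
  fix x assume "x \<in> M"
  hence x: "x \<in> \<Union>MM" using M by blast
  obtain f where f: "f \<in> F" "inv f \<otimes> x \<in> L" using F(3)[OF x] by blast
  obtain l where l: "l \<in> FL" "inv l \<otimes> (inv f \<otimes> x) \<in> M1" using FL(3)[OF f(2)] by blast
  have c: "x \<in> carrier H" "f \<in> carrier H" "l \<in> carrier H" using x f(1) F(2) Uc l(1) FL(2) Lc by blast+
  have e: "inv (f \<otimes> l) \<otimes> x \<in> M1" using l(2) c by (simp add: inv_mult m_ac)
  have z: "(f, l) \<in> Z" unfolding Z_def using f(1) l(1) x e by auto
  have Rz: "R (f, l) \<in> \<Union>MM" "inv (f \<otimes> l) \<otimes> R (f, l) \<in> M1" using R[OF z] by simp_all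
  have Rc: "R (f, l) \<in> carrier H" using Rz(1) Uc by blast
  have "inv (R (f, l)) \<otimes> x \<in> M1"
   using inv_mult_mem_trans[OF csubD(1)[OF MM_csub[OF M1]] Rc _ c(1) inv_mult_mem_sym[OF csubD(1)[OF MM_csub[OF M1]] _ Rc Rz(2)] e] c by simp
  moreover have "R (f, l) \<in> M2" using M2(2) z by blast
  ultimately have "R (f, l) \<in> K" "inv (R (f, l)) \<otimes> x \<in> K" using upper[OF M1 M2(1)] unfolding K_def by blast+
  from subgroup.m_closed[OF Ks this] show "x \<in> K" using Rc c(1) by (simp add: m_assoc[symmetric])
 qed
 have "alm K L" by (rule idx_le_imp_alm[OF csubD(3)[OF MM_csub[OF K]] Ls idx1[OF K]])
 hence "comm_eq K L" using MM_alm[OF K] by (simp add: comm_eq_def)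
 moreover have "EX W. osub W & (ALL g:W. act g ` K <= K)"
 proof -
  obtain U where U: "openin TG U" "\<one>\<^sub>G \<in> U" "U <= W0" "ALL w:U. idx_le r K (act w ` L)" using MM_U[OF K] by blast
  obtain W where W: "osub W" "W <= U" using osub_exists[OF U(1,2)] by blast
  have "act g ` K <= K" if g: "g \<in> W" for g
  proof (rule max, rule translate[OF _ MM_csub[OF K] MM_alm[OF K] U(1) _ U(3)])
   show "g \<in> W0" using g W(2) U(3) by blast
   show "inv\<^sub>G g \<in> U" using subgroup.m_inv_closed[OF osubD(1)[OF W(1)] g] W(2) by blast
   show "!!w. w \<in> U ==> idx_le r K (act w ` L)" using U(4) by blast
  qed
  thus ?thesis using W(1) by blast
 qed
 moreover have "act g ` K <= K" if g: "g \<in> carrier G" "act g ` L = L" for g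
 proof (rule max)
  obtain U where U: "openin TG U" "\<one>\<^sub>G \<in> U" "U <= W0" "ALL w:U. idx_le r K (act w ` L)" using MM_U[OF K] by blast
  let ?U = "{x \<in> topspace TG. inv\<^sub>G g \<cdot> x \<cdot> g \<in> U} \<inter> W0"
  have Kc: "K <= carrier H" by (rule csubD(3)[OF MM_csub[OF K]])
  show "act g ` K \<in> MM"
  proof (rule MM_I[OF csub_image[OF g(1) MM_csub[OF K]], of ?U])
   show "alm L (act g ` K)" using alm_image[OF g(1) Lc MM_alm[OF K]] unfolding g(2) .
   show "openin TG ?U" by (rule openin_Int[OF openin_continuous_map_preimage[OF conj_cont[OF g(1)] U(1)] osubD(2)[OF W0(1)]])
   show "\<one>\<^sub>G \<in> ?U" using g(1) U(2) top_G osubD(4)[OF W0(1)] by simp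
   fix w assume "w \<in> ?U"
   hence w: "inv\<^sub>G g \<cdot> w \<cdot> g \<in> U" "w \<in> carrier G" using top_G by auto
   let ?w = "inv\<^sub>G g \<cdot> w \<cdot> g"
   have "act ?w ` L = act (inv\<^sub>G g) ` act w ` L"
    using image_mult[OF _ g(1) Lc, of "inv\<^sub>G g \<cdot> w"] image_mult[OF G.inv_closed[OF g(1)] w(2) Lc] g w(2) by simp
   hence "act g ` act ?w ` L = act w ` L" using image_cancel(2)[OF g(1) image_closed[OF w(2) Lc]] by simp
   thus "idx_le r (act g ` K) (act w ` L)" using idx_le_image[OF g(1) Kc bspec[OF U(4) w(1)]] by simp
  qed blast
 qed
 ultimately show ?thesis using MM_csub[OF K] by blast
qed

text \<open>\<open>Q\<close> has countably many cosets in \<open>G\<close>, and a representative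
  \<open>d\<close> of a coset carries the countable family to the translates by that coset.\<close>

lemma good_of_osub:
 assumes L: "csub L" and Q: "osub Q" and C: "countable \<C>" "!!M. M \<in> \<C> ==> csub M" "!!g. g \<in> Q ==> EX M:\<C>. comm_eq (act g ` L) M"
 shows "good L"
proof -
 obtain D where D: "countable D" "D <= carrier G" "ALL g:carrier G. EX d:D. inv\<^sub>G d \<cdot> g \<in> Q" using osub_cosets[OF Q] by blast
 let ?C = "(%(d, M). act d ` M) ` (D \<times> \<C>)"
 have "countable ?C" using D(1) C(1) by (intro countable_image countable_SIGMA)
 moreover have "ALL M:?C. csub M" using D(2) C(2) csub_image by auto
 moreover have "EX M:?C. comm_eq (act g ` L) M" if g: "g \<in> carrier G" for g
 proof -
  obtain d where d: "d \<in> D" "inv\<^sub>G d \<cdot> g \<in> Q" using D(3) g by blast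
  have dc: "d \<in> carrier G" using d D(2) by blast
  obtain M where M: "M \<in> \<C>" "comm_eq (act (inv\<^sub>G d \<cdot> g) ` L) M" using C(3)[OF d(2)] by blast
  have "act d ` act (inv\<^sub>G d \<cdot> g) ` L = act g ` L"
   using image_mult[OF G.inv_closed[OF dc] g csubD(3)[OF L]] image_cancel(2)[OF dc image_closed[OF g csubD(3)[OF L]]] by simp
  hence "comm_eq (act g ` L) (act d ` M)"
   using comm_eq_image[OF dc image_closed[OF G.m_closed[OF G.inv_closed[OF dc] g] csubD(3)[OF L]] csubD(3)[OF C(2)[OF M(1)]] M(2)] by simp
  thus ?thesis using d(1) M(1) by (intro bexI[of _ "act d ` M"]) auto
 qed
 ultimately show ?thesis unfolding good_def by (intro exI[of _ ?C] conjI ballI) auto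
qed

lemma good_comm_eq:
 assumes L: "csub L" "csub L'" "comm_eq L L'" and gd: "good L'" shows "good L"
proof -
 obtain \<C> where C: "countable \<C>" "!!M. M \<in> \<C> ==> csub M" "!!g. g \<in> carrier G ==> EX M:\<C>. comm_eq (act g ` L') M"
  using gd unfolding good_def by blast
 have "EX M:\<C>. comm_eq (act g ` L) M" if g: "g \<in> carrier G" for g
 proof -
  obtain M where M: "M \<in> \<C>" "comm_eq (act g ` L') M" using C(3)[OF g] by blast
  have "comm_eq (act g ` L) M"
   by (rule comm_eq_trans[OF csubD(1)[OF csub_image[OF g L(1)]] csubD(1)[OF csub_image[OF g L(2)]] csubD(1)[OF C(2)[OF M(1)]]
    comm_eq_image[OF g csubD(3)[OF L(1)] csubD(3)[OF L(2)] L(3)] M(2)])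
  thus ?thesis using M(1) by blast
 qed
 thus ?thesis unfolding good_def using C(1,2) by blast
qed

end

section \<open>Induction on the length of chains\<close>

context inv_setting
begin

text \<open>Intersecting a chain below \<open>L'\<close> with a subgroup of finite index leaves
  every step of infinite index.\<close>

lemma chain_Int:
 assumes "chain n M L'" "L \<in> LL" "L' \<in> LL" "M \<in> LL" "L <= L'" "alm L' L"
 shows "chain n (M \<inter> L) L"
 using assms
proof (induction n arbitrary: L' L)
 case (Suc n)
 then obtain P where P: "P \<in> LL" "M <= P" "P <= L'" "\<not> alm L' P" "chain n M P" by auto
 have PL: "P \<inter> L \<in> LL" using LL_Int P(1) Suc.prems by blast
 have "alm P L" by (rule alm_mono[OF LLD(2)[OF Suc.prems(3)] LLD(2)[OF P(1)] LLD(2)[OF Suc.prems(2)] P(3) Suc.prems(6) subset_refl])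
 hence "alm P (P \<inter> L)" by (rule alm_Int[OF LLD(2)[OF P(1)]])
 hence "chain n (M \<inter> (P \<inter> L)) (P \<inter> L)" using Suc.IH[OF P(5) PL P(1) Suc.prems(4)] by blast
 moreover have "M \<inter> (P \<inter> L) = M \<inter> L" using P(2) by blast
 moreover have "\<not> alm L (P \<inter> L)"
 proof
  assume "alm L (P \<inter> L)"
  hence "alm L P" by (rule alm_super) blast
  hence "alm L' P" by (rule alm_trans[OF LLD(2)[OF Suc.prems(3)] LLD(2)[OF Suc.prems(2)] LLD(2)[OF P(1)] Suc.prems(6)])
  thus False using P(4) by contradiction
 qed
 ultimately have "chain n (M \<inter> L) (P \<inter> L)" "\<not> alm L (P \<inter> L)" by simp_all
 thus ?case unfolding chain.simps using P(2) by (intro bexI[OF _ PL]) auto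
qed auto

lemma chain_prepend:
 assumes "chain n M L" "K \<in> LL" "L \<in> LL" "M \<in> LL" "K <= M" "\<not> alm M K"
 shows "chain (Suc n) K L"
 using assms
proof (induction n arbitrary: L)
 case 0
 have "M <= L" using 0(1) by simp
 have "\<not> alm L K"
  using alm_mono[OF LLD(2)[OF 0(3)] LLD(2)[OF 0(4)] LLD(2)[OF 0(2)] \<open>M <= L\<close> _ subset_refl] 0(6) by blast
 thus ?case using 0 by auto
next
 case (Suc n)
 then obtain P where P: "P \<in> LL" "M <= P" "P <= L" "\<not> alm L P" "chain n M P" by auto
 have "chain (Suc n) K P" by (rule Suc.IH[OF P(5) Suc.prems(2) P(1) Suc.prems(4-6)])
 thus ?case using P Suc.prems(5) unfolding chain.simps(2)[of "Suc n"] by blast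
qed

end

context compact_group_action
begin

abbreviation "chain \<equiv> inv.chain"

text \<open>The induction bounds chains above a base \<open>K\<close> preserved by an open subgroup
  \<open>Q\<close>. A group of infinite index on both sides between \<open>K\<close> and
  \<open>L\<close> splits the problem into two with shorter chains. If there is none,
  \<open>L\<close> is minimal over \<open>K\<close>; so are its translates by \<open>Q\<close>, and
  \<open>relative_atoms_cc\<close> leaves countably many classes for them.\<close>

lemma good_of_relative_rank:
 assumes rank: "\<not> chain N {\<one>} (carrier H)"
 assumes "K \<in> LL" "osub Q" "!!g. g \<in> Q ==> act g ` K <= K" "L \<in> LL" "K <= L" "\<not> chain n K L"
 shows "good L"
 using assms(2-)
proof (induction n arbitrary: K L Q)
 case (Suc n)
 note K = Suc.prems(1) and Q = Suc.prems(2,3) and L = Suc.prems(4) and KL = Suc.prems(5)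
 note Ks = inv.LLD(2)[OF K] and Ls = inv.LLD(2)[OF L] and Kl = inv.LLD(1)[OF K] and Ll = inv.LLD(1)[OF L]
 have QK: "act g ` K = K" if "g \<in> Q" for g by (rule invar_eq[OF osubD(1)[OF Q(1)] inv.LLD(3)[OF K] Q(2) that])
 consider "alm L K" | P where "P \<in> LL" "K <= P" "P <= L" "\<not> alm P K" "\<not> alm L P"
  | "\<not> alm L K" "ALL C:LL. K <= C & C <= L --> alm C K \<or> alm L C" by blast
 thus ?case
 proof cases
  case 1
  have LK: "comm_eq L K" using 1 alm_subset[OF Ks KL] by (simp add: comm_eq_def)
  show ?thesis
  proof (rule good_of_osub[OF Ll Q(1), of "{K}"])
   fix g assume g: "g \<in> Q"
   have "comm_eq (act g ` L) (act g ` K)" by (rule comm_eq_image[OF subsetD[OF osubD(3)[OF Q(1)] g] csubD(3)[OF Ll] csubD(3)[OF Kl] LK])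
   thus "EX M:{K}. comm_eq (act g ` L) M" using QK[OF g] by simp
  qed (use Kl in simp_all)
 next
  case (2 P)
  note Ps = inv.LLD(2)[OF 2(1)] and Pl = inv.LLD(1)[OF 2(1)]
  have "\<not> chain n K P" using Suc.prems(6) 2 by auto
  from Suc.IH[OF K Q 2(1,2) this] have gP: "good P" by blast
  \<comment> \<open>\<open>P\<close> itself may fail to have an open stabilizer, so it cannot serve
    as the next base, while \<open>KP\<close> is preserved by \<open>W\<close>. Being preserved also
    by the stabilizer of \<open>P\<close> puts \<open>KP\<close> into \<open>LL\<close>.\<close>
  obtain KP W where KP: "csub KP" "comm_eq KP P" "osub W" "ALL g:W. act g ` KP <= KP"
   "ALL g:carrier G. act g ` P = P --> act g ` KP <= KP" using good_imp_invariant[OF Pl gP] by blast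
  note KPs = csubD(1)[OF KP(1)]
  have aKP: "alm KP P" "alm P KP" using KP(2) by (simp_all add: comm_eq_def)
  have KPL: "KP \<in> LL"
  proof -
   obtain S where S: "S \<in> SS" "inv.invar S P" using inv.LL_invar[OF 2(1)] by blast
   have "act g ` P = P" if "g \<in> S" for g
    by (rule invar_eq[OF SS_subgroup[OF S(1)] csubD(3)[OF Pl] _ that]) (use S(2) in \<open>auto simp: inv.invar_def\<close>)
   hence "inv.invar S KP" unfolding inv.invar_def using KP(5) SS_carrier[OF S(1)] by blast
   thus ?thesis by (rule inv.LLI[OF KP(1) S(1)])
  qed
  \<comment> \<open>\<open>KP\<close> is related to \<open>K\<close> and \<open>L\<close> only up to
    finite index through \<open>P\<close>. Adding it to both restores the inclusions and changes
    \<open>L\<close> only by finite index.\<close>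
  define K' L' where "K' = K <#> KP" and "L' = L <#> KP"
  have K': "K' \<in> LL" and L': "L' \<in> LL" unfolding K'_def L'_def by (intro inv.LL_set_mult K L KPL)+
  have K'L': "K' <= L'" unfolding K'_def L'_def using KL unfolding set_mult_def by blast
  have LL': "L <= L'" unfolding L'_def by (rule set_mult_upper1[OF csubD(3)[OF Ll] KPs])
  have KK': "K <= K'" unfolding K'_def by (rule set_mult_upper1[OF csubD(3)[OF Kl] KPs])
  have "alm KP L" by (rule alm_super[OF aKP(1) 2(3)])
  hence aL': "alm L' L" unfolding L'_def by (rule alm_set_mult_least[OF Ls KPs Ls alm_subset[OF Ls subset_refl]])
  have "osub (Q \<inter> W)" by (rule osub_Int[OF Q(1) KP(3)])
  moreover have "act g ` K' <= K'" if g: "g \<in> Q \<inter> W" for g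
  proof -
   have gc: "g \<in> carrier G" using g osubD(3)[OF Q(1)] by blast
   show ?thesis
   proof
    fix y assume "y \<in> act g ` K'"
    then obtain a b where ab: "a \<in> K" "b \<in> KP" "y = act g (a \<otimes> b)" unfolding K'_def by (auto simp: set_mult_iff)
    have "y = act g a \<otimes> act g b" unfolding ab(3) using action_m[OF gc] ab(1,2) csubD(3)[OF Kl] csubD(3)[OF KP(1)] by blast
    moreover have "act g a \<in> K" "act g b \<in> KP" using ab(1,2) Q(2) KP(4) g by blast+
    ultimately show "y \<in> K'" unfolding K'_def using set_mult_I by simp
   qed
  qed
  \<comment> \<open>Cut down to \<open>L\<close>, a chain of length \<open>n\<close> over
    \<open>K'\<close> could be prolonged by the step from \<open>K' \<inter> L\<close> to
    \<open>K\<close>, which has infinite index because \<open>P\<close> is almost contained in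
    \<open>K' \<inter> L\<close>.\<close>
  moreover have "\<not> chain n K' L'"
  proof
   assume "chain n K' L'"
   hence c: "chain n (K' \<inter> L) L" by (rule inv.chain_Int[OF _ L L' K' LL' aL'])
   have K'L: "K' \<inter> L \<in> LL" by (rule inv.LL_Int[OF K' L])
   have "alm P K'" by (rule alm_super[OF aKP(2)]) (unfold K'_def, rule set_mult_upper2[OF Ks csubD(3)[OF KP(1)]])
   hence "alm P (P \<inter> K')" by (rule alm_Int[OF Ps])
   hence aP: "alm P (K' \<inter> L)" by (rule alm_super) (use 2(3) in blast)
   have "\<not> alm (K' \<inter> L) K" using alm_trans[OF Ps inv.LLD(2)[OF K'L] Ks aP] 2(4) by blast
   hence "chain (Suc n) K L" using inv.chain_prepend[OF c K L K'L] KK' KL by blast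
   thus False using Suc.prems(6) by contradiction
  qed
  ultimately have "good L'" using Suc.IH[OF K' _ _ L' K'L'] by blast
  moreover have "comm_eq L L'" using aL' alm_subset[OF Ls LL'] by (simp add: comm_eq_def)
  ultimately show ?thesis using good_comm_eq[OF Ll inv.LLD(1)[OF L']] by blast
 next
  case 3
  let ?A = "{L \<in> LL. K <= L & \<not> alm L K & (ALL C:LL. K <= C & C <= L --> alm C K \<or> alm L C)}"
  have "cc ?A" by (rule inv.relative_atoms_cc[OF rank K])
  from cc_imp[OF this] obtain \<C> where C: "countable \<C>" "\<C> <= ?A" "ALL L:?A. EX M:\<C>. comm_eq L M" by (elim exE conjE)
  have mem: "act g ` L \<in> ?A" if g: "g \<in> Q" for g
  proof -
   have gc: "g \<in> carrier G" using g osubD(3)[OF Q(1)] by blast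
   note gi = G.inv_closed[OF gc]
   have giK: "act (inv\<^sub>G g) ` K = K" by (rule QK[OF subgroup.m_inv_closed[OF osubD(1)[OF Q(1)] g]])
   have Lc: "act (inv\<^sub>G g) ` act g ` L = L" by (rule image_cancel(1)[OF gc csubD(3)[OF Ll]])
   note gL = LL_image[OF gc L]
   have "K <= act g ` L" using image_mono[OF KL, of "act g"] QK[OF g] by simp
   moreover have "\<not> alm (act g ` L) K"
   proof
    assume "alm (act g ` L) K"
    from alm_image[OF gi inv.LLD(3)[OF gL] this] show False using 3(1) unfolding Lc giK by contradiction
   qed
   moreover have "alm C K \<or> alm (act g ` L) C" if C: "C \<in> LL" "K <= C" "C <= act g ` L" for C
   proof -
    let ?C = "act (inv\<^sub>G g) ` C"
    have Cc: "act g ` ?C = C" by (rule image_cancel(2)[OF gc inv.LLD(3)[OF C(1)]])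
    have "?C \<in> LL" by (rule LL_image[OF gi C(1)])
    moreover have "K <= ?C" using image_mono[OF C(2), of "act (inv\<^sub>G g)"] unfolding giK .
    moreover have "?C <= L" using image_mono[OF C(3), of "act (inv\<^sub>G g)"] unfolding Lc .
    ultimately have "alm ?C K \<or> alm L ?C" using 3(2) by blast
    thus ?thesis
    proof
     assume "alm ?C K"
     from alm_image[OF gc image_closed[OF gi inv.LLD(3)[OF C(1)]] this] show ?thesis unfolding Cc QK[OF g] ..
    next
     assume "alm L ?C"
     from alm_image[OF gc csubD(3)[OF Ll] this] show ?thesis unfolding Cc ..
    qed
   qed
   ultimately show ?thesis using gL by blast
  qed
  show ?thesis
  proof (rule good_of_osub[OF Ll Q(1) C(1)])
   show "csub M" if "M \<in> \<C>" for M using that C(2) inv.LLD(1) by blast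
   show "EX M:\<C>. comm_eq (act g ` L) M" if "g \<in> Q" for g using C(3) mem[OF that] by blast
  qed
 qed
qed simp

theorem commensurable_open_stabilizer:
 assumes rank: "\<not> chain N {\<one>} (carrier H)" and L: "L \<in> LL"
 shows "EX K. csub K & comm_eq K L & (EX W. osub W & (ALL g:W. act g ` K <= K)) &
  (ALL g:carrier G. act g ` L = L --> act g ` K <= K)"
proof -
 have one: "\<one> \<in> L" by (rule subgroup.one_closed[OF inv.LLD(2)[OF L]])
 have "act g ` {\<one>} <= {\<one>}" if "g \<in> carrier G" for g using group_hom.hom_one[OF action_group_hom[OF that]] by simp
 moreover have "\<not> chain N {\<one>} L"
 proof
  assume ch: "chain N {\<one>} L"
  obtain P where P: "P \<in> SS" using inv.SS_nonempty by blast
  have "carrier H \<in> LL"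
   by (rule inv.LLI[OF csub_carrier P]) (use action_closed SS_carrier[OF P] in \<open>auto simp: inv.invar_def\<close>)
  from inv.chain_mono_right[OF ch inv.LLD(3)[OF L] L this] show False using rank by contradiction
 qed
 ultimately have "good L" using good_of_relative_rank[OF rank inv.one_LL osub_carrier _ L, of N] one by blast
 from good_imp_invariant[OF inv.LLD(1)[OF L] this] show ?thesis .
qed

end

section \<open>Sorts of a small compact space and their orbits\<close>

lemma tuple_act_cont:
 assumes "!!i. i < n ==> continuous_map (prod_topology TG (Y i)) (Y i) (%(g, x). \<rho> g x)"
 shows "continuous_map (prod_topology TG (product_topology Y {..<n})) (product_topology Y {..<n}) (%(g, t). tuple_act n \<rho> g t)"
 unfolding continuous_map_componentwise
proof (intro conjI ballI)
 show "(%(g, t). tuple_act n \<rho> g t) ` topspace (prod_topology TG (product_topology Y {..<n})) <= extensional {..<n}"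
  by (auto simp: tuple_act_def)
 fix i assume i: "i \<in> {..<n}"
 have "continuous_map (prod_topology TG (product_topology Y {..<n})) (prod_topology TG (Y i)) (%z. (fst z, snd z i))"
 proof (rule continuous_map_pairedI)
  show "continuous_map (prod_topology TG (product_topology Y {..<n})) (Y i) (%z. snd z i)"
   using continuous_map_compose[OF continuous_map_snd continuous_map_product_projection[OF i]] by (simp add: o_def)
 qed (rule continuous_map_fst)
 from continuous_map_compose[OF this assms] i
 have "continuous_map (prod_topology TG (product_topology Y {..<n})) (Y i) (%z. \<rho> (fst z) (snd z i))" by (simp add: o_def)
 thus "continuous_map (prod_topology TG (product_topology Y {..<n})) (Y i) (%x. (case x of (g, t) => tuple_act n \<rho> g t) i)"
  using i by (simp add: tuple_act_def case_prod_unfold)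
qed

text \<open>A continuous map from a compact to a Hausdorff space is proper. Properness survives the
  product with \<open>TG\<close>, and a proper continuous surjection is a quotient map, so
  continuity may be checked before passing to the quotient.\<close>

lemma quotient_action_cont:
 assumes X: "compact_space X" and Q: "Hausdorff_space Q" and q: "quotient_map X Q q"
  and act: "continuous_map (prod_topology TG X) X (%(g, x). \<alpha> g x)"
  and comm: "!!g x. g \<in> topspace TG ==> x \<in> topspace X ==> \<beta> g (q x) = q (\<alpha> g x)"
 shows "continuous_map (prod_topology TG Q) Q (%(g, y). \<beta> g y)"
proof (rule continuous_compose_quotient_map)
 let ?f = "%(g, x). (id g, q x)"
 have qc: "continuous_map X Q q" by (rule quotient_imp_continuous_map[OF q])
 have "proper_map X Q q" by (rule continuous_imp_proper_map[OF X Hausdorff_imp_kc_space[OF Q] qc])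
 hence "proper_map (prod_topology TG X) (prod_topology TG Q) ?f" unfolding proper_map_prod using proper_map_id[of TG] by (simp add: id_def)
 moreover have "continuous_map (prod_topology TG X) (prod_topology TG Q) ?f"
  unfolding continuous_map_prod_top using qc by simp
 moreover have "?f ` topspace (prod_topology TG X) = topspace (prod_topology TG Q)"
  using q by (simp add: quotient_map_def map_prod_def[symmetric] map_prod_surj_on)
 ultimately show "quotient_map (prod_topology TG X) (prod_topology TG Q) ?f"
  by (intro continuous_closed_imp_quotient_map proper_imp_closed_map)
 show "continuous_map (prod_topology TG X) Q ((%(g, y). \<beta> g y) \<circ> ?f)"
 proof (rule continuous_map_eq)
  show "continuous_map (prod_topology TG X) Q (q \<circ> (%(g, x). \<alpha> g x))" by (rule continuous_map_compose[OF act qc])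
 qed (auto simp: comm)
qed

locale small_compact_gspace =
 fixes S :: "('g, 'x) gspace"
 assumes cg: "compact_gspace S" and sm: "small S" and osb: "open_subgroup_basis (Grp S) (GTop S)"
begin

abbreviation "G \<equiv> Grp S"
abbreviation "TG \<equiv> GTop S"
abbreviation "XS \<equiv> topspace (XTop S)"
abbreviation "xact \<equiv> gspace.act S"
abbreviation "ta n \<equiv> tuple_act n xact"

abbreviation gmult (infixl "\<cdot>" 70) where "g \<cdot> h \<equiv> g \<otimes>\<^bsub>G\<^esub> h"
abbreviation ginv ("inv\<^sub>G _" [81] 80) where "inv\<^sub>G g \<equiv> inv\<^bsub>G\<^esub> g"
abbreviation gone ("\<one>\<^sub>G") where "\<one>\<^sub>G \<equiv> \<one>\<^bsub>G\<^esub>"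

lemma polish: "polish_group G TG" using cg by (simp add: compact_gspace_def polish_structure_def)

sublocale G: group G using polish by (simp add: polish_group_def)

lemma top_G: "topspace TG = carrier G" using polish by (simp add: polish_group_def)

sublocale A: faithful_action G XS "xact" using cg by (simp add: compact_gspace_def polish_structure_def)

lemma x_act: "g \<in> carrier G ==> x \<in> XS ==> xact g x \<in> XS" using A.surj_prop by blast

lemma x_act_mult: "g \<in> carrier G ==> h \<in> carrier G ==> x \<in> XS ==> xact (g \<cdot> h) x = xact g (xact h x)"
 using A.composition_rule by simp

lemma x_act_one: "x \<in> XS ==> xact \<one>\<^sub>G x = x" using A.id_eq_one by (metis restrict_apply')

lemma pow_iff: "t \<in> pow S n \<longleftrightarrow> t \<in> extensional {..<n} & (ALL i<n. t i \<in> XS)"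
 unfolding pow_top_def by (auto simp: PiE_iff)

lemma ta_closed: "g \<in> carrier G ==> t \<in> pow S n ==> ta n g t \<in> pow S n"
 using x_act by (simp add: pow_iff tuple_act_def)

lemma ta_mult: "g \<in> carrier G ==> h \<in> carrier G ==> t \<in> pow S n ==> ta n (g \<cdot> h) t = ta n g (ta n h t)"
 by (rule ext) (simp add: pow_iff tuple_act_def x_act_mult restrict_def)

lemma ta_one: "t \<in> pow S n ==> ta n \<one>\<^sub>G t = t"
 unfolding tuple_act_def pow_iff by (rule extensionalityI[where A = "{..<n}"]) (auto simp: x_act_one)

lemma ta_cancel: "g \<in> carrier G ==> t \<in> pow S n ==> ta n (inv\<^sub>G g) (ta n g t) = t"
 "g \<in> carrier G ==> t \<in> pow S n ==> ta n g (ta n (inv\<^sub>G g) t) = t"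
 using ta_mult[of "inv\<^sub>G g" g t n] ta_mult[of g "inv\<^sub>G g" t n] ta_one by simp_all

lemma ta_cont: "continuous_map (prod_topology TG (pow_top S n)) (pow_top S n) (%(g, t). ta n g t)"
 unfolding pow_top_def by (rule tuple_act_cont) (use cg in \<open>simp add: compact_gspace_def\<close>)

lemma pow_compact: "compact_space (pow_top S n)" "Hausdorff_space (pow_top S n)"
 using cg unfolding pow_top_def compact_gspace_def by (auto simp: compact_space_product_topology Hausdorff_space_product_topology)

lemma class_act:
 assumes E: "invariant_equiv S n E" and g: "g \<in> carrier G" and t: "t \<in> pow S n"
 shows "ta n g ` (E `` {t}) = E `` {ta n g t}"
proof -
 have eqv: "equiv (pow S n) E" and inv: "!!g s u. g \<in> carrier G ==> (s, u) \<in> E ==> (ta n g s, ta n g u) \<in> E"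
  using E unfolding invariant_equiv_def by auto
 have sub: "E <= pow S n \<times> pow S n" using eqv by (auto simp: equiv_def refl_on_def)
 show ?thesis
 proof
  show "ta n g ` (E `` {t}) <= E `` {ta n g t}" using inv[OF g] by blast
  show "E `` {ta n g t} <= ta n g ` (E `` {t})"
  proof
   fix u assume "u \<in> E `` {ta n g t}"
   hence u: "(ta n g t, u) \<in> E" by simp
   hence up: "u \<in> pow S n" using sub by blast
   have "(t, ta n (inv\<^sub>G g) u) \<in> E" using inv[OF G.inv_closed[OF g] u] ta_cancel(1)[OF g t] by simp
   thus "u \<in> ta n g ` (E `` {t})" by (intro image_eqI[of _ _ "ta n (inv\<^sub>G g) u"]) (simp_all add: ta_cancel(2)[OF g up])
  qed
 qed
qed

lemma imag_act_class:
 "invariant_equiv S n E ==> g \<in> carrier G ==> t \<in> pow S n ==> imag_act S g ((n, E), E `` {t}) = ((n, E), E `` {ta n g t})"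
 by (simp add: class_act)

lemma teq_sortD: "(n, E) \<in> teq_sorts S ==> invariant_equiv S n E"
 "(n, E) \<in> teq_sorts S ==> closedin (prod_topology (pow_top S n) (pow_top S n)) E"
 by (auto simp: teq_sorts_def)

lemma sort_topspace: "topspace (sort_top S (n, E)) = (%t. ((n, E), E `` {t})) ` pow S n"
 using quotient_map_quotient_topology[of "pow_top S n" "%t. ((n, E), E `` {t})"] by (simp add: quotient_map_def)

lemma sort_compact:
 assumes "s \<in> teq_sorts S"
 shows "compact_space (sort_top S s)" "Hausdorff_space (sort_top S s)"
  "continuous_map (prod_topology TG (sort_top S s)) (sort_top S s) (%(g, x). imag_act S g x)"
proof -
 obtain n E where s: "s = (n, E)" by (cases s)
 note E = teq_sortD[OF assms[unfolded s]]
 let ?q = "%t. ((n, E), E `` {t})"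
 have "?q u = ?q t \<longleftrightarrow> (u, t) \<in> E" if "u \<in> pow S n" "t \<in> pow S n" for u t
  using E(1) that eq_equiv_class_iff[of "pow S n" E u t] by (simp add: invariant_equiv_def)
 note ch = compact_Hausdorff_quotient[OF pow_compact E(2) this]
 show "compact_space (sort_top S s)" "Hausdorff_space (sort_top S s)" using ch unfolding s by simp_all
 show "continuous_map (prod_topology TG (sort_top S s)) (sort_top S s) (%(g, x). imag_act S g x)"
  unfolding s sort_top.simps
  by (rule quotient_action_cont[OF pow_compact(1) ch(2) quotient_map_quotient_topology ta_cont])
   (use imag_act_class[OF E(1)] top_G in auto)
qed

definition GF :: "'x set => 'g set" where "GF F = {g \<in> carrier G. ALL x:F. xact g x = x}"

lemma GF_subgroup: "F <= XS ==> subgroup (GF F) G"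
proof (rule G.subgroupI)
 assume F: "F <= XS"
 show "GF F ~= {}" unfolding GF_def using x_act_one F by blast
 show "inv\<^sub>G g \<in> GF F" if "g \<in> GF F" for g
  using that F x_act_mult[of "inv\<^sub>G g" g] x_act_one unfolding GF_def by (simp add: subset_iff) metis
 show "g \<cdot> h \<in> GF F" if "g \<in> GF F" "h \<in> GF F" for g h
  using that F x_act_mult unfolding GF_def by (simp add: subset_iff)
qed (auto simp: GF_def)

lemma GF_mono: "F <= F' ==> GF F' <= GF F" unfolding GF_def by blast

lemma GF_fixes_tuple: "t \<in> pow S n ==> g \<in> GF F ==> t ` {..<n} <= F ==> ta n g t = t"
 unfolding tuple_act_def pow_iff by (rule extensionalityI[where A = "{..<n}"]) (auto simp: GF_def)

lemma closedin_stab: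
 assumes "t \<in> pow S n" shows "closedin TG {g \<in> carrier G. ta n g t = t}"
proof -
 have "continuous_map TG (prod_topology TG (pow_top S n)) (%g. (g, t))"
  using assms by (intro continuous_map_pairedI) (auto simp: top_G)
 from continuous_map_compose[OF this ta_cont] have "continuous_map TG (pow_top S n) (%g. ta n g t)" by (simp add: o_def)
 from closedin_continuous_maps_eq[OF pow_compact(2) this, of "%_. t"] assms show ?thesis by (simp add: top_G)
qed

lemma enumerate:
 assumes "finite F" "F <= XS" shows "EX n x. x \<in> pow S n & x ` {..<n} = F"
proof -
 obtain xs where xs: "set xs = F" using finite_list[OF assms(1)] by blast
 let ?x = "restrict (%i. xs ! i) {..<length xs}"
 have "?x ` {..<length xs} = F" using xs by (force simp: in_set_conv_nth)
 moreover have "?x \<in> pow S (length xs)" using xs assms(2) nth_mem unfolding pow_iff by fastforce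
 ultimately show ?thesis by blast
qed

text \<open>The tuple \<open>x\<close> enumerating \<open>F\<close> is put in front of
  \<open>t\<close>. An element matching two such extended tuples fixes \<open>F\<close>, so
  smallness for the longer tuples counts the orbits of \<open>GF F\<close>.\<close>

lemma GF_pow_orbits:
 assumes F: "finite F" "F <= XS"
 shows "EX C. countable C & C <= pow S n & (ALL t:pow S n. EX c:C. EX g:GF F. t = ta n g c)"
proof -
 obtain m x where x: "x \<in> pow S m" "x ` {..<m} = F" using enumerate[OF F] by blast
 define cat where "cat t = (\<lambda>i\<in>{..<m + n}. if i < m then x i else t (i - m))" for t
 have cat: "cat t \<in> pow S (m + n)" if "t \<in> pow S n" for t using that x(1) unfolding cat_def pow_iff by auto
 define \<O> where "\<O> = (%t. orbit G (ta (m + n)) (cat t)) ` pow S n"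
 have "\<O> <= orbits G (pow S (m + n)) (ta (m + n))" unfolding \<O>_def orbits_def using cat by blast
 hence "countable \<O>" using sm unfolding small_def by (meson countable_subset)
 define r where "r o' = (SOME t. t \<in> pow S n & cat t \<in> o')" for o'
 let ?C = "r ` \<O> \<inter> pow S n"
 have "EX c:?C. EX g:GF F. t = ta n g c" if t: "t \<in> pow S n" for t
 proof -
  let ?o = "orbit G (ta (m + n)) (cat t)"
  have "cat t \<in> ?o" unfolding orbit_def using ta_one[OF cat[OF t]] G.one_closed by force
  hence "EX t. t \<in> pow S n & cat t \<in> ?o" using t by blast
  hence r: "r ?o \<in> pow S n & cat (r ?o) \<in> ?o" unfolding r_def by (rule someI_ex)
  then obtain h where h: "h \<in> carrier G" "cat (r ?o) = ta (m + n) h (cat t)" unfolding orbit_def by blast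
  have hx: "xact h (x i) = x i" if "i < m" for i
   using fun_cong[OF h(2), of i] that unfolding cat_def tuple_act_def by simp
  have ht: "r ?o i = xact h (t i)" if "i < n" for i
   using fun_cong[OF h(2), of "m + i"] that unfolding cat_def tuple_act_def by simp
  have hF: "h \<in> GF F" unfolding GF_def x(2)[symmetric] using h(1) hx by auto
  have "r ?o = ta n h t"
   by (rule extensionalityI[where A = "{..<n}"]) (use r ht in \<open>auto simp: pow_iff tuple_act_def\<close>)
  hence "t = ta n (inv\<^sub>G h) (r ?o)" using ta_cancel(1)[OF h(1) t] by simp
  moreover have "?o \<in> \<O>" unfolding \<O>_def using t by blast
  moreover have "inv\<^sub>G h \<in> GF F" by (rule subgroup.m_inv_closed[OF GF_subgroup[OF F(2)] hF])
  ultimately show ?thesis using r by blast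
 qed
 thus ?thesis using \<open>countable \<O>\<close> by (intro exI[of _ ?C]) auto
qed

lemma GF_sort_orbits:
 assumes F: "finite F" "F <= XS" and s: "s \<in> teq_sorts S"
 shows "EX C. countable C & C <= topspace (sort_top S s) & (ALL t:topspace (sort_top S s). EX c:C. EX g:GF F. t = imag_act S g c)"
proof -
 obtain n E where sE: "s = (n, E)" by (cases s)
 note E = teq_sortD[OF s[unfolded sE]]
 from GF_pow_orbits[OF F, of n] obtain C
  where C: "countable C" "C <= pow S n" "ALL t:pow S n. EX c:C. EX g:GF F. t = ta n g c" by (elim exE conjE)
 let ?q = "%t. ((n, E), E `` {t})"
 have "EX c:?q ` C. EX g:GF F. y = imag_act S g c" if y: "y \<in> topspace (sort_top S s)" for y
 proof -
  obtain t where t: "t \<in> pow S n" "y = ?q t" by (rule imageE[OF y[unfolded sE sort_topspace]], rule that)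
  obtain c g where cg: "c \<in> C" "g \<in> GF F" "t = ta n g c" using C(3) t(1) by blast
  have "y = imag_act S g (?q c)" unfolding t(2) cg(3)
   by (rule imag_act_class[OF E(1), symmetric]) (use cg C(2) in \<open>auto simp: GF_def\<close>)
  thus ?thesis using cg by blast
 qed
 thus ?thesis using C(1,2) unfolding sE sort_topspace by (intro exI[of _ "?q ` C"]) auto
qed

end

section \<open>The definable group as a compact group with an action\<close>

locale definable_abelian_group = small_compact_gspace S for S :: "('g, 'x) gspace" +
 fixes k :: nat and \<sigma> :: "nat => 'x srt" and H :: "(nat => 'x imag) monoid" (structure)
 assumes sorts: "!!i. i < k ==> \<sigma> i \<in> teq_sorts S"
  and closed_H: "A_closed_group S k \<sigma> {} H" and abelian: "comm_group H"
begin

sublocale H: comm_group H by (rule abelian)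

abbreviation "\<rho> \<equiv> tuple_act k (imag_act S)"
abbreviation "PT \<equiv> sorts_top S k \<sigma>"
definition "TH = subtopology PT (carrier H)"

lemma PT_compact: "compact_space PT" "Hausdorff_space PT" "continuous_map (prod_topology TG PT) PT (%(g, h). \<rho> g h)"
 unfolding sorts_top_def using sort_compact[OF sorts]
 by (auto simp: compact_space_product_topology Hausdorff_space_product_topology intro!: tuple_act_cont)

lemma PT_iff: "h \<in> topspace PT \<longleftrightarrow> h \<in> extensional {..<k} & (ALL i<k. h i \<in> topspace (sort_top S (\<sigma> i)))"
 unfolding sorts_top_def by (auto simp: PiE_iff)

lemma pstab_empty: "pstab S {} = carrier G" by (simp add: pstab_def)

lemma H_closed: "closedin PT (carrier H)" "g \<in> carrier G ==> \<rho> g ` carrier H <= carrier H"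
 "closedin (prod_topology PT (prod_topology PT PT)) (mult_graph H)"
 "g \<in> carrier G ==> map_prod (\<rho> g) (map_prod (\<rho> g) (\<rho> g)) ` mult_graph H <= mult_graph H"
 using closed_H unfolding A_closed_group_def A_closed_def Let_def pstab_empty by blast+

lemma top_H: "topspace TH = carrier H"
 unfolding TH_def using closedin_subset[OF H_closed(1)] by (simp add: Int_absorb1)

lemma H_sub: "h \<in> carrier H ==> h \<in> topspace PT" using closedin_subset[OF H_closed(1)] by blast

lemma TH_compact: "compact_space TH" "Hausdorff_space TH"
 unfolding TH_def using closedin_compact_space[OF PT_compact(1) H_closed(1)] PT_compact(2)
 by (simp_all add: compact_space_subtopology Hausdorff_space_subtopology)

lemma sort_elem:
 assumes "i < k" "y \<in> topspace (sort_top S (\<sigma> i))"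
 obtains n E t where "\<sigma> i = (n, E)" "invariant_equiv S n E" "t \<in> pow S n" "y = ((n, E), E `` {t})"
proof -
 obtain n E where s: "\<sigma> i = (n, E)" by (cases "\<sigma> i")
 obtain t where "y = ((n, E), E `` {t})" "t \<in> pow S n" by (rule imageE[OF assms(2)[unfolded s sort_topspace]])
 thus ?thesis using that[OF s teq_sortD(1)] sorts[OF assms(1)] s by simp
qed

lemma sort_act:
 assumes i: "i < k" and y: "y \<in> topspace (sort_top S (\<sigma> i))" and g: "g \<in> carrier G"
 shows "imag_act S g y \<in> topspace (sort_top S (\<sigma> i))" "h \<in> carrier G ==> imag_act S (h \<cdot> g) y = imag_act S h (imag_act S g y)"
  "imag_act S \<one>\<^sub>G y = y"
proof -
 obtain n E t where t: "\<sigma> i = (n, E)" "invariant_equiv S n E" "t \<in> pow S n" "y = ((n, E), E `` {t})" by (rule sort_elem[OF i y])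
 note a = imag_act_class[OF t(2)]
 show "imag_act S g y \<in> topspace (sort_top S (\<sigma> i))" unfolding t(1,4) a[OF g t(3)] sort_topspace using ta_closed[OF g t(3)] by blast
 show "imag_act S \<one>\<^sub>G y = y" unfolding t(4) a[OF G.one_closed t(3)] ta_one[OF t(3)] ..
 assume h: "h \<in> carrier G"
 show "imag_act S (h \<cdot> g) y = imag_act S h (imag_act S g y)"
  unfolding t(4) a[OF g t(3)] a[OF h ta_closed[OF g t(3)]] a[OF G.m_closed[OF h g] t(3)] ta_mult[OF h g t(3)] ..
qed

lemma rho_mult:
 assumes "g \<in> carrier G" "h \<in> carrier G" "x \<in> topspace PT" shows "\<rho> (g \<cdot> h) x = \<rho> g (\<rho> h x)"
 unfolding tuple_act_def using assms(3) sort_act(2)[OF _ _ assms(2,1)] by (intro restrict_ext) (simp add: PT_iff)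

lemma rho_one: "x \<in> topspace PT ==> \<rho> \<one>\<^sub>G x = x"
 unfolding tuple_act_def PT_iff by (rule extensionalityI[where A = "{..<k}"]) (auto simp: sort_act(3)[OF _ _ G.one_closed])

lemma rho_hom: assumes g: "g \<in> carrier G" shows "\<rho> g \<in> hom H H"
proof (rule homI)
 show "\<rho> g x \<in> carrier H" if "x \<in> carrier H" for x using H_closed(2)[OF g] that by blast
 fix x y assume xy: "x \<in> carrier H" "y \<in> carrier H"
 hence "(x, y, x \<otimes> y) \<in> mult_graph H" unfolding mult_graph_def by blast
 hence "map_prod (\<rho> g) (map_prod (\<rho> g) (\<rho> g)) (x, y, x \<otimes> y) \<in> mult_graph H" using H_closed(4)[OF g] by blast
 thus "\<rho> g (x \<otimes> y) = \<rho> g x \<otimes> \<rho> g y" unfolding mult_graph_def by auto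
qed

text \<open>The graph of the operation is closed by assumption and the group is compact; only the
  bracketing of the triple product has to be changed.\<close>

lemma TH_mult_cont: "continuous_map (prod_topology TH TH) TH (%(x, y). x \<otimes> y)"
proof (rule closed_graph_continuous[OF TH_compact(1)])
 let ?P = "prod_topology PT (prod_topology PT PT)"
 let ?f = "%z. (fst (fst z), snd (fst z), snd z)"
 have "continuous_map (prod_topology (prod_topology PT PT) PT) ?P ?f"
  by (intro continuous_map_pairedI continuous_map_fst_of continuous_map_snd_of continuous_map_snd)
   (use continuous_map_id in \<open>simp_all add: continuous_map_compose[OF continuous_map_fst, unfolded o_def] continuous_map_fst continuous_map_snd\<close>)
 hence "continuous_map (prod_topology (prod_topology TH TH) TH) ?P ?f"
  unfolding TH_def prod_topology_subtopology subtopology_subtopology by (rule continuous_map_from_subtopology)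
 from closedin_continuous_map_preimage[OF this H_closed(3)]
 have "closedin (prod_topology (prod_topology TH TH) TH) {z \<in> topspace (prod_topology (prod_topology TH TH) TH). ?f z \<in> mult_graph H}" .
 moreover have "{z \<in> topspace (prod_topology (prod_topology TH TH) TH). ?f z \<in> mult_graph H} =
  {(x, (%(x, y). x \<otimes> y) x) | x. x \<in> topspace (prod_topology TH TH)}"
  unfolding mult_graph_def by (auto simp: top_H)
 ultimately show "closedin (prod_topology (prod_topology TH TH) TH) {(x, (%(x, y). x \<otimes> y) x) | x. x \<in> topspace (prod_topology TH TH)}" by simp
qed (auto simp: top_H)

lemma TH_inv_cont: "continuous_map TH TH (%x. inv x)"
proof (rule closed_graph_continuous[OF TH_compact(1)])
 have "closedin TH {\<one>}" using TH_compact(2) top_H by (simp add: closedin_Hausdorff_singleton)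
 from closedin_continuous_map_preimage[OF TH_mult_cont this]
 have "closedin (prod_topology TH TH) {z \<in> topspace (prod_topology TH TH). (case z of (x, y) => x \<otimes> y) \<in> {\<one>}}" .
 moreover have "{z \<in> topspace (prod_topology TH TH). (case z of (x, y) => x \<otimes> y) \<in> {\<one>}} = {(x, inv x) | x. x \<in> topspace TH}"
  by (auto simp: top_H) (metis H.inv_equality H.m_comm)
 ultimately show "closedin (prod_topology TH TH) {(x, inv x) | x. x \<in> topspace TH}" by simp
qed (simp add: top_H)

lemma fixing_set:
 assumes "h \<in> topspace PT"
 shows "EX F. finite F & F <= XS & (ALL g:GF F. ALL i<k. imag_act S g (h i) = h i)"
proof -
 have "EX F. finite F & F <= XS & (ALL g:GF F. imag_act S g (h i) = h i)" if i: "i < k" for i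
 proof -
  obtain n E t where t: "\<sigma> i = (n, E)" "invariant_equiv S n E" "t \<in> pow S n" "h i = ((n, E), E `` {t})"
   by (rule sort_elem[OF i]) (use assms i PT_iff in auto)
  have "imag_act S g (h i) = h i" if "g \<in> GF (t ` {..<n})" for g
   unfolding t(4) using imag_act_class[OF t(2) _ t(3), of g] GF_fixes_tuple[OF t(3) that] that by (simp add: GF_def)
  moreover have "t ` {..<n} <= XS" using t(3) by (auto simp: pow_iff)
  ultimately show ?thesis by (intro exI[of _ "t ` {..<n}"]) simp
 qed
 then obtain F where F: "!!i. i < k ==> finite (F i) & F i <= XS & (ALL g:GF (F i). imag_act S g (h i) = h i)" by metis
 have "imag_act S g (h i) = h i" if "g \<in> GF (\<Union>i<k. F i)" "i < k" for g i
  using F[OF that(2)] that GF_mono[of "F i" "\<Union>i<k. F i"] by blast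
 thus ?thesis using F by (intro exI[of _ "\<Union>i<k. F i"]) auto
qed

text \<open>Orbits are counted one coordinate at a time. To keep the coordinates already matched
  with \<open>c\<close>, the next one is moved only by elements fixing both \<open>F\<close> and a
  finite set whose stabilizer fixes \<open>c\<close>.\<close>

lemma GF_PT_orbits:
 assumes F: "finite F" "F <= XS"
 shows "EX C. countable C & C <= topspace PT & (ALL h:topspace PT. EX c:C. EX g:GF F. h = \<rho> g c)"
proof -
 have "EX C. countable C & C <= topspace PT & (ALL h:topspace PT. EX c:C. EX g:GF F. ALL i<j. h i = imag_act S g (c i))" if "j \<le> k" for j
  using that
 proof (induction j)
  case 0
  thus ?case
  proof (cases "topspace PT = {}")
   case False
   then obtain h where "h \<in> topspace PT" by blast
   thus ?thesis using subgroup.one_closed[OF GF_subgroup[OF F(2)]] by (intro exI[of _ "{h}"]) auto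
  qed auto
 next
  case (Suc j)
  hence j: "j < k" by simp
  obtain C where C: "countable C" "C <= topspace PT" "ALL h:topspace PT. EX c:C. EX g:GF F. ALL i<j. h i = imag_act S g (c i)"
   using Suc by auto
  let ?Y = "topspace (sort_top S (\<sigma> j))"
  have "ALL c:C. EX D. countable D & D <= ?Y & (ALL y:?Y. EX d:D. EX g:GF F. y = imag_act S g d & (ALL i<k. imag_act S g (c i) = c i))"
  proof
   fix c assume "c \<in> C"
   with C(2) have "c \<in> topspace PT" by (rule subsetD)
   from fixing_set[OF this] obtain F' where F': "finite F'" "F' <= XS" "ALL g:GF F'. ALL i<k. imag_act S g (c i) = c i" by (elim exE conjE)
   obtain D where D: "countable D" "D <= ?Y" "ALL y:?Y. EX d:D. EX g:GF (F \<union> F'). y = imag_act S g d"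
    using GF_sort_orbits[of "F \<union> F'" "\<sigma> j"] F F' sorts[OF j] by auto
   have "GF (F \<union> F') <= GF F" "GF (F \<union> F') <= GF F'" by (auto simp: GF_def)
   hence "ALL y:?Y. EX d:D. EX g:GF F. y = imag_act S g d & (ALL i<k. imag_act S g (c i) = c i)" using D(3) F'(3) by blast
   thus "EX D. countable D & D <= ?Y & (ALL y:?Y. EX d:D. EX g:GF F. y = imag_act S g d & (ALL i<k. imag_act S g (c i) = c i))"
    using D(1,2) by blast
  qed
  from bchoice[OF this] obtain D where D: "ALL c:C. countable (D c) & D c <= ?Y & (ALL y:?Y. EX d:D c. EX g:GF F. y = imag_act S g d & (ALL i<k. imag_act S g (c i) = c i))" ..
  let ?C = "(%(c, d). c(j := d)) ` (SIGMA c:C. D c)"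
  have "countable ?C" using C(1) D by (intro countable_image countable_SIGMA) auto
  moreover have "?C <= topspace PT"
  proof
   fix h assume "h \<in> ?C"
   then obtain c d where cd: "c \<in> C" "d \<in> D c" "h = c(j := d)" by auto
   hence "c \<in> topspace PT" "d \<in> ?Y" using C(2) D by auto
   thus "h \<in> topspace PT" unfolding cd(3) PT_iff using j by (auto simp: extensional_def)
  qed
  moreover have "EX c:?C. EX g:GF F. ALL i<Suc j. h i = imag_act S g (c i)" if h: "h \<in> topspace PT" for h
  proof -
   obtain c g where cg: "c \<in> C" "g \<in> GF F" "ALL i<j. h i = imag_act S g (c i)" using C(3) h by blast
   note Gs = GF_subgroup[OF F(2)]
   have gc: "g \<in> carrier G" using cg(2) by (simp add: GF_def)
   have hi: "h i \<in> topspace (sort_top S (\<sigma> i))" "c i \<in> topspace (sort_top S (\<sigma> i))" if "i < k" for i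
    using h cg(1) C(2) PT_iff that by blast+
   have "imag_act S (inv\<^sub>G g) (h j) \<in> ?Y" by (rule sort_act(1)[OF j hi(1)[OF j] G.inv_closed[OF gc]])
   then obtain d g' where d: "d \<in> D c" "g' \<in> GF F" "imag_act S (inv\<^sub>G g) (h j) = imag_act S g' d" "ALL i<k. imag_act S g' (c i) = c i"
    using D cg(1) by blast
   have g'c: "g' \<in> carrier G" using d(2) by (simp add: GF_def)
   have dY: "d \<in> ?Y" using D cg(1) d(1) by blast
   have "h j = imag_act S (g \<cdot> g') d"
    using sort_act(2)[OF j dY g'c gc] d(3) sort_act(2)[OF j hi(1)[OF j] G.inv_closed[OF gc] gc] sort_act(3)[OF j hi(1)[OF j] gc] gc by simp
   moreover have "h i = imag_act S (g \<cdot> g') (c i)" if "i < j" for i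
    using sort_act(2)[OF _ hi(2) g'c gc, of i] that j d(4) cg(3) by simp
   ultimately have "ALL i<Suc j. h i = imag_act S (g \<cdot> g') ((c(j := d)) i)" by (simp add: less_Suc_eq)
   moreover have "g \<cdot> g' \<in> GF F" by (rule subgroup.m_closed[OF Gs cg(2) d(2)])
   moreover have "c(j := d) \<in> ?C" using cg(1) d(1) by (intro image_eqI[of _ _ "(c, d)"]) auto
   ultimately show ?thesis by blast
  qed
  ultimately show ?case by (intro exI[of _ ?C] conjI ballI)
 qed
 from this[OF order_refl] obtain C where C: "countable C" "C <= topspace PT"
  "ALL h:topspace PT. EX c:C. EX g:GF F. ALL i<k. h i = imag_act S g (c i)" by (elim exE conjE)
 have "EX c:C. EX g:GF F. h = \<rho> g c" if h: "h \<in> topspace PT" for h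
 proof -
  obtain c g where cg: "c \<in> C" "g \<in> GF F" "ALL i<k. h i = imag_act S g (c i)" using C(3) h by blast
  have "h = \<rho> g c" by (rule extensionalityI[where A = "{..<k}"]) (use cg(3) h PT_iff in \<open>auto simp: tuple_act_def\<close>)
  thus ?thesis using cg by blast
 qed
 thus ?thesis using C(1,2) by blast
qed

definition BB :: "'g set set" where "BB = {GF F | F. finite F & F <= XS}"

lemma GF_H_orbits:
 assumes F: "finite F" "F <= XS"
 shows "EX C. countable C & C <= carrier H & (ALL h:carrier H. EX c:C. EX g:GF F. h = \<rho> g c)"
proof -
 obtain C where C: "countable C" "ALL h:topspace PT. EX c:C. EX g:GF F. h = \<rho> g c" "C <= topspace PT" using GF_PT_orbits[OF F] by (elim exE conjE)
 note Gs = GF_subgroup[OF F(2)]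
 define r where "r c = (SOME h. h \<in> carrier H & (EX g:GF F. h = \<rho> g c))" for c
 have "EX c:r ` C \<inter> carrier H. EX g:GF F. h = \<rho> g c" if h: "h \<in> carrier H" for h
 proof -
  obtain c g where cg: "c \<in> C" "g \<in> GF F" "h = \<rho> g c" using C(2) H_sub[OF h] by blast
  have "EX h. h \<in> carrier H & (EX g:GF F. h = \<rho> g c)" using h cg by blast
  hence r: "r c \<in> carrier H & (EX g:GF F. r c = \<rho> g c)" unfolding r_def by (rule someI_ex)
  then obtain g' where g': "g' \<in> GF F" "r c = \<rho> g' c" by blast
  have gc: "g \<in> carrier G" "g' \<in> carrier G" using cg(2) g'(1) by (simp_all add: GF_def)
  have cP: "c \<in> topspace PT" using cg(1) C(3) by blast
  have "\<rho> (inv\<^sub>G g') (r c) = c" unfolding g'(2) using rho_mult[OF G.inv_closed[OF gc(2)] gc(2) cP] rho_one[OF cP] gc by simp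
  hence "h = \<rho> (g \<cdot> inv\<^sub>G g') (r c)" using rho_mult[OF gc(1) G.inv_closed[OF gc(2)] H_sub] r cg(3) by simp
  moreover have "g \<cdot> inv\<^sub>G g' \<in> GF F" by (intro subgroup.m_closed[OF Gs] subgroup.m_inv_closed[OF Gs] cg(2) g'(1))
  ultimately show ?thesis using r cg(1) by blast
 qed
 thus ?thesis using C(1) by (intro exI[of _ "r ` C \<inter> carrier H"]) auto
qed

end

context definable_abelian_group
begin

lemma GF_closed: assumes "finite F" "F <= XS" shows "closedin TG (GF F)"
proof -
 obtain n x where x: "x \<in> pow S n" "x ` {..<n} = F" using enumerate[OF assms] by blast
 have "GF F = {g \<in> carrier G. ta n g x = x}"
 proof
  show "GF F <= {g \<in> carrier G. ta n g x = x}" using GF_fixes_tuple[OF x(1), of _ F] x(2) by (auto simp: GF_def)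
  show "{g \<in> carrier G. ta n g x = x} <= GF F"
  proof
   fix g assume g: "g \<in> {g \<in> carrier G. ta n g x = x}"
   hence e: "ta n g x = x" by simp
   have "xact g (x i) = x i" if "i < n" for i using fun_cong[OF e, of i] that by (simp add: tuple_act_def)
   thus "g \<in> GF F" using g unfolding GF_def x(2)[symmetric] by auto
  qed
 qed
 thus ?thesis using closedin_stab[OF x(1)] by simp
qed

sublocale act: compact_group_action H TH G TG \<rho> BB
proof (intro compact_group_action.intro compact_group_action_axioms.intro compact_abelian_group.intro compact_abelian_group_axioms.intro)
 show "comm_group H" by (rule abelian)
 show "topspace TH = carrier H" by (rule top_H)
 show "compact_space TH" "Hausdorff_space TH" by (rule TH_compact)+
 show "continuous_map (prod_topology TH TH) TH (%(x, y). x \<otimes> y)" by (rule TH_mult_cont)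
 show "continuous_map TH TH (%x. inv x)" by (rule TH_inv_cont)
 show "polish_group G TG" by (rule polish)
 show "open_subgroup_basis G TG" by (rule osb)
 have cont: "continuous_map (prod_topology TG TH) TH (%(g, h). \<rho> g h)"
 proof -
  have "continuous_map (prod_topology TG TH) PT (%(g, h). \<rho> g h)"
   using continuous_map_from_subtopology[OF PT_compact(3), of "topspace TG \<times> carrier H"]
   unfolding TH_def prod_topology_subtopology by simp
  moreover have "(%(g, h). \<rho> g h) ` topspace (prod_topology TG TH) <= carrier H" using H_closed(2) by (auto simp: top_G top_H)
  ultimately show ?thesis unfolding TH_def by (subst continuous_map_in_subtopology) (auto simp: TH_def)
 qed
 show "continuous_map (prod_topology TG TH) TH (%(g, h). \<rho> g h)" by (rule cont)
 fix g assume g: "g \<in> carrier G"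
 show "\<rho> g \<in> hom H H" by (rule rho_hom[OF g])
 show "\<rho> (g \<cdot> g') h = \<rho> g (\<rho> g' h)" if "g' \<in> carrier G" "h \<in> carrier H" for g' h by (rule rho_mult[OF g that(1) H_sub[OF that(2)]])
 show "EX B':BB. ALL b:B'. inv\<^sub>G g \<cdot> b \<cdot> g \<in> B" if B: "B \<in> BB" for B
 proof -
  obtain F where F: "finite F" "F <= XS" "B = GF F" using B unfolding BB_def by blast
  let ?F = "xact g ` F"
  have "?F <= XS" using x_act[OF g] F(2) by blast
  hence "GF ?F \<in> BB" unfolding BB_def using F(1) by blast
  moreover have "inv\<^sub>G g \<cdot> b \<cdot> g \<in> B" if b: "b \<in> GF ?F" for b
  proof -
   have bc: "b \<in> carrier G" using b by (simp add: GF_def)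
   have "xact (inv\<^sub>G g \<cdot> b \<cdot> g) x = x" if x: "x \<in> F" for x
   proof -
    have xX: "x \<in> XS" using x F(2) by blast
    have "xact b (xact g x) = xact g x" using b x unfolding GF_def by blast
    thus ?thesis using x_act_mult[of "inv\<^sub>G g \<cdot> b" g x] x_act_mult[of "inv\<^sub>G g" b "xact g x"]
      x_act_mult[of "inv\<^sub>G g" g x] x_act[OF g xX] x_act_one[OF xX] bc g xX by simp
   qed
   thus ?thesis unfolding F(3) GF_def using bc g by simp
  qed
  ultimately show ?thesis by blast
 qed
next
 show "second_countable TH"
 proof -
  have sc: "second_countable TG" using polish by (simp add: polish_group_def)
  obtain \<B> where B: "countable \<B>" "!!U. U \<in> \<B> ==> openin TG U" "!!U x. openin TG U ==> x \<in> U ==> EX W:\<B>. x \<in> W & W <= U"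
   using sc unfolding second_countable_def by metis
  from GF_H_orbits[of "{}"] obtain C where C: "countable C" "C <= carrier H" "ALL h:carrier H. EX c:C. EX g:GF {}. h = \<rho> g c" by auto
  \<comment> \<open>Images of basic open sets of \<open>G\<close> under the orbit maps of countably
    many representatives: a countable network of the group.\<close>
  let ?N = "(%(V, c). (%g. \<rho> g c) ` V) ` (\<B> \<times> C)"
  show ?thesis
  proof (rule second_countable_of_network[OF TH_compact])
   show "countable ?N" using B(1) C(1) by (intro countable_image countable_SIGMA)
   fix U h assume U: "openin TH U" "h \<in> U"
   hence h: "h \<in> carrier H" using openin_subset top_H by blast
   obtain c g where cg: "c \<in> C" "g \<in> carrier G" "h = \<rho> g c" using C(3) h by (auto simp: GF_def)
   have "continuous_map TG PT (%g. \<rho> g c)"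
   proof -
    have "continuous_map TG (prod_topology TG PT) (%g. (g, c))"
     using cg(1) C(2) H_sub by (intro continuous_map_pairedI) auto
    from continuous_map_compose[OF this PT_compact(3)] show ?thesis by (simp add: o_def)
   qed
   moreover have "(%g. \<rho> g c) ` topspace TG <= carrier H" using H_closed(2) cg(1) C(2) top_G by blast
   ultimately have "continuous_map TG TH (%g. \<rho> g c)" unfolding TH_def by (subst continuous_map_in_subtopology) auto
   hence "openin TG {g \<in> topspace TG. \<rho> g c \<in> U}" using U(1) by (rule openin_continuous_map_preimage)
   moreover have "g \<in> {g \<in> topspace TG. \<rho> g c \<in> U}" using cg U(2) top_G by simp
   ultimately have "EX V:\<B>. g \<in> V & V <= {g \<in> topspace TG. \<rho> g c \<in> U}" by (rule B(3))
   then obtain V where V: "V \<in> \<B>" "g \<in> V" "V <= {g \<in> topspace TG. \<rho> g c \<in> U}" by (elim bexE conjE)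
   have "(%g. \<rho> g c) ` V \<in> ?N" using V(1) cg(1) by (intro image_eqI[of _ _ "(V, c)"]) auto
   moreover have "h \<in> (%g. \<rho> g c) ` V" "(%g. \<rho> g c) ` V <= U" using V cg(3) by auto
   ultimately show "EX N:?N. h \<in> N & N <= U" by blast
  qed
 qed
 show "\<rho> \<one>\<^sub>G h = h" if "h \<in> carrier H" for h by (rule rho_one[OF H_sub[OF that]])
 show "BB ~= {}" unfolding BB_def by blast
 show "subgroup B G" if "B \<in> BB" for B using that GF_subgroup unfolding BB_def by blast
 show "EX C:BB. C <= B & C <= B'" if B: "B \<in> BB" "B' \<in> BB" for B B'
 proof -
  obtain F F' where F: "finite F" "F <= XS" "B = GF F" "finite F'" "F' <= XS" "B' = GF F'" using B unfolding BB_def by blast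
  hence "GF (F \<union> F') \<in> BB" unfolding BB_def by blast
  thus ?thesis using GF_mono[of F "F \<union> F'"] GF_mono[of F' "F \<union> F'"] F by auto
 qed
 show "EX B:BB. ALL g:B. \<rho> g h = h" if h: "h \<in> carrier H" for h
 proof -
  from fixing_set[OF H_sub[OF h]] obtain F where F: "finite F" "F <= XS" "ALL g:GF F. ALL i<k. imag_act S g (h i) = h i" by (elim exE conjE)
  have "\<rho> g h = h" if "g \<in> GF F" for g
   by (rule extensionalityI[where A = "{..<k}"]) (use that F(3) H_sub[OF h] PT_iff in \<open>auto simp: tuple_act_def\<close>)
  thus ?thesis using F unfolding BB_def by blast
 qed
 show "EX C. countable C & C <= carrier H & (ALL h:carrier H. EX c:C. EX g:B. h = \<rho> g c)" if B: "B \<in> BB" for B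
  using B GF_H_orbits unfolding BB_def by blast
qed

end

section \<open>Long chains force large rank\<close>

context definable_abelian_group
begin

text \<open>A point \<open>x\<close> of \<open>X\<close>, as an element of the sort \<open>X\<^sup>1/=\<close>.\<close>

definition point :: "'x => 'x imag" where
 "point x = ((1, Id_on (pow S 1)), {\<lambda>i\<in>{..<1}. x})"

lemma point_act:
 assumes "g \<in> carrier G" shows "imag_act S g (point x) = point (xact g x)"
 unfolding point_def by (auto simp: tuple_act_def restrict_def)

lemma point_eq_iff: "point x = point y \<longleftrightarrow> x = y"
proof
 assume "point x = point y"
 hence "(\<lambda>i\<in>{..<1::nat}. x) = (\<lambda>i\<in>{..<1}. y)" by (simp add: point_def)
 from fun_cong[OF this, of 0] show "x = y" by simp
qed simp

lemma point_Xeq: assumes x: "x \<in> XS" shows "point x \<in> Xeq S"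
proof -
 let ?E = "Id_on (pow S 1)"
 have cls: "?E `` {t} = {t}" if "t \<in> pow S 1" for t using that by auto
 have eqv: "equiv (pow S 1) ?E" by (auto simp: equiv_def refl_on_def sym_def trans_def)
 moreover have "ALL g:carrier G. ALL (s, t):?E. (ta 1 g s, ta 1 g t) \<in> ?E" using ta_closed by auto
 ultimately have ie: "invariant_equiv S 1 ?E" by (simp add: invariant_equiv_def)
 moreover have "closedin TG (stabilizer G (%g. (`) (ta 1 g)) c)" if c: "c \<in> pow S 1 // ?E" for c
 proof -
  obtain t where t': "t \<in> pow S 1" "c = ?E `` {t}" by (rule quotientE[OF c], rule that)
  hence t: "t \<in> pow S 1" "c = {t}" using cls by simp_all
  show ?thesis unfolding stabilizer_def t(2) using closedin_stab[OF t(1)] by simp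
 qed
 ultimately have "(1, ?E) \<in> eq_sorts S" by (simp add: eq_sorts_def)
 moreover have px: "(\<lambda>i\<in>{..<1}. x) \<in> pow S 1" using x by (simp add: pow_iff)
 moreover have "{\<lambda>i\<in>{..<1}. x} \<in> pow S 1 // ?E" using quotientI[OF px, of ?E] cls[OF px] by simp
 ultimately show ?thesis unfolding Xeq_def point_def by blast
qed

lemma pstab_points: "pstab S (point ` F) = GF F"
 unfolding pstab_def GF_def using point_act point_eq_iff by auto

lemma pstab_points_sub:
 assumes "finite F" "F <= XS" "A <= point ` F"
 shows "GF F <= pstab S A" "closedin TG (pstab S A)" "subgroup (pstab S A) G"
proof -
 obtain F' where F': "F' <= F" "A = point ` F'" using assms(3) by (metis subset_imageE)
 have f: "finite F'" "F' <= XS" using F' assms by (auto intro: rev_finite_subset)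
 show "GF F <= pstab S A" "closedin TG (pstab S A)" "subgroup (pstab S A) G"
  unfolding F'(2) pstab_points using GF_mono[OF F'(1)] GF_closed[OF f] GF_subgroup[OF f(2)] by auto
qed

lemma meager_in_cover:
 assumes J: "countable J" and cov: "M <= (\<Union>j\<in>J. N j)"
  and N: "!!j. j \<in> J ==> closedin T (N j)" "!!j. j \<in> J ==> T interior_of (N j) = {}"
 shows "meager_in T M"
 unfolding meager_in_def
proof (intro exI[of _ "(%j. M \<inter> N j) ` J"] conjI ballI)
 show "countable ((%j. M \<inter> N j) ` J)" using J by simp
 show "M = \<Union>((%j. M \<inter> N j) ` J)" using cov by blast
 fix A assume "A \<in> (%j. M \<inter> N j) ` J"
 then obtain j where j: "j \<in> J" "A = M \<inter> N j" by blast
 show "A <= topspace T" using closedin_subset[OF N(1)[OF j(1)]] j(2) by blast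
 have "T closure_of A <= N j" by (rule closure_of_minimal[OF _ N(1)[OF j(1)]]) (use j(2) in blast)
 from interior_of_mono[OF this, of T] show "T interior_of (T closure_of A) = {}" unfolding N(2)[OF j(1)] by blast
qed

text \<open>Up to countably many translations \<open>GF F'\<close> keeps the coset
  \<open>b P\<close> containing \<open>h\<close>, whereas arbitrarily small elements of
  \<open>GF F\<close> move it. So the elements carrying \<open>h\<close> into its orbit over
  \<open>F'\<close> are covered by countably many closed sets without interior.\<close>

lemma nm_dependent:
 assumes F: "finite F" "F <= XS" and P: "act.csub P" and W: "act.osub W" "!!g. g \<in> W \<inter> GF F ==> \<rho> g ` P <= P"
  and b: "b \<in> carrier H" and bad: "!!V. act.osub V ==> EX g:V \<inter> GF F. inv b \<otimes> \<rho> g b \<notin> P"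
  and F': "finite F'" "F <= F'" "F' <= XS" "!!g. g \<in> GF F' ==> \<rho> g b = b"
  and h: "h \<in> carrier H" "inv b \<otimes> h \<in> P" and A: "A <= point ` F"
 shows "\<not> nm_indep S k h A (point ` F')"
proof -
 let ?G0 = "pstab S A" and ?T0 = "subtopology TG (pstab S A)"
 note G0 = pstab_points_sub[OF F A]
 note G0s = G0(3) and Ws = act.osubD(1)[OF W(1)] and Ps = act.csubD(1)[OF P] and Pc = act.csubD(3)[OF P]
 have G0c: "?G0 <= carrier G" by (rule subgroup.subset[OF G0s])
 have top0: "topspace ?T0 = ?G0" using G0c top_G by (simp add: Int_absorb1)
 have FF: "GF F' <= GF F" by (rule GF_mono[OF F'(2)])
 have orb: "orbit_over S k h A = (%g. \<rho> g h) ` pstab S A" for A unfolding orbit_over_def orbit_def by auto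
 have "A <= point ` F'" using A F'(2) by blast
 hence AF': "A \<union> point ` F' = point ` F'" by blast
 have pi1: "pi_vimage S k h A (orbit_over S k h A) = ?G0" unfolding pi_vimage_def orb by blast
 have pi2: "pi_vimage S k h A (orbit_over S k h (A \<union> point ` F')) = {g \<in> ?G0. EX c:GF F'. \<rho> g h = \<rho> c h}"
  unfolding pi_vimage_def orb AF' pstab_points by auto
 obtain D where D: "countable D" "D <= carrier G" "ALL g:carrier G. EX d:D. inv\<^sub>G d \<cdot> g \<in> W" using act.osub_cosets[OF W(1)] by blast
 \<comment> \<open>Cosets of \<open>W\<close> that meet \<open>GF F'\<close> get a representative
   inside \<open>GF F'\<close>.\<close>
 define e where "e d = (SOME c. c \<in> GF F' & inv\<^sub>G d \<cdot> c \<in> W)" for d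
 let ?J = "{d \<in> D. EX c. c \<in> GF F' & inv\<^sub>G d \<cdot> c \<in> W}"
 have e: "e d \<in> GF F' & inv\<^sub>G d \<cdot> e d \<in> W" if "d \<in> ?J" for d unfolding e_def by (rule someI_ex) (use that in simp)
 let ?bP = "{x \<in> carrier H. inv b \<otimes> x \<in> P}"
 \<comment> \<open>An element \<open>c\<close> of \<open>GF F'\<close> is \<open>e d\<close> times
   some \<open>w\<close> in \<open>W \<inter> GF F'\<close>. This \<open>w\<close> fixes
   \<open>b\<close> and preserves \<open>P\<close>, so it keeps \<open>h\<close> in the coset
   \<open>?bP\<close>.\<close>
 let ?N = "%d. {g \<in> ?G0. \<rho> (inv\<^sub>G (e d) \<cdot> g) h \<in> ?bP}"
 have clbP: "closedin TH ?bP"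
  using act.closedin_translation[OF b act.csubD(2)[OF P]] act.translation_image[OF b Pc] by simp
 have shift: "inv b \<otimes> \<rho> w x \<in> P" if x: "x \<in> carrier H" "inv b \<otimes> x \<in> P" and w: "w \<in> W \<inter> GF F" "inv b \<otimes> \<rho> w b \<in> P" for x w
 proof -
  have wc: "w \<in> carrier G" using w(1) by (auto simp: GF_def)
  have c: "\<rho> w b \<in> carrier H" "\<rho> w x \<in> carrier H" using act.action_closed[OF wc] b x by auto
  have "\<rho> w (inv b \<otimes> x) \<in> P" using W(2)[OF w(1)] x(2) by blast
  hence "inv (\<rho> w b) \<otimes> \<rho> w x \<in> P" using act.action_m[OF wc] act.action_inv[OF wc] b x(1) by simp
  thus ?thesis using H.inv_mult_mem_trans[OF Ps b c w(2)] by simp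
 qed
 have "meager_in ?T0 {g \<in> ?G0. EX c:GF F'. \<rho> g h = \<rho> c h}"
 proof (rule meager_in_cover[of ?J _ ?N])
  show "countable ?J" using D(1) by (rule countable_subset[rotated]) blast
  show "{g \<in> ?G0. EX c:GF F'. \<rho> g h = \<rho> c h} <= (\<Union>d\<in>?J. ?N d)"
  proof
   fix g assume "g \<in> {g \<in> ?G0. EX c:GF F'. \<rho> g h = \<rho> c h}"
   then obtain c where g: "g \<in> ?G0" "c \<in> GF F'" "\<rho> g h = \<rho> c h" by blast
   have cc: "c \<in> carrier G" "g \<in> carrier G" using g G0c by (auto simp: GF_def)
   obtain d where d: "d \<in> D" "inv\<^sub>G d \<cdot> c \<in> W" using D(3) cc(1) by blast
   hence dJ: "d \<in> ?J" using g(2) by blast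
   have dc: "d \<in> carrier G" using d(1) D(2) by blast
   have ec: "e d \<in> carrier G" using e[OF dJ] by (simp add: GF_def)
   let ?w = "inv\<^sub>G (e d) \<cdot> c"
   have "inv\<^sub>G (inv\<^sub>G d \<cdot> e d) \<cdot> (inv\<^sub>G d \<cdot> c) \<in> W"
    by (rule subgroup.m_closed[OF Ws subgroup.m_inv_closed[OF Ws conjunct2[OF e[OF dJ]]] d(2)])
   moreover have "inv\<^sub>G (inv\<^sub>G d \<cdot> e d) \<cdot> (inv\<^sub>G d \<cdot> c) = ?w"
   proof -
    have "d \<cdot> (inv\<^sub>G d \<cdot> c) = c" using dc cc G.m_assoc[of d "inv\<^sub>G d" c] by simp
    thus ?thesis using dc cc ec by (simp add: G.inv_mult_group G.m_assoc)
   qed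
   moreover have wF': "?w \<in> GF F'"
    using e[OF dJ] g(2) by (intro subgroup.m_closed[OF GF_subgroup[OF F'(3)]] subgroup.m_inv_closed[OF GF_subgroup[OF F'(3)]]) simp_all
   ultimately have wW: "?w \<in> W \<inter> GF F" using FF by auto
   have wc: "?w \<in> carrier G" using cc ec by simp
   have "inv b \<otimes> \<rho> ?w b \<in> P" using F'(4)[OF wF'] b subgroup.one_closed[OF Ps] by simp
   from shift[OF h wW this] have "\<rho> ?w h \<in> ?bP" using act.action_closed[OF wc h(1)] by simp
   moreover have "\<rho> ?w h = \<rho> (inv\<^sub>G (e d) \<cdot> g) h" using g(3) h(1) ec cc by (simp add: act.action_mult)
   ultimately have "g \<in> ?N d" using g(1) by simp
   thus "g \<in> (\<Union>d\<in>?J. ?N d)" using dJ by blast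
  qed
  fix d assume d: "d \<in> ?J"
  have ed: "e d \<in> GF F'" "e d \<in> carrier G" using e[OF d] by (simp_all add: GF_def)
  note ei = G.inv_closed[OF ed(2)]
  have "continuous_map TG TH (%g. \<rho> (inv\<^sub>G (e d) \<cdot> g) h)"
   using continuous_map_compose[OF act.left_cont[OF ei] act.orbit_cont[OF h(1)]] by (simp add: o_def)
  from closedin_continuous_map_preimage[OF continuous_map_from_subtopology[OF this] clbP, of ?G0]
  show "closedin ?T0 (?N d)" unfolding top0 .
  show "?T0 interior_of (?N d) = {}"
  proof (rule ccontr)
   assume "?T0 interior_of (?N d) ~= {}"
   then obtain g where gi: "g \<in> ?T0 interior_of (?N d)" by blast
   obtain U where U: "openin TG U" "?T0 interior_of (?N d) = U \<inter> ?G0" using openin_interior_of[of ?T0 "?N d"] unfolding openin_subtopology by blast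
   have UN: "U \<inter> ?G0 <= ?N d" using interior_of_subset[of ?T0 "?N d"] U(2) by simp
   have g: "g \<in> ?G0" "g \<in> U" using gi U(2) by auto
   have gc: "g \<in> carrier G" using g(1) G0c by blast
   have edG: "e d \<in> ?G0" using ed(1) FF G0(1) by blast
   define x where "x = \<rho> (inv\<^sub>G (e d) \<cdot> g) h"
   have "g \<in> ?N d" using UN g by blast
   hence x: "x \<in> carrier H" "inv b \<otimes> x \<in> P" unfolding x_def by simp_all
   let ?V = "{w \<in> topspace TG. (e d \<cdot> w) \<cdot> (inv\<^sub>G (e d) \<cdot> g) \<in> U}"
   have "openin TG ?V"
    using openin_continuous_map_preimage[OF continuous_map_compose[OF act.left_cont[OF ed(2)] act.right_cont[OF G.m_closed[OF ei gc]]] U(1)]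
    by (simp add: o_def)
   moreover have "\<one>\<^sub>G \<in> ?V"
   proof -
    have "e d \<cdot> (inv\<^sub>G (e d) \<cdot> g) = g" using ed(2) gc G.m_assoc[of "e d" "inv\<^sub>G (e d)" g] by simp
    thus ?thesis using g(2) top_G ed(2) by simp
   qed
   ultimately obtain V where V: "act.osub V" "V <= ?V" using act.osub_exists by blast
   \<comment> \<open>Such a \<open>w\<close>, as small as desired, preserves \<open>P\<close> but
     moves the coset of \<open>b\<close>; it takes the interior point \<open>g\<close> out of
     \<open>?N d\<close> while staying in the neighbourhood.\<close>
   obtain w where w: "w \<in> (V \<inter> W) \<inter> GF F" "inv b \<otimes> \<rho> w b \<notin> P" using bad[OF act.osub_Int[OF V(1) W(1)]] by blast
   have wc: "w \<in> carrier G" using w(1) by (simp add: GF_def)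
   let ?g = "(e d \<cdot> w) \<cdot> (inv\<^sub>G (e d) \<cdot> g)"
   have "w \<in> ?G0" using w(1) G0(1) by blast
   hence "?g \<in> ?G0" by (intro subgroup.m_closed[OF G0s] subgroup.m_inv_closed[OF G0s] edG g(1))
   moreover have "?g \<in> U" using w(1) V(2) by blast
   ultimately have "?g \<in> ?N d" using UN by blast
   moreover have "\<rho> (inv\<^sub>G (e d) \<cdot> ?g) h = \<rho> w x"
    unfolding x_def using ed(2) wc gc h(1) by (simp add: act.action_mult act.action_closed act.action_cancel)
   ultimately have wx: "\<rho> w x \<in> carrier H" "inv b \<otimes> \<rho> w x \<in> P" by simp_all
   have "\<rho> w (inv b \<otimes> x) \<in> P" using W(2)[of w] w(1) x(2) by blast
   hence "inv (\<rho> w b) \<otimes> \<rho> w x \<in> P" using act.action_m[OF wc] act.action_inv[OF wc] b x(1) by simp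
   hence "inv b \<otimes> \<rho> w b \<in> P"
    using H.inv_mult_mem_trans[OF Ps b wx(1) act.action_closed[OF wc b] wx(2)] H.inv_mult_mem_sym[OF Ps _ wx(1)] act.action_closed[OF wc b] by simp
   thus False using w(2) by contradiction
  qed
 qed
 thus ?thesis unfolding nm_indep_def pi1 pi2 by simp
qed

text \<open>If every coset of \<open>P\<close> inside \<open>b L\<close> were kept by some
  \<open>V \<inter> GF F\<close>, then countably many \<open>V\<close> from a base at the identity,
  with their countably many orbits each, would leave only countably many such cosets. Then
  \<open>L\<close> would be almost contained in \<open>P\<close>.\<close>

lemma exists_moving_coset:
 assumes F: "finite F" "F <= XS" and P: "act.csub P" "act.csub L" "\<not> H.alm L P" and b: "b \<in> carrier H"
 shows "EX c. c \<in> carrier H & inv b \<otimes> c \<in> L & (ALL V. act.osub V --> (EX g:V \<inter> GF F. inv c \<otimes> \<rho> g c \<notin> P))"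
proof (rule ccontr)
 assume neg: "\<not> ?thesis"
 note Ps = act.csubD(1)[OF P(1)]
 have sc: "second_countable TG" using polish by (simp add: polish_group_def)
 obtain \<B> where B: "countable \<B>" "!!U. U \<in> \<B> ==> openin TG U" "!!U x. openin TG U ==> x \<in> U ==> EX W:\<B>. x \<in> W & W <= U"
  using sc unfolding second_countable_def by metis
 let ?B = "{U \<in> \<B>. \<one>\<^sub>G \<in> U}"
 have "ALL U:?B. EX V. act.osub V & V <= U" using act.osub_exists B(2) by blast
 from bchoice[OF this] obtain V where V: "ALL U:?B. act.osub (V U) & V U <= U" ..
 have "ALL U:?B. EX C. countable C & C <= carrier H & (ALL h:carrier H. EX c:C. EX g:V U \<inter> GF F. h = \<rho> g c)"
 proof
  fix U assume "U \<in> ?B"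
  hence "V U \<inter> GF F \<in> act.SS" using V F by (intro act.SS_I) (auto simp: BB_def)
  thus "EX C. countable C & C <= carrier H & (ALL h:carrier H. EX c:C. EX g:V U \<inter> GF F. h = \<rho> g c)" by (rule act.SS_orbits)
 qed
 from bchoice[OF this] obtain C where
  C: "ALL U:?B. countable (C U) & C U <= carrier H & (ALL h:carrier H. EX c:C U. EX g:V U \<inter> GF F. h = \<rho> g c)" ..
 let ?D = "(%c. inv b \<otimes> c) ` (\<Union>U\<in>?B. C U)"
 have "H.alm L P"
 proof (rule act.alm_of_countable_cosets[OF P(2,1), of ?D])
  have "countable ?B" by (rule countable_subset[OF _ B(1)]) blast
  thus "countable ?D" using C by (intro countable_image countable_UN) auto
  show "?D <= carrier H" using C b by auto
  fix l assume l: "l \<in> L"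
  have lc: "l \<in> carrier H" by (rule subsetD[OF act.csubD(3)[OF P(2)] l])
  let ?c = "b \<otimes> l"
  have cc: "?c \<in> carrier H" "inv b \<otimes> ?c = l" using b lc by (simp_all add: H.m_assoc[symmetric])
  then obtain V' where V': "act.osub V'" "ALL g:V' \<inter> GF F. inv ?c \<otimes> \<rho> g ?c \<in> P" using neg l by (metis (no_types, lifting))
  obtain U where U: "U \<in> \<B>" "\<one>\<^sub>G \<in> U" "U <= V'" using B(3)[OF act.osubD(2,4)[OF V'(1)]] by blast
  hence UB: "U \<in> ?B" by simp
  obtain c g where cg: "c \<in> C U" "g \<in> V U \<inter> GF F" "?c = \<rho> g c" using bspec[OF C UB] cc(1) by blast
  have c: "c \<in> carrier H" using cg(1) C UB by blast
  have VU: "act.osub (V U)" "V U <= V'" using bspec[OF V UB] U(3) by auto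
  have gc: "g \<in> carrier G" using cg(2) by (simp add: GF_def)
  have "inv\<^sub>G g \<in> V' \<inter> GF F"
   using subgroup.m_inv_closed[OF act.osubD(1)[OF VU(1)]] subgroup.m_inv_closed[OF GF_subgroup[OF F(2)]] cg(2) VU(2) by blast
  hence "inv ?c \<otimes> \<rho> (inv\<^sub>G g) ?c \<in> P" using V'(2) by blast
  moreover have "\<rho> (inv\<^sub>G g) ?c = c" unfolding cg(3) by (rule act.action_cancel(1)[OF gc c])
  ultimately have "inv ?c \<otimes> c \<in> P" by simp
  hence "inv c \<otimes> ?c \<in> P" by (rule H.inv_mult_mem_sym[OF Ps cc(1) c])
  moreover have "inv (inv b \<otimes> c) \<otimes> l = inv c \<otimes> ?c" using b c lc by (simp add: H.inv_mult H.m_ac)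
  ultimately show "EX d:?D. inv d \<otimes> l \<in> P" using cg(1) UB by (intro bexI[of _ "inv b \<otimes> c"]) auto
 qed
 thus False using P(3) by contradiction
qed

text \<open>The element \<open>h\<close> for the shorter chain must be found in a prescribed coset
  of \<open>P\<close> and over an enlarged set that also fixes the new \<open>c\<close>; hence the
  quantifiers over \<open>b\<close> and over all larger \<open>F\<close>. Allowing every
  \<open>A\<close> below \<open>F\<close> makes the empty parameter set available at the
  end.\<close>

lemma rank_of_chain:
 assumes "L \<in> act.LL" "act.chain n K L"
 shows "EX F0. finite F0 & F0 <= XS & (ALL F. finite F --> F0 <= F --> F <= XS --> (ALL b:carrier H. EX h:carrier H.
  inv b \<otimes> h \<in> L & (ALL A. A <= point ` F --> NM_ge S k h A n)))"
 using assms
proof (induction n arbitrary: L)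
 case 0
 have "EX h:carrier H. inv b \<otimes> h \<in> L & (ALL A. A <= point ` F --> NM_ge S k h A 0)" if "b \<in> carrier H" for b F
  using that subgroup.one_closed[OF act.inv.LLD(2)[OF 0(1)]] by (intro bexI[OF _ that]) simp
 thus ?case by (intro exI[of _ "{}"]) simp
next
 case (Suc n)
 then obtain P where P: "P \<in> act.LL" "K <= P" "P <= L" "\<not> H.alm L P" "act.chain n K P" by auto
 note Ps = act.inv.LLD(2)[OF P(1)] and Pc = act.inv.LLD(1)[OF P(1)] and Ls = act.inv.LLD(2)[OF Suc.prems(1)]
 from Suc.IH[OF P(1,5)] obtain F1 where F1: "finite F1" "F1 <= XS"
  "ALL F. finite F --> F1 <= F --> F <= XS --> (ALL b:carrier H. EX h:carrier H.
   inv b \<otimes> h \<in> P & (ALL A. A <= point ` F --> NM_ge S k h A n))" by (elim exE conjE)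
 obtain Q where Q: "Q \<in> act.SS" "act.inv.invar Q P" using act.inv.LL_invar[OF P(1)] by blast
 obtain W B where WB: "act.osub W" "B \<in> BB" "Q = W \<inter> B" using Q(1) by (rule act.SS_E)
 obtain F2 where F2: "finite F2" "F2 <= XS" "B = GF F2" using WB(2) unfolding BB_def by blast
 have "EX h:carrier H. inv b \<otimes> h \<in> L & (ALL A. A <= point ` F --> NM_ge S k h A (Suc n))"
  if F: "finite F" "F1 \<union> F2 <= F" "F <= XS" and b: "b \<in> carrier H" for F b
 proof -
  obtain c where c: "c \<in> carrier H" "inv b \<otimes> c \<in> L" "!!V. act.osub V ==> EX g:V \<inter> GF F. inv c \<otimes> \<rho> g c \<notin> P"
   using exists_moving_coset[OF F(1,3) Pc act.inv.LLD(1)[OF Suc.prems(1)] P(4) b] by blast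
  obtain B' where B': "B' \<in> BB" "ALL g:B'. \<rho> g c = c" using act.BB_fix[OF c(1)] by blast
  obtain F3 where F3: "finite F3" "F3 <= XS" "B' = GF F3" using B'(1) unfolding BB_def by blast
  let ?F = "F \<union> F3"
  have F': "finite ?F" "F <= ?F" "?F <= XS" "F1 <= ?F" using F F3 by auto
  have fixc: "\<rho> g c = c" if "g \<in> GF ?F" for g using B'(2) F3(3) GF_mono[of F3 ?F] that by blast
  obtain h where h: "h \<in> carrier H" "inv c \<otimes> h \<in> P" "!!A. A <= point ` ?F ==> NM_ge S k h A n"
   using F1(3)[rule_format, OF F'(1,4,3) c(1)] by blast
  have pres: "\<rho> g ` P <= P" if "g \<in> W \<inter> GF F" for g
   using Q(2) WB(3) F2(3) GF_mono[of F2 F] F(2) that unfolding act.inv.invar_def by blast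
  have "NM_ge S k h A (Suc n)" if A: "A <= point ` F" for A
  proof -
   have "\<not> nm_indep S k h A (point ` ?F)"
    by (rule nm_dependent[OF F(1,3) Pc WB(1) pres c(1,3) F'(1-3) fixc h(1,2) A])
   moreover have "finite (point ` ?F)" "A <= point ` ?F" "point ` ?F <= Xeq S" using F' A point_Xeq by auto
   ultimately show ?thesis using h(3)[of "point ` ?F"] unfolding NM_ge.simps by blast
  qed
  moreover have "inv b \<otimes> h \<in> L" by (rule H.inv_mult_mem_trans[OF Ls b c(1) h(1) c(2) subsetD[OF P(3) h(2)]])
  ultimately show ?thesis using h(1) by blast
 qed
 thus ?case using F1(1,2) F2(1,2) by (intro exI[of _ "F1 \<union> F2"]) auto
qed

lemma finite_rank:
 assumes "NM_set S k (carrier H) < \<infinity>"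
 shows "EX N. \<not> act.chain N {\<one>} (carrier H)"
proof -
 obtain N where N: "NM_set S k (carrier H) = enat N" using assms by (cases "NM_set S k (carrier H)") auto
 have "\<not> act.chain (Suc N) {\<one>} (carrier H)"
 proof
  assume ch: "act.chain (Suc N) {\<one>} (carrier H)"
  obtain P where P: "P \<in> act.SS" using act.inv.SS_nonempty by blast
  have "carrier H \<in> act.LL"
   by (rule act.inv.LLI[OF act.csub_carrier P]) (use act.action_closed act.SS_carrier[OF P] in \<open>auto simp: act.inv.invar_def\<close>)
  from rank_of_chain[OF this ch] obtain F0 where F0: "finite F0" "F0 <= XS"
   "ALL F. finite F --> F0 <= F --> F <= XS --> (ALL b:carrier H. EX h:carrier H.
    inv b \<otimes> h \<in> carrier H & (ALL A. A <= point ` F --> NM_ge S k h A (Suc N)))" by (elim exE conjE)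
  obtain h where h: "h \<in> carrier H" "NM_ge S k h {} (Suc N)" using F0(3)[rule_format, OF F0(1) subset_refl F0(2) H.one_closed] by blast
  have "enat (Suc N) \<le> NM S k h {}" unfolding NM_def by (rule Sup_upper) (use h(2) in blast)
  also have "\<dots> \<le> NM_set S k (carrier H)" unfolding NM_set_def by (rule SUP_upper[OF h(1)])
  finally show False unfolding N by simp
 qed
 thus ?thesis ..
qed

end

section \<open>Open subgroups, imaginaries and the conclusion\<close>

context compact_group_action
begin

lemma osub_super:
 assumes W: "osub W" and Q: "subgroup Q G" "W <= Q" shows "osub Q"
proof -
 have "EX U. openin TG U & q \<in> U & U <= Q" if q: "q \<in> Q" for q
 proof -
  have qc: "q \<in> carrier G" by (rule subgroup.mem_carrier[OF Q(1) q])
  let ?U = "{x \<in> topspace TG. inv\<^sub>G q \<cdot> x \<in> W}"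
  have "openin TG ?U" by (rule openin_continuous_map_preimage[OF left_cont[OF G.inv_closed[OF qc]] osubD(2)[OF W]])
  moreover have "q \<in> ?U" using qc osubD(4)[OF W] top_G by simp
  moreover have "?U <= Q"
  proof
   fix x assume x: "x \<in> ?U"
   hence "q \<cdot> (inv\<^sub>G q \<cdot> x) \<in> Q" using Q(2) by (intro subgroup.m_closed[OF Q(1) q]) auto
   thus "x \<in> Q" using x qc top_G G.m_assoc[of q "inv\<^sub>G q" x] by simp
  qed
  ultimately show ?thesis by blast
 qed
 hence "openin TG Q" by (subst openin_subopen) blast
 thus ?thesis using Q(1) by (simp add: osub_def)
qed

lemma osub_closedin:
 assumes Q: "osub Q" shows "closedin TG Q"
proof -
 note Qs = osubD(1)[OF Q]
 have "topspace TG - Q = (\<Union>g\<in>carrier G - Q. {x \<in> topspace TG. inv\<^sub>G g \<cdot> x \<in> Q})"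
 proof
  show "topspace TG - Q <= (\<Union>g\<in>carrier G - Q. {x \<in> topspace TG. inv\<^sub>G g \<cdot> x \<in> Q})"
   using osubD(4)[OF Q] top_G by auto
  show "(\<Union>g\<in>carrier G - Q. {x \<in> topspace TG. inv\<^sub>G g \<cdot> x \<in> Q}) <= topspace TG - Q"
  proof
   fix x assume "x \<in> (\<Union>g\<in>carrier G - Q. {x \<in> topspace TG. inv\<^sub>G g \<cdot> x \<in> Q})"
   then obtain g where g: "g \<in> carrier G" "g \<notin> Q" "x \<in> carrier G" "inv\<^sub>G g \<cdot> x \<in> Q" using top_G by auto
   have "x \<notin> Q"
   proof
    assume "x \<in> Q"
    hence "x \<cdot> inv\<^sub>G (inv\<^sub>G g \<cdot> x) \<in> Q" by (intro subgroup.m_closed[OF Qs] subgroup.m_inv_closed[OF Qs] g)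
    moreover have "x \<cdot> inv\<^sub>G (inv\<^sub>G g \<cdot> x) = g" using g by (simp add: G.inv_mult_group G.m_assoc[symmetric])
    ultimately show False using g(2) by simp
   qed
   thus "x \<in> topspace TG - Q" using g(3) top_G by simp
  qed
 qed
 moreover have "openin TG (\<Union>g\<in>carrier G - Q. {x \<in> topspace TG. inv\<^sub>G g \<cdot> x \<in> Q})"
  by (rule openin_Union) (auto intro!: openin_continuous_map_preimage[OF left_cont osubD(2)[OF Q]])
 moreover have "Q <= topspace TG" using osubD(3)[OF Q] top_G by simp
 ultimately show ?thesis unfolding closedin_def by simp
qed

end

context definable_abelian_group
begin

text \<open>An open subgroup \<open>Q\<close> containing the stabilizer of a tuple \<open>x\<close> is the stabilizer of an
  imaginary: the class of \<open>x\<close> under the relation with classes \<open>g Q x\<close> and singletons.\<close>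

lemma open_subgroup_stabilizer:
 assumes Q: "act.osub Q" and F: "finite F" "F <= XS" "GF F <= Q"
 shows "EX a:Acl_empty S. pstab S {a} <= Q"
proof -
 note Qs = act.osubD(1)[OF Q]
 obtain n x where x: "x \<in> pow S n" "x ` {..<n} = F" using enumerate[OF F(1,2)] by blast
 have stab: "g \<in> Q" if "g \<in> carrier G" "ta n g x = x" for g
 proof -
  have "xact g (x i) = x i" if "i < n" for i
   using fun_cong[OF \<open>ta n g x = x\<close>, of i] that by (simp add: tuple_act_def)
  hence "g \<in> GF F" unfolding GF_def x(2)[symmetric] using \<open>g \<in> carrier G\<close> by auto
  thus ?thesis using F(3) by blast
 qed
 \<comment> \<open>The stabilizer of \<open>x\<close> lies in \<open>Q\<close>, so the coset
   \<open>g Q\<close> depends only on the tuple \<open>g x\<close>; this is what makes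
   \<open>E\<close> transitive and \<open>key\<close> an equivalence.\<close>
 have stab2: "inv\<^sub>G g \<cdot> h \<in> Q" if g: "g \<in> carrier G" and h: "h \<in> carrier G" and e: "ta n g x = ta n h x" for g h
  using stab[of "inv\<^sub>G g \<cdot> h"] ta_mult[OF G.inv_closed[OF g] h x(1)] ta_cancel(1)[OF g x(1)] e g h by simp
 define E where "E = {(s, t). s \<in> pow S n & t \<in> pow S n & (s = t \<or> (EX g:carrier G. EX h:carrier G.
  s = ta n g x & t = ta n h x & inv\<^sub>G g \<cdot> h \<in> Q))}"
 have comp: "inv\<^sub>G g \<cdot> l \<in> Q" if "g \<in> carrier G" "h \<in> carrier G" "l \<in> carrier G" "inv\<^sub>G g \<cdot> h \<in> Q" "inv\<^sub>G h \<cdot> l \<in> Q" for g h l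
 proof -
  have "h \<cdot> (inv\<^sub>G h \<cdot> l) = l" using that G.m_assoc[of h "inv\<^sub>G h" l] by simp
  hence "(inv\<^sub>G g \<cdot> h) \<cdot> (inv\<^sub>G h \<cdot> l) = inv\<^sub>G g \<cdot> l" using that by (simp add: G.m_assoc)
  thus ?thesis using subgroup.m_closed[OF Qs that(4,5)] by simp
 qed
 have key: "(ta n g x, ta n h x) \<in> E \<longleftrightarrow> inv\<^sub>G g \<cdot> h \<in> Q" if g: "g \<in> carrier G" and h: "h \<in> carrier G" for g h
 proof
  assume "inv\<^sub>G g \<cdot> h \<in> Q"
  thus "(ta n g x, ta n h x) \<in> E" unfolding E_def using g h ta_closed[OF _ x(1)] by blast
 next
  assume "(ta n g x, ta n h x) \<in> E"
  hence "ta n g x = ta n h x \<or> (EX g':carrier G. EX h':carrier G. ta n g x = ta n g' x & ta n h x = ta n h' x & inv\<^sub>G g' \<cdot> h' \<in> Q)"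
   unfolding E_def mem_Collect_eq case_prod_conv by (elim conjE)
  thus "inv\<^sub>G g \<cdot> h \<in> Q"
  proof (elim disjE bexE conjE)
   assume "ta n g x = ta n h x"
   thus ?thesis by (rule stab2[OF g h])
  next
   fix g' h' assume 2: "g' \<in> carrier G" "h' \<in> carrier G" "ta n g x = ta n g' x" "ta n h x = ta n h' x" "inv\<^sub>G g' \<cdot> h' \<in> Q"
   show ?thesis by (rule comp[OF g 2(1) h stab2[OF g 2(1,3)] comp[OF 2(1,2) h 2(5) stab2[OF 2(2) h 2(4)[symmetric]]]])
  qed
 qed
 have orb: "s = t \<or> (EX g:carrier G. EX h:carrier G. s = ta n g x & t = ta n h x)" if "(s, t) \<in> E" for s t
  using that unfolding E_def by blast
 have sub: "E <= pow S n \<times> pow S n" unfolding E_def by blast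
 have symE: "(t, s) \<in> E" if st: "(s, t) \<in> E" for s t
  using orb[OF st]
 proof (elim disjE bexE conjE)
  fix g h assume gh: "g \<in> carrier G" "h \<in> carrier G" "s = ta n g x" "t = ta n h x"
  have "inv\<^sub>G (inv\<^sub>G g \<cdot> h) \<in> Q" using st key[OF gh(1,2)] gh(3,4) subgroup.m_inv_closed[OF Qs] by blast
  hence "inv\<^sub>G h \<cdot> g \<in> Q" using gh(1,2) by (simp add: G.inv_mult_group)
  thus ?thesis using key[OF gh(2,1)] gh(3,4) by simp
 qed (use st in simp)
 have transE: "(s, u) \<in> E" if st: "(s, t) \<in> E" "(t, u) \<in> E" for s t u
  using orb[OF st(1)] orb[OF st(2)]
 proof (elim disjE bexE conjE)
  fix g h g' h' assume g: "g \<in> carrier G" "h \<in> carrier G" "s = ta n g x" "t = ta n h x"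
   and g': "g' \<in> carrier G" "h' \<in> carrier G" "t = ta n g' x" "u = ta n h' x"
  have "inv\<^sub>G g \<cdot> h \<in> Q" using st(1) key[OF g(1,2)] g(3,4) by simp
  moreover have "inv\<^sub>G h \<cdot> h' \<in> Q" using st(2) key[OF g(2) g'(2)] g(4) g'(4) by simp
  ultimately show ?thesis using key[OF g(1) g'(2)] comp[OF g(1,2) g'(2)] g(3) g'(4) by simp
 qed (use st in simp_all)
 have eqv: "equiv (pow S n) E"
 proof (rule equivI)
  show "refl_on (pow S n) E" unfolding refl_on_def by (simp add: E_def)
  show "sym E" by (rule symI) (rule symE)
  show "trans E" by (rule transI) (rule transE)
 qed (rule sub)
 have ie: "invariant_equiv S n E"
  unfolding invariant_equiv_def
 proof (intro conjI eqv ballI, clarify)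
  fix g s t assume g: "g \<in> carrier G" and st: "(s, t) \<in> E"
  hence c: "s \<in> pow S n" "t \<in> pow S n" using sub by auto
  show "(ta n g s, ta n g t) \<in> E"
   using orb[OF st]
  proof (elim disjE bexE conjE)
   assume "s = t"
   thus ?thesis unfolding E_def using ta_closed[OF g] c by blast
  next
   fix h l assume h: "h \<in> carrier G" "l \<in> carrier G" "s = ta n h x" "t = ta n l x"
   have "inv\<^sub>G (g \<cdot> h) \<cdot> (g \<cdot> l) = inv\<^sub>G h \<cdot> l"
    using g h G.m_assoc[of "inv\<^sub>G g" g l] by (simp add: G.inv_mult_group G.m_assoc)
   thus ?thesis using key[of "g \<cdot> h" "g \<cdot> l"] key[OF h(1,2)] st g h ta_mult[OF g _ x(1)] by simp
  qed
 qed
 have class_stab: "ta n g ` (E `` {s}) = E `` {s} \<longleftrightarrow> (s, ta n g s) \<in> E" if "g \<in> carrier G" "s \<in> pow S n" for g s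
  unfolding class_act[OF ie that] using eq_equiv_class_iff[OF eqv that(2) ta_closed[OF that]] by auto
 have "closedin TG (stabilizer G (%g. (`) (ta n g)) c)" if c: "c \<in> pow S n // E" for c
 proof -
  obtain s where s: "s \<in> pow S n" "c = E `` {s}" by (rule quotientE[OF c], rule that)
  have st: "stabilizer G (%g. (`) (ta n g)) c = {g \<in> carrier G. (s, ta n g s) \<in> E}"
   unfolding stabilizer_def s(2) using class_stab[OF _ s(1)] by blast
  show ?thesis
  \<comment> \<open>On the orbit of \<open>x\<close> the stabilizer of a class is a conjugate of
    \<open>Q\<close>, and open subgroups are closed. Elsewhere the class is a singleton and its
    stabilizer that of a tuple.\<close>
  proof (cases "EX h:carrier G. s = ta n h x")
   case False
   hence "{g \<in> carrier G. (s, ta n g s) \<in> E} = {g \<in> carrier G. ta n g s = s}"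
    using orb[of s] s(1) unfolding E_def by auto
   thus ?thesis unfolding st using closedin_stab[OF s(1)] by simp
  next
   case True
   then obtain h where h: "h \<in> carrier G" "s = ta n h x" by blast
   have "(s, ta n g s) \<in> E \<longleftrightarrow> inv\<^sub>G h \<cdot> g \<cdot> h \<in> Q" if g: "g \<in> carrier G" for g
    using key[OF h(1), of "g \<cdot> h"] ta_mult[OF g h(1) x(1)] h g by (simp add: G.m_assoc)
   hence "{g \<in> carrier G. (s, ta n g s) \<in> E} = {g \<in> topspace TG. inv\<^sub>G h \<cdot> g \<cdot> h \<in> Q}" using top_G by auto
   thus ?thesis unfolding st
    using closedin_continuous_map_preimage[OF act.conj_cont[OF h(1)] act.osub_closedin[OF Q]] by simp
  qed
 qed
 hence "(n, E) \<in> eq_sorts S" using ie by (simp add: eq_sorts_def)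
 hence aX: "((n, E), E `` {x}) \<in> Xeq S" unfolding Xeq_def using quotientI[OF x(1)] by blast
 obtain D where D: "countable D" "D <= carrier G" "ALL g:carrier G. EX d:D. inv\<^sub>G d \<cdot> g \<in> Q" using act.osub_cosets[OF Q] by blast
 have "orbit G (imag_act S) ((n, E), E `` {x}) <= (%d. ((n, E), E `` {ta n d x})) ` D"
 proof
  fix y assume "y \<in> orbit G (imag_act S) ((n, E), E `` {x})"
  then obtain g where g: "g \<in> carrier G" "y = ((n, E), E `` {ta n g x})" unfolding orbit_def using imag_act_class[OF ie _ x(1)] by auto
  obtain d where d: "d \<in> D" "inv\<^sub>G d \<cdot> g \<in> Q" using D(3) g(1) by blast
  hence "(ta n d x, ta n g x) \<in> E" using key[OF _ g(1)] D(2) by blast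
  from equiv_class_eq[OF eqv this] show "y \<in> (%d. ((n, E), E `` {ta n d x})) ` D" unfolding g(2) using d(1) by (intro image_eqI[of _ _ d]) simp_all
 qed
 hence "countable (orbit G (imag_act S) ((n, E), E `` {x}))" by (rule countable_subset) (use D(1) in simp)
 hence "((n, E), E `` {x}) \<in> Acl_empty S" using aX by (simp add: Acl_empty_def)
 moreover have "pstab S {((n, E), E `` {x})} <= Q"
 proof
  fix g assume "g \<in> pstab S {((n, E), E `` {x})}"
  hence g: "g \<in> carrier G" "ta n g ` (E `` {x}) = E `` {x}" by (auto simp: pstab_def)
  hence "(ta n \<one>\<^sub>G x, ta n g x) \<in> E" using class_stab[OF g(1) x(1)] ta_one[OF x(1)] by simp
  thus "g \<in> Q" using key[OF G.one_closed g(1)] g(1) by simp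
 qed
 ultimately show ?thesis by blast
qed

text \<open>An imaginary is fixed as soon as a tuple representing it is.\<close>

lemma pstab_contains_GF:
 assumes "finite A" "A <= Xeq S"
 shows "EX F. finite F & F <= XS & GF F <= pstab S A"
 using assms
proof (induction A)
 case empty
 thus ?case by (intro exI[of _ "{}"]) (auto simp: GF_def pstab_def)
next
 case (insert a A)
 then obtain F where F: "finite F" "F <= XS" "GF F <= pstab S A" by blast
 obtain n E c where a: "a = ((n, E), c)" "(n, E) \<in> eq_sorts S" "c \<in> pow S n // E" using insert.prems unfolding Xeq_def by blast
 have ie: "invariant_equiv S n E" using a(2) by (simp add: eq_sorts_def)
 obtain t where t: "t \<in> pow S n" "c = E `` {t}" by (rule quotientE[OF a(3)], rule that)
 let ?F = "F \<union> t ` {..<n}"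
 have "imag_act S g a = a" if g: "g \<in> GF ?F" for g
  unfolding a(1) t(2) using imag_act_class[OF ie _ t(1), of g] GF_fixes_tuple[OF t(1) g] g by (simp add: GF_def)
 hence "GF ?F <= pstab S (insert a A)" using F(3) GF_mono[of F ?F] unfolding pstab_def by auto
 moreover have "t ` {..<n} <= XS" using t(1) by (auto simp: pow_iff)
 ultimately show ?case using F(1,2) by (intro exI[of _ ?F]) simp
qed

lemma finite_rcosets:
 assumes K: "subgroup K H" and L: "subgroup L H" and KL: "H.alm K L"
 shows "finite (rcosets\<^bsub>H\<lparr>carrier := K\<rparr>\<^esub> (K \<inter> L))"
proof -
 obtain F where F: "finite F" "F <= K" "!!a. a \<in> K ==> EX f:F. inv f \<otimes> a \<in> L" by (rule H.almE[OF KL], rule that)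
 have "rcosets\<^bsub>H\<lparr>carrier := K\<rparr>\<^esub> (K \<inter> L) <= (%f. (K \<inter> L) #> f) ` F"
 proof
  fix C assume "C \<in> rcosets\<^bsub>H\<lparr>carrier := K\<rparr>\<^esub> (K \<inter> L)"
  then obtain a where a: "a \<in> K" "C = (K \<inter> L) #> a" unfolding RCOSETS_def r_coset_def by auto
  obtain f where f: "f \<in> F" "inv f \<otimes> a \<in> L" using F(3)[OF a(1)] by blast
  have fK: "f \<in> K" using f(1) F(2) by blast
  have c: "a \<in> carrier H" "f \<in> carrier H" using subgroup.mem_carrier[OF K] a(1) fK by auto
  have "a \<otimes> inv f \<in> K" by (intro subgroup.m_closed[OF K] subgroup.m_inv_closed[OF K] a fK)
  moreover have "a \<otimes> inv f \<in> L" using f(2) c by (simp add: H.m_comm)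
  ultimately have "C = (K \<inter> L) #> f" unfolding a(2) using act.coset_eq_iff[OF H.subgroups_Inter_pair[OF K L] c] by simp
  thus "C \<in> (%f. (K \<inter> L) #> f) ` F" using f(1) by blast
 qed
 thus ?thesis using F(1) by (rule finite_surj[rotated])
qed

lemma Acl_closed_commensurable:
 assumes rank: "NM_set S k (carrier H) < \<infinity>" and H1: "subgroup H1 H" "star_closed_group S k \<sigma> (H\<lparr>carrier := H1\<rparr>)"
 shows "EX K. subgroup K H & Acl_closed_group S k \<sigma> (H\<lparr>carrier := K\<rparr>) & commensurable H K H1"
proof -
 obtain N where N: "\<not> act.chain N {\<one>} (carrier H)" using finite_rank[OF rank] by blast
 obtain A where A: "finite A" "A <= Xeq S" "closedin PT H1" "ALL g:pstab S A. \<rho> g ` H1 <= H1"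
  using H1(2) unfolding star_closed_group_def A_closed_group_def A_closed_def Let_def by auto
 obtain F where F: "finite F" "F <= XS" "GF F <= pstab S A" using pstab_contains_GF[OF A(1,2)] by blast
 note Gs = GF_subgroup[OF F(2)]
 have H1c: "H1 <= carrier H" by (rule subgroup.subset[OF H1(1)])
 have "closedin TH H1" unfolding TH_def by (rule closedin_subset_topspace[OF A(3) H1c])
 hence cs: "act.csub H1" using H1(1) by (simp add: act.csub_def)
 have FH1: "\<rho> g ` H1 <= H1" if "g \<in> GF F" for g using A(4) F(3) that by blast
 have "carrier G \<inter> GF F \<in> act.SS" by (rule act.SS_I[OF act.osub_carrier]) (use F in \<open>auto simp: BB_def\<close>)
 hence "H1 \<in> act.LL" by (rule act.inv.LLI[OF cs]) (use FH1 in \<open>auto simp: act.inv.invar_def\<close>)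
 \<comment> \<open>Two properties of \<open>K\<close> matter: an open subgroup preserves it, and so
   does every element stabilizing \<open>H1\<close>, in particular all of \<open>GF F\<close>.
   Together they make its stabilizer \<open>Q\<close> an open subgroup containing
   \<open>GF F\<close>.\<close>
 from act.commensurable_open_stabilizer[OF N this] obtain K W where K: "act.csub K" "H.comm_eq K H1" "act.osub W"
  "ALL g:W. \<rho> g ` K <= K" "ALL g:carrier G. \<rho> g ` H1 = H1 --> \<rho> g ` K <= K" by (elim exE conjE)
 note Ks = act.csubD(1)[OF K(1)] and Kc = act.csubD(3)[OF K(1)]
 define Q where "Q = {g \<in> carrier G. \<rho> g ` K = K}"
 have Qs: "subgroup Q G"
 proof (rule G.subgroupI)
  show "Q ~= {}" unfolding Q_def using act.image_one[OF Kc] by blast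
  show "inv\<^sub>G g \<in> Q" if "g \<in> Q" for g using that act.image_cancel(1)[OF _ Kc, of g] unfolding Q_def by simp
  show "g \<cdot> h \<in> Q" if "g \<in> Q" "h \<in> Q" for g h using that act.image_mult[OF _ _ Kc, of g h] unfolding Q_def by simp
 qed (auto simp: Q_def)
 have "W <= Q"
  unfolding Q_def using act.invar_eq[OF act.osubD(1)[OF K(3)] Kc] K(4) act.osubD(3)[OF K(3)] by blast
 hence Q: "act.osub Q" by (rule act.osub_super[OF K(3) Qs])
 have FK: "\<rho> g ` K <= K" if g: "g \<in> GF F" for g
  using K(5) act.invar_eq[OF Gs H1c FH1 g] g by (simp add: GF_def)
 have "GF F <= Q" unfolding Q_def using act.invar_eq[OF Gs Kc FK] by (auto simp: GF_def)
 from open_subgroup_stabilizer[OF Q F(1,2) this] obtain a where a: "a \<in> Acl_empty S" "pstab S {a} <= Q" by blast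
 have inv: "\<rho> g x \<in> K" if "g \<in> pstab S {a}" "x \<in> K" for g x using a(2) that unfolding Q_def by blast
 have clK: "closedin PT K" using closedin_trans_full[OF act.csubD(2)[OF K(1), unfolded TH_def] H_closed(1)] .
 have graph: "mult_graph (H\<lparr>carrier := K\<rparr>) = mult_graph H \<inter> (K \<times> K \<times> K)"
  unfolding mult_graph_def using Kc subgroup.m_closed[OF Ks] by auto
 have "A_closed_group S k \<sigma> {a} (H\<lparr>carrier := K\<rparr>)"
  unfolding A_closed_group_def A_closed_def Let_def
 proof (intro conjI ballI)
  show "group (H\<lparr>carrier := K\<rparr>)" by (rule subgroup.subgroup_is_group[OF Ks H.is_group])
  show "closedin PT (carrier (H\<lparr>carrier := K\<rparr>))" using clK by simp
  show "closedin (prod_topology PT (prod_topology PT PT)) (mult_graph (H\<lparr>carrier := K\<rparr>))"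
   unfolding graph using H_closed(3) clK by (intro closedin_Int) (simp_all add: closedin_prod_Times_iff)
  fix g assume g: "g \<in> pstab S {a}"
  show "\<rho> g ` carrier (H\<lparr>carrier := K\<rparr>) <= carrier (H\<lparr>carrier := K\<rparr>)" using inv[OF g] by auto
  have gc: "g \<in> carrier G" using g by (simp add: pstab_def)
  show "map_prod (\<rho> g) (map_prod (\<rho> g) (\<rho> g)) ` mult_graph (H\<lparr>carrier := K\<rparr>) <= mult_graph (H\<lparr>carrier := K\<rparr>)"
   unfolding graph using H_closed(4)[OF gc] inv[OF g] by auto
 qed
 hence "Acl_closed_group S k \<sigma> (H\<lparr>carrier := K\<rparr>)" unfolding Acl_closed_group_def using a(1) by (intro exI[of _ "{a}"]) simp
 moreover have "commensurable H K H1"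
  unfolding commensurable_def using finite_rcosets[OF Ks H1(1)] finite_rcosets[OF H1(1) Ks] K(2)
  by (simp add: H.comm_eq_def Int_commute)
 ultimately show ?thesis using Ks by blast
qed

end

theorem theorem2p11:
  fixes S :: "('g, 'x) gspace"
    and k :: nat
    and \<sigma> :: "nat \<Rightarrow> 'x srt"
    and H :: "(nat \<Rightarrow> 'x imag) monoid"
    and H1 :: "(nat \<Rightarrow> 'x imag) set"
  assumes "compact_gspace S"
    and "small S"
    and "open_subgroup_basis (Grp S) (GTop S)"
    and "\<And>i. i < k \<Longrightarrow> \<sigma> i \<in> teq_sorts S"
    and "A_closed_group S k \<sigma> {} H"
    and "comm_group H"
    and "NM_set S k (carrier H) < \<infinity>"
    and "subgroup H1 H"
    and "star_closed_group S k \<sigma> (H\<lparr>carrier := H1\<rparr>)"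
  shows "\<exists>K. subgroup K H \<and> Acl_closed_group S k \<sigma> (H\<lparr>carrier := K\<rparr>) \<and> commensurable H K H1"
proof -
 interpret definable_abelian_group S k \<sigma> H
  by (intro definable_abelian_group.intro small_compact_gspace.intro definable_abelian_group_axioms.intro assms)
 show ?thesis by (rule Acl_closed_commensurable[OF assms(7-9)])
qed

end
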